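(* Suppose that $\theta^\pm\in C^1([0,T]\times\Omega)$ and $\varphi^\pm\in C^1(\Omega)$ are bounded from below, that for each $t\in[0,T]$ the functions $\theta^\pm(t,\cdot)$ and $\varphi^\pm$ attain their global minimum at points $z_{\mathfrak d}^\pm(t)\in\Omega$ and $z_T^\pm\in\Omega$, respectively, and that they are convex in a neighborhood of $z_{\mathfrak d}^\pm(t)$ and $z_T^\pm$, respectively. Then the reduced optimal control problem $$\min_{B\in\mathbb{B}_{\mathrm{ad}}}\widetilde J(B)$$ possesses at least one globally optimal solution $\bar B$.
   Context: Dimensions: $d=(d_x,d_v)\in\{(1,2),(2,2),(2,3)\}$ is fixed, $D=d_x+d_v$, $x\in\mathbb{R}^{d_x}$ is position, $v\in\mathbb{R}^{d_v}$ is velocity, $z=(x,v)$. $d_B=1$ if $d_v=2$ and $d_B=3$ if $d_v=3$. For fixed radii $R_x,R_v>0$, $\Omega_x$ and $\Omega_v$ are the open balls of radius $R_x$ in $\mathbb{R}^{d_x}$ and of radius $R_v$ in $\mathbb{R}^{d_v}$ centered at $0$, and $\Omega=\Omega_x\times\Omega_v$. Scaling parameters: $\mu_x^-=1$, $\mu_v^-=-1$, and $\mu_x^+,\mu_v^+>0$ are fixed constants. Initial data: $\mathring f=(\mathring f^-,\mathring f^+)$ with $\mathring f^\pm\in C^1_c(\mathbb{R}^D;[0,\infty))$, $\operatorname{supp}\mathring f^\pm\subset\Omega$, and $\int_{\mathbb{R}^D}(\mathring f^+-\mathring f^-)\,\mathrm dv\,\mathrm dx=0$. Notation: $\partial_x=\nabla_x$,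 $\partial_v=\nabla_v$. In sums and scalar products of vectors of different length the shorter vector is filled up by zeros. $F\otimes G=F\times G$ (cross product) if $F,G\in\mathbb{R}^3$, and $F\otimes G=(F_2,-F_1)^TG$ if $F\in\mathbb{R}^2$, $G\in\mathbb{R}$. Vlasov--Poisson system: $$\partial_t f^\pm+\mu_x^\pm v\cdot\partial_x f^\pm+\mu_v^\pm\big(E_f+\mu_x^\pm v\otimes B\big)\cdot\partial_v f^\pm=0,\qquad f^\pm|_{t=0}=\mathring f^\pm,$$ where $\rho_f(t,x)=\int_{\mathbb{R}^{d_v}}(f^+-f^-)(t,x,v)\,\mathrm dv$, $E_f(t,x)=\int_{-\infty}^x\rho_f(t,y)\,\mathrm dy$ if $d_x=1$, and $E_f(t,x)=\frac1{2\pi}\int_{\mathbb{R}^2}\frac{x-y}{|x-y|^2}\rho_f(t,y)\,\mathrm dy$ if $d_x=2$. Control-to-state operator: $T>0$ is a fixed final time, depending only on $\mathring f,R_x,R_v,d$, such that for every $B\in W^{1,\infty}([0,T]\times\Omega_x;\mathbb{R}^{d_B})$ the system has a unique strong solution $f_B=(f_B^-,f_B^+)$, $f_B^\pm\in W^{1,\infty}([0,T]\times\mathbb{R}^D)$ (equations satisfied a.e.), with $\operatorname{supp} f_B^\pm(t)\subset\overline\Omega$ for all $t\in[0,T]$ (such a $T$ exists; it is chosen so that moreover for $B\in C^1([0,T]\times\overline{\Omega_x};\mathbb{R}^{d_B})$ the solution is classical, i.e. $f_B^\pm\in C^1([0,T]\times\mathbb{R}^D)$). Control space: $\mathcal V=H^1([0,T]\times\Omega_x;\mathbb{R}^{d_B})$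 with scalar product $(B_1,B_2)_{\mathcal V}=(B_1,B_2)_{L^2}+\kappa_t(\partial_tB_1,\partial_tB_2)_{L^2}+\kappa_x(D_xB_1,D_xB_2)_{L^2}$ (all $L^2$ products over $[0,T]\times\Omega_x$), fixed $\kappa_t,\kappa_x>0$, and induced norm $\|\cdot\|_{\mathcal V}$. Admissible controls: for $i\in\{0,\dots,d_x\}$, $j\in\{1,\dots,d_B\}$ let $a_{ij},b_{ij}\in L^\infty([0,T]\times\Omega_x)$ be given with $a_{ij}\le0\le b_{ij}$ a.e.; then $$\mathbb{B}_{\mathrm{ad}}=\Big\{B\in\mathcal V:\ a_{0j}\le\partial_tB_j\le b_{0j}\ \text{and}\ a_{ij}\le\partial_{x_i}B_j\le b_{ij}\ \text{a.e. in }[0,T]\times\Omega_x\ \text{for all }i\in\{1,\dots,d_x\},\ j\in\{1,\dots,d_B\}\Big\}.$$ Every $B\in\mathbb{B}_{\mathrm{ad}}$ belongs to $W^{1,\infty}([0,T]\times\Omega_x;\mathbb{R}^{d_B})$, so $f_B$ is defined. Cost functional: for fixed $\alpha>0$, $$J(f,B)=\sum_\pm\int_0^T\!\!\int_{\Omega_x}\!\int_{\Omega_v}\theta^\pm(t,x,v)f^\pm(t,x,v)\,\mathrm dv\,\mathrm dx\,\mathrm dt+\sum_\pm\int_{\Omega_x}\!\int_{\Omega_v}\varphi^\pm(x,v)f^\pm(T,x,v)\,\mathrm dv\,\mathrm dx+\frac\alpha2\|B\|_{\mathcal V}^2,$$ and the reduced cost functional is $\widetilde J(B)=J(f_B,B)$.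 *)

theory Defs
  imports "HOL-Analysis.Analysis"
begin

section \<open>Vectors of different length\<close>

text \<open>
  The index types of the position, velocity and control vectors are arbitrary linearly ordered
  finite types; their elements are numbered \<open>1, 2, \<dots>\<close> in increasing order. This is what
  relates the coordinates of vectors with different index types.
\<close>

type_synonym 'n rvec = "real^'n"

definition rank :: "'n::{finite,linorder} \<Rightarrow> nat" where
  "rank k = card {l. l \<le> k}"

text \<open>
  \<open>entry x i\<close> is the \<open>i\<close>-th component of \<open>x\<close>, counted from 1. The sum has exactly one summand
  if \<open>1 \<le> i \<le> CARD('n)\<close> and none otherwise, so that vectors are filled up by zeros.
\<close>

definition entry :: "('n::{finite,linorder}) rvec \<Rightarrow> nat \<Rightarrow> real" where
  "entry x i = (\<Sum>k | rank k = i. x $ k)"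

definition vec_of :: "(nat \<Rightarrow> real) \<Rightarrow> ('n::{finite,linorder}) rvec" where
  "vec_of a = (\<chi> k. a (rank k))"

definition pad :: "('m::{finite,linorder}) rvec \<Rightarrow> ('n::{finite,linorder}) rvec" where
  "pad x = vec_of (entry x)"

text \<open>The product \<open>v \<otimes> B\<close>: \<open>(v\<^sub>2, - v\<^sub>1) B\<close> in dimension two, the cross product in dimension three.\<close>

definition lorentz ::
  "('v::{finite,linorder}) rvec \<Rightarrow> ('b::{finite,linorder}) rvec \<Rightarrow> 'v rvec" where
  "lorentz v B =
     (let w = entry v; b = entry B in
      if CARD('v) = 2
      then vec_of (\<lambda>i. if i = 1 then w 2 * b 1 else - w 1 * b 1)
      else vec_of (\<lambda>i. if i = 1 then w 2 * b 3 - w 3 * b 2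
                       else if i = 2 then w 3 * b 1 - w 1 * b 3
                       else w 1 * b 2 - w 2 * b 1))"


section \<open>Function spaces\<close>

text \<open>
  \<open>C\<^sup>1\<close> on a set, by differentiability within the set. It is used for sets with dense interior
  of the form interval times convex set, where the derivative within the set is unique.
\<close>

definition C1_on ::
  "'a::real_normed_vector set \<Rightarrow> ('a \<Rightarrow> 'b::real_normed_vector) \<Rightarrow> bool" where
  "C1_on S f \<longleftrightarrow>
     (\<exists>f' :: 'a \<Rightarrow> 'a \<Rightarrow>\<^sub>L 'b. continuous_on S f' \<and>
        (\<forall>x\<in>S. (f has_derivative blinfun_apply (f' x)) (at x within S)))"

primrec Ck :: "nat \<Rightarrow> ('a::euclidean_space \<Rightarrow> real) \<Rightarrow> bool" where
  "Ck 0 \<phi> \<longleftrightarrow> continuous_on UNIV \<phi>"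
| "Ck (Suc k) \<phi> \<longleftrightarrow> (\<forall>x. \<phi> differentiable (at x)) \<and>
     (\<forall>b\<in>Basis. Ck k (\<lambda>x. frechet_derivative \<phi> (at x) b))"

definition test_fun :: "'a::euclidean_space set \<Rightarrow> ('a \<Rightarrow> real) \<Rightarrow> bool" where
  "test_fun U \<phi> \<longleftrightarrow> (\<forall>k. Ck k \<phi>) \<and>
     (\<exists>K. compact K \<and> K \<subseteq> U \<and> (\<forall>x. x \<notin> K \<longrightarrow> \<phi> x = 0))"

definition loc_integrable ::
  "'a::euclidean_space set \<Rightarrow> ('a \<Rightarrow> 'b::euclidean_space) \<Rightarrow> bool" where
  "loc_integrable U g \<longleftrightarrow> (\<forall>K. compact K \<and> K \<subseteq> U \<longrightarrow> integrable (lebesgue_on K) g)"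

definition has_weak_grad ::
  "'a::euclidean_space set \<Rightarrow> ('a \<Rightarrow> real) \<Rightarrow> ('a \<Rightarrow> 'a) \<Rightarrow> bool" where
  "has_weak_grad U g G \<longleftrightarrow> loc_integrable U g \<and> loc_integrable U G \<and>
     (\<forall>\<phi>. test_fun U \<phi> \<longrightarrow> (\<forall>b\<in>Basis.
        (LINT x|lebesgue_on U. g x * frechet_derivative \<phi> (at x) b) =
        - (LINT x|lebesgue_on U. (G x \<bullet> b) * \<phi> x)))"

text \<open>A representative; the weak gradient is unique only up to a null set.\<close>

definition wgrad :: "'a::euclidean_space set \<Rightarrow> ('a \<Rightarrow> real) \<Rightarrow> 'a \<Rightarrow> 'a" where
  "wgrad U g = (SOME G. has_weak_grad U g G)"

definition in_Linf ::
  "'a::euclidean_space set \<Rightarrow> ('a \<Rightarrow> 'b::euclidean_space) \<Rightarrow> bool" where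
  "in_Linf U g \<longleftrightarrow> g \<in> borel_measurable (lebesgue_on U) \<and>
     (\<exists>C. AE x in lebesgue_on U. norm (g x) \<le> C)"

definition in_L2 ::
  "'a::euclidean_space set \<Rightarrow> ('a \<Rightarrow> 'b::euclidean_space) \<Rightarrow> bool" where
  "in_L2 U g \<longleftrightarrow> g \<in> borel_measurable (lebesgue_on U) \<and>
     integrable (lebesgue_on U) (\<lambda>x. (norm (g x))\<^sup>2)"

definition in_W1inf :: "'a::euclidean_space set \<Rightarrow> ('a \<Rightarrow> real) \<Rightarrow> bool" where
  "in_W1inf U g \<longleftrightarrow> in_Linf U g \<and> (\<exists>G. has_weak_grad U g G \<and> in_Linf U G)"

definition in_H1 :: "'a::euclidean_space set \<Rightarrow> ('a \<Rightarrow> real) \<Rightarrow> bool" where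
  "in_H1 U g \<longleftrightarrow> in_L2 U g \<and> (\<exists>G. has_weak_grad U g G \<and> in_L2 U G)"

text \<open>
  Integral with values in the extended reals. It is meaningful whenever the positive or the
  negative part of the integrand has a finite integral.
\<close>

definition ext_integral :: "'a::euclidean_space set \<Rightarrow> ('a \<Rightarrow> real) \<Rightarrow> ereal" where
  "ext_integral S g =
     enn2ereal (\<integral>\<^sup>+x\<in>S. ennreal (g x) \<partial>lborel) - enn2ereal (\<integral>\<^sup>+x\<in>S. ennreal (- g x) \<partial>lborel)"


section \<open>The Vlasov--Poisson system\<close>

datatype species = Neg | Pos

text \<open>
  The arguments of a density are grouped as \<open>(t, (x, v))\<close>, those of a control as \<open>(t, x)\<close>.
\<close>

type_synonym ('x, 'v) phase = "'x rvec \<times> 'v rvec"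
type_synonym ('x, 'v) density = "species \<Rightarrow> real \<times> ('x, 'v) phase \<Rightarrow> real"
type_synonym ('x, 'b) control = "real \<times> 'x rvec \<Rightarrow> 'b rvec"

definition Omega :: "real \<Rightarrow> real \<Rightarrow> ('x::finite, 'v::finite) phase set" where
  "Omega Rx Rv = ball 0 Rx \<times> ball 0 Rv"

text \<open>Sobolev spaces and a.e. statements on \<open>[0,T] \<times> \<dots>\<close> are taken on the open time interval.\<close>

definition Qx :: "real \<Rightarrow> real \<Rightarrow> (real \<times> ('x::finite) rvec) set" where
  "Qx T Rx = {0<..<T} \<times> ball 0 Rx"

definition Qz :: "real \<Rightarrow> (real \<times> ('x::finite, 'v::finite) phase) set" where
  "Qz T = {0<..<T} \<times> UNIV"

definition charge :: "('x::finite, 'v::finite) density \<Rightarrow> real \<Rightarrow> 'x rvec \<Rightarrow> real" where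
  "charge f t x = (LINT v|lborel. f Pos (t, x, v) - f Neg (t, x, v))"

definition efield ::
  "('x::{finite,linorder}, 'v::finite) density \<Rightarrow> real \<Rightarrow> 'x rvec \<Rightarrow> 'x rvec" where
  "efield f t x =
     (if CARD('x) = 1
      then vec_of (\<lambda>_. LINT y:{y. entry y 1 \<le> entry x 1}|lborel. charge f t y)
      else (1 / (2 * pi)) *\<^sub>R
             (LINT y|lborel. (charge f t y / (norm (x - y))\<^sup>2) *\<^sub>R (x - y)))"

definition vlasov_ae ::
  "real \<Rightarrow> (species \<Rightarrow> real) \<Rightarrow> (species \<Rightarrow> real) \<Rightarrow>
   ('x::{finite,linorder}, 'b::{finite,linorder}) control \<Rightarrow>
   ('x, 'v::{finite,linorder}) density \<Rightarrow> bool" where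
  "vlasov_ae T mux muv B f \<longleftrightarrow>
     (\<forall>s. AE (t, x, v) in lebesgue_on (Qz T).
        (let G = wgrad (Qz T) (f s) (t, x, v);
             ft = fst G; fx = fst (snd G); fv = snd (snd G)
         in ft + mux s * (v \<bullet> pad fx)
              + muv s * ((pad (efield f t x) + mux s *\<^sub>R lorentz v (B (t, x))) \<bullet> fv) = 0))"

text \<open>
  Strong solutions on \<open>[0,T]\<close>. A density of class \<open>W\<^sup>1\<^sup>,\<^sup>\<infinity>\<close> is represented by its continuous
  representative, which gives a meaning to its values at fixed times. Since it vanishes for
  \<open>z\<close> outside the closure of \<open>Omega\<close>, the values of \<open>B\<close> outside \<open>[0,T] \<times> ball 0 Rx\<close> play no
  role in the equation. By convention a density is extended by zero to times outside \<open>[0,T]\<close>,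
  so that it is determined as a function on the whole type.
\<close>

definition strong_solution ::
  "real \<Rightarrow> real \<Rightarrow> real \<Rightarrow> (species \<Rightarrow> real) \<Rightarrow> (species \<Rightarrow> real) \<Rightarrow>
   (species \<Rightarrow> ('x::{finite,linorder}, 'v::{finite,linorder}) phase \<Rightarrow> real) \<Rightarrow>
   ('x, 'b::{finite,linorder}) control \<Rightarrow> ('x, 'v) density \<Rightarrow> bool" where
  "strong_solution T Rx Rv mux muv f0 B f \<longleftrightarrow>
     (\<forall>s. in_W1inf (Qz T) (f s) \<and> continuous_on ({0..T} \<times> UNIV) (f s)) \<and>
     vlasov_ae T mux muv B f \<and>
     (\<forall>s z. f s (0, z) = f0 s z) \<and>
     (\<forall>s. \<forall>t\<in>{0..T}. closure {z. f s (t, z) \<noteq> 0} \<subseteq> closure (Omega Rx Rv)) \<and>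
     (\<forall>s t z. t \<notin> {0..T} \<longrightarrow> f s (t, z) = 0)"

definition state ::
  "real \<Rightarrow> real \<Rightarrow> real \<Rightarrow> (species \<Rightarrow> real) \<Rightarrow> (species \<Rightarrow> real) \<Rightarrow>
   (species \<Rightarrow> ('x::{finite,linorder}, 'v::{finite,linorder}) phase \<Rightarrow> real) \<Rightarrow>
   ('x, 'b::{finite,linorder}) control \<Rightarrow> ('x, 'v) density" where
  "state T Rx Rv mux muv f0 B = (THE f. strong_solution T Rx Rv mux muv f0 B f)"

definition control_W1inf ::
  "real \<Rightarrow> real \<Rightarrow> ('x::finite, 'b::{finite,linorder}) control \<Rightarrow> bool" where
  "control_W1inf T Rx B \<longleftrightarrow> (\<forall>j\<in>{1..CARD('b)}. in_W1inf (Qx T Rx) (\<lambda>p. entry (B p) j))"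

text \<open>The defining property of the final time; it involves the control dimension \<open>'b\<close>.\<close>

definition final_time ::
  "'b::{finite,linorder} itself \<Rightarrow> real \<Rightarrow> real \<Rightarrow> real \<Rightarrow>
   (species \<Rightarrow> real) \<Rightarrow> (species \<Rightarrow> real) \<Rightarrow>
   (species \<Rightarrow> ('x::{finite,linorder}, 'v::{finite,linorder}) phase \<Rightarrow> real) \<Rightarrow> bool" where
  "final_time _ T Rx Rv mux muv f0 \<longleftrightarrow> 0 < T \<and>
     (\<forall>B :: ('x, 'b) control. control_W1inf T Rx B \<longrightarrow>
        (\<exists>!f. strong_solution T Rx Rv mux muv f0 B f)) \<and>
     (\<forall>B :: ('x, 'b) control. C1_on ({0..T} \<times> cball 0 Rx) B \<longrightarrow>
        (\<forall>s. C1_on ({0..T} \<times> UNIV) (state T Rx Rv mux muv f0 B s)))"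

definition initial_datum ::
  "real \<Rightarrow> real \<Rightarrow> (species \<Rightarrow> ('x::finite, 'v::finite) phase \<Rightarrow> real) \<Rightarrow> bool" where
  "initial_datum Rx Rv f0 \<longleftrightarrow>
     (\<forall>s. C1_on UNIV (f0 s) \<and> (\<forall>z. 0 \<le> f0 s z) \<and>
          compact (closure {z. f0 s z \<noteq> 0}) \<and> closure {z. f0 s z \<noteq> 0} \<subseteq> Omega Rx Rv) \<and>
     (LINT z|lborel. f0 Pos z - f0 Neg z) = 0"


section \<open>The optimal control problem\<close>

definition control_space ::
  "real \<Rightarrow> real \<Rightarrow> ('x::finite, 'b::{finite,linorder}) control set" where
  "control_space T Rx = {B. \<forall>j\<in>{1..CARD('b)}. in_H1 (Qx T Rx) (\<lambda>p. entry (B p) j)}"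

text \<open>\<open>control_deriv T Rx i B j\<close> is \<open>\<partial>\<^sub>t B\<^sub>j\<close> for \<open>i = 0\<close> and the derivative of \<open>B\<^sub>j\<close> by \<open>x\<^sub>i\<close> for \<open>i \<ge> 1\<close>.\<close>

definition control_deriv ::
  "real \<Rightarrow> real \<Rightarrow> nat \<Rightarrow> ('x::{finite,linorder}, 'b::{finite,linorder}) control \<Rightarrow> nat \<Rightarrow>
   real \<times> 'x rvec \<Rightarrow> real" where
  "control_deriv T Rx i B j p =
     (let G = wgrad (Qx T Rx) (\<lambda>q. entry (B q) j) p
      in if i = 0 then fst G else entry (snd G) i)"

definition control_inner ::
  "real \<Rightarrow> real \<Rightarrow> real \<Rightarrow> real \<Rightarrow>
   ('x::{finite,linorder}, 'b::{finite,linorder}) control \<Rightarrow> ('x, 'b) control \<Rightarrow> real" where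
  "control_inner T Rx \<kappa>t \<kappa>x B1 B2 =
     (LINT p|lebesgue_on (Qx T Rx). B1 p \<bullet> B2 p)
     + \<kappa>t * (LINT p|lebesgue_on (Qx T Rx).
         (\<Sum>j\<in>{1..CARD('b)}. control_deriv T Rx 0 B1 j p * control_deriv T Rx 0 B2 j p))
     + \<kappa>x * (LINT p|lebesgue_on (Qx T Rx).
         (\<Sum>i\<in>{1..CARD('x)}. \<Sum>j\<in>{1..CARD('b)}.
            control_deriv T Rx i B1 j p * control_deriv T Rx i B2 j p))"

definition control_norm ::
  "real \<Rightarrow> real \<Rightarrow> real \<Rightarrow> real \<Rightarrow>
   ('x::{finite,linorder}, 'b::{finite,linorder}) control \<Rightarrow> real" where
  "control_norm T Rx \<kappa>t \<kappa>x B = sqrt (control_inner T Rx \<kappa>t \<kappa>x B B)"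

definition admissible ::
  "real \<Rightarrow> real \<Rightarrow> (nat \<Rightarrow> nat \<Rightarrow> real \<times> ('x::{finite,linorder}) rvec \<Rightarrow> real) \<Rightarrow>
   (nat \<Rightarrow> nat \<Rightarrow> real \<times> 'x rvec \<Rightarrow> real) \<Rightarrow>
   ('x, 'b::{finite,linorder}) control set" where
  "admissible T Rx a b = {B \<in> control_space T Rx.
     \<forall>i\<in>{0..CARD('x)}. \<forall>j\<in>{1..CARD('b)}. AE p in lebesgue_on (Qx T Rx).
        a i j p \<le> control_deriv T Rx i B j p \<and> control_deriv T Rx i B j p \<le> b i j p}"

text \<open>
  The weights \<open>\<theta>\<close> and \<open>\<phi>\<close> are bounded from below but, being \<open>C\<^sup>1\<close> on the open set \<open>Omega\<close> only,
  need not be bounded near its boundary. The cost can therefore take the value \<open>\<infinity>\<close>, whereas the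
  Bochner integral of a function that is not integrable would be \<open>0\<close>.
\<close>

definition cost ::
  "real \<Rightarrow> real \<Rightarrow> real \<Rightarrow>
   (species \<Rightarrow> real \<times> ('x::{finite,linorder}, 'v::{finite,linorder}) phase \<Rightarrow> real) \<Rightarrow>
   (species \<Rightarrow> ('x, 'v) phase \<Rightarrow> real) \<Rightarrow> real \<Rightarrow> real \<Rightarrow> real \<Rightarrow>
   ('x, 'v) density \<Rightarrow> ('x, 'b::{finite,linorder}) control \<Rightarrow> ereal" where
  "cost T Rx Rv \<theta> \<phi> \<alpha> \<kappa>t \<kappa>x f B =
     (ext_integral ({0..T} \<times> Omega Rx Rv) (\<lambda>p. \<theta> Neg p * f Neg p)
      + ext_integral ({0..T} \<times> Omega Rx Rv) (\<lambda>p. \<theta> Pos p * f Pos p))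
     + (ext_integral (Omega Rx Rv) (\<lambda>z. \<phi> Neg z * f Neg (T, z))
      + ext_integral (Omega Rx Rv) (\<lambda>z. \<phi> Pos z * f Pos (T, z)))
     + ereal (\<alpha> / 2 * (control_norm T Rx \<kappa>t \<kappa>x B)\<^sup>2)"

definition reduced_cost ::
  "real \<Rightarrow> real \<Rightarrow> real \<Rightarrow> (species \<Rightarrow> real) \<Rightarrow> (species \<Rightarrow> real) \<Rightarrow>
   (species \<Rightarrow> ('x::{finite,linorder}, 'v::{finite,linorder}) phase \<Rightarrow> real) \<Rightarrow>
   (species \<Rightarrow> real \<times> ('x, 'v) phase \<Rightarrow> real) \<Rightarrow> (species \<Rightarrow> ('x, 'v) phase \<Rightarrow> real) \<Rightarrow>
   real \<Rightarrow> real \<Rightarrow> real \<Rightarrow> ('x, 'b::{finite,linorder}) control \<Rightarrow> ereal" where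
  "reduced_cost T Rx Rv mux muv f0 \<theta> \<phi> \<alpha> \<kappa>t \<kappa>x B =
     cost T Rx Rv \<theta> \<phi> \<alpha> \<kappa>t \<kappa>x (state T Rx Rv mux muv f0 B) B"

definition global_min_at :: "'z set \<Rightarrow> ('z \<Rightarrow> real) \<Rightarrow> 'z \<Rightarrow> bool" where
  "global_min_at S h z0 \<longleftrightarrow> z0 \<in> S \<and> (\<forall>z\<in>S. h z0 \<le> h z)"

definition convex_near :: "'z::real_normed_vector set \<Rightarrow> ('z \<Rightarrow> real) \<Rightarrow> 'z \<Rightarrow> bool" where
  "convex_near S h z0 \<longleftrightarrow> (\<exists>U. open U \<and> z0 \<in> U \<and> U \<subseteq> S \<and> convex_on U h)"

end

theory Submission
  imports Defs "HOL-Complex_Analysis.Great_Picard"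
begin

text \<open>
  Direct method. The box constraints bound the weak gradients of admissible controls, so these have
  uniformly Lipschitz versions and a minimizing sequence has a uniformly convergent subsequence.
  Convex combinations of its tail whose \<open>\<V>\<close>-norms are nearly minimal are Cauchy in the
  control space (a hands-on form of Mazur's lemma); this gives admissibility of the limit and
  lower semicontinuity of the norm.

  The states converge in \<open>L\<^sup>1\<close>, uniformly in time: the difference of two states is transported by
  the characteristics of one control with a source that involves only the bounded gradient of the
  limiting state, and Gronwall's lemma applies since the field depends on the density
  \<open>L\<^sup>1\<close>-continuously. As the weights are bounded from below and the states are nonnegative with
  conserved mass, Fatou's lemma gives lower semicontinuity of the remaining cost terms, which may
  be infinite.
\<close>

section \<open>Smooth bumps on boxes\<close>

lemma Ck_SucI:
  fixes \<phi> :: "'a::euclidean_space \<Rightarrow> real"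
  assumes "\<And>x. (\<phi> has_derivative D x) (at x)" "\<And>b. Ck k (\<lambda>x. D x b)"
  shows "Ck (Suc k) \<phi>"
proof -
  have "frechet_derivative \<phi> (at x) = D x" for x
    using frechet_derivative_at[OF assms(1)[of x]] by simp
  then show ?thesis
    using assms by (auto simp: differentiable_def)
qed

lemma Ck_Suc_has_derivative:
  "Ck (Suc k) \<phi> \<Longrightarrow> (\<phi> has_derivative frechet_derivative \<phi> (at x)) (at x)"
  by (auto simp: frechet_derivative_works)

lemma Ck_const: "Ck k (\<lambda>x::'a::euclidean_space. c)"
proof (induction k arbitrary: c)
  case (Suc k)
  then show ?case by (intro Ck_SucI[where D="\<lambda>x h. 0"]) auto
qed auto

lemma Ck_imp_continuous: "Ck k \<phi> \<Longrightarrow> continuous_on UNIV \<phi>"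
  by (cases k) (auto intro!: differentiable_imp_continuous_on simp: differentiable_on_def differentiable_at_withinI)

lemma Ck_Suc_imp_Ck: "Ck (Suc k) \<phi> \<Longrightarrow> Ck k \<phi>"
proof (induction k arbitrary: \<phi>)
  case 0
  then show ?case using Ck_imp_continuous[of "Suc 0"] by auto
next
  case (Suc k)
  show ?case unfolding Ck.simps(2)[of k]
    using Suc.prems unfolding Ck.simps(2)[of "Suc k"] using Suc.IH by blast
qed

lemma Ck_add:
  fixes \<phi> \<psi> :: "'a::euclidean_space \<Rightarrow> real"
  shows "Ck k \<phi> \<Longrightarrow> Ck k \<psi> \<Longrightarrow> Ck k (\<lambda>x. \<phi> x + \<psi> x)"
proof (induction k arbitrary: \<phi> \<psi>)
  case 0 then show ?case by (auto intro: continuous_intros)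
next
  case (Suc k)
  have d: "frechet_derivative (\<lambda>x. \<phi> x + \<psi> x) (at x) =
      (\<lambda>h. frechet_derivative \<phi> (at x) h + frechet_derivative \<psi> (at x) h)" for x
    by (rule frechet_derivative_at[symmetric])
      (intro has_derivative_add Ck_Suc_has_derivative[OF Suc.prems(1)] Ck_Suc_has_derivative[OF Suc.prems(2)])
  show ?case
    using Suc by (auto simp: d)
qed

lemma Ck_mult:
  fixes \<phi> \<psi> :: "'a::euclidean_space \<Rightarrow> real"
  shows "Ck k \<phi> \<Longrightarrow> Ck k \<psi> \<Longrightarrow> Ck k (\<lambda>x. \<phi> x * \<psi> x)"
proof (induction k arbitrary: \<phi> \<psi>)
  case 0 then show ?case by (auto intro: continuous_intros)
next
  case (Suc k)
  have d: "frechet_derivative (\<lambda>x. \<phi> x * \<psi> x) (at x) =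
      (\<lambda>h. \<phi> x * frechet_derivative \<psi> (at x) h + frechet_derivative \<phi> (at x) h * \<psi> x)" for x
    by (rule frechet_derivative_at[symmetric])
      (intro has_derivative_mult Ck_Suc_has_derivative[OF Suc.prems(1)] Ck_Suc_has_derivative[OF Suc.prems(2)])
  have "Ck k \<phi>" "Ck k \<psi>" using Suc.prems Ck_Suc_imp_Ck by blast+
  with Suc show ?case
    by (auto simp: d intro!: Ck_add differentiable_mult)
qed

lemma Ck_prod:
  assumes "\<And>i. i \<in> I \<Longrightarrow> Ck k (\<phi> i)"
  shows "Ck k (\<lambda>x::'a::euclidean_space. \<Prod>i\<in>I. \<phi> i x)"
proof (cases "finite I")
  case True
  then show ?thesis using assms by induction (auto intro: Ck_const Ck_mult)
qed (auto intro: Ck_const)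

lemma Ck_affine:
  fixes e :: "real \<Rightarrow> real"
  shows "Ck k e \<Longrightarrow> Ck k (\<lambda>x::'a::euclidean_space. e (c + d * (x \<bullet> b)))"
proof (induction k arbitrary: e)
  case 0
  then show ?case
    by (auto intro!: continuous_on_compose2[of UNIV e] continuous_intros)
next
  case (Suc k)
  have e: "(e has_derivative frechet_derivative e (at y)) (at y)" for y
    by (rule Ck_Suc_has_derivative[OF Suc.prems])
  have lin: "frechet_derivative e (at y) h = frechet_derivative e (at y) 1 * h" for y h
    using linear_scale[OF has_derivative_linear[OF e[of y]], of h 1] by simp
  have d: "((\<lambda>x::'a. e (c + d * (x \<bullet> b))) has_derivative
      (\<lambda>h. frechet_derivative e (at (c + d * (x \<bullet> b))) 1 * (d * (h \<bullet> b)))) (at x)" for x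
    unfolding lin[symmetric]
    by (rule has_derivative_compose[of "\<lambda>x. c + d * (x \<bullet> b)" "\<lambda>h. d * (h \<bullet> b)" _ _ e])
      (auto intro!: derivative_eq_intros e)
  show ?case
    by (rule Ck_SucI[OF d]) (use Suc in \<open>auto intro!: Ck_mult Ck_const\<close>)
qed

lemma Ck_translate:
  fixes \<phi> :: "'a::euclidean_space \<Rightarrow> real"
  shows "Ck k \<phi> \<Longrightarrow> Ck k (\<lambda>x. \<phi> (x - z))"
proof (induction k arbitrary: \<phi>)
  case 0 then show ?case by (auto intro!: continuous_on_compose2[of UNIV \<phi>] continuous_intros)
next
  case (Suc k)
  have d: "((\<lambda>x. \<phi> (x - z)) has_derivative frechet_derivative \<phi> (at (x - z))) (at x)" for x
  proof -
    have "((\<lambda>x. x - z) has_derivative (\<lambda>h. h)) (at x)"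
      by (auto intro!: derivative_eq_intros)
    from has_derivative_compose[OF this Ck_Suc_has_derivative[OF Suc.prems]] show ?thesis .
  qed
  then have "frechet_derivative (\<lambda>x. \<phi> (x - z)) (at x) = frechet_derivative \<phi> (at (x - z))" for x
    by (metis frechet_derivative_at)
  moreover have "(\<lambda>x. \<phi> (x - z)) differentiable at x" for x
    using d by (rule differentiableI)
  moreover have "Ck k (\<lambda>x. frechet_derivative \<phi> (at (x - z)) b)" if "b \<in> Basis" for b
    using Suc.IH[of "\<lambda>x. frechet_derivative \<phi> (at x) b"] Suc.prems that by simp
  ultimately show ?case
    by simp
qed

definition flat :: "nat \<Rightarrow> real \<Rightarrow> real" where
  "flat n x = (if 0 < x then exp (- (1 / x)) * (1 / x) ^ n else 0)"

lemma flat_tendsto_0: "(flat n \<longlongrightarrow> 0) (at 0)"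
proof -
  have "((\<lambda>y::real. y ^ n / exp y) \<longlongrightarrow> 0) at_top"
    by (rule tendsto_power_div_exp_0)
  then have "((\<lambda>x::real. inverse x ^ n / exp (inverse x)) \<longlongrightarrow> 0) (at_right 0)"
    by (rule filterlim_compose[OF _ filterlim_inverse_at_top_right])
  then have r: "(flat n \<longlongrightarrow> 0) (at_right 0)"
    by (rule Lim_transform_eventually)
      (auto simp: eventually_at_right_field flat_def exp_minus field_simps intro!: exI[of _ 1])
  have "(flat n \<longlongrightarrow> 0) (at_left 0)"
    by (rule tendsto_eventually) (auto simp: eventually_at_left_field flat_def intro!: exI[of _ "-1"])
  with r show ?thesis by (simp add: filterlim_split_at)
qed

lemma flat_has_derivative:
  "(flat n has_real_derivative flat (n + 2) x - of_nat n * flat (n + 1) x) (at x)"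
proof (cases x "0::real" rule: linorder_cases)
  case less
  have "((\<lambda>_. 0) has_real_derivative 0) (at x)" by simp
  then have "(flat n has_real_derivative 0) (at x)"
    by (rule has_field_derivative_transform_within_open[of _ _ _ "{..<0}"])
      (use less in \<open>auto simp: flat_def\<close>)
  then show ?thesis using less by (simp add: flat_def)
next
  case equal
  have "flat n y / y = flat (Suc n) y" for y
    by (auto simp: flat_def field_simps)
  then have "((\<lambda>y. (flat n y - flat n 0) / (y - 0)) \<longlongrightarrow> 0) (at 0)"
    using flat_tendsto_0[of "Suc n"] by (simp add: flat_def[of _ 0] )
  then show ?thesis using equal by (simp add: has_field_derivative_iff flat_def[of _ 0])
next
  case greater
  have "((\<lambda>x. exp (- (1 / x)) * (1 / x) ^ n) has_real_derivative
      exp (- (1 / x)) * (1 / x)^(n+2) - of_nat n * (exp (- (1 / x)) * (1 / x)^(n+1))) (at x)"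
  proof -
    have e: "((\<lambda>x. exp (- (1 / x))) has_real_derivative exp (- (1 / x)) * (1 / x)\<^sup>2) (at x)"
      using greater by (auto intro!: derivative_eq_intros simp: power2_eq_square)
    have i: "((\<lambda>x. 1 / x) has_real_derivative - (1 / x)\<^sup>2) (at x)"
      using greater by (auto intro!: derivative_eq_intros simp: power2_eq_square)
    have "real n * (- (1 / x)\<^sup>2 * (1 / x) ^ (n - Suc 0)) = - (real n * (1 / x) ^ (n + 1))"
      by (cases n) (simp_all add: power2_eq_square)
    with DERIV_power[OF i, of n]
    have p: "((\<lambda>x. (1 / x) ^ n) has_real_derivative - (real n * (1 / x) ^ (n + 1))) (at x)"
      by simp
    have "E * w\<^sup>2 * w ^ n + - (real n * w ^ (n + 1)) * E =
        E * w ^ (n + 2) - real n * (E * w ^ (n + 1))" for E w :: real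
      by (simp add: power_add algebra_simps power2_eq_square)
    then show ?thesis
      by (rule DERIV_cong[OF DERIV_mult[OF e p]])
  qed
  then have "(flat n has_real_derivative
      exp (- (1 / x)) * (1 / x)^(n+2) - of_nat n * (exp (- (1 / x)) * (1 / x)^(n+1))) (at x)"
    by (rule has_field_derivative_transform_within_open[of _ _ _ "{0<..}"])
      (use greater in \<open>auto simp: flat_def\<close>)
  then show ?thesis using greater by (simp add: flat_def)
qed

lemma Ck_flat: "Ck k (flat n)"
proof (induction k arbitrary: n)
  case 0
  show ?case
    using DERIV_isCont[OF flat_has_derivative] by (simp add: continuous_on_eq_continuous_at)
next
  case (Suc k)
  have *: "(\<lambda>x. (flat (n + 2) x - real n * flat (n + 1) x) * b) =
      (\<lambda>x. b * flat (n + 2) x + (- b * real n) * flat (n + 1) x)" for b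
    by (auto simp: algebra_simps)
  show ?case
    by (rule Ck_SucI[OF flat_has_derivative[unfolded has_field_derivative_def]], subst *)
      (intro Ck_add Ck_mult Ck_const Suc)
qed

lemma flat_0_tendsto_1:
  assumes "0 < x" shows "(\<lambda>n. flat 0 (real n * x)) \<longlonglongrightarrow> 1"
proof -
  have "(\<lambda>n. exp (- (inverse x * (1 / real n)))) \<longlonglongrightarrow> exp (- (inverse x * 0))"
    by (intro tendsto_intros lim_1_over_n)
  then have "(\<lambda>n. exp (- (inverse x * (1 / real n)))) \<longlonglongrightarrow> 1" by simp
  then show ?thesis
    by (rule Lim_transform_eventually)
      (use assms in \<open>auto simp: eventually_sequentially flat_def field_simps intro!: exI[of _ 1]\<close>)
qed

definition box_bump :: "'a::euclidean_space \<Rightarrow> 'a \<Rightarrow> nat \<Rightarrow> 'a \<Rightarrow> real" where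
  "box_bump a c n x = (\<Prod>b\<in>Basis. flat 0 (real n * (x \<bullet> b - a \<bullet> b)) * flat 0 (real n * (c \<bullet> b - x \<bullet> b)))"

lemma flat_0_bounds: "0 \<le> flat 0 x" "flat 0 x \<le> 1"
  by (auto simp: flat_def)

lemma box_bump_bounds: "0 \<le> box_bump a c n x" "box_bump a c n x \<le> 1"
  unfolding box_bump_def by (auto intro!: prod_nonneg prod_le_1 mult_nonneg_nonneg mult_le_one flat_0_bounds)

lemma box_bump_eq_0:
  assumes "x \<notin> box a c" shows "box_bump a c n x = 0"
proof -
  obtain b where b: "b \<in> Basis" "x \<bullet> b \<le> a \<bullet> b \<or> c \<bullet> b \<le> x \<bullet> b"
    using assms by (auto simp: mem_box not_less)
  then have "\<not> 0 < real n * (x \<bullet> b - a \<bullet> b) \<or> \<not> 0 < real n * (c \<bullet> b - x \<bullet> b)"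
    by (auto simp: zero_less_mult_iff)
  then show ?thesis
    unfolding box_bump_def using b(1) by (auto simp: flat_def intro!: prod_zero bexI[of _ b])
qed

lemma Ck_box_bump: "Ck k (box_bump a c n)"
proof -
  have "Ck k (\<lambda>x. \<Prod>b\<in>Basis. flat 0 (- (real n * (a \<bullet> b)) + real n * (x \<bullet> b)) *
      flat 0 (real n * (c \<bullet> b) + (- real n) * (x \<bullet> b)))"
    by (intro Ck_prod Ck_mult Ck_affine Ck_flat)
  also have "(\<lambda>x. \<Prod>b\<in>Basis. flat 0 (- (real n * (a \<bullet> b)) + real n * (x \<bullet> b)) *
      flat 0 (real n * (c \<bullet> b) + (- real n) * (x \<bullet> b))) = box_bump a c n"
    by (auto simp: box_bump_def algebra_simps)
  finally show ?thesis .
qed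

lemma box_bump_tendsto: "(\<lambda>n. box_bump a c n x) \<longlonglongrightarrow> indicator (box a c) x"
proof (cases "x \<in> box a c")
  case True
  have "(\<lambda>n. box_bump a c n x) \<longlonglongrightarrow> (\<Prod>b\<in>(Basis :: 'a set). 1 * 1)"
    unfolding box_bump_def
    by (intro tendsto_prod tendsto_mult flat_0_tendsto_1) (use True in \<open>auto simp: mem_box\<close>)
  then show ?thesis using True by simp
qed (simp add: box_bump_eq_0)

lemma test_fun_box_bump_translate:
  assumes "cbox (a + z) (c + z) \<subseteq> U" shows "test_fun U (\<lambda>x. box_bump a c n (x - z))"
  unfolding test_fun_def
proof (intro conjI exI[of _ "cbox (a + z) (c + z)"] allI impI)
  fix x assume "x \<notin> cbox (a + z) (c + z)"
  then have "x - z \<notin> box a c" by (fastforce simp: mem_box algebra_simps)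
  then show "box_bump a c n (x - z) = 0" by (rule box_bump_eq_0)
qed (use assms in \<open>auto intro: Ck_translate Ck_box_bump\<close>)

section \<open>Weak gradients and box averages\<close>

text \<open>
  Weak gradients between Borel functions and with integrals over the whole space, where translation
  invariance and Fubini's theorem are available.
\<close>

definition bwg :: "'a::euclidean_space set \<Rightarrow> ('a \<Rightarrow> real) \<Rightarrow> ('a \<Rightarrow> 'a) \<Rightarrow> bool" where
  "bwg U g G \<longleftrightarrow> g \<in> borel_measurable borel \<and> G \<in> borel_measurable borel \<and>
     (\<forall>K. compact K \<and> K \<subseteq> U \<longrightarrow> set_integrable lborel K g \<and> set_integrable lborel K G) \<and>
     (\<forall>\<phi>. test_fun U \<phi> \<longrightarrow> (\<forall>b\<in>Basis.
        (LINT x|lborel. g x * frechet_derivative \<phi> (at x) b) = - (LINT x|lborel. (G x \<bullet> b) * \<phi> x)))"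

lemma bwgD:
  assumes "bwg U g G"
  shows "g \<in> borel_measurable borel" "G \<in> borel_measurable borel"
    "compact K \<Longrightarrow> K \<subseteq> U \<Longrightarrow> set_integrable lborel K g"
    "compact K \<Longrightarrow> K \<subseteq> U \<Longrightarrow> set_integrable lborel K G"
  using assms by (auto simp: bwg_def)

lemma integrable_mult_compact:
  fixes f :: "'a::euclidean_space \<Rightarrow> 'b::{banach,second_countable_topology}"
  assumes f: "set_integrable lborel K f" and [measurable]: "\<psi> \<in> borel_measurable borel"
    "f \<in> borel_measurable borel"
    and C: "\<And>x. \<bar>\<psi> x\<bar> \<le> C" and z: "\<And>x. x \<notin> K \<Longrightarrow> \<psi> x = 0"
  shows "integrable lborel (\<lambda>x. \<psi> x *\<^sub>R f x)"
proof (rule Bochner_Integration.integrable_bound)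
  show "integrable lborel (\<lambda>x. C *\<^sub>R norm (indicator K x *\<^sub>R f x))"
    using f unfolding set_integrable_def by (intro integrable_scaleR_right integrable_norm)
  have "0 \<le> C" using C[of undefined] by auto
  then show "AE x in lborel. norm (\<psi> x *\<^sub>R f x) \<le> norm (C *\<^sub>R norm (indicator K x *\<^sub>R f x))"
    using C z by (auto split: split_indicator intro!: AE_I2 mult_right_mono)
qed simp

lemma test_fun_derivative_bound:
  fixes \<phi> :: "'a::euclidean_space \<Rightarrow> real"
  assumes "test_fun U \<phi>"
  shows "\<And>x. (\<phi> has_derivative frechet_derivative \<phi> (at x)) (at x)"
    and "\<And>e. continuous_on UNIV (\<lambda>x. frechet_derivative \<phi> (at x) e)"
    and "\<exists>C. \<forall>x e. \<bar>frechet_derivative \<phi> (at x) e\<bar> \<le> C * norm e"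
    and "\<exists>C. \<forall>x. \<bar>\<phi> x\<bar> \<le> C"
    and "\<And>K x e. \<lbrakk>compact K; \<And>x. x \<notin> K \<Longrightarrow> \<phi> x = 0; x \<notin> K\<rbrakk> \<Longrightarrow> frechet_derivative \<phi> (at x) e = 0"
proof -
  obtain K where K: "compact K" "\<And>x. x \<notin> K \<Longrightarrow> \<phi> x = 0"
    using assms by (auto simp: test_fun_def)
  have Ck: "Ck k \<phi>" for k using assms by (auto simp: test_fun_def)
  show d: "(\<phi> has_derivative frechet_derivative \<phi> (at x)) (at x)" for x
    by (rule Ck_Suc_has_derivative[OF Ck[of 1, simplified One_nat_def]])
  have lin: "frechet_derivative \<phi> (at x) e = (\<Sum>b\<in>Basis. (e \<bullet> b) * frechet_derivative \<phi> (at x) b)" for x e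
  proof -
    have l: "linear (frechet_derivative \<phi> (at x))" by (rule has_derivative_linear[OF d])
    have "frechet_derivative \<phi> (at x) (\<Sum>b\<in>Basis. (e \<bullet> b) *\<^sub>R b) = (\<Sum>b\<in>Basis. (e \<bullet> b) * frechet_derivative \<phi> (at x) b)"
      by (simp add: linear_sum[OF l] linear_cmul[OF l])
    then show ?thesis by (simp add: euclidean_representation)
  qed
  have cb: "continuous_on UNIV (\<lambda>x. frechet_derivative \<phi> (at x) b)" if "b \<in> Basis" for b
    using Ck[of "Suc 0"] that by auto
  show "continuous_on UNIV (\<lambda>x. frechet_derivative \<phi> (at x) e)" for e
    by (subst lin) (intro continuous_intros cb)
  show z: "frechet_derivative \<phi> (at x) e = 0"
    if "compact K" "\<And>x. x \<notin> K \<Longrightarrow> \<phi> x = 0" "x \<notin> K" for K x e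
  proof -
    have "(\<phi> has_derivative (\<lambda>_. 0)) (at x)"
      by (rule has_derivative_transform_within_open[of "\<lambda>_. 0" _ _ _ "- K"])
        (use that in \<open>auto simp: compact_imp_closed open_Compl\<close>)
    then show ?thesis by (metis frechet_derivative_at)
  qed
  have bd: "\<exists>C. \<forall>x. \<bar>f x\<bar> \<le> C" if "continuous_on UNIV f" "\<And>x. x \<notin> K \<Longrightarrow> f x = 0" for f :: "'a \<Rightarrow> real"
  proof -
    have "bounded (f ` K)"
      using that K by (intro compact_imp_bounded compact_continuous_image) (auto intro: continuous_on_subset)
    then obtain C where "\<And>x. x \<in> K \<Longrightarrow> \<bar>f x\<bar> \<le> C" by (auto simp: bounded_iff)
    then show ?thesis using that(2) by (intro exI[of _ "max C 0"]) (metis abs_zero max.cobounded2 max.coboundedI1)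
  qed
  show "\<exists>C. \<forall>x. \<bar>\<phi> x\<bar> \<le> C" using Ck[of 0] K by (intro bd) auto
  have "\<forall>b\<in>Basis. \<exists>C. \<forall>x. \<bar>frechet_derivative \<phi> (at x) b\<bar> \<le> C"
    using cb z K by (intro ballI bd) auto
  then obtain C where C: "\<And>b x. b \<in> Basis \<Longrightarrow> \<bar>frechet_derivative \<phi> (at x) b\<bar> \<le> C b" by metis
  show "\<exists>C. \<forall>x e. \<bar>frechet_derivative \<phi> (at x) e\<bar> \<le> C * norm e"
  proof (intro exI allI)
    fix x e
    have "\<bar>frechet_derivative \<phi> (at x) e\<bar> \<le> (\<Sum>b\<in>Basis. \<bar>(e \<bullet> b) * frechet_derivative \<phi> (at x) b\<bar>)"
      by (subst lin) (rule sum_abs)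
    also have "\<dots> \<le> (\<Sum>b\<in>Basis. norm e * C b)"
      by (intro sum_mono) (auto simp: abs_mult intro!: mult_mono C Basis_le_norm)
    finally show "\<bar>frechet_derivative \<phi> (at x) e\<bar> \<le> (\<Sum>b\<in>Basis. C b) * norm e"
      by (simp add: sum_distrib_left mult.commute)
  qed
qed

lemma test_fun_measurable:
  assumes "test_fun U \<phi>"
  shows "\<phi> \<in> borel_measurable borel" "(\<lambda>x. frechet_derivative \<phi> (at x) e) \<in> borel_measurable borel"
  using assms test_fun_derivative_bound(2)[OF assms]
  by (auto simp: test_fun_def intro: borel_measurable_continuous_onI Ck_imp_continuous)

lemma bwg_direction:
  assumes w: "bwg U g G" and t: "test_fun U \<phi>"
  shows "(LINT x|lborel. g x * frechet_derivative \<phi> (at x) e) = - (LINT x|lborel. (G x \<bullet> e) * \<phi> x)"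
proof -
  note tb = test_fun_derivative_bound[OF t]
  note [measurable] = test_fun_measurable[OF t] bwgD(1,2)[OF w]
  obtain K where K: "compact K" "K \<subseteq> U" "\<And>x. x \<notin> K \<Longrightarrow> \<phi> x = 0"
    using t by (auto simp: test_fun_def)
  obtain C where C: "\<And>x e. \<bar>frechet_derivative \<phi> (at x) e\<bar> \<le> C * norm e" using tb(3) by auto
  obtain C' where C': "\<And>x. \<bar>\<phi> x\<bar> \<le> C'" using tb(4) by auto
  have i1: "integrable lborel (\<lambda>x. frechet_derivative \<phi> (at x) b *\<^sub>R g x)" for b
    by (rule integrable_mult_compact[OF bwgD(3)[OF w K(1,2)], of _ "C * norm b"])
      (use K C tb(5)[OF K(1)] in auto)
  have i2: "integrable lborel (\<lambda>x. \<phi> x *\<^sub>R G x)"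
    by (rule integrable_mult_compact[OF bwgD(4)[OF w K(1,2)], of _ C']) (use K C' in auto)
  have i3: "integrable lborel (\<lambda>x. (G x \<bullet> b) * \<phi> x)" for b
    using integrable_inner_left[OF i2, of b] by (simp add: mult.commute)
  have l: "linear (frechet_derivative \<phi> (at x))" for x by (rule has_derivative_linear[OF tb(1)])
  have "(LINT x|lborel. g x * frechet_derivative \<phi> (at x) e) =
      (LINT x|lborel. (\<Sum>b\<in>Basis. (e \<bullet> b) * (g x * frechet_derivative \<phi> (at x) b)))"
  proof (rule Bochner_Integration.integral_cong[OF refl])
    fix x
    have "frechet_derivative \<phi> (at x) (\<Sum>b\<in>Basis. (e \<bullet> b) *\<^sub>R b) = (\<Sum>b\<in>Basis. (e \<bullet> b) * frechet_derivative \<phi> (at x) b)"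
      by (simp add: linear_sum[OF l] linear_cmul[OF l])
    then show "g x * frechet_derivative \<phi> (at x) e = (\<Sum>b\<in>Basis. (e \<bullet> b) * (g x * frechet_derivative \<phi> (at x) b))"
      by (simp add: euclidean_representation sum_distrib_left mult_ac)
  qed
  also have "\<dots> = (\<Sum>b\<in>Basis. (e \<bullet> b) * (LINT x|lborel. g x * frechet_derivative \<phi> (at x) b))"
    using i1 by (subst Bochner_Integration.integral_sum) (auto simp: mult.commute)
  also have "\<dots> = (\<Sum>b\<in>Basis. (e \<bullet> b) * - (LINT x|lborel. (G x \<bullet> b) * \<phi> x))"
    using w t by (intro sum.cong) (auto simp: bwg_def)
  also have "\<dots> = - (LINT x|lborel. (\<Sum>b\<in>Basis. (e \<bullet> b) * ((G x \<bullet> b) * \<phi> x)))"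
    using i3 by (subst Bochner_Integration.integral_sum) (auto simp: sum_negf)
  also have "(\<lambda>x. \<Sum>b\<in>Basis. (e \<bullet> b) * ((G x \<bullet> b) * \<phi> x)) = (\<lambda>x. (G x \<bullet> e) * \<phi> x)"
    by (subst euclidean_inner[of _ e]) (auto simp: sum_distrib_left sum_distrib_right mult_ac)
  finally show ?thesis .
qed

lemma bwg_translate_derivative:
  assumes w: "bwg U g G"
    and Ck: "\<And>k. Ck k \<psi>" and K: "compact K" "K \<subseteq> U"
    and z: "\<And>r y. r \<in> {0..s} \<Longrightarrow> y \<notin> K \<Longrightarrow> \<psi> (y - (p + r *\<^sub>R e)) = 0"
    and r: "r \<in> {0..s}"
  shows "((\<lambda>r. LINT y|lborel. g y * \<psi> (y - (p + r *\<^sub>R e))) has_real_derivative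
      (LINT y|lborel. (G y \<bullet> e) * \<psi> (y - (p + r *\<^sub>R e)))) (at r within {0..s})"
proof -
  define \<phi> where "\<phi> r y = \<psi> (y - (p + r *\<^sub>R e))" for r y
  have t: "test_fun U (\<phi> r)" if "r \<in> {0..s}" for r
    unfolding test_fun_def \<phi>_def using z[OF that] K by (auto intro: Ck_translate Ck)
  have tU: "test_fun UNIV \<psi>"
    unfolding test_fun_def
  proof (intro conjI exI[of _ "(\<lambda>y. y - (p + r *\<^sub>R e)) ` K"] allI impI)
    show "compact ((\<lambda>y. y - (p + r *\<^sub>R e)) ` K)"
      using K(1) by (intro compact_continuous_image continuous_intros)
    fix x assume "x \<notin> (\<lambda>y. y - (p + r *\<^sub>R e)) ` K"
    then have "x + (p + r *\<^sub>R e) \<notin> K" by (metis add_diff_cancel_right' image_eqI)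
    then show "\<psi> x = 0" using z[OF r, of "x + (p + r *\<^sub>R e)"] by simp
  qed (use Ck in auto)
  note d\<psi> = test_fun_derivative_bound(1)[OF tU]
  obtain C where C: "\<And>x e. \<bar>frechet_derivative \<psi> (at x) e\<bar> \<le> C * norm e"
    using test_fun_derivative_bound(3)[OF tU] by auto
  obtain C' where C': "\<And>x. \<bar>\<psi> x\<bar> \<le> C'" using test_fun_derivative_bound(4)[OF tU] by auto
  have [measurable]: "g \<in> borel_measurable borel" "\<psi> \<in> borel_measurable borel"
    using bwgD(1)[OF w] test_fun_measurable(1)[OF tU] by auto
  have dline: "((\<lambda>r. \<psi> (y - (p + r *\<^sub>R e))) has_real_derivative - frechet_derivative \<psi> (at (y - (p + r *\<^sub>R e))) e) (at r within A)" for y r A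
  proof -
    have l: "linear (frechet_derivative \<psi> (at (y - (p + r *\<^sub>R e))))" by (rule has_derivative_linear[OF d\<psi>])
    have "((\<lambda>r. y - (p + r *\<^sub>R e)) has_derivative (\<lambda>h. - (h *\<^sub>R e))) (at r within A)"
      by (auto intro!: derivative_eq_intros)
    from has_derivative_compose[OF this d\<psi>]
    have "((\<lambda>r. \<psi> (y - (p + r *\<^sub>R e))) has_derivative (\<lambda>h. frechet_derivative \<psi> (at (y - (p + r *\<^sub>R e))) (- (h *\<^sub>R e)))) (at r within A)" .
    moreover have "(\<lambda>h. frechet_derivative \<psi> (at (y - (p + r *\<^sub>R e))) (- (h *\<^sub>R e))) =
        (*) (- frechet_derivative \<psi> (at (y - (p + r *\<^sub>R e))) e)"
      by (simp add: fun_eq_iff linear_neg[OF l] linear_cmul[OF l])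
    ultimately show ?thesis
      by (simp add: has_field_derivative_def)
  qed
  have lip: "\<bar>\<psi> (y - (p + r1 *\<^sub>R e)) - \<psi> (y - (p + r2 *\<^sub>R e))\<bar> \<le> (C * norm e) * \<bar>r1 - r2\<bar>" for y r1 r2
  proof -
    have "norm (\<psi> (y - (p + r1 *\<^sub>R e)) - \<psi> (y - (p + r2 *\<^sub>R e))) \<le> (C * norm e) * norm (r1 - r2)"
      by (rule field_differentiable_bound[of UNIV, OF _ dline]) (use C in auto)
    then show ?thesis by simp
  qed
  have fd: "frechet_derivative (\<phi> r) (at y) = frechet_derivative \<psi> (at (y - (p + r *\<^sub>R e)))" for y
  proof -
    have "((\<lambda>x. x - (p + r *\<^sub>R e)) has_derivative (\<lambda>h. h)) (at y)" by (auto intro!: derivative_eq_intros)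
    from has_derivative_compose[OF this d\<psi>] show ?thesis
      unfolding \<phi>_def by (metis frechet_derivative_at)
  qed
  have int: "integrable lborel (\<lambda>y. g y * \<phi> r y)" if "r \<in> {0..s}" for r
    using integrable_mult_compact[OF bwgD(3)[OF w K], of "\<phi> r" C'] C' z[OF that]
      test_fun_measurable(1)[OF t[OF that]]
    by (auto simp: \<phi>_def mult.commute)
  have gK: "integrable lborel (\<lambda>y. norm (indicator K y *\<^sub>R g y))"
    using bwgD(3)[OF w K] by (auto simp: set_integrable_def)
  have "((\<lambda>r'. ((LINT y|lborel. g y * \<phi> r' y) - (LINT y|lborel. g y * \<phi> r y)) / (r' - r)) \<longlongrightarrow>
      (LINT y|lborel. (G y \<bullet> e) * \<phi> r y)) (at r within {0..s})"
    unfolding tendsto_at_iff_sequentially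
  proof (intro allI impI)
    fix X assume X: "\<forall>i. X i \<in> {0..s} - {r}" "X \<longlonglongrightarrow> r"
    have "(\<lambda>i. LINT y|lborel. g y * ((\<phi> (X i) y - \<phi> r y) / (X i - r))) \<longlonglongrightarrow>
        (LINT y|lborel. g y * - frechet_derivative (\<phi> r) (at y) e)"
    proof (rule integral_dominated_convergence[where w="\<lambda>y. (C * norm e) * norm (indicator K y *\<^sub>R g y)"])
      show "AE y in lborel. (\<lambda>i. g y * ((\<phi> (X i) y - \<phi> r y) / (X i - r))) \<longlonglongrightarrow> g y * - frechet_derivative (\<phi> r) (at y) e"
      proof (intro AE_I2 tendsto_mult tendsto_const)
        fix y
        show "(\<lambda>i. (\<phi> (X i) y - \<phi> r y) / (X i - r)) \<longlonglongrightarrow> - frechet_derivative (\<phi> r) (at y) e"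
          using dline[of y r "{0..s}"] X
          unfolding has_field_derivative_iff tendsto_at_iff_sequentially fd \<phi>_def comp_def by blast
      qed
      show "AE y in lborel. norm (g y * ((\<phi> (X i) y - \<phi> r y) / (X i - r))) \<le> (C * norm e) * norm (indicator K y *\<^sub>R g y)" for i
      proof (intro AE_I2)
        fix y
        show "norm (g y * ((\<phi> (X i) y - \<phi> r y) / (X i - r))) \<le> (C * norm e) * norm (indicator K y *\<^sub>R g y)"
        proof (cases "y \<in> K")
          case True
          have "\<bar>\<phi> (X i) y - \<phi> r y\<bar> / \<bar>X i - r\<bar> \<le> C * norm e"
            using lip[of y "X i" r] X(1)[rule_format, of i] by (auto simp: \<phi>_def divide_le_eq)
          from mult_left_mono[OF this, of "\<bar>g y\<bar>"] show ?thesis using True by (simp add: abs_mult mult.commute)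
        next
          case False
          then show ?thesis using z[of "X i" y] z[OF r, of y] X(1) by (auto simp: \<phi>_def)
        qed
      qed
    qed (use gK test_fun_measurable(2)[OF t[OF r]] in \<open>auto simp: \<phi>_def\<close>)
    moreover have "(LINT y|lborel. g y * ((\<phi> (X i) y - \<phi> r y) / (X i - r))) =
        ((LINT y|lborel. g y * \<phi> (X i) y) - (LINT y|lborel. g y * \<phi> r y)) / (X i - r)" for i
    proof -
      have "X i \<in> {0..s}" using X(1) by auto
      then have "(LINT y|lborel. g y * \<phi> (X i) y) - (LINT y|lborel. g y * \<phi> r y) = (LINT y|lborel. g y * \<phi> (X i) y - g y * \<phi> r y)"
        using int r by (intro Bochner_Integration.integral_diff[symmetric]) auto
      moreover have "(LINT y|lborel. g y * ((\<phi> (X i) y - \<phi> r y) / (X i - r))) =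
          (LINT y|lborel. (g y * \<phi> (X i) y - g y * \<phi> r y) / (X i - r))"
        by (intro Bochner_Integration.integral_cong refl) (simp add: right_diff_distrib)
      ultimately show ?thesis by simp
    qed
    moreover have "(LINT y|lborel. g y * - frechet_derivative (\<phi> r) (at y) e) = (LINT y|lborel. (G y \<bullet> e) * \<phi> r y)"
      using bwg_direction[OF w t[OF r], of e] by simp
    ultimately show "((\<lambda>r'. ((LINT y|lborel. g y * \<phi> r' y) - (LINT y|lborel. g y * \<phi> r y)) / (r' - r)) \<circ> X) \<longlonglongrightarrow>
      (LINT y|lborel. (G y \<bullet> e) * \<phi> r y)"
      by (simp only: comp_def)
  qed
  then show ?thesis
    unfolding has_field_derivative_iff \<phi>_def .
qed

definition box_int :: "real \<Rightarrow> ('a::euclidean_space \<Rightarrow> 'b::{banach,second_countable_topology}) \<Rightarrow> 'a \<Rightarrow> 'b" where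
  "box_int h f p = (LINT y:cbox p (p + h *\<^sub>R One)|lborel. f y)"

lemma AE_not_box_frontier: "AE y in lborel. y \<in> cbox a c \<longrightarrow> y \<in> box a c"
proof -
  have "negligible (cbox a c - box a c)" by (rule negligible_frontier_interval)
  then have "cbox a c - box a c \<in> null_sets lborel"
    using negligible_iff_null_sets null_sets_completion_iff[of "cbox a c - box a c" lborel] by auto
  then have "AE y in lborel. y \<notin> cbox a c - box a c" by (rule AE_not_in)
  then show ?thesis by (rule eventually_mono) auto
qed

lemma cbox_translate_iff: "y \<in> cbox q (q + h *\<^sub>R One) \<longleftrightarrow> y - q \<in> cbox 0 (h *\<^sub>R One)"
  for y :: "'a::euclidean_space"
  by (auto simp: mem_box algebra_simps)

lemma box_translate_iff: "y \<in> box q (q + h *\<^sub>R One) \<longleftrightarrow> y - q \<in> box 0 (h *\<^sub>R One)"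
  for y :: "'a::euclidean_space"
  by (auto simp: mem_box algebra_simps)

lemma bump_integral_bound:
  fixes f :: "'a::euclidean_space \<Rightarrow> real"
  assumes f: "set_integrable lborel K f" "f \<in> borel_measurable borel"
    and K: "cbox q (q + h *\<^sub>R One) \<subseteq> K"
  shows "integrable lborel (\<lambda>y. f y * box_bump 0 (h *\<^sub>R One) n (y - q))"
    and "\<bar>LINT y|lborel. f y * box_bump 0 (h *\<^sub>R One) n (y - q)\<bar> \<le> (LINT y|lborel. norm (indicator K y *\<^sub>R f y))"
proof -
  have m: "(\<lambda>y. box_bump 0 (h *\<^sub>R One) n (y - q)) \<in> borel_measurable borel"
    by (intro borel_measurable_continuous_onI Ck_imp_continuous[of 0] Ck_translate Ck_box_bump)
  have z: "box_bump 0 (h *\<^sub>R One) n (y - q) = 0" if "y \<notin> K" for y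
    using that K box_subset_cbox[of q] by (intro box_bump_eq_0) (auto simp flip: box_translate_iff)
  have i: "integrable lborel (\<lambda>y. box_bump 0 (h *\<^sub>R One) n (y - q) *\<^sub>R f y)"
    using f m z by (intro integrable_mult_compact[where K=K and C=1]) (auto simp: abs_of_nonneg box_bump_bounds)
  then show "integrable lborel (\<lambda>y. f y * box_bump 0 (h *\<^sub>R One) n (y - q))"
    by (simp add: mult.commute)
  then have "\<bar>LINT y|lborel. f y * box_bump 0 (h *\<^sub>R One) n (y - q)\<bar> \<le> (LINT y|lborel. \<bar>f y * box_bump 0 (h *\<^sub>R One) n (y - q)\<bar>)"
    using integral_norm_bound[of lborel "\<lambda>y. f y * box_bump 0 (h *\<^sub>R One) n (y - q)"] by simp
  also have "\<dots> \<le> (LINT y|lborel. norm (indicator K y *\<^sub>R f y))"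
  proof (rule integral_mono)
    show "integrable lborel (\<lambda>y. \<bar>f y * box_bump 0 (h *\<^sub>R One) n (y - q)\<bar>)"
      using i by (simp add: mult.commute)
    show "integrable lborel (\<lambda>y. norm (indicator K y *\<^sub>R f y))"
      using f(1) unfolding set_integrable_def by (rule integrable_norm)
    show "\<bar>f y * box_bump 0 (h *\<^sub>R One) n (y - q)\<bar> \<le> norm (indicator K y *\<^sub>R f y)" for y
      using z[of y] mult_left_mono[OF box_bump_bounds(2)[of 0 "h *\<^sub>R One" n "y - q"], of "\<bar>f y\<bar>"] box_bump_bounds(1)[of 0 "h *\<^sub>R One" n "y - q"]
      by (auto simp: abs_mult split: split_indicator)
  qed
  finally show "\<bar>LINT y|lborel. f y * box_bump 0 (h *\<^sub>R One) n (y - q)\<bar> \<le> (LINT y|lborel. norm (indicator K y *\<^sub>R f y))" .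
qed

lemma bump_integral_tendsto:
  fixes f :: "'a::euclidean_space \<Rightarrow> real"
  assumes f: "set_integrable lborel K f" "f \<in> borel_measurable borel"
    and K: "cbox q (q + h *\<^sub>R One) \<subseteq> K"
  shows "(\<lambda>n. LINT y|lborel. f y * box_bump 0 (h *\<^sub>R One) n (y - q)) \<longlonglongrightarrow> box_int h f q"
  unfolding box_int_def set_lebesgue_integral_def
proof (rule integral_dominated_convergence[where w="\<lambda>y. norm (indicator K y *\<^sub>R f y)"])
  have [measurable]: "(\<lambda>y. box_bump 0 (h *\<^sub>R One) n (y - q)) \<in> borel_measurable borel" for n
    by (intro borel_measurable_continuous_onI Ck_imp_continuous[of 0] Ck_translate Ck_box_bump)
  note f(2)[measurable]
  show "(\<lambda>y. f y * box_bump 0 (h *\<^sub>R One) n (y - q)) \<in> borel_measurable lborel" for n by simp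
  show "(\<lambda>y. indicator (cbox q (q + h *\<^sub>R One)) y *\<^sub>R f y) \<in> borel_measurable lborel" by simp
  show "integrable lborel (\<lambda>y. norm (indicator K y *\<^sub>R f y))"
    using f(1) unfolding set_integrable_def by (rule integrable_norm)
  show "AE y in lborel. (\<lambda>n. f y * box_bump 0 (h *\<^sub>R One) n (y - q)) \<longlonglongrightarrow> indicator (cbox q (q + h *\<^sub>R One)) y *\<^sub>R f y"
    using AE_not_box_frontier[of q "q + h *\<^sub>R One"]
  proof (rule eventually_mono)
    fix y assume y: "y \<in> cbox q (q + h *\<^sub>R One) \<longrightarrow> y \<in> box q (q + h *\<^sub>R One)"
    have "indicator (cbox q (q + h *\<^sub>R One)) y = (indicator (box 0 (h *\<^sub>R One)) (y - q) :: real)"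
      using y box_subset_cbox[of q "q + h *\<^sub>R One"] box_translate_iff[of y q h] by (auto split: split_indicator)
    then show "(\<lambda>n. f y * box_bump 0 (h *\<^sub>R One) n (y - q)) \<longlonglongrightarrow> indicator (cbox q (q + h *\<^sub>R One)) y *\<^sub>R f y"
      using tendsto_mult[OF tendsto_const[of "f y"] box_bump_tendsto[of 0 "h *\<^sub>R One" "y - q"]] by (simp add: mult.commute)
  qed
  show "AE y in lborel. norm (f y * box_bump 0 (h *\<^sub>R One) n (y - q)) \<le> norm (indicator K y *\<^sub>R f y)" for n
  proof (rule AE_I2)
    fix y
    have z: "box_bump 0 (h *\<^sub>R One) n (y - q) = 0" if "y \<notin> K"
      using that K box_subset_cbox[of q] by (intro box_bump_eq_0) (auto simp flip: box_translate_iff)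
    show "norm (f y * box_bump 0 (h *\<^sub>R One) n (y - q)) \<le> norm (indicator K y *\<^sub>R f y)"
      using z mult_left_mono[OF box_bump_bounds(2)[of 0 "h *\<^sub>R One" n "y - q"], of "\<bar>f y\<bar>"] box_bump_bounds(1)[of 0 "h *\<^sub>R One" n "y - q"]
      by (auto simp: abs_mult split: split_indicator)
  qed
qed

lemma bwg_inner_integrable:
  assumes "bwg U g G" "compact K" "K \<subseteq> U"
  shows "set_integrable lborel K (\<lambda>y. G y \<bullet> e)"
  using integrable_inner_left[OF bwgD(4)[OF assms, unfolded set_integrable_def], of e]
  by (simp add: set_integrable_def)

lemma box_sweep_compact:
  fixes p e :: "'a::euclidean_space" and s h :: real
  defines "K \<equiv> (\<lambda>(r, y). p + r *\<^sub>R e + y) ` ({0..s} \<times> cbox 0 (h *\<^sub>R One))"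
  shows "compact K"
    and "K = (\<Union>r\<in>{0..s}. cbox (p + r *\<^sub>R e) (p + r *\<^sub>R e + h *\<^sub>R One))"
proof -
  show "compact K" unfolding K_def
    by (intro compact_continuous_image compact_Times) (auto simp: case_prod_unfold intro!: continuous_intros)
  show "K = (\<Union>r\<in>{0..s}. cbox (p + r *\<^sub>R e) (p + r *\<^sub>R e + h *\<^sub>R One))"
  proof (intro set_eqI iffI)
    fix y assume "y \<in> (\<Union>r\<in>{0..s}. cbox (p + r *\<^sub>R e) (p + r *\<^sub>R e + h *\<^sub>R One))"
    then obtain r where "r \<in> {0..s}" "y - (p + r *\<^sub>R e) \<in> cbox 0 (h *\<^sub>R One)"
      using cbox_translate_iff by blast
    then show "y \<in> K" unfolding K_def by (intro image_eqI[of _ _ "(r, y - (p + r *\<^sub>R e))"]) auto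
  next
    fix y assume "y \<in> K"
    then obtain r z where "r \<in> {0..s}" "z \<in> cbox 0 (h *\<^sub>R One)" "y = p + r *\<^sub>R e + z"
      unfolding K_def by auto
    then show "y \<in> (\<Union>r\<in>{0..s}. cbox (p + r *\<^sub>R e) (p + r *\<^sub>R e + h *\<^sub>R One))"
      by (intro UN_I[of r]) (simp_all add: cbox_translate_iff)
  qed
qed

lemma box_int_line:
  assumes w: "bwg U g G"
    and s: "0 \<le> s" and box: "\<And>r. r \<in> {0..s} \<Longrightarrow> cbox (p + r *\<^sub>R e) (p + r *\<^sub>R e + h *\<^sub>R One) \<subseteq> U"
  shows "((\<lambda>r. box_int h (\<lambda>y. G y \<bullet> e) (p + r *\<^sub>R e)) has_integral
      box_int h g (p + s *\<^sub>R e) - box_int h g p) {0..s}"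
proof -
  define K where "K = (\<lambda>(r, y). p + r *\<^sub>R e + y) ` ({0..s} \<times> cbox 0 (h *\<^sub>R One))"
  have K: "compact K" and KU: "K = (\<Union>r\<in>{0..s}. cbox (p + r *\<^sub>R e) (p + r *\<^sub>R e + h *\<^sub>R One))"
    unfolding K_def by (rule box_sweep_compact)+
  have "K \<subseteq> U" unfolding KU using box by blast
  have Kr: "cbox (p + r *\<^sub>R e) (p + r *\<^sub>R e + h *\<^sub>R One) \<subseteq> K" if "r \<in> {0..s}" for r
    unfolding KU using that by blast
  note [measurable] = bwgD(1,2)[OF w]
  define \<psi> where "\<psi> = box_bump 0 (h *\<^sub>R One :: 'a)"
  define J where "J n r = (LINT y|lborel. g y * \<psi> n (y - (p + r *\<^sub>R e)))" for n r
  define D where "D n r = (LINT y|lborel. (G y \<bullet> e) * \<psi> n (y - (p + r *\<^sub>R e)))" for n r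
  have der: "(J n has_real_derivative D n r) (at r within {0..s})" if r: "r \<in> {0..s}" for n r
    unfolding J_def D_def
  proof (rule bwg_translate_derivative[OF w _ K \<open>K \<subseteq> U\<close> _ r])
    show "Ck k (\<psi> n)" for k unfolding \<psi>_def by (rule Ck_box_bump)
    show "\<psi> n (y - (p + r *\<^sub>R e)) = 0" if "r \<in> {0..s}" "y \<notin> K" for r y
      unfolding \<psi>_def using Kr[OF that(1)] that(2) box_subset_cbox[of "p + r *\<^sub>R e"]
      by (intro box_bump_eq_0) (auto simp flip: box_translate_iff)
  qed
  have "(D n has_integral J n s - J n 0) {0..s}" for n
    by (rule fundamental_theorem_of_calculus[OF s])
      (use der in \<open>simp add: has_real_derivative_iff_has_vector_derivative\<close>)
  then show ?thesis
  proof (rule has_integral_dominated_convergence)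
    note Ge = bwg_inner_integrable[OF w K \<open>K \<subseteq> U\<close>, of e]
    show "(\<lambda>_. LINT y|lborel. norm (indicator K y *\<^sub>R (G y \<bullet> e))) integrable_on {0..s}"
      by (rule integrable_const_ivl)
    show "\<forall>r\<in>{0..s}. norm (D n r) \<le> (LINT y|lborel. norm (indicator K y *\<^sub>R (G y \<bullet> e)))" for n
      unfolding D_def \<psi>_def real_norm_def using bump_integral_bound(2)[OF Ge _ Kr] by auto
    show "\<forall>r\<in>{0..s}. (\<lambda>n. D n r) \<longlonglongrightarrow> box_int h (\<lambda>y. G y \<bullet> e) (p + r *\<^sub>R e)"
      unfolding D_def \<psi>_def using bump_integral_tendsto[OF Ge _ Kr] by auto
    have "(\<lambda>n. J n r) \<longlonglongrightarrow> box_int h g (p + r *\<^sub>R e)" if "r \<in> {0..s}" for r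
      unfolding J_def \<psi>_def using bump_integral_tendsto[OF bwgD(3)[OF w K \<open>K \<subseteq> U\<close>] _ Kr[OF that]] by auto
    from this[of s] this[of 0] s
    show "(\<lambda>n. J n s - J n 0) \<longlonglongrightarrow> box_int h g (p + s *\<^sub>R e) - box_int h g p"
      by (auto intro!: tendsto_diff)
  qed
qed

lemma continuous_box_int:
  fixes f :: "'a::euclidean_space \<Rightarrow> 'b::{banach,second_countable_topology}"
  assumes f: "integrable lborel f"
  shows "continuous_on UNIV (box_int h f)"
proof -
  have [measurable]: "f \<in> borel_measurable borel" using borel_measurable_integrable[OF f] by simp
  have "(\<lambda>n. box_int h f (X n)) \<longlonglongrightarrow> box_int h f p" if X: "X \<longlonglongrightarrow> p" for X p
    unfolding box_int_def set_lebesgue_integral_def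
  proof (rule integral_dominated_convergence[where w="\<lambda>y. norm (f y)"])
    show "AE y in lborel. (\<lambda>n. indicator (cbox (X n) (X n + h *\<^sub>R One)) y *\<^sub>R f y) \<longlonglongrightarrow> indicator (cbox p (p + h *\<^sub>R One)) y *\<^sub>R f y"
      using AE_not_box_frontier[of p "p + h *\<^sub>R One"]
    proof (rule eventually_mono)
      fix y assume y: "y \<in> cbox p (p + h *\<^sub>R One) \<longrightarrow> y \<in> box p (p + h *\<^sub>R One)"
      have X': "(\<lambda>n. y - X n) \<longlonglongrightarrow> y - p" by (intro tendsto_intros X)
      have "eventually (\<lambda>n. indicator (cbox (X n) (X n + h *\<^sub>R One)) y = (indicator (cbox p (p + h *\<^sub>R One)) y :: real)) sequentially"
      proof (cases "y \<in> cbox p (p + h *\<^sub>R One)")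
        case True
        then have "y - p \<in> box 0 (h *\<^sub>R One)" using y by (simp flip: box_translate_iff)
        then have "eventually (\<lambda>n. y - X n \<in> box 0 (h *\<^sub>R One)) sequentially"
          using topological_tendstoD[OF X' open_box] by auto
        then show ?thesis
        proof (rule eventually_mono)
          fix n assume "y - X n \<in> box 0 (h *\<^sub>R One)"
          then have "y \<in> cbox (X n) (X n + h *\<^sub>R One)"
            using box_subset_cbox[of 0 "h *\<^sub>R One :: 'a"] by (subst cbox_translate_iff) auto
          then show "indicator (cbox (X n) (X n + h *\<^sub>R One)) y = (indicator (cbox p (p + h *\<^sub>R One)) y :: real)"
            using True by simp
        qed
      next
        case False
        then have "y - p \<in> - cbox 0 (h *\<^sub>R One)" by (simp flip: cbox_translate_iff)
        then have "eventually (\<lambda>n. y - X n \<in> - cbox 0 (h *\<^sub>R One)) sequentially"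
          using topological_tendstoD[OF X', of "- cbox 0 (h *\<^sub>R One)"] by (auto simp: open_Compl)
        then show ?thesis
          by (rule eventually_mono) (use False in \<open>simp flip: cbox_translate_iff\<close>)
      qed
      then show "(\<lambda>n. indicator (cbox (X n) (X n + h *\<^sub>R One)) y *\<^sub>R f y) \<longlonglongrightarrow> indicator (cbox p (p + h *\<^sub>R One)) y *\<^sub>R f y"
        by (intro tendsto_eventually) (auto elim: eventually_mono)
    qed
  qed (use f in \<open>auto split: split_indicator\<close>)
  then show ?thesis by (auto simp: continuous_on_sequentially comp_def)
qed

lemma box_int_restrict:
  assumes "cbox p (p + h *\<^sub>R One) \<subseteq> K"
  shows "box_int h (\<lambda>y. indicator K y *\<^sub>R f y) p = box_int h f p"
  unfolding box_int_def set_lebesgue_integral_def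
  using assms by (intro Bochner_Integration.integral_cong) (auto split: split_indicator)

lemma measure_cbox_One:
  fixes p :: "'a::euclidean_space"
  assumes "0 \<le> h"
  shows "measure lborel (cbox p (p + h *\<^sub>R One)) = h ^ DIM('a)"
  using assms by (simp add: measure_lborel_cbox_eq inner_add_left)

lemma norm_box_int_le:
  fixes f :: "'a::euclidean_space \<Rightarrow> 'b::{banach,second_countable_topology}"
  assumes h: "0 \<le> h" and M: "AE y in lborel. y \<in> cbox p (p + h *\<^sub>R One) \<longrightarrow> norm (f y) \<le> M" "0 \<le> M"
  shows "norm (box_int h f p) \<le> M * h ^ DIM('a)"
proof -
  let ?B = "cbox p (p + h *\<^sub>R One)"
  have "norm (box_int h f p) \<le> (LINT y|lborel. norm (indicator ?B y *\<^sub>R f y))"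
    unfolding box_int_def set_lebesgue_integral_def by (rule integral_norm_bound)
  also have "\<dots> \<le> (LINT y|lborel. indicator ?B y * M)"
  proof (cases "integrable lborel (\<lambda>y. norm (indicator ?B y *\<^sub>R f y))")
    case True
    then show ?thesis
      by (rule integral_mono_AE) (use M in \<open>auto split: split_indicator elim!: eventually_mono simp: emeasure_lborel_cbox_eq\<close>)
  next
    case False
    then show ?thesis using M by (simp add: not_integrable_integral_eq integral_nonneg_AE)
  qed
  also have "\<dots> = M * h ^ DIM('a)" using measure_cbox_One[OF h, of p] by (simp add: mult.commute)
  finally show ?thesis .
qed

lemma box_average_tendsto_AE:
  fixes f :: "'a::euclidean_space \<Rightarrow> 'b::euclidean_space"
  assumes f: "integrable lborel f"
  shows "AE p in lborel. (\<lambda>n. box_int (1 / real (Suc n)) f p /\<^sub>R (1 / real (Suc n)) ^ DIM('a)) \<longlonglongrightarrow> f p"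
proof -
  have si: "set_integrable lborel (cbox a b) f" for a b
    using f unfolding set_integrable_def by (intro integrable_mult_indicator) auto
  have hk: "integral (cbox a b) f = (LINT y:cbox a b|lborel. f y)" "f integrable_on cbox a b" for a b
    using set_borel_integral_eq_integral[OF si[of a b]] by auto
  obtain N where N: "negligible N"
    and lim: "\<And>x e. \<lbrakk>x \<notin> N; 0 < e\<rbrakk> \<Longrightarrow> \<exists>d>0. \<forall>h. 0 < h \<and> h < d \<longrightarrow>
          norm (integral (cbox x (x + h *\<^sub>R One)) f /\<^sub>R h ^ DIM('a) - f x) < e"
    using integrable_ccontinuous_explicit[OF hk(2)] by metis
  have "AE p in lebesgue. p \<notin> N" using N by (intro AE_not_in) (simp add: negligible_iff_null_sets)
  then have "AE p in lborel. p \<notin> N" by (simp add: AE_completion_iff)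
  then show ?thesis
  proof (rule eventually_mono)
    fix p assume "p \<notin> N"
    show "(\<lambda>n. box_int (1 / real (Suc n)) f p /\<^sub>R (1 / real (Suc n)) ^ DIM('a)) \<longlonglongrightarrow> f p"
      unfolding tendsto_iff
    proof (intro allI impI)
      fix e :: real assume "0 < e"
      then obtain d where d: "d > 0" "\<And>h. 0 < h \<and> h < d \<Longrightarrow>
          norm (integral (cbox p (p + h *\<^sub>R One)) f /\<^sub>R h ^ DIM('a) - f p) < e"
        using lim[OF \<open>p \<notin> N\<close>] by blast
      have "(\<lambda>n. 1 / real (Suc n)) \<longlonglongrightarrow> 0" by (rule LIMSEQ_Suc[OF lim_1_over_n])
      then have "eventually (\<lambda>n. 1 / real (Suc n) < d) sequentially"
        by (rule order_tendstoD(2)) (use d in simp)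
      then show "\<forall>\<^sub>F n in sequentially. dist (box_int (1 / real (Suc n)) f p /\<^sub>R (1 / real (Suc n)) ^ DIM('a)) (f p) < e"
        by (rule eventually_mono) (use d(2) in \<open>auto simp: dist_norm box_int_def hk\<close>)
    qed
  qed
qed

lemma box_average_tendsto_continuous:
  fixes f :: "'a::euclidean_space \<Rightarrow> 'b::euclidean_space"
  assumes f: "integrable lborel f" and c: "isCont f p"
  shows "(\<lambda>n. box_int (1 / real (Suc n)) f p /\<^sub>R (1 / real (Suc n)) ^ DIM('a)) \<longlonglongrightarrow> f p"
  unfolding tendsto_iff
proof (intro allI impI)
  fix e :: real assume e: "0 < e"
  obtain d where d: "d > 0" "\<And>y. dist y p < d \<Longrightarrow> dist (f y) (f p) < e / 2"
    using c e unfolding continuous_at_eps_delta by (metis half_gt_zero)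
  have "(\<lambda>n. norm ((1 / real (Suc n)) *\<^sub>R (One :: 'a))) \<longlonglongrightarrow> norm (0 *\<^sub>R (One :: 'a))"
    by (intro tendsto_intros LIMSEQ_Suc[OF lim_1_over_n])
  then have "eventually (\<lambda>n. norm ((1 / real (Suc n)) *\<^sub>R (One :: 'a)) < d) sequentially"
    by (rule order_tendstoD(2)) (use d in simp)
  then show "\<forall>\<^sub>F n in sequentially. dist (box_int (1 / real (Suc n)) f p /\<^sub>R (1 / real (Suc n)) ^ DIM('a)) (f p) < e"
  proof (rule eventually_mono)
    fix n assume n: "norm ((1 / real (Suc n)) *\<^sub>R (One :: 'a)) < d"
    define h where "h = 1 / real (Suc n)"
    have h: "0 < h" by (simp add: h_def)
    let ?B = "cbox p (p + h *\<^sub>R One)"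
    have si: "set_integrable lborel ?B f"
      using f unfolding set_integrable_def by (intro integrable_mult_indicator) auto
    have ci: "integrable lborel (\<lambda>y. indicator ?B y *\<^sub>R f p)"
      by (simp add: emeasure_lborel_cbox_eq)
    have "box_int h (\<lambda>y. f y - f p) p = box_int h f p - box_int h (\<lambda>y. f p) p"
      unfolding box_int_def using si ci by (intro set_integral_diff) (auto simp: set_integrable_def)
    also have "box_int h (\<lambda>y. f p) p = h ^ DIM('a) *\<^sub>R f p"
      unfolding box_int_def set_lebesgue_integral_def
      using measure_cbox_One[of h p] h by (subst integral_scaleR_left) (auto simp: emeasure_lborel_cbox_eq)
    finally have eq: "box_int h (\<lambda>y. f y - f p) p = box_int h f p - h ^ DIM('a) *\<^sub>R f p" .
    have near: "norm (f y - f p) \<le> e / 2" if "y \<in> ?B" for y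
    proof -
      have "norm (y - p) \<le> norm (h *\<^sub>R One :: 'a)"
        using that by (intro norm_le_componentwise) (auto simp: mem_box algebra_simps)
      then have "dist y p < d" using n by (simp add: dist_norm h_def)
      then show ?thesis using d(2)[of y] by (simp add: dist_norm)
    qed
    have "norm (box_int h (\<lambda>y. f y - f p) p) \<le> (e / 2) * h ^ DIM('a)"
      by (rule norm_box_int_le) (use h e near in auto)
    moreover have "norm (box_int h f p /\<^sub>R h ^ DIM('a) - f p) = norm (box_int h f p - h ^ DIM('a) *\<^sub>R f p) / h ^ DIM('a)"
    proof -
      have "box_int h f p /\<^sub>R h ^ DIM('a) - f p = (1 / h ^ DIM('a)) *\<^sub>R (box_int h f p - h ^ DIM('a) *\<^sub>R f p)"
        using h by (simp add: scaleR_diff_right divide_inverse)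
      then show ?thesis using h by simp
    qed
    ultimately have "norm (box_int h f p /\<^sub>R h ^ DIM('a) - f p) \<le> e / 2"
      using h unfolding eq by (simp add: divide_le_eq)
    then show "dist (box_int (1 / real (Suc n)) f p /\<^sub>R (1 / real (Suc n)) ^ DIM('a)) (f p) < e"
      using e unfolding dist_norm h_def by simp
  qed
qed

lemma bwg_test_integrable:
  assumes w: "bwg U g G" and t: "test_fun U \<phi>"
  shows "integrable lborel (\<lambda>x. g x * frechet_derivative \<phi> (at x) e)"
    and "integrable lborel (\<lambda>x. (G x \<bullet> e) * \<phi> x)"
proof -
  note tb = test_fun_derivative_bound[OF t]
  note [measurable] = test_fun_measurable[OF t] bwgD(1,2)[OF w]
  obtain K where K: "compact K" "K \<subseteq> U" "\<And>x. x \<notin> K \<Longrightarrow> \<phi> x = 0"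
    using t by (auto simp: test_fun_def)
  obtain C where C: "\<And>x e. \<bar>frechet_derivative \<phi> (at x) e\<bar> \<le> C * norm e" using tb(3) by auto
  obtain C' where C': "\<And>x. \<bar>\<phi> x\<bar> \<le> C'" using tb(4) by auto
  have "integrable lborel (\<lambda>x. frechet_derivative \<phi> (at x) e *\<^sub>R g x)"
    by (rule integrable_mult_compact[OF bwgD(3)[OF w K(1,2)], of _ "C * norm e"])
      (use K C tb(5)[OF K(1)] in auto)
  then show "integrable lborel (\<lambda>x. g x * frechet_derivative \<phi> (at x) e)"
    by (simp add: mult.commute)
  have "integrable lborel (\<lambda>x. \<phi> x *\<^sub>R (G x \<bullet> e))"
    by (rule integrable_mult_compact[OF bwg_inner_integrable[OF w K(1,2)], where C=C']) (use K C' in auto)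
  then show "integrable lborel (\<lambda>x. (G x \<bullet> e) * \<phi> x)"
    by (simp add: mult.commute)
qed

lemma bwg_diff:
  assumes g: "bwg U g G" and h: "bwg U h H"
  shows "bwg U (\<lambda>x. g x - h x) (\<lambda>x. G x - H x)"
  unfolding bwg_def
proof (intro conjI allI impI ballI)
  note [measurable] = bwgD(1,2)[OF g] bwgD(1,2)[OF h]
  show "(\<lambda>x. g x - h x) \<in> borel_measurable borel" "(\<lambda>x. G x - H x) \<in> borel_measurable borel" by simp_all
  fix K assume "compact K \<and> K \<subseteq> U"
  then show "set_integrable lborel K (\<lambda>x. g x - h x)" "set_integrable lborel K (\<lambda>x. G x - H x)"
    using bwgD(3,4)[OF g] bwgD(3,4)[OF h] by (auto intro: set_integral_diff)
next
  fix \<phi> :: "'a \<Rightarrow> real" and b :: 'a assume t: "test_fun U \<phi>" and b: "b \<in> Basis"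
  note i = bwg_test_integrable[OF g t, of b] bwg_test_integrable[OF h t, of b]
  have "(LINT x|lborel. (g x - h x) * frechet_derivative \<phi> (at x) b) =
      (LINT x|lborel. g x * frechet_derivative \<phi> (at x) b) - (LINT x|lborel. h x * frechet_derivative \<phi> (at x) b)"
    using i by (simp add: left_diff_distrib)
  also have "\<dots> = - (LINT x|lborel. (G x \<bullet> b) * \<phi> x) - - (LINT x|lborel. (H x \<bullet> b) * \<phi> x)"
    using bwg_direction[OF g t, of b] bwg_direction[OF h t, of b] by simp
  also have "\<dots> = - (LINT x|lborel. ((G x - H x) \<bullet> b) * \<phi> x)"
    using i by (simp add: left_diff_distrib inner_diff_left)
  finally show "(LINT x|lborel. (g x - h x) * frechet_derivative \<phi> (at x) b) = - (LINT x|lborel. ((G x - H x) \<bullet> b) * \<phi> x)" .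
qed

lemma small_box_subset:
  fixes p :: "'a::euclidean_space"
  assumes "open S" "p \<in> S"
  shows "\<exists>d>0. \<forall>h. h < d \<longrightarrow> cbox p (p + h *\<^sub>R One) \<subseteq> S"
proof -
  obtain e where e: "e > 0" "ball p e \<subseteq> S" using assms open_contains_ball by blast
  let ?d = "e / (norm (One :: 'a) + 1)"
  have "cbox p (p + h *\<^sub>R One) \<subseteq> S" if "h < ?d" for h
  proof
    fix y assume y: "y \<in> cbox p (p + h *\<^sub>R One)"
    have "norm (y - p) \<le> norm (h *\<^sub>R One :: 'a)"
      using y by (intro norm_le_componentwise) (auto simp: mem_box algebra_simps)
    moreover have "0 \<le> h"
    proof -
      have "(SOME b. b \<in> Basis) \<in> (Basis :: 'a set)" by (rule SOME_Basis)
      then show ?thesis using y by (force simp: mem_box inner_add_left)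
    qed
    moreover have "h * (norm (One :: 'a) + 1) < e"
      using that by (simp add: pos_less_divide_eq add_nonneg_pos)
    ultimately have "dist p y < e"
      by (simp add: dist_norm norm_minus_commute distrib_left)
    then show "y \<in> S" using e by auto
  qed
  moreover have "?d > 0" using e by (simp add: add_nonneg_pos)
  ultimately show ?thesis by blast
qed

lemma eventually_small_box_subset:
  fixes p :: "'a::euclidean_space"
  assumes "open S" "p \<in> S"
  shows "eventually (\<lambda>n. cbox p (p + (1 / real (Suc n)) *\<^sub>R One) \<subseteq> S) sequentially"
proof -
  obtain d where d: "d > 0" "\<And>h. h < d \<Longrightarrow> cbox p (p + h *\<^sub>R One) \<subseteq> S"
    using small_box_subset[OF assms] by blast
  have "(\<lambda>n. 1 / real (Suc n)) \<longlonglongrightarrow> 0" by (rule LIMSEQ_Suc[OF lim_1_over_n])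
  then have "eventually (\<lambda>n. 1 / real (Suc n) < d) sequentially"
    by (rule order_tendstoD(2)) (use d in simp)
  then show ?thesis by (rule eventually_mono) (rule d(2))
qed

lemma box_average_tendsto_AE_local:
  fixes f :: "'a::euclidean_space \<Rightarrow> 'b::euclidean_space"
  assumes f: "\<And>K. compact K \<Longrightarrow> K \<subseteq> V \<Longrightarrow> set_integrable lborel K f" and V: "open V"
  shows "AE p in lborel. p \<in> V \<longrightarrow>
    (\<lambda>n. box_int (1 / real (Suc n)) f p /\<^sub>R (1 / real (Suc n)) ^ DIM('a)) \<longlonglongrightarrow> f p"
proof -
  obtain D where D: "countable D" "D \<subseteq> Pow V" "\<And>X. X \<in> D \<Longrightarrow> \<exists>a b. X = cbox a b" "\<Union>D = V"
    using open_countable_Union_open_cbox[OF V] by metis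
  have "AE p in lborel. p \<in> X \<longrightarrow> (\<lambda>n. box_int (1 / real (Suc n)) f p /\<^sub>R (1 / real (Suc n)) ^ DIM('a)) \<longlonglongrightarrow> f p"
    if X: "X \<in> D" for X
  proof -
    obtain a b where ab: "X = cbox a b" using D(3)[OF X] by auto
    have "integrable lborel (\<lambda>y. indicator X y *\<^sub>R f y)"
      using f[of X] X D(2) ab by (auto simp: set_integrable_def)
    from box_average_tendsto_AE[OF this] AE_not_box_frontier[of a b]
    show ?thesis
    proof eventually_elim
      case (elim p)
      show ?case
      proof
        assume pX: "p \<in> X"
        then have "p \<in> box a b" using elim(2) ab by auto
        then have "eventually (\<lambda>n. cbox p (p + (1 / real (Suc n)) *\<^sub>R One) \<subseteq> box a b) sequentially"
          by (intro eventually_small_box_subset) auto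
        then have "eventually (\<lambda>n. box_int (1 / real (Suc n)) (\<lambda>y. indicator X y *\<^sub>R f y) p /\<^sub>R (1 / real (Suc n)) ^ DIM('a)
            = box_int (1 / real (Suc n)) f p /\<^sub>R (1 / real (Suc n)) ^ DIM('a)) sequentially"
        proof (rule eventually_mono)
          fix n assume "cbox p (p + (1 / real (Suc n)) *\<^sub>R One) \<subseteq> box a b"
          then have "cbox p (p + (1 / real (Suc n)) *\<^sub>R One) \<subseteq> X" using box_subset_cbox[of a b] ab by auto
          from box_int_restrict[OF this, of f]
          show "box_int (1 / real (Suc n)) (\<lambda>y. indicator X y *\<^sub>R f y) p /\<^sub>R (1 / real (Suc n)) ^ DIM('a)
            = box_int (1 / real (Suc n)) f p /\<^sub>R (1 / real (Suc n)) ^ DIM('a)" by simp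
        qed
        from Lim_transform_eventually[OF elim(1) this] pX
        show "(\<lambda>n. box_int (1 / real (Suc n)) f p /\<^sub>R (1 / real (Suc n)) ^ DIM('a)) \<longlonglongrightarrow> f p"
          by simp
      qed
    qed
  qed
  then have "AE p in lborel. \<forall>X\<in>D. p \<in> X \<longrightarrow> (\<lambda>n. box_int (1 / real (Suc n)) f p /\<^sub>R (1 / real (Suc n)) ^ DIM('a)) \<longlonglongrightarrow> f p"
    by (rule AE_ball_countable'[OF _ D(1)])
  then show ?thesis by (rule eventually_mono) (use D(4) in blast)
qed

lemma box_int_inner:
  fixes G :: "'a::euclidean_space \<Rightarrow> 'a"
  assumes "set_integrable lborel (cbox p (p + h *\<^sub>R One)) G"
  shows "box_int h (\<lambda>y. G y \<bullet> e) p = box_int h G p \<bullet> e"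
  using integral_inner_left[of e lborel "\<lambda>y. indicator (cbox p (p + h *\<^sub>R One)) y *\<^sub>R G y"] assms
  unfolding box_int_def set_lebesgue_integral_def set_integrable_def by simp

lemma bwg_zero:
  assumes w: "bwg U g G" and V: "open V" "V \<subseteq> U" and z: "AE x in lborel. x \<in> V \<longrightarrow> g x = 0"
  shows "AE x in lborel. x \<in> V \<longrightarrow> G x = 0"
proof -
  have bz: "box_int h G q = 0" if q: "cbox q (q + h *\<^sub>R One) \<subseteq> V" for q h
  proof -
    have qU: "compact (cbox q (q + h *\<^sub>R One))" "cbox q (q + h *\<^sub>R One) \<subseteq> U" using q V by auto
    have "box_int h (\<lambda>y. G y \<bullet> e) q = 0" for e
    proof (rule LIMSEQ_unique)
      show "(\<lambda>n. LINT y|lborel. (G y \<bullet> e) * box_bump 0 (h *\<^sub>R One) n (y - q)) \<longlonglongrightarrow> box_int h (\<lambda>y. G y \<bullet> e) q"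
        by (rule bump_integral_tendsto[OF bwg_inner_integrable[OF w qU]]) (use bwgD(2)[OF w] in auto)
      have "(LINT y|lborel. (G y \<bullet> e) * box_bump 0 (h *\<^sub>R One) n (y - q)) = 0" for n
      proof -
        have t: "test_fun U (\<lambda>y. box_bump 0 (h *\<^sub>R One) n (y - q))"
          by (rule test_fun_box_bump_translate) (use qU in \<open>simp add: add.commute\<close>)
        have "y \<in> V" if "frechet_derivative (\<lambda>y. box_bump 0 (h *\<^sub>R One) n (y - q)) (at y) e \<noteq> 0" for y
        proof (rule ccontr)
          assume "y \<notin> V"
          then have "y \<notin> cbox q (q + h *\<^sub>R One)" using q by auto
          moreover have "box_bump 0 (h *\<^sub>R One) n (x - q) = 0" if "x \<notin> cbox q (q + h *\<^sub>R One)" for x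
            using that box_subset_cbox[of q "q + h *\<^sub>R One"] by (intro box_bump_eq_0) (auto simp flip: box_translate_iff)
          ultimately show False using that test_fun_derivative_bound(5)[OF t qU(1)] by blast
        qed
        then have "(LINT y|lborel. g y * frechet_derivative (\<lambda>y. box_bump 0 (h *\<^sub>R One) n (y - q)) (at y) e) = (LINT y|(lborel :: 'a measure). 0)"
          using z test_fun_measurable(2)[OF t] bwgD(1)[OF w]
          by (intro integral_cong_AE) (auto elim!: eventually_mono)
        then show ?thesis using bwg_direction[OF w t, of e] by simp
      qed
      then show "(\<lambda>n. LINT y|lborel. (G y \<bullet> e) * box_bump 0 (h *\<^sub>R One) n (y - q)) \<longlonglongrightarrow> 0" by simp
    qed
    then have "box_int h G q \<bullet> box_int h G q = 0"
      using box_int_inner[OF bwgD(4)[OF w qU]] by metis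
    then show ?thesis by simp
  qed
  have "AE p in lborel. p \<in> V \<longrightarrow> (\<lambda>n. box_int (1 / real (Suc n)) G p /\<^sub>R (1 / real (Suc n)) ^ DIM('a)) \<longlonglongrightarrow> G p"
    by (rule box_average_tendsto_AE_local[OF _ V(1)]) (use bwgD(4)[OF w] V in auto)
  then show ?thesis
  proof (rule eventually_mono, intro impI)
    fix p assume p: "p \<in> V \<longrightarrow> (\<lambda>n. box_int (1 / real (Suc n)) G p /\<^sub>R (1 / real (Suc n)) ^ DIM('a)) \<longlonglongrightarrow> G p" and pV: "p \<in> V"
    have "(\<lambda>n. box_int (1 / real (Suc n)) G p /\<^sub>R (1 / real (Suc n)) ^ DIM('a)) \<longlonglongrightarrow> 0"
      using eventually_small_box_subset[OF V(1) pV]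
      by (intro tendsto_eventually) (auto elim!: eventually_mono simp: bz)
    with p pV show "G p = 0" using LIMSEQ_unique by blast
  qed
qed

lemma bwg_Lipschitz:
  fixes U :: "'a::euclidean_space set"
  assumes w: "bwg U g G" and U: "open U" "convex U"
    and M: "AE x in lborel. x \<in> U \<longrightarrow> norm (G x) \<le> M" "0 \<le> M"
  shows "\<exists>N\<in>null_sets lborel. \<forall>x\<in>U - N. \<forall>y\<in>U - N. \<bar>g x - g y\<bar> \<le> M * norm (x - y)"
proof -
  define A where "A n p = box_int (1 / real (Suc n)) g p /\<^sub>R (1 / real (Suc n)) ^ DIM('a)" for n p
  have "AE p in lborel. p \<in> U \<longrightarrow> (\<lambda>n. A n p) \<longlonglongrightarrow> g p"
    unfolding A_def by (rule box_average_tendsto_AE_local[OF _ U(1)]) (use bwgD(3)[OF w] in auto)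
  then obtain N where N: "N \<in> null_sets lborel" "{p \<in> space lborel. \<not> (p \<in> U \<longrightarrow> (\<lambda>n. A n p) \<longlonglongrightarrow> g p)} \<subseteq> N"
    unfolding eventually_ae_filter by auto
  have "\<bar>g x - g y\<bar> \<le> M * norm (x - y)" if x: "x \<in> U - N" and y: "y \<in> U - N" for x y
  proof -
    have lim: "(\<lambda>n. A n x) \<longlonglongrightarrow> g x" "(\<lambda>n. A n y) \<longlonglongrightarrow> g y"
      using N(2) x y by auto
    have xy: "x \<in> U" "y \<in> U" using x y by auto
    have "eventually (\<lambda>n. \<bar>A n x - A n y\<bar> \<le> M * norm (x - y)) sequentially"
      using eventually_small_box_subset[OF U(1) xy(1)] eventually_small_box_subset[OF U(1) xy(2)]
    proof eventually_elim
      case n: (elim n)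
      define h where "h = 1 / real (Suc n)"
      have h: "0 < h" by (simp add: h_def)
      have box: "cbox (y + r *\<^sub>R (x - y)) (y + r *\<^sub>R (x - y) + h *\<^sub>R One) \<subseteq> U" if r: "r \<in> {0..1}" for r
      proof
        fix z assume "z \<in> cbox (y + r *\<^sub>R (x - y)) (y + r *\<^sub>R (x - y) + h *\<^sub>R One)"
        then have "z - (y + r *\<^sub>R (x - y)) \<in> cbox 0 (h *\<^sub>R One)" by (simp add: cbox_translate_iff)
        then have "z - r *\<^sub>R (x - y) \<in> cbox y (y + h *\<^sub>R One)" "z - r *\<^sub>R (x - y) + (x - y) \<in> cbox x (x + h *\<^sub>R One)"
          by (simp_all only: cbox_translate_iff) (simp_all add: algebra_simps)
        then have "z - r *\<^sub>R (x - y) \<in> U" "z - r *\<^sub>R (x - y) + (x - y) \<in> U"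
          using n unfolding h_def[symmetric] by blast+
        then have "(1 - r) *\<^sub>R (z - r *\<^sub>R (x - y)) + r *\<^sub>R (z - r *\<^sub>R (x - y) + (x - y)) \<in> U"
          using U(2) r unfolding convex_alt by auto
        moreover have "(1 - r) *\<^sub>R (z - r *\<^sub>R (x - y)) + r *\<^sub>R (z - r *\<^sub>R (x - y) + (x - y)) = z"
          by (simp add: algebra_simps)
        ultimately show "z \<in> U" by simp
      qed
      have hi: "((\<lambda>r. box_int h (\<lambda>y. G y \<bullet> (x - y')) (y' + r *\<^sub>R (x - y'))) has_integral
          box_int h g (y' + 1 *\<^sub>R (x - y')) - box_int h g y') {0..1}" if "y' = y" for y'
        unfolding that by (rule box_int_line[OF w _ box]) auto
      have "norm (box_int h g (y + 1 *\<^sub>R (x - y)) - box_int h g y) \<le> (M * norm (x - y) * h ^ DIM('a)) * measure lborel (cbox 0 (1::real))"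
      proof (rule has_integral_bound[OF _ hi[OF refl, unfolded cbox_interval[symmetric]]])
        show "0 \<le> M * norm (x - y) * h ^ DIM('a)" using M h by simp
        fix r :: real assume "r \<in> cbox 0 1"
        then have bU: "cbox (y + r *\<^sub>R (x - y)) (y + r *\<^sub>R (x - y) + h *\<^sub>R One) \<subseteq> U" by (intro box) auto
        show "norm (box_int h (\<lambda>ya. G ya \<bullet> (x - y)) (y + r *\<^sub>R (x - y))) \<le> M * norm (x - y) * h ^ DIM('a)"
        proof (rule norm_box_int_le)
          show "AE z in lborel. z \<in> cbox (y + r *\<^sub>R (x - y)) (y + r *\<^sub>R (x - y) + h *\<^sub>R One) \<longrightarrow> norm (G z \<bullet> (x - y)) \<le> M * norm (x - y)"
            using M(1)
          proof (rule eventually_mono, intro impI)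
            fix z assume "z \<in> U \<longrightarrow> norm (G z) \<le> M" "z \<in> cbox (y + r *\<^sub>R (x - y)) (y + r *\<^sub>R (x - y) + h *\<^sub>R One)"
            then have "norm (G z) \<le> M" using bU by auto
            then show "norm (G z \<bullet> (x - y)) \<le> M * norm (x - y)"
              using Cauchy_Schwarz_ineq2[of "G z" "x - y"] mult_right_mono[of "norm (G z)" M "norm (x - y)"] by simp
          qed
        qed (use M h in auto)
      qed
      then have "\<bar>box_int h g x - box_int h g y\<bar> \<le> (M * norm (x - y)) * h ^ DIM('a)" by simp
      moreover have "A n x - A n y = (box_int h g x - box_int h g y) / h ^ DIM('a)"
        unfolding A_def h_def[symmetric] by (simp add: divide_inverse algebra_simps)
      ultimately show "\<bar>A n x - A n y\<bar> \<le> M * norm (x - y)" using h by (simp add: abs_divide divide_le_eq)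
    qed
    moreover have "(\<lambda>n. \<bar>A n x - A n y\<bar>) \<longlonglongrightarrow> \<bar>g x - g y\<bar>" by (intro tendsto_intros lim)
    ultimately show ?thesis by (intro tendsto_upperbound[of _ "\<bar>g x - g y\<bar>"]) auto
  qed
  with N(1) show ?thesis by blast
qed

lemma AE_lebesgue_on_iff:
  assumes "open U"
  shows "(AE x in lebesgue_on U. P x) \<longleftrightarrow> (AE x in lborel. x \<in> U \<longrightarrow> P x)"
  using assms by (simp add: AE_restrict_space_iff AE_completion_iff)

lemma borel_version:
  fixes f :: "'a::euclidean_space \<Rightarrow> 'b::euclidean_space"
  assumes f: "f \<in> borel_measurable (lebesgue_on U)" and U: "open U"
  shows "\<exists>f'. f' \<in> borel_measurable borel \<and> (\<forall>x. x \<notin> U \<longrightarrow> f' x = 0) \<and> (AE x in lborel. x \<in> U \<longrightarrow> f x = f' x)"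
proof -
  have m: "(\<lambda>x. indicator U x *\<^sub>R f x) \<in> borel_measurable lebesgue"
    using f U by (simp add: borel_measurable_restrict_space_iff)
  have "\<exists>h\<in>borel_measurable lborel. AE x in lborel. indicator U x *\<^sub>R f x \<bullet> b = h x" for b
    by (rule completion_ex_borel_measurable_real[OF borel_measurable_inner[OF m borel_measurable_const]])
  then obtain h where h: "\<And>b. h b \<in> borel_measurable lborel" "\<And>b. AE x in lborel. indicator U x *\<^sub>R f x \<bullet> b = h b x"
    by metis
  define f' where "f' x = indicator U x *\<^sub>R (\<Sum>b\<in>Basis. h b x *\<^sub>R b)" for x
  have [measurable]: "h b \<in> borel_measurable borel" for b using h(1)[of b] by simp
  have "f' \<in> borel_measurable borel" unfolding f'_def using U
    by (intro borel_measurable_scaleR borel_measurable_indicator borel_measurable_sum) auto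
  moreover have "AE x in lborel. \<forall>b\<in>Basis. indicator U x *\<^sub>R f x \<bullet> b = h b x"
    using h(2) by (simp add: AE_finite_all)
  then have "AE x in lborel. x \<in> U \<longrightarrow> f x = f' x"
  proof (rule eventually_mono, intro impI)
    fix x assume x: "\<forall>b\<in>Basis. indicator U x *\<^sub>R f x \<bullet> b = h b x" "x \<in> U"
    have "(\<Sum>b\<in>Basis. h b x *\<^sub>R b) = (\<Sum>b\<in>Basis. (f x \<bullet> b) *\<^sub>R b)"
      using x by (intro sum.cong) auto
    then show "f x = f' x" using x(2) by (simp add: f'_def euclidean_representation)
  qed
  ultimately show ?thesis by (auto simp: f'_def intro!: exI[of _ f'])
qed

lemma loc_integrable_measurable:
  fixes f :: "'a::euclidean_space \<Rightarrow> 'b::euclidean_space"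
  assumes f: "loc_integrable U f" and U: "open U"
  shows "f \<in> borel_measurable (lebesgue_on U)"
proof -
  obtain D where D: "countable D" "D \<subseteq> Pow U" "\<And>X. X \<in> D \<Longrightarrow> \<exists>a b. X = cbox a b" "\<Union>D = U"
    using open_countable_Union_open_cbox[OF U] by metis
  show ?thesis
  proof (rule measurable_piecewise_restrict[OF D(1)])
    fix X assume X: "X \<in> D"
    then obtain a b where ab: "X = cbox a b" "X \<subseteq> U" using D(2,3) by blast
    then have XU: "U \<inter> X = X" by auto
    show "X \<inter> space (lebesgue_on U) \<in> sets (lebesgue_on U)"
      using ab U by (auto simp: sets_restrict_space_iff)
    have "X \<in> sets lebesgue" using ab by simp
    have "integrable (lebesgue_on X) f" using f ab by (auto simp: loc_integrable_def)
    then show "f \<in> borel_measurable (restrict_space (lebesgue_on U) X)"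
      using \<open>X \<in> sets lebesgue\<close> U restrict_restrict_space[of U lebesgue X] by (simp add: XU borel_measurable_integrable)
  qed (use D(4) in auto)
qed

lemma lebesgue_on_integral_eq:
  fixes f f' :: "'a::euclidean_space \<Rightarrow> 'b::euclidean_space"
  assumes "open U" "f \<in> borel_measurable (lebesgue_on U)" "f' \<in> borel_measurable borel"
    "\<And>x. x \<notin> U \<Longrightarrow> f' x = 0" "AE x in lborel. x \<in> U \<longrightarrow> f x = f' x"
  shows "(LINT x|lebesgue_on U. f x) = (LINT x|lborel. f' x)"
    and "integrable (lebesgue_on U) f \<longleftrightarrow> integrable lborel f'"
proof -
  have m: "(\<lambda>x. indicator U x *\<^sub>R f x) \<in> borel_measurable lebesgue"
    using assms(1,2) by (simp add: borel_measurable_restrict_space_iff)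
  have m': "f' \<in> borel_measurable lebesgue"
    using assms(3) by (intro measurable_completion) simp
  have ae: "AE x in lebesgue. indicator U x *\<^sub>R f x = f' x"
    using assms(4,5) by (auto simp: AE_completion_iff elim!: eventually_mono split: split_indicator)
  have "(LINT x|lebesgue_on U. f x) = (LINT x|lebesgue. indicator U x *\<^sub>R f x)"
    using assms(1) by (simp add: integral_restrict_space)
  also have "\<dots> = (LINT x|lebesgue. f' x)" by (rule integral_cong_AE[OF m m' ae])
  also have "\<dots> = (LINT x|lborel. f' x)" using assms(3) by (intro integral_completion) simp
  finally show "(LINT x|lebesgue_on U. f x) = (LINT x|lborel. f' x)" .
  have "integrable (lebesgue_on U) f \<longleftrightarrow> integrable lebesgue (\<lambda>x. indicator U x *\<^sub>R f x)"
    using assms(1) by (simp add: integrable_restrict_space)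
  also have "\<dots> \<longleftrightarrow> integrable lebesgue f'" by (rule integrable_cong_AE[OF m m' ae])
  also have "\<dots> \<longleftrightarrow> integrable lborel f'" using assms(3) by (intro integrable_completion) simp
  finally show "integrable (lebesgue_on U) f \<longleftrightarrow> integrable lborel f'" .
qed

lemma set_integrable_borel_version:
  fixes f f' :: "'a::euclidean_space \<Rightarrow> 'b::euclidean_space"
  assumes "compact K" "K \<subseteq> U" "f' \<in> borel_measurable borel" "AE x in lborel. x \<in> U \<longrightarrow> f x = f' x"
    "f \<in> borel_measurable (lebesgue_on U)" "open U"
  shows "integrable (lebesgue_on K) f \<longleftrightarrow> set_integrable lborel K f'"
proof -
  have K: "K \<in> sets borel" using assms(1) by (simp add: borel_compact)
  have "K \<inter> U = K" using assms(2) by auto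
  then have "f \<in> borel_measurable (lebesgue_on K)"
    using measurable_restrict_space1[OF assms(5), of K] restrict_restrict_space[of U lebesgue K] K assms(6)
    by (simp add: Int_commute)
  then have m: "(\<lambda>x. indicator K x *\<^sub>R f x) \<in> borel_measurable lebesgue"
    using K by (simp add: borel_measurable_restrict_space_iff)
  have m': "(\<lambda>x. indicator K x *\<^sub>R f' x) \<in> borel_measurable lborel"
    using assms(3) K by simp
  have "integrable (lebesgue_on K) f \<longleftrightarrow> integrable lebesgue (\<lambda>x. indicator K x *\<^sub>R f x)"
    using K by (simp add: integrable_restrict_space)
  also have "\<dots> \<longleftrightarrow> integrable lebesgue (\<lambda>x. indicator K x *\<^sub>R f' x)"
    by (rule integrable_cong_AE[OF m measurable_completion[OF m']])
      (use assms(2,4) in \<open>auto simp: AE_completion_iff elim!: eventually_mono split: split_indicator\<close>)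
  also have "\<dots> \<longleftrightarrow> set_integrable lborel K f'"
    using m' by (simp add: integrable_completion set_integrable_def)
  finally show ?thesis .
qed

lemma test_fun_outside:
  assumes "test_fun U \<phi>" "x \<notin> U"
  shows "\<phi> x = 0" "frechet_derivative \<phi> (at x) e = 0"
proof -
  obtain K where K: "compact K" "K \<subseteq> U" "\<And>x. x \<notin> K \<Longrightarrow> \<phi> x = 0"
    using assms by (auto simp: test_fun_def)
  then show "\<phi> x = 0" using assms(2) by auto
  show "frechet_derivative \<phi> (at x) e = 0"
    using test_fun_derivative_bound(5)[OF assms(1) K(1,3)] K(2) assms(2) by blast
qed

lemma has_weak_grad_iff_bwg:
  fixes U :: "'a::euclidean_space set"
  assumes U: "open U"
    and m: "g \<in> borel_measurable (lebesgue_on U)" "G \<in> borel_measurable (lebesgue_on U)"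
    and m': "g' \<in> borel_measurable borel" "G' \<in> borel_measurable borel"
    and ae: "AE x in lborel. x \<in> U \<longrightarrow> g x = g' x" "AE x in lborel. x \<in> U \<longrightarrow> G x = G' x"
  shows "has_weak_grad U g G \<longleftrightarrow> bwg U g' G'"
proof -
  note [measurable] = m'
  have "(LINT x|lebesgue_on U. g x * frechet_derivative \<phi> (at x) b) = (LINT x|lborel. g' x * frechet_derivative \<phi> (at x) b)"
    "(LINT x|lebesgue_on U. (G x \<bullet> b) * \<phi> x) = (LINT x|lborel. (G' x \<bullet> b) * \<phi> x)"
    if t: "test_fun U \<phi>" for \<phi> b
  proof -
    note [measurable] = test_fun_measurable[OF t]
    have l: "f \<in> borel_measurable (lebesgue_on U)" if "f \<in> borel_measurable borel" for f :: "'a \<Rightarrow> real"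
      using that by (intro measurable_restrict_space1 measurable_completion) simp
    show "(LINT x|lebesgue_on U. g x * frechet_derivative \<phi> (at x) b) = (LINT x|lborel. g' x * frechet_derivative \<phi> (at x) b)"
      by (rule lebesgue_on_integral_eq(1)[OF U])
        (use m(1) ae(1) test_fun_outside[OF t] l[OF test_fun_measurable(2)[OF t]] in \<open>auto elim!: eventually_mono\<close>)
    show "(LINT x|lebesgue_on U. (G x \<bullet> b) * \<phi> x) = (LINT x|lborel. (G' x \<bullet> b) * \<phi> x)"
      by (rule lebesgue_on_integral_eq(1)[OF U])
        (use m(2) ae(2) test_fun_outside[OF t] l[OF test_fun_measurable(1)[OF t]] in \<open>auto elim!: eventually_mono\<close>)
  qed
  moreover have "loc_integrable U g \<and> loc_integrable U G \<longleftrightarrow>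
      (\<forall>K. compact K \<and> K \<subseteq> U \<longrightarrow> set_integrable lborel K g' \<and> set_integrable lborel K G')"
    using set_integrable_borel_version[OF _ _ m'(1) ae(1) m(1) U] set_integrable_borel_version[OF _ _ m'(2) ae(2) m(2) U]
    unfolding loc_integrable_def by blast
  ultimately show ?thesis
    unfolding has_weak_grad_def bwg_def using m' by auto
qed

lemma has_weak_grad_borel_version:
  assumes U: "open U" and w: "has_weak_grad U g G"
  obtains g' G' where "bwg U g' G'" "AE x in lborel. x \<in> U \<longrightarrow> g x = g' x" "AE x in lborel. x \<in> U \<longrightarrow> G x = G' x"
    "\<And>x. x \<notin> U \<Longrightarrow> g' x = 0" "\<And>x. x \<notin> U \<Longrightarrow> G' x = 0"
proof -
  have m: "g \<in> borel_measurable (lebesgue_on U)" "G \<in> borel_measurable (lebesgue_on U)"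
    using w loc_integrable_measurable[OF _ U] by (auto simp: has_weak_grad_def)
  obtain g' where g': "g' \<in> borel_measurable borel" "\<And>x. x \<notin> U \<Longrightarrow> g' x = 0" "AE x in lborel. x \<in> U \<longrightarrow> g x = g' x"
    using borel_version[OF m(1) U] by auto
  obtain G' where G': "G' \<in> borel_measurable borel" "\<And>x. x \<notin> U \<Longrightarrow> G' x = 0" "AE x in lborel. x \<in> U \<longrightarrow> G x = G' x"
    using borel_version[OF m(2) U] by auto
  show ?thesis
    using that has_weak_grad_iff_bwg[OF U m g'(1) G'(1) g'(3) G'(3)] w g' G' by blast
qed

lemma has_weak_grad_unique:
  assumes U: "open U" and w: "has_weak_grad U g G" "has_weak_grad U g H"
  shows "AE x in lborel. x \<in> U \<longrightarrow> G x = H x"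
proof -
  obtain g1 G1 where 1: "bwg U g1 G1" "AE x in lborel. x \<in> U \<longrightarrow> g x = g1 x" "AE x in lborel. x \<in> U \<longrightarrow> G x = G1 x"
    using has_weak_grad_borel_version[OF U w(1)] by metis
  obtain g2 H2 where 2: "bwg U g2 H2" "AE x in lborel. x \<in> U \<longrightarrow> g x = g2 x" "AE x in lborel. x \<in> U \<longrightarrow> H x = H2 x"
    using has_weak_grad_borel_version[OF U w(2)] by metis
  have "AE x in lborel. x \<in> U \<longrightarrow> g1 x - g2 x = 0" using 1(2) 2(2) by eventually_elim auto
  from bwg_zero[OF bwg_diff[OF 1(1) 2(1)] U subset_refl this] 1(3) 2(3)
  show ?thesis by eventually_elim auto
qed

lemma has_weak_grad_wgrad: "has_weak_grad U g G \<Longrightarrow> has_weak_grad U g (wgrad U g)"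
  unfolding wgrad_def by (rule someI[of "has_weak_grad U g"])

lemma McShane_extension:
  fixes g :: "'a::real_normed_vector \<Rightarrow> real"
  assumes "S \<noteq> {}" "0 \<le> M" and lip: "\<And>x y. x \<in> S \<Longrightarrow> y \<in> S \<Longrightarrow> \<bar>g x - g y\<bar> \<le> M * norm (x - y)"
  shows "\<exists>h. (\<forall>x\<in>S. h x = g x) \<and> (\<forall>x y. \<bar>h x - h y\<bar> \<le> M * norm (x - y))"
proof -
  define h where "h x = (INF y\<in>S. g y + M * norm (x - y))" for x
  obtain s where s: "s \<in> S" using assms(1) by auto
  have lb: "g s - M * norm (x - s) \<le> g y + M * norm (x - y)" if "y \<in> S" for x y
  proof -
    have "norm (s - y) \<le> norm (x - s) + norm (x - y)"
      by (metis norm_minus_commute norm_triangle_le_diff dist_norm dist_triangle3)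
    then have "M * norm (s - y) \<le> M * norm (x - s) + M * norm (x - y)"
      using mult_left_mono[of _ _ M] assms(2) by (fastforce simp: distrib_left)
    then show ?thesis using lip[OF s that] by linarith
  qed
  have bdd: "bdd_below ((\<lambda>y. g y + M * norm (x - y)) ` S)" for x
    using lb by (intro bdd_belowI2) auto
  have one: "h x \<le> h y + M * norm (x - y)" for x y
  proof -
    have "h x - M * norm (x - y) \<le> g z + M * norm (y - z)" if z: "z \<in> S" for z
    proof -
      have "h x \<le> g z + M * norm (x - z)" unfolding h_def by (rule cINF_lower[OF bdd z])
      moreover have "M * norm (x - z) \<le> M * norm (x - y) + M * norm (y - z)"
        using mult_left_mono[OF norm_triangle_ineq[of "x - y" "y - z"] assms(2)] by (simp add: distrib_left)
      ultimately show ?thesis by linarith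
    qed
    then have "h x - M * norm (x - y) \<le> h y" unfolding h_def[of y] by (intro cINF_greatest assms(1))
    then show ?thesis by linarith
  qed
  have "h x = g x" if x: "x \<in> S" for x
  proof (rule antisym)
    have "h x \<le> g x + M * norm (x - x)" unfolding h_def by (rule cINF_lower[OF bdd x])
    then show "h x \<le> g x" by simp
    show "g x \<le> h x" unfolding h_def using lip[OF x] by (intro cINF_greatest assms(1)) (fastforce simp: abs_le_iff)
  qed
  moreover have "\<bar>h x - h y\<bar> \<le> M * norm (x - y)" for x y
    using one[of x y] one[of y x] by (simp add: norm_minus_commute abs_le_iff)
  ultimately show ?thesis by blast
qed

section \<open>Transport of weakly differentiable densities\<close>

lemma integrable_bounded_support:
  fixes f :: "'a::euclidean_space \<Rightarrow> 'b::{banach,second_countable_topology}"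
  assumes "f \<in> borel_measurable borel" "\<And>x. norm (f x) \<le> C" "bounded S" "\<And>x. x \<notin> S \<Longrightarrow> f x = 0"
  shows "integrable lborel f"
proof -
  obtain a where a: "S \<subseteq> cbox (- a) a" using bounded_subset_cbox_symmetric[OF assms(3)] by auto
  show ?thesis
  proof (rule Bochner_Integration.integrable_bound)
    show "integrable lborel (\<lambda>x. indicator (cbox (- a) a) x *\<^sub>R C)"
      by (simp add: emeasure_lborel_cbox_eq)
    show "AE x in lborel. norm (f x) \<le> norm (indicator (cbox (- a) a) x *\<^sub>R C)"
      using assms(2,4) a by (intro AE_I2) (force split: split_indicator intro: order_trans[OF _ abs_ge_self])
  qed (use assms(1) in simp)
qed

lemma integral_lborel_translate:
  fixes f :: "'a::euclidean_space \<Rightarrow> 'b::{banach,second_countable_topology}"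
  assumes [measurable]: "f \<in> borel_measurable borel"
  shows "(LINT x|lborel. f (x + c)) = (LINT x|lborel. f x)"
proof -
  have "(LINT x|lborel. f x) = (LINT x|distr lborel borel ((+) c). f x)" by (simp add: lborel_distr_plus)
  also have "\<dots> = (LINT x|lborel. f (c + x))" by (subst integral_distr) auto
  finally show ?thesis by (simp add: add.commute)
qed

lemma One_inner: "b \<in> Basis \<Longrightarrow> One \<bullet> b = (1 :: real)"
  by (simp add: inner_sum_left inner_Basis)

lemma slab_borel [measurable]: "{a..b::real} \<times> (UNIV :: 'a::euclidean_space set) \<in> sets borel"
  by (intro borel_closed closed_Times) auto

locale transport_density =
  fixes T :: real and u :: "real \<times> 'z::euclidean_space \<Rightarrow> real" and G :: "real \<times> 'z \<Rightarrow> real \<times> 'z"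
    and M :: real and Z :: "'z set"
  assumes T: "0 < T"
    and u_cont: "continuous_on ({0..T} \<times> UNIV) u"
    and u_time: "\<And>t z. t \<notin> {0..T} \<Longrightarrow> u (t, z) = 0"
    and u_supp: "\<And>t z. z \<notin> Z \<Longrightarrow> u (t, z) = 0"
    and Z: "compact Z"
    and weak: "bwg ({0<..<T} \<times> UNIV) u G"
    and G_bound: "\<And>p. norm (G p) \<le> M"
    and G_supp: "\<And>p. p \<notin> {0..T} \<times> Z \<Longrightarrow> G p = 0"
begin

lemma u_measurable [measurable]: "u \<in> borel_measurable borel"
  and G_measurable [measurable]: "G \<in> borel_measurable borel"
  using bwgD(1,2)[OF weak] by auto

lemma u_bounded: "\<exists>C. \<forall>p. \<bar>u p\<bar> \<le> C"
proof -
  have "bounded (u ` ({0..T} \<times> Z))"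
    by (intro compact_imp_bounded compact_continuous_image compact_Times Z compact_Icc
        continuous_on_subset[OF u_cont]) auto
  then obtain C where C: "\<And>p. p \<in> {0..T} \<times> Z \<Longrightarrow> \<bar>u p\<bar> \<le> C" unfolding bounded_iff by force
  have "\<bar>u p\<bar> \<le> max C 0" for p
  proof (cases "p \<in> {0..T} \<times> Z")
    case False
    then have "u p = 0" by (cases p) (auto intro: u_time u_supp)
    then show ?thesis by simp
  qed (use C in force)
  then show ?thesis by blast
qed

definition C where "C = (SOME C. \<forall>p. \<bar>u p\<bar> \<le> C)"

lemma u_le_C: "\<bar>u p\<bar> \<le> C"
  using someI_ex[OF u_bounded] unfolding C_def by blast

lemma C_nonneg: "0 \<le> C" using u_le_C[of undefined] by linarith

lemma M_nonneg: "0 \<le> M" using norm_ge_zero G_bound order_trans by blast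

lemma support_bounded: "bounded ({0..T} \<times> Z)"
  using Z by (intro bounded_Times compact_imp_bounded) auto

lemma u_integrable: "integrable lborel u"
  by (rule integrable_bounded_support[OF _ _ support_bounded, of _ C])
    (use u_le_C in \<open>auto intro: u_time u_supp\<close>)

lemma G_integrable: "integrable lborel G"
  by (rule integrable_bounded_support[OF _ G_bound support_bounded G_supp]) auto

definition R where "R = (SOME r. \<forall>z\<in>Z. norm z \<le> r)"

lemma Z_R: "z \<in> Z \<Longrightarrow> norm z \<le> R"
  using someI_ex[of "\<lambda>r. \<forall>z\<in>Z. norm z \<le> r"] Z compact_imp_bounded[OF Z]
  unfolding R_def bounded_iff by blast

definition Z1 :: "'z set" where "Z1 = cball 0 (R + norm (One :: 'z))"

lemma Z1_borel [measurable]: "Z1 \<in> sets borel" "{a..b::real} \<times> Z1 \<in> sets borel"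
  unfolding Z1_def by (intro borel_closed closed_Times; simp)+

definition um where "um h p = box_int h u p /\<^sub>R h ^ DIM(real \<times> 'z)"
definition Gm where "Gm h p = box_int h G p /\<^sub>R h ^ DIM(real \<times> 'z)"

lemma um_cont: "continuous_on UNIV (um h)" and Gm_cont: "continuous_on UNIV (Gm h)"
  unfolding um_def Gm_def
  by (intro continuous_intros continuous_box_int u_integrable G_integrable)+

lemma um_measurable [measurable]: "um h \<in> borel_measurable borel"
  and Gm_measurable [measurable]: "Gm h \<in> borel_measurable borel"
  by (intro borel_measurable_continuous_onI um_cont Gm_cont)+

lemma um_bound: assumes "0 < h" shows "\<bar>um h p\<bar> \<le> C"
proof -
  have "norm (box_int h u p) \<le> C * h ^ DIM(real \<times> 'z)"
    by (rule norm_box_int_le) (use assms u_le_C C_nonneg in auto)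
  then show ?thesis using assms by (simp add: um_def abs_mult field_simps del: DIM_prod)
qed

lemma Gm_bound: assumes "0 < h" shows "norm (Gm h p) \<le> M"
proof -
  have "norm (box_int h G p) \<le> M * h ^ DIM(real \<times> 'z)"
    by (rule norm_box_int_le) (use assms G_bound M_nonneg in auto)
  then show ?thesis using assms by (simp add: Gm_def field_simps del: DIM_prod)
qed

lemma mollified_supp:
  assumes h: "0 < h" "h \<le> 1" and z: "z \<notin> Z1"
  shows "um h (t, z) = 0" "Gm h (t, z) = 0"
proof -
  have out: "snd y \<notin> Z" if y: "y \<in> cbox (t, z) ((t, z) + h *\<^sub>R One)" for y
  proof
    assume "snd y \<in> Z"
    then have R: "norm (snd y) \<le> R" by (rule Z_R)
    have "snd y \<in> cbox z (z + h *\<^sub>R One)"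
    proof -
      have "z \<bullet> b \<le> snd y \<bullet> b \<and> snd y \<bullet> b \<le> (z + h *\<^sub>R One) \<bullet> b" if "b \<in> Basis" for b
      proof -
        have b: "(0 :: real, b) \<in> Basis" using that by (auto simp: Basis_prod_def)
        then have lo: "(t, z) \<bullet> (0, b) \<le> y \<bullet> (0, b)" and hi: "y \<bullet> (0, b) \<le> ((t, z) + h *\<^sub>R One) \<bullet> (0, b)"
          using y unfolding mem_box by blast+
        have eq: "((t, z) + h *\<^sub>R One) \<bullet> (0, b) = z \<bullet> b + h"
          unfolding inner_add_left inner_scaleR_left One_inner[OF b] by simp
        have "y \<bullet> (0, b) = snd y \<bullet> b" "(t, z) \<bullet> (0, b) = z \<bullet> b" by (simp_all add: inner_prod_def)
        moreover have "(z + h *\<^sub>R One) \<bullet> b = z \<bullet> b + h"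
          unfolding inner_add_left inner_scaleR_left One_inner[OF that] by simp
        ultimately show ?thesis using lo hi unfolding eq by simp
      qed
      then show ?thesis by (simp add: mem_box)
    qed
    then have "norm (snd y - z) \<le> norm (h *\<^sub>R One :: 'z)"
      by (intro norm_le_componentwise) (auto simp: mem_box algebra_simps)
    also have "\<dots> \<le> norm (One :: 'z)" using h by (simp add: mult_left_le_one_le)
    finally have "norm z \<le> R + norm (One :: 'z)" using R norm_triangle_sub[of z "snd y"] by (simp add: norm_minus_commute)
    then show False using z by (simp add: Z1_def)
  qed
  have "(\<lambda>y. indicator (cbox (t, z) ((t, z) + h *\<^sub>R One)) y *\<^sub>R u y) = (\<lambda>_. 0)"
    "(\<lambda>y. indicator (cbox (t, z) ((t, z) + h *\<^sub>R One)) y *\<^sub>R G y) = (\<lambda>_. 0)"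
    using out by (auto simp: fun_eq_iff split: split_indicator intro!: u_supp G_supp)
  then show "um h (t, z) = 0" "Gm h (t, z) = 0"
    unfolding um_def Gm_def box_int_def set_lebesgue_integral_def by simp_all
qed

lemma um_tendsto:
  assumes "0 < t" "t < T" shows "(\<lambda>n. um (1 / real (Suc n)) (t, z)) \<longlonglongrightarrow> u (t, z)"
proof -
  have "open ({0<..<T} \<times> (UNIV :: 'z set))" by (intro open_Times) auto
  moreover have "continuous_on ({0<..<T} \<times> UNIV) u" by (rule continuous_on_subset[OF u_cont]) auto
  ultimately have "isCont u (t, z)"
    using assms by (auto simp: continuous_on_eq_continuous_at)
  then show ?thesis
    unfolding um_def by (rule box_average_tendsto_continuous[OF u_integrable])
qed

lemma Gm_tendsto: "AE p in lborel. (\<lambda>n. Gm (1 / real (Suc n)) p) \<longlonglongrightarrow> G p"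
  unfolding Gm_def by (rule box_average_tendsto_AE[OF G_integrable])

lemma um_line_derivative:
  assumes h: "0 < h" and s: "0 \<le> s"
    and reg: "\<And>r. r \<in> {0..s} \<Longrightarrow> 0 < fst (p + r *\<^sub>R e) \<and> fst (p + r *\<^sub>R e) + h < T"
    and r: "r \<in> {0..s}"
  shows "((\<lambda>r. um h (p + r *\<^sub>R e)) has_real_derivative Gm h (p + r *\<^sub>R e) \<bullet> e) (at r within {0..s})"
proof -
  have box: "cbox (p + r *\<^sub>R e) (p + r *\<^sub>R e + h *\<^sub>R One) \<subseteq> {0<..<T} \<times> UNIV" if r: "r \<in> {0..s}" for r
  proof
    fix y assume y: "y \<in> cbox (p + r *\<^sub>R e) (p + r *\<^sub>R e + h *\<^sub>R One)"
    have b: "(1 :: real, 0 :: 'z) \<in> Basis" by (auto simp: Basis_prod_def)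
    have lo: "(p + r *\<^sub>R e) \<bullet> (1, 0) \<le> y \<bullet> (1, 0)" and hi: "y \<bullet> (1, 0) \<le> (p + r *\<^sub>R e + h *\<^sub>R One) \<bullet> (1, 0)"
      using y b unfolding mem_box by blast+
    have f: "q \<bullet> (1, 0) = fst q" for q :: "real \<times> 'z" by (simp add: inner_prod_def)
    have eq: "(p + r *\<^sub>R e + h *\<^sub>R One) \<bullet> (1, 0) = fst (p + r *\<^sub>R e) + h"
      unfolding inner_add_left[of "p + r *\<^sub>R e"] inner_scaleR_left One_inner[OF b] by (simp add: f)
    have "fst (p + r *\<^sub>R e) \<le> fst y" "fst y \<le> fst (p + r *\<^sub>R e) + h"
      using lo hi unfolding eq unfolding f .
    then show "y \<in> {0<..<T} \<times> UNIV" using reg[OF r] by (cases y) auto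
  qed
  have sG: "set_integrable lborel (cbox q (q + h *\<^sub>R One)) G" for q
    using G_integrable unfolding set_integrable_def by (intro integrable_mult_indicator) auto
  define k where "k r = box_int h G (p + r *\<^sub>R e) \<bullet> e" for r
  have k: "continuous_on {0..s} k" unfolding k_def
    by (intro continuous_on_inner continuous_on_const continuous_on_compose2[OF continuous_box_int[OF G_integrable]])
      (auto intro!: continuous_intros)
  have int: "(k has_integral box_int h u (p + r *\<^sub>R e) - box_int h u p) {0..r}" if "r \<in> {0..s}" for r
    unfolding k_def box_int_inner[OF sG, symmetric]
    by (rule box_int_line[OF weak]) (use that in \<open>auto intro!: box\<close>)
  have "((\<lambda>r. integral {0..r} k) has_vector_derivative k r) (at r within {0..s})"
    by (rule integral_has_vector_derivative[OF k r])
  then have "((\<lambda>r. integral {0..r} k + box_int h u p) has_real_derivative k r) (at r within {0..s})"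
    by (auto simp: has_real_derivative_iff_has_vector_derivative intro!: derivative_eq_intros)
  then have "((\<lambda>r. box_int h u (p + r *\<^sub>R e)) has_real_derivative k r) (at r within {0..s})"
    by (rule has_field_derivative_transform_within[of _ _ _ _ 1])
      (use r in \<open>auto simp: integral_unique[OF int]\<close>)
  then have "((\<lambda>r. inverse (h ^ DIM(real \<times> 'z)) * box_int h u (p + r *\<^sub>R e)) has_real_derivative inverse (h ^ DIM(real \<times> 'z)) * k r) (at r within {0..s})"
    by (rule DERIV_cmult)
  then show ?thesis unfolding um_def Gm_def k_def by (simp del: DIM_prod)
qed

context
  fixes \<beta> \<beta>' :: "real \<Rightarrow> real"
  assumes \<beta>: "\<And>x. (\<beta> has_real_derivative \<beta>' x) (at x)"
    and \<beta>': "continuous_on UNIV \<beta>'" and \<beta>0: "\<beta> 0 = 0"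
begin

lemma \<beta>_cont: "continuous_on UNIV \<beta>"
  using \<beta> by (auto simp: continuous_on_eq_continuous_at intro: DERIV_isCont)

lemma \<beta>_measurable [measurable]: "\<beta> \<in> borel_measurable borel" "\<beta>' \<in> borel_measurable borel"
  by (intro borel_measurable_continuous_onI \<beta>_cont \<beta>')+

lemma \<beta>_bounds: "\<exists>B. \<forall>x. \<bar>x\<bar> \<le> C \<longrightarrow> \<bar>\<beta> x\<bar> \<le> B \<and> \<bar>\<beta>' x\<bar> \<le> B"
proof -
  have "bounded (\<beta> ` {-C..C})" "bounded (\<beta>' ` {-C..C})"
    by (intro compact_imp_bounded compact_continuous_image continuous_on_subset[OF \<beta>_cont] continuous_on_subset[OF \<beta>']; simp)+
  then obtain B1 B2 where "\<And>x. x \<in> {-C..C} \<Longrightarrow> \<bar>\<beta> x\<bar> \<le> B1" "\<And>x. x \<in> {-C..C} \<Longrightarrow> \<bar>\<beta>' x\<bar> \<le> B2"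
    unfolding bounded_iff by force
  then show ?thesis by (intro exI[of _ "max B1 B2"]) (fastforce simp: abs_le_iff)
qed

lemma chain_rule_integral:
  assumes h: "0 < h" and s: "0 \<le> s"
    and reg: "\<And>r. r \<in> {0..s} \<Longrightarrow> 0 < fst (p + r *\<^sub>R e) \<and> fst (p + r *\<^sub>R e) + h < T"
  shows "(LINT r:{0..s}|lborel. \<beta>' (um h (p + r *\<^sub>R e)) * (Gm h (p + r *\<^sub>R e) \<bullet> e)) = \<beta> (um h (p + s *\<^sub>R e)) - \<beta> (um h p)"
proof -
  define k where "k r = \<beta>' (um h (p + r *\<^sub>R e)) * (Gm h (p + r *\<^sub>R e) \<bullet> e)" for r
  have der: "((\<lambda>r. \<beta> (um h (p + r *\<^sub>R e))) has_real_derivative k r) (at r within {0..s})" if "r \<in> {0..s}" for r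
    unfolding k_def by (rule DERIV_chain'[OF um_line_derivative[OF h s reg that] \<beta>])
  have "(k has_integral \<beta> (um h (p + s *\<^sub>R e)) - \<beta> (um h (p + 0 *\<^sub>R e))) {0..s}"
    by (rule fundamental_theorem_of_calculus[OF s])
      (use der in \<open>simp add: has_real_derivative_iff_has_vector_derivative\<close>)
  moreover have "continuous_on {0..s} k" unfolding k_def
    by (intro continuous_intros continuous_on_compose2[OF \<beta>'] continuous_on_compose2[OF um_cont] continuous_on_compose2[OF Gm_cont]) auto
  then have "set_integrable lborel {0..s} k" by (rule borel_integrable_atLeastAtMost')
  from set_borel_integral_eq_integral(2)[OF this]
  have "(LINT r:{0..s}|lborel. k r) = integral {0..s} k" .
  ultimately show ?thesis unfolding k_def by (simp add: integral_unique)
qed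

lemma time_identity:
  assumes t: "0 < t1" "t1 \<le> t2" "t2 < T"
  shows "(LINT z|lborel. \<beta> (u (t2, z))) - (LINT z|lborel. \<beta> (u (t1, z))) =
    (LINT p|lborel. indicator ({t1..t2} \<times> UNIV) p * (\<beta>' (u p) * (G p \<bullet> (1, 0))))"
proof -
  obtain B where B: "\<And>x. \<bar>x\<bar> \<le> C \<Longrightarrow> \<bar>\<beta> x\<bar> \<le> B" "\<And>x. \<bar>x\<bar> \<le> C \<Longrightarrow> \<bar>\<beta>' x\<bar> \<le> B"
    using \<beta>_bounds by blast
  have B0: "0 \<le> B" using B(1)[of 0] C_nonneg by simp
  let ?h = "\<lambda>n. 1 / real (Suc n)"
  have Z1: "bounded Z1" by (simp add: Z1_def)
  define W where "W n p = indicator ({t1..t2} \<times> UNIV) p * (\<beta>' (um (?h n) p) * (Gm (?h n) p \<bullet> (1, 0)))" for n p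
  have [measurable]: "W n \<in> borel_measurable borel" for n
    unfolding W_def by measurable
  have Wb: "norm (W n p) \<le> B * M" for n p
  proof -
    have "\<bar>Gm (?h n) p \<bullet> (1, 0)\<bar> \<le> M"
      using Cauchy_Schwarz_ineq2[of "Gm (?h n) p" "(1, 0)"] Gm_bound[of "?h n" p] by simp
    then have "\<bar>\<beta>' (um (?h n) p)\<bar> * \<bar>Gm (?h n) p \<bullet> (1, 0)\<bar> \<le> B * M"
      using B0 by (intro mult_mono B um_bound) auto
    then show ?thesis using B0 M_nonneg by (auto simp: W_def abs_mult split: split_indicator)
  qed
  have W0: "W n p = 0" if "p \<notin> {t1..t2} \<times> Z1" for n p
    using that mollified_supp[of "?h n" "snd p" "fst p"] by (cases p) (auto simp: W_def split: split_indicator)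
  have bd: "bounded ({t1..t2} \<times> Z1)" by (intro bounded_Times Z1) auto
  have Wi: "integrable lborel (W n)" for n
    by (rule integrable_bounded_support[OF _ Wb bd W0]) auto
  have \<beta>i: "integrable lborel (\<lambda>z. \<beta> (um (?h n) (t, z)))" for n t
    by (rule integrable_bounded_support[OF _ _ Z1, of _ B])
      (use mollified_supp(1)[of "?h n"] \<beta>0 in \<open>auto intro!: B um_bound\<close>)
  have eq: "(LINT z|lborel. \<beta> (um (?h n) (t2, z))) - (LINT z|lborel. \<beta> (um (?h n) (t1, z))) = (LINT p|lborel. W n p)"
    if n: "?h n < T - t2" for n
  proof -
    have "(LINT z|lborel. \<beta> (um (?h n) (t2, z))) - (LINT z|lborel. \<beta> (um (?h n) (t1, z))) =
        (LINT z|lborel. \<beta> (um (?h n) (t2, z)) - \<beta> (um (?h n) (t1, z)))"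
      using \<beta>i by simp
    also have "\<dots> = (LINT z|lborel. (LINT t|lborel. W n (t, z)))"
    proof (rule Bochner_Integration.integral_cong[OF refl])
      fix z :: 'z
      have "\<beta> (um (?h n) ((t1, z) + (t2 - t1) *\<^sub>R (1, 0))) - \<beta> (um (?h n) (t1, z)) =
        (LINT r:{0..t2 - t1}|lborel. \<beta>' (um (?h n) ((t1, z) + r *\<^sub>R (1, 0))) * (Gm (?h n) ((t1, z) + r *\<^sub>R (1, 0)) \<bullet> (1, 0)))"
        by (rule chain_rule_integral[symmetric]) (use t n in auto)
      also have "\<dots> = (LINT r|lborel. W n (r + t1, z))"
        unfolding set_lebesgue_integral_def W_def
        by (intro Bochner_Integration.integral_cong) (auto simp: add.commute split: split_indicator)
      also have "\<dots> = (LINT t|lborel. W n (t, z))"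
        by (rule integral_lborel_translate) measurable
      finally show "\<beta> (um (?h n) (t2, z)) - \<beta> (um (?h n) (t1, z)) = (LINT t|lborel. W n (t, z))" by simp
    qed
    also have "\<dots> = (LINT p|lborel. W n p)"
      using lborel_pair.integral_snd[of "\<lambda>t z. W n (t, z)"] Wi[of n] by (simp add: lborel_prod)
    finally show ?thesis .
  qed
  have lim1: "(\<lambda>n. LINT z|lborel. \<beta> (um (?h n) (t, z))) \<longlonglongrightarrow> (LINT z|lborel. \<beta> (u (t, z)))" if t: "0 < t" "t < T" for t
  proof (rule integral_dominated_convergence[where w="\<lambda>z. indicator Z1 z *\<^sub>R B"])
    show "integrable lborel (\<lambda>z. indicator Z1 z *\<^sub>R B)"
      by (rule integrable_bounded_support[OF _ _ Z1, of _ B]) (use B0 in \<open>auto split: split_indicator\<close>)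
    show "AE z in lborel. (\<lambda>n. \<beta> (um (?h n) (t, z))) \<longlonglongrightarrow> \<beta> (u (t, z))"
      by (intro AE_I2 isCont_tendsto_compose[OF DERIV_isCont[OF \<beta>]] um_tendsto t)
    show "AE z in lborel. norm (\<beta> (um (?h n) (t, z))) \<le> indicator Z1 z *\<^sub>R B" for n
      using mollified_supp(1)[of "?h n"] \<beta>0 B(1)[OF um_bound[of "?h n"]] by (intro AE_I2) (auto split: split_indicator)
  qed auto
  have lim2: "(\<lambda>n. LINT p|lborel. W n p) \<longlonglongrightarrow>
      (LINT p|lborel. indicator ({t1..t2} \<times> UNIV) p * (\<beta>' (u p) * (G p \<bullet> (1, 0))))"
  proof (rule integral_dominated_convergence[where w="\<lambda>p. indicator ({t1..t2} \<times> Z1) p *\<^sub>R (B * M)"])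
    show "integrable lborel (\<lambda>p. indicator ({t1..t2} \<times> Z1) p *\<^sub>R (B * M))"
      by (rule integrable_bounded_support[OF _ _ bd, of _ "B * M"])
        (use B0 M_nonneg in \<open>auto split: split_indicator\<close>)
    show "AE p in lborel. (\<lambda>n. W n p) \<longlonglongrightarrow> indicator ({t1..t2} \<times> UNIV) p * (\<beta>' (u p) * (G p \<bullet> (1, 0)))"
      using Gm_tendsto
    proof (rule eventually_mono)
      fix p assume G: "(\<lambda>n. Gm (?h n) p) \<longlonglongrightarrow> G p"
      show "(\<lambda>n. W n p) \<longlonglongrightarrow> indicator ({t1..t2} \<times> UNIV) p * (\<beta>' (u p) * (G p \<bullet> (1, 0)))"
      proof (cases "fst p \<in> {t1..t2}")
        case True
        then have "(\<lambda>n. um (?h n) p) \<longlonglongrightarrow> u p" using um_tendsto[of "fst p" "snd p"] t by auto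
        moreover have "isCont \<beta>' (u p)" using \<beta>' by (simp add: continuous_on_eq_continuous_at)
        ultimately have "(\<lambda>n. \<beta>' (um (?h n) p)) \<longlonglongrightarrow> \<beta>' (u p)" by (rule isCont_tendsto_compose[rotated])
        then show ?thesis unfolding W_def by (intro tendsto_mult tendsto_const tendsto_inner G)
      next
        case False
        then have "p \<notin> {t1..t2} \<times> UNIV" by (cases p) auto
        then show ?thesis by (simp add: W_def)
      qed
    qed
    show "AE p in lborel. norm (W n p) \<le> indicator ({t1..t2} \<times> Z1) p *\<^sub>R (B * M)" for n
      using Wb[of n] W0[of _ n] by (intro AE_I2) (auto split: split_indicator)
    show "(\<lambda>p. indicator ({t1..t2} \<times> UNIV) p * (\<beta>' (u p) * (G p \<bullet> (1, 0)))) \<in> borel_measurable lborel"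
      by measurable
  qed auto
  have "eventually (\<lambda>n. ?h n < T - t2) sequentially"
    by (rule order_tendstoD(2)[OF LIMSEQ_Suc[OF lim_1_over_n]]) (use t in simp)
  then have "eventually (\<lambda>n. (LINT z|lborel. \<beta> (um (?h n) (t2, z))) - (LINT z|lborel. \<beta> (um (?h n) (t1, z))) = (LINT p|lborel. W n p)) sequentially"
    by (rule eventually_mono) (rule eq)
  from Lim_transform_eventually[OF tendsto_diff[OF lim1 lim1] this] t
  have "(\<lambda>n. LINT p|lborel. W n p) \<longlonglongrightarrow> (LINT z|lborel. \<beta> (u (t2, z))) - (LINT z|lborel. \<beta> (u (t1, z)))"
    by auto
  from LIMSEQ_unique[OF this lim2] show ?thesis .
qed

lemma transversal_identity:
  assumes t: "0 < t1" "t1 \<le> t2" "t2 < T" and e: "fst e = 0"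
    and m: "m \<in> borel_measurable borel" "\<And>p. \<bar>m p\<bar> \<le> K" "\<And>p r. m (p + r *\<^sub>R e) = m p"
  shows "(LINT p|lborel. indicator ({t1..t2} \<times> UNIV) p * (m p * (\<beta>' (u p) * (G p \<bullet> e)))) = 0"
proof -
  note m(1)[measurable]
  obtain B where B: "\<And>x. \<bar>x\<bar> \<le> C \<Longrightarrow> \<bar>\<beta> x\<bar> \<le> B" "\<And>x. \<bar>x\<bar> \<le> C \<Longrightarrow> \<bar>\<beta>' x\<bar> \<le> B"
    using \<beta>_bounds by blast
  have B0: "0 \<le> B" using B(1)[of 0] C_nonneg by simp
  have K0: "0 \<le> K" using m(2)[of undefined] by linarith
  let ?h = "\<lambda>n. 1 / real (Suc n)"
  have Z1: "bounded Z1" by (simp add: Z1_def)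
  define k where "k p = indicator ({t1..t2} \<times> UNIV) p * m p" for p :: "real \<times> 'z"
  have [measurable]: "k \<in> borel_measurable borel"
    unfolding k_def by measurable
  have k_inv: "k (p + r *\<^sub>R e) = k p" for p r
    unfolding k_def m(3) using e by (cases p; cases e) (auto split: split_indicator)
  have kb: "\<bar>k p\<bar> \<le> K" for p using m(2)[of p] K0 by (auto simp: k_def split: split_indicator)
  have k0: "k p = 0" if "fst p \<notin> {t1..t2}" for p using that by (cases p) (auto simp: k_def)
  define W where "W n p = \<beta>' (um (?h n) p) * (Gm (?h n) p \<bullet> e)" for n p
  have Wc: "continuous_on UNIV (W n)" for n unfolding W_def
    by (intro continuous_intros continuous_on_compose2[OF \<beta>'] um_cont Gm_cont) auto
  have [measurable]: "W n \<in> borel_measurable borel" for n by (intro borel_measurable_continuous_onI Wc)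
  have Wb: "\<bar>W n p\<bar> \<le> B * (M * norm e)" for n p
  proof -
    have "\<bar>Gm (?h n) p \<bullet> e\<bar> \<le> M * norm e"
      using Cauchy_Schwarz_ineq2[of "Gm (?h n) p" e] mult_right_mono[OF Gm_bound[of "?h n" p], of "norm e"] by simp
    then show ?thesis unfolding W_def abs_mult
      using B0 by (intro mult_mono B um_bound) auto
  qed
  have W0: "W n p = 0" if "snd p \<notin> Z1" for n p
    using that mollified_supp(2)[of "?h n" "snd p" "fst p"] by (simp add: W_def)
  define A where "A = B * (M * norm e)"
  have A0: "0 \<le> A" using B0 M_nonneg by (simp add: A_def)
  have bd: "bounded ({t1..t2} \<times> Z1)" by (intro bounded_Times Z1) auto
  have zero: "(LINT p|lborel. k p * W n p) = 0" if n: "?h n < T - t2" for n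
  proof -
    define F where "F r p = indicator {0..1::real} r *\<^sub>R (k p * W n (p + r *\<^sub>R e))" for r p
    have "(\<lambda>x. W n (snd x + fst x *\<^sub>R e)) \<in> borel_measurable borel"
      by (intro borel_measurable_continuous_onI continuous_on_compose2[OF Wc] continuous_intros) auto
    then have Fm: "(\<lambda>x. F (fst x) (snd x)) \<in> borel_measurable borel"
      unfolding F_def by (intro borel_measurable_scaleR borel_measurable_times measurable_compose[OF _ borel_measurable_indicator])
        (auto intro!: borel_measurable_continuous_onI continuous_intros measurable_compose[OF borel_measurable_continuous_onI \<open>k \<in> borel_measurable borel\<close>])
    have Fi: "integrable lborel (\<lambda>x. F (fst x) (snd x))"
    proof (rule integrable_bounded_support[OF Fm])
      show "norm (F (fst x) (snd x)) \<le> K * A" for x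
        using mult_mono[OF kb[of "snd x"] Wb[of n "snd x + fst x *\<^sub>R e"]] K0 A0
        by (auto simp: F_def abs_mult A_def split: split_indicator)
      show "bounded ({0..1::real} \<times> ({t1..t2} \<times> cball 0 (R + norm (One :: 'z) + norm e)))"
        by (intro bounded_Times) (simp_all add: compact_imp_bounded)
      fix x :: "real \<times> real \<times> 'z" assume x: "x \<notin> {0..1} \<times> ({t1..t2} \<times> cball 0 (R + norm (One :: 'z) + norm e))"
      show "F (fst x) (snd x) = 0"
      proof (rule ccontr)
        assume "F (fst x) (snd x) \<noteq> 0"
        then have a: "fst x \<in> {0..1}" "fst (snd x) \<in> {t1..t2}" "snd (snd x + fst x *\<^sub>R e) \<in> Z1"
          using k0[of "snd x"] W0[of "snd x + fst x *\<^sub>R e" n] by (auto simp: F_def split: split_indicator_asm)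
        have "norm (snd (snd x)) \<le> norm (snd (snd x + fst x *\<^sub>R e)) + norm (fst x *\<^sub>R snd e)"
          using norm_triangle_ineq4[of "snd (snd x + fst x *\<^sub>R e)" "fst x *\<^sub>R snd e"] by simp
        also have "norm (fst x *\<^sub>R snd e) \<le> norm (snd e)" using a(1) by (simp add: mult_left_le_one_le)
        also have "norm (snd e) \<le> norm e" by (metis norm_snd_le prod.collapse)
        finally have "norm (snd (snd x)) \<le> R + norm (One :: 'z) + norm e" using a(3) by (simp add: Z1_def)
        then show False using x a by (cases x) auto
      qed
    qed
    have line: "(LINT r|lborel. F r p) = k p * (\<beta> (um (?h n) (p + e)) - \<beta> (um (?h n) p))" for p
    proof (cases "fst p \<in> {t1..t2}")
      case True
      have "(LINT r:{0..1}|lborel. \<beta>' (um (?h n) (p + r *\<^sub>R e)) * (Gm (?h n) (p + r *\<^sub>R e) \<bullet> e)) = \<beta> (um (?h n) (p + 1 *\<^sub>R e)) - \<beta> (um (?h n) p)"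
        by (rule chain_rule_integral) (use True t n e in auto)
      moreover have "(LINT r|lborel. F r p) = k p * (LINT r:{0..1}|lborel. \<beta>' (um (?h n) (p + r *\<^sub>R e)) * (Gm (?h n) (p + r *\<^sub>R e) \<bullet> e))"
        unfolding F_def W_def set_lebesgue_integral_def
        by (subst integral_mult_right_zero[symmetric]) (auto simp: mult_ac intro!: Bochner_Integration.integral_cong)
      ultimately show ?thesis by simp
    next
      case False
      then show ?thesis by (simp add: k0 F_def)
    qed
    have "(LINT p|lborel. k p * W n p) = (LINT r:{0..1::real}|lborel. (LINT p|lborel. k p * W n p))"
      by (simp add: set_lebesgue_integral_def)
    also have "\<dots> = (LINT r|lborel. LINT p|lborel. F r p)"
      unfolding set_lebesgue_integral_def
    proof (intro Bochner_Integration.integral_cong refl)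
      fix r :: real
      have "(LINT p|lborel. F r p) = indicator {0..1} r *\<^sub>R (LINT p|lborel. k (p + r *\<^sub>R e) * W n (p + r *\<^sub>R e))"
        by (simp add: F_def k_inv)
      also have "(LINT p|lborel. k (p + r *\<^sub>R e) * W n (p + r *\<^sub>R e)) = (LINT p|lborel. k p * W n p)"
        by (rule integral_lborel_translate) measurable
      finally show "indicator {0..1} r *\<^sub>R (LINT p|lborel. k p * W n p) = (LINT p|lborel. F r p)" by simp
    qed
    also have "\<dots> = (LINT x|(lborel \<Otimes>\<^sub>M lborel). F (fst x) (snd x))"
      using lborel_pair.integral_fst'[of "\<lambda>x. F (fst x) (snd x)"] Fi by (simp add: lborel_prod)
    also have "\<dots> = (LINT p|lborel. LINT r|lborel. F r p)"
      using lborel_pair.integral_snd[of F] Fi by (simp add: lborel_prod case_prod_beta')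
    also have "\<dots> = (LINT p|lborel. k p * \<beta> (um (?h n) (p + e)) - k p * \<beta> (um (?h n) p))"
      by (simp add: line right_diff_distrib)
    also have "\<dots> = (LINT p|lborel. k p * \<beta> (um (?h n) (p + e))) - (LINT p|lborel. k p * \<beta> (um (?h n) p))"
    proof (rule Bochner_Integration.integral_diff)
      have i: "integrable lborel (\<lambda>p. k p * \<beta> (um (?h n) p))"
      proof (rule integrable_bounded_support[OF _ _ bd])
        show "norm (k p * \<beta> (um (?h n) p)) \<le> K * B" for p
          using mult_mono[OF kb B(1)[OF um_bound[of "?h n" p]] K0] by (simp add: abs_mult)
        show "k p * \<beta> (um (?h n) p) = 0" if "p \<notin> {t1..t2} \<times> Z1" for p
          using that k0[of p] mollified_supp(1)[of "?h n" "snd p" "fst p"] \<beta>0 by (cases p) auto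
      qed measurable
      then show "integrable lborel (\<lambda>p. k p * \<beta> (um (?h n) p))" .
      have "integrable (distr lborel borel ((+) e)) (\<lambda>p. k p * \<beta> (um (?h n) p))"
        using i by (simp add: lborel_distr_plus)
      then have "integrable lborel (\<lambda>p. k (e + p) * \<beta> (um (?h n) (e + p)))"
        by (subst (asm) integrable_distr_eq) auto
      then show "integrable lborel (\<lambda>p. k p * \<beta> (um (?h n) (p + e)))"
        using k_inv[of _ 1] by (simp add: add.commute)
    qed
    also have "(LINT p|lborel. k p * \<beta> (um (?h n) (p + e))) = (LINT p|lborel. k (p + e) * \<beta> (um (?h n) (p + e)))"
      using k_inv[of _ 1] by simp
    also have "\<dots> = (LINT p|lborel. k p * \<beta> (um (?h n) p))"
      by (rule integral_lborel_translate) measurable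
    finally show ?thesis by simp
  qed
  have lim: "(\<lambda>n. LINT p|lborel. k p * W n p) \<longlonglongrightarrow> (LINT p|lborel. k p * (\<beta>' (u p) * (G p \<bullet> e)))"
  proof (rule integral_dominated_convergence[where w="\<lambda>p. indicator ({t1..t2} \<times> Z1) p *\<^sub>R (K * A)"])
    show "integrable lborel (\<lambda>p. indicator ({t1..t2} \<times> Z1) p *\<^sub>R (K * A))"
      by (rule integrable_bounded_support[OF _ _ bd, of _ "K * A"])
        (use K0 A0 in \<open>auto split: split_indicator\<close>)
    show "AE p in lborel. (\<lambda>n. k p * W n p) \<longlonglongrightarrow> k p * (\<beta>' (u p) * (G p \<bullet> e))"
      using Gm_tendsto
    proof (rule eventually_mono)
      fix p assume G: "(\<lambda>n. Gm (?h n) p) \<longlonglongrightarrow> G p"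
      show "(\<lambda>n. k p * W n p) \<longlonglongrightarrow> k p * (\<beta>' (u p) * (G p \<bullet> e))"
      proof (cases "fst p \<in> {t1..t2}")
        case True
        then have "(\<lambda>n. um (?h n) p) \<longlonglongrightarrow> u p" using um_tendsto[of "fst p" "snd p"] t by auto
        moreover have "isCont \<beta>' (u p)" using \<beta>' by (simp add: continuous_on_eq_continuous_at)
        ultimately have "(\<lambda>n. \<beta>' (um (?h n) p)) \<longlonglongrightarrow> \<beta>' (u p)" by (rule isCont_tendsto_compose[rotated])
        then show ?thesis unfolding W_def by (intro tendsto_mult tendsto_const tendsto_inner G)
      qed (simp add: k0)
    qed
    show "AE p in lborel. norm (k p * W n p) \<le> indicator ({t1..t2} \<times> Z1) p *\<^sub>R (K * A)" for n
    proof (rule AE_I2)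
      fix p
      show "norm (k p * W n p) \<le> indicator ({t1..t2} \<times> Z1) p *\<^sub>R (K * A)"
        using mult_mono[OF kb[of p] Wb[of n p] K0] k0[of p] W0[of p n]
        by (cases "p \<in> {t1..t2} \<times> Z1") (auto simp: abs_mult A_def mem_Times_iff)
    qed
  qed auto
  have "eventually (\<lambda>n. ?h n < T - t2) sequentially"
    by (rule order_tendstoD(2)[OF LIMSEQ_Suc[OF lim_1_over_n]]) (use t in simp)
  then have "eventually (\<lambda>n. (LINT p|lborel. k p * W n p) = 0) sequentially"
    by (rule eventually_mono) (rule zero)
  then have "(\<lambda>n. LINT p|lborel. k p * W n p) \<longlonglongrightarrow> 0" by (rule tendsto_eventually)
  from LIMSEQ_unique[OF lim this] show ?thesis by (simp add: k_def mult.assoc)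
qed

end

end

lemma smooth_abs:
  fixes c :: real
  assumes c: "0 < c"
  shows "((\<lambda>x. sqrt (x\<^sup>2 + c\<^sup>2) - c) has_real_derivative x / sqrt (x\<^sup>2 + c\<^sup>2)) (at x)"
    and "continuous_on UNIV (\<lambda>x. x / sqrt (x\<^sup>2 + c\<^sup>2))"
    and "sqrt (0\<^sup>2 + c\<^sup>2) - c = 0"
    and "\<bar>x / sqrt (x\<^sup>2 + c\<^sup>2)\<bar> \<le> 1"
    and "0 \<le> sqrt (x\<^sup>2 + c\<^sup>2) - c"
    and "sqrt (x\<^sup>2 + c\<^sup>2) - c \<le> \<bar>x\<bar>"
    and "\<bar>x\<bar> - c \<le> sqrt (x\<^sup>2 + c\<^sup>2) - c"
proof -
  have pos: "0 < x\<^sup>2 + c\<^sup>2" for x using c by (intro add_nonneg_pos) auto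
  have spos: "0 < sqrt (x\<^sup>2 + c\<^sup>2)" for x using pos by simp
  have q: "((\<lambda>x. x\<^sup>2 + c\<^sup>2) has_real_derivative 2 * x) (at x)"
    by (rule derivative_eq_intros refl | simp)+
  have "((\<lambda>x. sqrt (x\<^sup>2 + c\<^sup>2) - c) has_real_derivative inverse (sqrt (x\<^sup>2 + c\<^sup>2)) / 2 * (2 * x) - 0) (at x)"
    by (rule DERIV_diff[OF DERIV_chain2[OF DERIV_real_sqrt[OF pos] q] DERIV_const])
  moreover have "inverse s / 2 * (2 * x) - 0 = x / s" if "0 < s" for s :: real
    using that by (simp add: field_simps)
  ultimately show "((\<lambda>x. sqrt (x\<^sup>2 + c\<^sup>2) - c) has_real_derivative x / sqrt (x\<^sup>2 + c\<^sup>2)) (at x)"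
    using spos[of x] by metis
  show "continuous_on UNIV (\<lambda>x. x / sqrt (x\<^sup>2 + c\<^sup>2))"
    using spos by (intro continuous_intros ballI) (metis less_irrefl)
  show "sqrt (0\<^sup>2 + c\<^sup>2) - c = 0" using c by simp
  have a: "\<bar>x\<bar> \<le> sqrt (x\<^sup>2 + c\<^sup>2)" by (rule real_le_rsqrt) simp
  then show "\<bar>x / sqrt (x\<^sup>2 + c\<^sup>2)\<bar> \<le> 1" using spos[of x] by (simp add: abs_divide)
  show "\<bar>x\<bar> - c \<le> sqrt (x\<^sup>2 + c\<^sup>2) - c" using a by simp
  have "c \<le> sqrt (x\<^sup>2 + c\<^sup>2)" by (rule real_le_rsqrt) simp
  then show "0 \<le> sqrt (x\<^sup>2 + c\<^sup>2) - c" by simp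
  have "sqrt (x\<^sup>2 + c\<^sup>2) \<le> \<bar>x\<bar> + c"
    using c by (intro real_le_lsqrt) (auto simp: power2_sum)
  then show "sqrt (x\<^sup>2 + c\<^sup>2) - c \<le> \<bar>x\<bar>" by simp
qed

context transport_density
begin

lemma continuous_on_space_integral:
  fixes \<psi> :: "real \<Rightarrow> real"
  assumes \<psi>: "continuous_on UNIV \<psi>" "\<psi> 0 = 0"
  shows "continuous_on {0..T} (\<lambda>t. LINT z|lborel. \<psi> (u (t, z)))"
    and "integrable lborel (\<lambda>z. \<psi> (u (t, z)))"
proof -
  have [measurable]: "\<psi> \<in> borel_measurable borel" by (intro borel_measurable_continuous_onI \<psi>)
  have "bounded (\<psi> ` {-C..C})"
    by (intro compact_imp_bounded compact_continuous_image continuous_on_subset[OF \<psi>(1)]) auto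
  then obtain B where B: "\<And>x. \<bar>x\<bar> \<le> C \<Longrightarrow> \<bar>\<psi> x\<bar> \<le> B" unfolding bounded_iff by (force simp: abs_le_iff)
  have B0: "0 \<le> B" using B[of 0] C_nonneg by simp
  have bZ: "bounded Z" and [measurable]: "Z \<in> sets borel" using Z by (auto simp: compact_imp_bounded borel_compact)
  have i: "integrable lborel (\<lambda>z. indicator Z z *\<^sub>R B)"
    by (rule integrable_bounded_support[OF _ _ bZ, of _ B]) (use B0 in \<open>auto split: split_indicator\<close>)
  have b: "norm (\<psi> (u (t, z))) \<le> indicator Z z *\<^sub>R B" for t z
    using u_supp[of z t] \<psi>(2) B[OF u_le_C[of "(t, z)"]] by (auto split: split_indicator)
  show "integrable lborel (\<lambda>z. \<psi> (u (t, z)))" for t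
    by (rule Bochner_Integration.integrable_bound[OF i]) (use b B0 in \<open>auto intro!: AE_I2 order_trans[OF b]\<close>)
  show "continuous_on {0..T} (\<lambda>t. LINT z|lborel. \<psi> (u (t, z)))"
    unfolding continuous_on_sequentially comp_def
  proof (intro allI ballI impI, elim conjE)
    fix X t assume t: "t \<in> {0..T}" and X: "\<forall>n. X n \<in> {0..T}" "X \<longlonglongrightarrow> t"
    show "(\<lambda>n. LINT z|lborel. \<psi> (u (X n, z))) \<longlonglongrightarrow> (LINT z|lborel. \<psi> (u (t, z)))"
    proof (rule integral_dominated_convergence[OF _ _ i])
      show "AE z in lborel. (\<lambda>n. \<psi> (u (X n, z))) \<longlonglongrightarrow> \<psi> (u (t, z))"
      proof (rule AE_I2)
        fix z :: 'z
        have "(\<lambda>n. (X n, z)) \<longlonglongrightarrow> (t, z)" by (intro tendsto_intros X)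
        then have "(\<lambda>n. u (X n, z)) \<longlonglongrightarrow> u (t, z)"
          using u_cont t X(1) unfolding continuous_on_sequentially comp_def by auto
        moreover have "isCont \<psi> (u (t, z))" using \<psi>(1) by (simp add: continuous_on_eq_continuous_at)
        ultimately show "(\<lambda>n. \<psi> (u (X n, z))) \<longlonglongrightarrow> \<psi> (u (t, z))" by (rule isCont_tendsto_compose[rotated])
      qed
    qed (use b in auto)
  qed
qed

context
  fixes I :: "'i set" and m :: "'i \<Rightarrow> real \<times> 'z \<Rightarrow> real" and e :: "'i \<Rightarrow> real \<times> 'z" and r :: "real \<times> 'z \<Rightarrow> real"
    and K :: real
  assumes I: "finite I" and e: "\<And>i. i \<in> I \<Longrightarrow> fst (e i) = 0"
    and m: "\<And>i. i \<in> I \<Longrightarrow> m i \<in> borel_measurable borel" "\<And>i p. i \<in> I \<Longrightarrow> \<bar>m i p\<bar> \<le> K"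
      "\<And>i p s. i \<in> I \<Longrightarrow> m i (p + s *\<^sub>R e i) = m i p"
    and r: "r \<in> borel_measurable borel"
    and eqn: "AE p in lborel. fst p \<in> {0<..<T} \<longrightarrow> G p \<bullet> (1, 0) + (\<Sum>i\<in>I. m i p * (G p \<bullet> e i)) = r p"
begin

lemma source_integrable:
  assumes S: "S \<in> sets borel" "S \<subseteq> {0<..<T}"
  shows "integrable lborel (\<lambda>p. indicator (S \<times> UNIV) p * r p)"
proof -
  note [measurable] = r
  have SU [measurable]: "S \<times> (UNIV :: 'z set) \<in> sets borel" using S by (simp add: borel_Times)
  have "integrable lborel (\<lambda>p. indicator (S \<times> UNIV) p *\<^sub>R (G p \<bullet> (1, 0) + (\<Sum>i\<in>I. m i p * (G p \<bullet> e i))))"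
  proof (intro integrable_mult_indicator Bochner_Integration.integrable_add integrable_inner_left Bochner_Integration.integrable_sum G_integrable)
    fix i assume i: "i \<in> I"
    have mi [measurable]: "m i \<in> borel_measurable borel" using m i by simp
    show "integrable lborel (\<lambda>p. m i p * (G p \<bullet> e i))"
    proof (rule integrable_bounded_support[OF _ _ support_bounded, of _ "K * (M * norm (e i))"])
      fix p
      have "\<bar>G p \<bullet> e i\<bar> \<le> M * norm (e i)"
        using Cauchy_Schwarz_ineq2[of "G p" "e i"] mult_right_mono[OF G_bound[of p], of "norm (e i)"] by simp
      then show "norm (m i p * (G p \<bullet> e i)) \<le> K * (M * norm (e i))"
        using m(2)[OF i, of p] unfolding real_norm_def abs_mult by (intro mult_mono) auto
    qed (auto simp: G_supp)
  qed (use SU in auto)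
  then show ?thesis
    by (rule integrable_cong_AE_imp) (use eqn S in \<open>auto elim!: eventually_mono split: split_indicator\<close>)
qed

lemma energy_identity:
  assumes \<beta>: "\<And>x. (\<beta> has_real_derivative \<beta>' x) (at x)" and \<beta>': "continuous_on UNIV \<beta>'" and \<beta>0: "\<beta> 0 = 0"
    and t: "0 < t1" "t1 \<le> t2" "t2 < T"
  shows "(LINT z|lborel. \<beta> (u (t2, z))) - (LINT z|lborel. \<beta> (u (t1, z))) =
    (LINT p|lborel. indicator ({t1..t2} \<times> UNIV) p * (\<beta>' (u p) * r p))"
proof -
  note [measurable] = r \<beta>_measurable(2)[OF \<beta> \<beta>' \<beta>0]
  let ?ind = "\<lambda>p. indicator ({t1..t2} \<times> (UNIV :: 'z set)) p :: real"
  obtain B where B: "\<And>x. \<bar>x\<bar> \<le> C \<Longrightarrow> \<bar>\<beta>' x\<bar> \<le> B" using \<beta>_bounds[OF \<beta> \<beta>' \<beta>0] by blast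
  have B0: "0 \<le> B" using B[of 0] C_nonneg by simp
  have bd: "integrable lborel (\<lambda>p. ?ind p * (mm p * (\<beta>' (u p) * (G p \<bullet> d))))"
    if [measurable]: "mm \<in> borel_measurable borel" and mK: "\<And>p. \<bar>mm p\<bar> \<le> K'" for mm d K'
  proof (rule integrable_bounded_support[OF _ _ support_bounded, of _ "K' * (B * (M * norm d))"])
    fix p
    have K': "0 \<le> K'" using mK[of p] by linarith
    have "\<bar>G p \<bullet> d\<bar> \<le> M * norm d"
      using Cauchy_Schwarz_ineq2[of "G p" d] mult_right_mono[OF G_bound[of p], of "norm d"] by simp
    then have "\<bar>mm p * (\<beta>' (u p) * (G p \<bullet> d))\<bar> \<le> K' * (B * (M * norm d))"
      using mK[of p] B[OF u_le_C[of p]] K' B0 unfolding abs_mult by (intro mult_mono) auto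
    then show "norm (?ind p * (mm p * (\<beta>' (u p) * (G p \<bullet> d)))) \<le> K' * (B * (M * norm d))"
      by (auto split: split_indicator)
  qed (auto simp: G_supp)
  have i0: "integrable lborel (\<lambda>p. ?ind p * (\<beta>' (u p) * (G p \<bullet> (1, 0))))"
    using bd[of "\<lambda>_. 1" 1 "(1, 0)"] by simp
  have ii: "integrable lborel (\<lambda>p. ?ind p * (m i p * (\<beta>' (u p) * (G p \<bullet> e i))))" if "i \<in> I" for i
    by (rule bd[OF m(1)[OF that] m(2)[OF that]])
  have "(LINT z|lborel. \<beta> (u (t2, z))) - (LINT z|lborel. \<beta> (u (t1, z))) =
      (LINT p|lborel. ?ind p * (\<beta>' (u p) * (G p \<bullet> (1, 0))))"
    by (rule time_identity[OF \<beta> \<beta>' \<beta>0 t])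
  also have "\<dots> = (LINT p|lborel. ?ind p * (\<beta>' (u p) * (G p \<bullet> (1, 0)))) +
      (\<Sum>i\<in>I. LINT p|lborel. ?ind p * (m i p * (\<beta>' (u p) * (G p \<bullet> e i))))"
    using transversal_identity[OF \<beta> \<beta>' \<beta>0 t e m] by simp
  also have "\<dots> = (LINT p|lborel. ?ind p * (\<beta>' (u p) * (G p \<bullet> (1, 0))) +
      (\<Sum>i\<in>I. ?ind p * (m i p * (\<beta>' (u p) * (G p \<bullet> e i)))))"
    using ii by (subst Bochner_Integration.integral_add[OF i0]) (auto simp: Bochner_Integration.integral_sum)
  also have "\<dots> = (LINT p|lborel. ?ind p * (\<beta>' (u p) * r p))"
  proof (rule integral_cong_AE)
    show "AE p in lborel. ?ind p * (\<beta>' (u p) * (G p \<bullet> (1, 0))) +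
        (\<Sum>i\<in>I. ?ind p * (m i p * (\<beta>' (u p) * (G p \<bullet> e i)))) = ?ind p * (\<beta>' (u p) * r p)"
      using eqn
    proof (rule eventually_mono)
      fix p assume p: "fst p \<in> {0<..<T} \<longrightarrow> G p \<bullet> (1, 0) + (\<Sum>i\<in>I. m i p * (G p \<bullet> e i)) = r p"
      show "?ind p * (\<beta>' (u p) * (G p \<bullet> (1, 0))) +
        (\<Sum>i\<in>I. ?ind p * (m i p * (\<beta>' (u p) * (G p \<bullet> e i)))) = ?ind p * (\<beta>' (u p) * r p)"
      proof (cases "p \<in> {t1..t2} \<times> UNIV")
        case True
        then have "r p = G p \<bullet> (1, 0) + (\<Sum>i\<in>I. m i p * (G p \<bullet> e i))" using p t by auto
        then show ?thesis using True by (simp add: distrib_left sum_distrib_left mult_ac)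
      qed auto
    qed
  qed (use borel_measurable_integrable[OF i0] borel_measurable_integrable[OF ii] in auto)
  finally show ?thesis .
qed

lemma L1_step:
  assumes t: "0 < t1" "t1 \<le> t2" "t2 < T"
  shows "(LINT z|lborel. \<bar>u (t2, z)\<bar>) \<le> (LINT z|lborel. \<bar>u (t1, z)\<bar>) +
    (LINT p|lborel. indicator ({t1..t2} \<times> UNIV) p * \<bar>r p\<bar>)"
proof -
  note [measurable] = r
  define \<beta> where "\<beta> n x = sqrt (x\<^sup>2 + (1 / real (Suc n))\<^sup>2) - 1 / real (Suc n)" for n x
  define \<beta>' where "\<beta>' n x = x / sqrt (x\<^sup>2 + (1 / real (Suc n))\<^sup>2)" for n x
  have c0: "0 < 1 / real (Suc n)" for n by simp
  have d: "(\<beta> n has_real_derivative \<beta>' n x) (at x)" for n x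
    unfolding \<beta>_def[abs_def] \<beta>'_def by (rule smooth_abs(1)[OF c0])
  have c: "continuous_on UNIV (\<beta>' n)" for n
    unfolding \<beta>'_def[abs_def] by (rule smooth_abs(2)[OF c0])
  have z: "\<beta> n 0 = 0" for n unfolding \<beta>_def by (rule smooth_abs(3)[OF c0])
  have le1: "\<bar>\<beta>' n x\<bar> \<le> 1" for n x unfolding \<beta>'_def by (rule smooth_abs(4)[OF c0])
  have b: "0 \<le> \<beta> n x" "\<beta> n x \<le> \<bar>x\<bar>" "\<bar>x\<bar> - 1 / real (Suc n) \<le> \<beta> n x" for n x
    unfolding \<beta>_def by (rule smooth_abs(5-7)[OF c0])+
  have [measurable]: "\<beta>' n \<in> borel_measurable borel" "\<beta> n \<in> borel_measurable borel" for n
    using \<beta>_measurable[OF d c z] by auto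
  have ri: "integrable lborel (\<lambda>p. indicator ({t1..t2} \<times> UNIV) p * \<bar>r p\<bar>)"
  proof -
    have "{t1..t2} \<subseteq> {0<..<T}" using t by auto
    from integrable_norm[OF source_integrable[OF _ this]] show ?thesis by (simp add: abs_mult)
  qed
  have lim: "(\<lambda>n. LINT z|lborel. \<beta> n (u (t, z))) \<longlonglongrightarrow> (LINT z|lborel. \<bar>u (t, z)\<bar>)" for t
  proof (rule integral_dominated_convergence[where w="\<lambda>z. \<bar>u (t, z)\<bar>"])
    show "integrable lborel (\<lambda>z. \<bar>u (t, z)\<bar>)"
      by (rule continuous_on_space_integral(2)[of abs]) (auto intro: continuous_intros)
    show "AE z in lborel. (\<lambda>n. \<beta> n (u (t, z))) \<longlonglongrightarrow> \<bar>u (t, z)\<bar>"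
    proof (rule AE_I2)
      fix z :: 'z
      have "(\<lambda>n. \<bar>u (t, z)\<bar> - 1 / real (Suc n)) \<longlonglongrightarrow> \<bar>u (t, z)\<bar> - 0"
        by (intro tendsto_intros LIMSEQ_Suc[OF lim_1_over_n])
      then have l: "(\<lambda>n. \<bar>u (t, z)\<bar> - 1 / real (Suc n)) \<longlonglongrightarrow> \<bar>u (t, z)\<bar>" by simp
      show "(\<lambda>n. \<beta> n (u (t, z))) \<longlonglongrightarrow> \<bar>u (t, z)\<bar>"
        by (rule real_tendsto_sandwich[OF _ _ l tendsto_const]; rule always_eventually; rule allI; rule b)
    qed
  qed (use b in auto)
  have "(LINT z|lborel. \<beta> n (u (t2, z))) \<le> (LINT z|lborel. \<beta> n (u (t1, z))) + (LINT p|lborel. indicator ({t1..t2} \<times> UNIV) p * \<bar>r p\<bar>)" for n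
  proof -
    have "(LINT z|lborel. \<beta> n (u (t2, z))) - (LINT z|lborel. \<beta> n (u (t1, z))) =
        (LINT p|lborel. indicator ({t1..t2} \<times> UNIV) p * (\<beta>' n (u p) * r p))"
      by (rule energy_identity[OF d c z t])
    also have "\<dots> \<le> (LINT p|lborel. indicator ({t1..t2} \<times> UNIV) p * \<bar>r p\<bar>)"
    proof (rule integral_mono'[OF ri])
      fix p :: "real \<times> 'z"
      have "\<beta>' n (u p) * r p \<le> \<bar>\<beta>' n (u p)\<bar> * \<bar>r p\<bar>" by (simp flip: abs_mult)
      also have "\<dots> \<le> 1 * \<bar>r p\<bar>" by (intro mult_right_mono le1) auto
      finally show "indicator ({t1..t2} \<times> UNIV) p * (\<beta>' n (u p) * r p) \<le> indicator ({t1..t2} \<times> UNIV) p * \<bar>r p\<bar>"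
        by (auto split: split_indicator)
    qed auto
    finally show ?thesis by simp
  qed
  then show ?thesis
    by (intro LIMSEQ_le[OF lim tendsto_add[OF lim tendsto_const]]) auto
qed

lemma interior_approx:
  assumes t: "t \<in> {0<..T}"
  shows "(\<lambda>n. t / real (n + 3)) \<longlonglongrightarrow> 0" "(\<lambda>n. t - t / real (n + 3)) \<longlonglongrightarrow> t"
    "0 < t / real (n + 3)" "t / real (n + 3) \<le> t - t / real (n + 3)" "t - t / real (n + 3) < t"
proof -
  have "(\<lambda>n. t * (1 / real (n + 3))) \<longlonglongrightarrow> t * 0"
    by (intro tendsto_intros LIMSEQ_ignore_initial_segment[OF lim_1_over_n])
  then show l: "(\<lambda>n. t / real (n + 3)) \<longlonglongrightarrow> 0" by simp
  show "(\<lambda>n. t - t / real (n + 3)) \<longlonglongrightarrow> t"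
    using tendsto_diff[OF tendsto_const l, of t] by simp
  show "0 < t / real (n + 3)" "t - t / real (n + 3) < t" using t by auto
  have "t / real (n + 3) \<le> t / 2" using t by (intro divide_left_mono) auto
  then show "t / real (n + 3) \<le> t - t / real (n + 3)" by linarith
qed

lemma L1_bound:
  assumes t: "t \<in> {0..T}"
  shows "(LINT z|lborel. \<bar>u (t, z)\<bar>) \<le> (LINT z|lborel. \<bar>u (0, z)\<bar>) +
    (LINT p|lborel. indicator ({0<..<t} \<times> UNIV) p * \<bar>r p\<bar>)"
proof (cases "t = 0")
  case False
  then have t': "t \<in> {0<..T}" using t by auto
  note ia = interior_approx[OF t']
  define \<Phi> where "\<Phi> t = (LINT z|lborel. \<bar>u (t, z)\<bar>)" for t
  have "continuous_on {0..T} \<Phi>"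
    unfolding \<Phi>_def by (rule continuous_on_space_integral(1)[of abs]) (auto intro: continuous_intros)
  then have lim: "(\<lambda>n. \<Phi> (X n)) \<longlonglongrightarrow> \<Phi> s" if "X \<longlonglongrightarrow> s" "s \<in> {0..T}" "\<And>n. X n \<in> {0..T}" for X s
    using that unfolding continuous_on_sequentially comp_def by blast
  have in1: "t / real (n + 3) \<in> {0..T}" and in2: "t - t / real (n + 3) \<in> {0..T}" for n
    using ia(3,4,5)[of n] t by auto
  have "\<Phi> (t - t / real (n + 3)) \<le> \<Phi> (t / real (n + 3)) + (LINT p|lborel. indicator ({0<..<t} \<times> UNIV) p * \<bar>r p\<bar>)" for n
  proof -
    have "\<Phi> (t - t / real (n + 3)) \<le> \<Phi> (t / real (n + 3)) +
        (LINT p|lborel. indicator ({t / real (n + 3)..t - t / real (n + 3)} \<times> UNIV) p * \<bar>r p\<bar>)"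
      unfolding \<Phi>_def using ia(3,4,5)[of n] t by (intro L1_step) auto
    also have "(LINT p|lborel. indicator ({t / real (n + 3)..t - t / real (n + 3)} \<times> UNIV) p * \<bar>r p\<bar>) \<le>
        (LINT p|lborel. indicator ({0<..<t} \<times> UNIV) p * \<bar>r p\<bar>)"
    proof (rule integral_mono')
      show "integrable lborel (\<lambda>p. indicator ({0<..<t} \<times> UNIV) p * \<bar>r p\<bar>)"
      proof -
        have "{0<..<t} \<subseteq> {0<..<T}" using t by auto
        from integrable_norm[OF source_integrable[OF _ this]] show ?thesis by (simp add: abs_mult)
      qed
      fix p :: "real \<times> 'z"
      show "indicator ({t / real (n + 3)..t - t / real (n + 3)} \<times> UNIV) p * \<bar>r p\<bar> \<le> indicator ({0<..<t} \<times> UNIV) p * \<bar>r p\<bar>"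
      proof (cases "fst p \<in> {t / real (n + 3)..t - t / real (n + 3)}")
        case True
        then have "fst p \<in> {0<..<t}" using ia(3,5)[of n] by auto
        then show ?thesis by (cases p) (auto split: split_indicator)
      next
        case False
        then show ?thesis by (cases p) (auto split: split_indicator)
      qed
    qed auto
    finally show ?thesis by simp
  qed
  then have "\<Phi> t \<le> \<Phi> 0 + (LINT p|lborel. indicator ({0<..<t} \<times> UNIV) p * \<bar>r p\<bar>)"
    by (intro LIMSEQ_le[OF lim[OF ia(2) t in2] tendsto_add[OF lim[OF ia(1) _ in1] tendsto_const]]) (use T in auto)
  then show ?thesis by (simp add: \<Phi>_def)
qed simp

lemma mass_conserved:
  assumes r0: "\<And>p. r p = 0" and t: "t \<in> {0..T}"
  shows "(LINT z|lborel. u (t, z)) = (LINT z|lborel. u (0, z))"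
proof (cases "t = 0")
  case False
  then have t': "t \<in> {0<..T}" using t by auto
  note ia = interior_approx[OF t']
  define \<Phi> where "\<Phi> t = (LINT z|lborel. u (t, z))" for t
  have "continuous_on {0..T} \<Phi>"
    unfolding \<Phi>_def by (rule continuous_on_space_integral(1)[of "\<lambda>x. x"]) (auto intro: continuous_intros)
  then have lim: "(\<lambda>n. \<Phi> (X n)) \<longlonglongrightarrow> \<Phi> s" if "X \<longlonglongrightarrow> s" "s \<in> {0..T}" "\<And>n. X n \<in> {0..T}" for X s
    using that unfolding continuous_on_sequentially comp_def by blast
  have in1: "t / real (n + 3) \<in> {0..T}" and in2: "t - t / real (n + 3) \<in> {0..T}" for n
    using ia(3,4,5)[of n] t by auto
  have eq: "\<Phi> (t - t / real (n + 3)) = \<Phi> (t / real (n + 3))" for n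
    using energy_identity[of "\<lambda>x. x" "\<lambda>_. 1" "t / real (n + 3)" "t - t / real (n + 3)"] ia(3,4,5)[of n] t
    by (auto simp: r0 \<Phi>_def)
  have l2: "(\<lambda>n. \<Phi> (t - t / real (n + 3))) \<longlonglongrightarrow> \<Phi> t" by (rule lim[OF ia(2) t in2])
  have "(\<lambda>n. \<Phi> (t / real (n + 3))) \<longlonglongrightarrow> \<Phi> 0" by (rule lim[OF ia(1) _ in1]) (use T in auto)
  from LIMSEQ_unique[OF l2[unfolded eq] this] show ?thesis unfolding \<Phi>_def .
qed simp

end

end

lemma cball_borel [measurable]: "cball x r \<in> sets borel" for x :: "'a::euclidean_space"
  by (intro borel_closed) auto

definition nice_density :: "real \<Rightarrow> real \<Rightarrow> real \<Rightarrow> ('x::finite, 'v::finite) density \<Rightarrow> bool" where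
  "nice_density T Rx Rv f \<longleftrightarrow> (\<forall>s. continuous_on ({0..T} \<times> UNIV) (f s) \<and>
     (\<forall>t z. t \<notin> {0..T} \<longrightarrow> f s (t, z) = 0) \<and>
     (\<forall>t x v. x \<notin> cball 0 Rx \<or> v \<notin> cball 0 Rv \<longrightarrow> f s (t, x, v) = 0))"

lemma nice_densityD:
  assumes "nice_density T Rx Rv f"
  shows "continuous_on ({0..T} \<times> UNIV) (f s)" "t \<notin> {0..T} \<Longrightarrow> f s (t, z) = 0"
    "x \<notin> cball 0 Rx \<Longrightarrow> f s (t, x, v) = 0" "v \<notin> cball 0 Rv \<Longrightarrow> f s (t, x, v) = 0"
    "z \<notin> cball 0 Rx \<times> cball 0 Rv \<Longrightarrow> f s (t, z) = 0"
  using assms by (cases z; auto simp: nice_density_def)+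

lemma nice_density_diff:
  assumes f: "nice_density T Rx Rv f" and g: "nice_density T Rx Rv g"
  shows "nice_density T Rx Rv (\<lambda>s p. f s p - g s p)"
  unfolding nice_density_def
  by (auto intro!: continuous_on_diff nice_densityD(1)[OF f] nice_densityD(1)[OF g]
      simp: nice_densityD(2-4)[OF f] nice_densityD(2-4)[OF g])

lemma nice_density_measurable:
  assumes f: "nice_density T Rx Rv f"
  shows "f s \<in> borel_measurable borel"
proof -
  have "(\<lambda>p. indicator ({0..T} \<times> UNIV) p *\<^sub>R f s p) \<in> borel_measurable borel"
    by (intro borel_measurable_continuous_on_indicator nice_densityD(1)[OF f] slab_borel)
  also have "(\<lambda>p. indicator ({0..T} \<times> UNIV) p *\<^sub>R f s p) = f s"
    using nice_densityD(2)[OF f] by (auto simp: fun_eq_iff split: split_indicator)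
  finally show ?thesis .
qed

lemma nice_density_bounded:
  assumes f: "nice_density T Rx Rv f"
  shows "\<exists>C\<ge>0. \<forall>s p. \<bar>f s p\<bar> \<le> C"
proof -
  have "\<exists>C\<ge>0. \<forall>p. \<bar>f s p\<bar> \<le> C" for s
  proof -
    let ?S = "{0..T} \<times> (cball 0 Rx \<times> cball 0 Rv)"
    have "bounded (f s ` ?S)"
      by (intro compact_imp_bounded compact_continuous_image compact_Times compact_cball compact_Icc
          continuous_on_subset[OF nice_densityD(1)[OF f]]) auto
    then obtain C where C: "\<And>p. p \<in> ?S \<Longrightarrow> \<bar>f s p\<bar> \<le> C" unfolding bounded_iff by force
    have "\<bar>f s p\<bar> \<le> max C 0" for p
    proof (cases "p \<in> ?S")
      case False
      then have "f s p = 0" using nice_densityD(2,5)[OF f] by (cases p) blast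
      then show ?thesis by simp
    qed (use C in force)
    then show ?thesis by (intro exI[of _ "max C 0"]) auto
  qed
  then obtain C where C: "\<And>s. 0 \<le> C s" "\<And>s p. \<bar>f s p\<bar> \<le> C s" by metis
  have "\<bar>f s p\<bar> \<le> C Pos + C Neg" for s p
    using C(1)[of Pos] C(1)[of Neg] C(2)[of s p] by (cases s) auto
  then show ?thesis using C(1) by (intro exI[of _ "C Pos + C Neg"]) auto
qed

lemma nice_density_space_integrable:
  assumes f: "nice_density T Rx Rv f"
  shows "integrable lborel (\<lambda>z. f s (t, z))" "integrable lborel (\<lambda>v. f s (t, x, v))"
proof -
  note [measurable] = nice_density_measurable[OF f]
  obtain C where C: "\<And>s p. \<bar>f s p\<bar> \<le> C" using nice_density_bounded[OF f] by auto
  show "integrable lborel (\<lambda>z. f s (t, z))"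
    by (rule integrable_bounded_support[where C=C and S="cball 0 Rx \<times> cball 0 Rv"])
      (auto simp: C nice_densityD(5)[OF f] bounded_Times)
  show "integrable lborel (\<lambda>v. f s (t, x, v))"
    by (rule integrable_bounded_support[where C=C and S="cball 0 Rv"])
      (auto simp: C nice_densityD(4)[OF f])
qed

lemma charge_measurable:
  fixes f :: "('x::finite, 'v::finite) density"
  assumes f: "nice_density T Rx Rv f"
  shows "(\<lambda>p. charge f (fst p) (snd p)) \<in> borel_measurable borel"
proof -
  note [measurable] = nice_density_measurable[OF f]
  have [measurable]: "(\<lambda>p. f s (fst (fst p), snd (fst p), snd p)) \<in> borel_measurable (borel \<Otimes>\<^sub>M borel)" for s
    by (rule measurable_compose[OF _ nice_density_measurable[OF f]])
      (auto simp: borel_prod intro!: borel_measurable_continuous_onI continuous_intros)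
  have "(\<lambda>p. LINT v|lborel. f Pos (fst p, snd p, v) - f Neg (fst p, snd p, v)) \<in> borel_measurable (borel :: (real \<times> 'x rvec) measure)"
    by (rule lborel.borel_measurable_lebesgue_integral) (simp add: case_prod_beta')
  then show ?thesis by (simp add: charge_def)
qed

lemma charge_bounded:
  fixes f :: "('x::finite, 'v::finite) density"
  assumes f: "nice_density T Rx Rv f"
  shows "\<exists>C\<ge>0. \<forall>t x. \<bar>charge f t x\<bar> \<le> C"
proof -
  obtain C where C: "0 \<le> C" "\<And>s p. \<bar>f s p\<bar> \<le> C" using nice_density_bounded[OF f] by auto
  let ?w = "\<lambda>v :: 'v rvec. indicator (cball 0 Rv) v *\<^sub>R (2 * C)"
  have "\<bar>charge f t x\<bar> \<le> (LINT v|lborel. ?w v)" for t x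
  proof -
    have "\<bar>charge f t x\<bar> \<le> (LINT v|lborel. \<bar>f Pos (t, x, v) - f Neg (t, x, v)\<bar>)"
      unfolding charge_def using integral_norm_bound[of lborel "\<lambda>v. f Pos (t, x, v) - f Neg (t, x, v)"] by simp
    also have "\<dots> \<le> (LINT v|lborel. ?w v)"
    proof (rule integral_mono')
      show "integrable lborel ?w"
        by (rule integrable_bounded_support[where C="2 * C" and S="cball 0 Rv"]) (use C in \<open>auto split: split_indicator\<close>)
      fix v
      show "\<bar>f Pos (t, x, v) - f Neg (t, x, v)\<bar> \<le> ?w v"
        using C(2)[of Pos "(t, x, v)"] C(2)[of Neg "(t, x, v)"] nice_densityD(4)[OF f, of v _ t x]
        by (cases "v \<in> cball 0 Rv") auto
      show "0 \<le> ?w v" using C(1) by simp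
    qed
    finally show ?thesis .
  qed
  then show ?thesis using C(1) by (intro exI[of _ "LINT v|lborel. ?w v"]) (auto simp: integral_nonneg_AE)
qed

lemma charge_support:
  assumes f: "nice_density T Rx Rv f" and x: "x \<notin> cball 0 Rx"
  shows "charge f t x = 0"
  using nice_densityD(3)[OF f x] by (simp add: charge_def)

lemma charge_diff:
  assumes f: "nice_density T Rx Rv f" and g: "nice_density T Rx Rv g"
  shows "charge f t x - charge g t x = charge (\<lambda>s p. f s p - g s p) t x"
  unfolding charge_def using nice_density_space_integrable(2)[OF f] nice_density_space_integrable(2)[OF g]
  by (subst Bochner_Integration.integral_diff[symmetric]) (auto intro!: Bochner_Integration.integral_cong)

lemma charge_L1:
  fixes f :: "('x::finite, 'v::finite) density"
  assumes f: "nice_density T Rx Rv f"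
  shows "(\<integral>\<^sup>+x. ennreal \<bar>charge f t x\<bar> \<partial>lborel) \<le>
    ennreal ((LINT z|lborel. \<bar>f Pos (t, z)\<bar>) + (LINT z|lborel. \<bar>f Neg (t, z)\<bar>))"
proof -
  note [measurable] = nice_density_measurable[OF f]
  have i: "integrable lborel (\<lambda>z. \<bar>f s (t, z)\<bar>)" for s using nice_density_space_integrable(1)[OF f] by simp
  have iv: "integrable lborel (\<lambda>v. f s (t, x, v))" for s x using nice_density_space_integrable(2)[OF f] by simp
  have "(\<integral>\<^sup>+x. ennreal \<bar>charge f t x\<bar> \<partial>lborel) \<le> (\<integral>\<^sup>+x. \<integral>\<^sup>+v. ennreal (\<bar>f Pos (t, x, v)\<bar> + \<bar>f Neg (t, x, v)\<bar>) \<partial>lborel \<partial>lborel)"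
  proof (rule nn_integral_mono)
    fix x :: "'x rvec"
    have "ennreal \<bar>charge f t x\<bar> \<le> (\<integral>\<^sup>+v. ennreal (norm (f Pos (t, x, v) - f Neg (t, x, v))) \<partial>lborel)"
      using integral_norm_bound_ennreal[of lborel "\<lambda>v. f Pos (t, x, v) - f Neg (t, x, v)"] iv by (simp add: charge_def)
    also have "\<dots> \<le> (\<integral>\<^sup>+v. ennreal (\<bar>f Pos (t, x, v)\<bar> + \<bar>f Neg (t, x, v)\<bar>) \<partial>lborel)"
      by (intro nn_integral_mono ennreal_leI) auto
    finally show "ennreal \<bar>charge f t x\<bar> \<le> (\<integral>\<^sup>+v. ennreal (\<bar>f Pos (t, x, v)\<bar> + \<bar>f Neg (t, x, v)\<bar>) \<partial>lborel)" .
  qed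
  also have "\<dots> = (\<integral>\<^sup>+z. ennreal (\<bar>f Pos (t, z)\<bar> + \<bar>f Neg (t, z)\<bar>) \<partial>(lborel \<Otimes>\<^sub>M lborel))"
    by (rule lborel.nn_integral_fst[of "\<lambda>z. ennreal (\<bar>f Pos (t, z)\<bar> + \<bar>f Neg (t, z)\<bar>)"]) (simp add: lborel_prod)
  also have "\<dots> = ennreal (LINT z|lborel. \<bar>f Pos (t, z)\<bar> + \<bar>f Neg (t, z)\<bar>)"
    unfolding lborel_prod using i by (intro nn_integral_eq_integral) auto
  finally show ?thesis using i by simp
qed

section \<open>The electric field\<close>

definition field_kernel :: "'x::{finite,linorder} rvec \<Rightarrow> 'x rvec \<Rightarrow> 'x rvec" where
  "field_kernel x y = (if CARD('x) = 1 then indicator {y. entry y 1 \<le> entry x 1} y *\<^sub>R vec_of (\<lambda>_. 1)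
     else (1 / (2 * pi) / (norm (x - y))\<^sup>2) *\<^sub>R (x - y))"

definition kernel_bound :: "'x::{finite,linorder} rvec \<Rightarrow> real" where
  "kernel_bound w = (if CARD('x) = 1 then 1 else 1 / norm w)"

lemma continuous_entry: "continuous_on UNIV (\<lambda>x :: 'x::{finite,linorder} rvec. entry x i)"
  unfolding entry_def by (intro continuous_intros)

lemma entry_measurable [measurable]: "(\<lambda>x :: 'x::{finite,linorder} rvec. entry x i) \<in> borel_measurable borel"
  by (intro borel_measurable_continuous_onI continuous_entry)

lemma efield_eq:
  fixes f :: "('x::{finite,linorder}, 'v::finite) density"
  shows "efield f t x = (LINT y|lborel. charge f t y *\<^sub>R field_kernel x y)"
proof (cases "CARD('x) = 1")
  case True
  have "(LINT y|lborel. charge f t y *\<^sub>R field_kernel x y) =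
      (LINT y|lborel. (indicator {y. entry y 1 \<le> entry x 1} y *\<^sub>R charge f t y) *\<^sub>R (vec_of (\<lambda>_. 1) :: 'x rvec))"
    using True by (simp add: field_kernel_def mult.commute)
  also have "\<dots> = (LINT y|lborel. indicator {y. entry y 1 \<le> entry x 1} y *\<^sub>R charge f t y) *\<^sub>R vec_of (\<lambda>_. 1)"
    (is "_ = ?c *\<^sub>R _")
  proof (cases "integrable lborel (\<lambda>y. indicator {y. entry y 1 \<le> entry x 1} y *\<^sub>R charge f t y)")
    case False
    let ?e = "vec_of (\<lambda>_. 1) :: 'x rvec"
    have nz: "?e \<bullet> ?e \<noteq> 0" by (simp add: vec_of_def vec_eq_iff)
    have "\<not> integrable lborel (\<lambda>y. (indicator {y. entry y 1 \<le> entry x 1} y *\<^sub>R charge f t y) *\<^sub>R ?e)"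
    proof
      assume "integrable lborel (\<lambda>y. (indicator {y. entry y 1 \<le> entry x 1} y *\<^sub>R charge f t y) *\<^sub>R ?e)"
      from integrable_mult_left[OF integrable_inner_left[OF this, of ?e], of "1 / (?e \<bullet> ?e)"]
      show False using False nz by simp
    qed
    from not_integrable_integral_eq[OF this] not_integrable_integral_eq[OF False] show ?thesis by (simp only: scaleR_zero_left)
  qed (rule integral_scaleR_left)
  also have "\<dots> = vec_of (\<lambda>_. ?c)" by (simp add: vec_of_def vec_eq_iff)
  finally show ?thesis using True by (simp add: efield_def set_lebesgue_integral_def)
next
  case False
  have "(LINT y|lborel. charge f t y *\<^sub>R field_kernel x y) =
      (LINT y|lborel. (1 / (2 * pi)) *\<^sub>R ((charge f t y / (norm (x - y))\<^sup>2) *\<^sub>R (x - y)))"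
    using False by (intro Bochner_Integration.integral_cong refl) (simp add: field_kernel_def)
  then show ?thesis using False unfolding integral_scaleR_right by (simp add: efield_def)
qed

lemma norm_field_kernel_le: "norm (field_kernel x y) \<le> kernel_bound (x - y)"
  for x y :: "'x::{finite,linorder} rvec"
proof (cases "CARD('x) = 1")
  case True
  have "norm (vec_of (\<lambda>_. 1) :: 'x rvec) \<le> (\<Sum>i\<in>UNIV. \<bar>(vec_of (\<lambda>_. 1) :: 'x rvec) $ i\<bar>)" by (rule norm_le_l1_cart)
  also have "\<dots> = 1" using True by (simp add: vec_of_def)
  finally show ?thesis using True by (auto simp: field_kernel_def kernel_bound_def split: split_indicator)
next
  case False
  have "norm (field_kernel x y) = (1 / (2 * pi)) * (norm (x - y) / (norm (x - y))\<^sup>2)"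
    using False by (simp add: field_kernel_def)
  also have "\<dots> = (1 / (2 * pi)) * (1 / norm (x - y))" by (simp add: power2_eq_square)
  also have "\<dots> \<le> 1 * (1 / norm (x - y))"
    using pi_gt3 by (intro mult_right_mono) (auto simp: divide_le_eq)
  finally show ?thesis using False by (simp add: kernel_bound_def)
qed

lemma field_kernel_measurable [measurable]:
  "(\<lambda>p. field_kernel (fst p) (snd p)) \<in> borel_measurable (borel \<Otimes>\<^sub>M (borel :: 'x::{finite,linorder} rvec measure))"
proof -
  have [measurable]: "Measurable.pred (borel \<Otimes>\<^sub>M (borel :: 'x rvec measure)) (\<lambda>p. entry (snd p) 1 \<le> entry (fst p) 1)"
    by measurable
  have "(\<lambda>p :: 'x rvec \<times> 'x rvec. indicator {y. entry y 1 \<le> entry (fst p) 1} (snd p) :: real) =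
      (\<lambda>p. if entry (snd p) 1 \<le> entry (fst p) 1 then 1 else 0)" by (auto split: split_indicator)
  then have [measurable]: "(\<lambda>p :: 'x rvec \<times> 'x rvec. indicator {y. entry y 1 \<le> entry (fst p) 1} (snd p) :: real) \<in> borel_measurable (borel \<Otimes>\<^sub>M borel)"
    by simp
  show ?thesis unfolding field_kernel_def by (cases "CARD('x) = 1") (simp_all, measurable)
qed

lemma kernel_bound_measurable [measurable]: "kernel_bound \<in> borel_measurable (borel :: 'x::{finite,linorder} rvec measure)"
  unfolding kernel_bound_def[abs_def] by measurable

lemma kernel_bound_nonneg: "0 \<le> kernel_bound w" by (simp add: kernel_bound_def)

lemma nn_integral_inverse_sqrt_finite:
  assumes R: "0 \<le> R"
  shows "(\<integral>\<^sup>+s. ennreal (indicator {-R..R} s * (1 / sqrt \<bar>s\<bar>)) \<partial>lborel) < \<infinity>"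
proof -
  define g where "g s = indicator {0..R} s * s powr (-1/2)" for s :: real
  have [measurable]: "g \<in> borel_measurable borel" unfolding g_def by measurable
  have hi: "((\<lambda>x. x powr (-1/2)) has_integral R powr (-1/2 + 1) / (-1/2 + 1)) {0..R}"
    using R by (intro has_integral_powr_from_0) auto
  have "(\<integral>\<^sup>+s. ennreal (g s) \<partial>lborel) = (\<integral>\<^sup>+s. ennreal (s powr (-1/2)) * indicator {0..R} s \<partial>lborel)"
    by (intro nn_integral_cong) (auto simp: g_def split: split_indicator)
  also have "\<dots> = ennreal (R powr (-1/2 + 1) / (-1/2 + 1))"
    by (rule nn_integral_has_integral_lebesgue'[OF _ hi]) auto
  finally have fin: "(\<integral>\<^sup>+s. ennreal (g s) \<partial>lborel) < \<infinity>" by simp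
  have refl: "(\<integral>\<^sup>+s. ennreal (g (- s)) \<partial>lborel) = (\<integral>\<^sup>+s. ennreal (g s) \<partial>lborel)"
    using nn_integral_real_affine[of "\<lambda>s. ennreal (g s)" "-1" 0] by simp
  have "(\<integral>\<^sup>+s. ennreal (indicator {-R..R} s * (1 / sqrt \<bar>s\<bar>)) \<partial>lborel) \<le> (\<integral>\<^sup>+s. ennreal (g s) + ennreal (g (- s)) \<partial>lborel)"
  proof (rule nn_integral_mono)
    fix s :: real
    have "1 / sqrt \<bar>s\<bar> = \<bar>s\<bar> powr (-1/2)"
      by (simp add: powr_minus_divide powr_half_sqrt)
    then have "indicator {-R..R} s * (1 / sqrt \<bar>s\<bar>) \<le> g s + g (- s)"
      by (auto simp: g_def split: split_indicator)
    then show "ennreal (indicator {-R..R} s * (1 / sqrt \<bar>s\<bar>)) \<le> ennreal (g s) + ennreal (g (- s))"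
      by (subst ennreal_plus[symmetric]) (auto simp: g_def intro: ennreal_leI simp del: ennreal_plus)
  qed
  also have "\<dots> = (\<integral>\<^sup>+s. ennreal (g s) \<partial>lborel) + (\<integral>\<^sup>+s. ennreal (g (- s)) \<partial>lborel)"
    by (rule nn_integral_add) measurable
  also have "\<dots> < \<infinity>" using fin refl by simp
  finally show ?thesis .
qed

lemma kernel_bound_integral_finite:
  fixes R :: real
  assumes card: "CARD('x::{finite,linorder}) \<in> {1, 2}" and R: "0 \<le> R"
  shows "(\<integral>\<^sup>+w. ennreal (indicator (cball (0 :: 'x rvec) R) w * kernel_bound w) \<partial>lborel) < \<infinity>"
proof (cases "CARD('x) = 1")
  case True
  have "(\<integral>\<^sup>+w. ennreal (indicator (cball (0 :: 'x rvec) R) w * kernel_bound w) \<partial>lborel) = (\<integral>\<^sup>+w. indicator (cball (0 :: 'x rvec) R) w \<partial>lborel)"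
    using True by (intro nn_integral_cong) (auto simp: kernel_bound_def split: split_indicator)
  also have "\<dots> < \<infinity>" using emeasure_lborel_cball_finite[of "0 :: 'x rvec" R] by simp
  finally show ?thesis .
next
  case False
  then have two: "DIM('x rvec) = 2" using card by simp
  define g where "g s = indicator {-R..R} s * (1 / sqrt \<bar>s\<bar>)" for s :: real
  have [measurable]: "g \<in> borel_measurable borel" unfolding g_def by measurable
  have g0: "0 \<le> g s" for s by (simp add: g_def)
  have "AE w in lborel. w \<bullet> b \<noteq> 0" if "b \<in> Basis" for b :: "'x rvec"
  proof -
    have "negligible {w. w \<bullet> b = 0}" using that by (rule negligible_standard_hyperplane)
    then have "AE w in lebesgue. w \<notin> {w. w \<bullet> b = 0}" by (intro AE_not_in) (simp add: negligible_iff_null_sets)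
    then show ?thesis by (simp add: AE_completion_iff)
  qed
  then have "AE w in lborel. \<forall>b\<in>(Basis :: 'x rvec set). w \<bullet> b \<noteq> 0"
    by (subst AE_ball_countable) (auto simp: countable_finite)
  then have "AE w in lborel. ennreal (indicator (cball (0 :: 'x rvec) R) w * kernel_bound w) \<le> ennreal (\<Prod>b\<in>Basis. g (w \<bullet> b))"
  proof (rule eventually_mono, intro ennreal_leI)
    fix w :: "'x rvec" assume nz: "\<forall>b\<in>Basis. w \<bullet> b \<noteq> 0"
    show "indicator (cball 0 R) w * kernel_bound w \<le> (\<Prod>b\<in>Basis. g (w \<bullet> b))"
    proof (cases "w \<in> cball 0 R")
      case True
      have inR: "w \<bullet> b \<in> {-R..R}" if "b \<in> Basis" for b
        using Basis_le_norm[OF that, of w] True by auto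
      have "(\<Prod>b\<in>Basis. g (w \<bullet> b)) = (\<Prod>b\<in>Basis. 1 / sqrt \<bar>w \<bullet> b\<bar>)"
        using inR by (intro prod.cong) (auto simp: g_def)
      also have "\<dots> = 1 / (\<Prod>b\<in>Basis. sqrt \<bar>w \<bullet> b\<bar>)" by (simp add: prod_dividef)
      finally have eq: "(\<Prod>b\<in>Basis. g (w \<bullet> b)) = 1 / (\<Prod>b\<in>Basis. sqrt \<bar>w \<bullet> b\<bar>)" .
      have "(\<Prod>b\<in>Basis. sqrt \<bar>w \<bullet> b\<bar>) \<le> (\<Prod>b\<in>(Basis :: 'x rvec set). sqrt (norm w))"
        by (intro prod_mono conjI) (auto intro: Basis_le_norm)
      also have "\<dots> = norm w" using two by (simp add: power2_eq_square)
      finally have le: "(\<Prod>b\<in>Basis. sqrt \<bar>w \<bullet> b\<bar>) \<le> norm w" .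
      have "0 < (\<Prod>b\<in>Basis. sqrt \<bar>w \<bullet> b\<bar>)" using nz by (intro prod_pos) auto
      then show ?thesis
        using le True False eq by (simp add: kernel_bound_def frac_le)
    qed (simp add: prod_nonneg g0)
  qed
  then have "(\<integral>\<^sup>+w. ennreal (indicator (cball (0 :: 'x rvec) R) w * kernel_bound w) \<partial>lborel) \<le> (\<integral>\<^sup>+w. ennreal (\<Prod>b\<in>(Basis :: 'x rvec set). g (w \<bullet> b)) \<partial>lborel)"
    by (rule nn_integral_mono_AE)
  also have "\<dots> = (\<integral>\<^sup>+w. (\<Prod>b\<in>(Basis :: 'x rvec set). ennreal (g (w \<bullet> b))) \<partial>lborel)"
    by (simp add: prod_ennreal g0)
  also have "\<dots> = (\<Prod>b\<in>(Basis :: 'x rvec set). \<integral>\<^sup>+s. ennreal (g s) \<partial>lborel)"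
    by (rule nn_integral_lborel_prod[of "\<lambda>_ s. ennreal (g s)"]) auto
  also have "\<dots> < \<infinity>"
    using nn_integral_inverse_sqrt_finite[OF R] unfolding g_def[symmetric] by (simp add: ennreal_prod_eq_top power_less_top_ennreal)
  finally show ?thesis .
qed

definition kernel_const :: "'x::{finite,linorder} itself \<Rightarrow> real \<Rightarrow> real" where
  "kernel_const _ R = enn2real (\<integral>\<^sup>+w. ennreal (indicator (cball (0 :: 'x rvec) (2 * R)) w * kernel_bound w) \<partial>lborel)"

context
  fixes R :: real
  assumes card: "CARD('x::{finite,linorder}) \<in> {1, 2}" and R: "0 \<le> R"
begin

lemma kernel_integral_le:
  fixes x :: "'x rvec"
  assumes x: "x \<in> cball 0 R"
  shows "(\<integral>\<^sup>+y. ennreal (indicator (cball 0 R) y * kernel_bound (x - y)) \<partial>lborel) \<le> ennreal (kernel_const TYPE('x) R)"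
    and "(\<integral>\<^sup>+y. ennreal (indicator (cball 0 R) y * kernel_bound (y - x)) \<partial>lborel) \<le> ennreal (kernel_const TYPE('x) R)"
proof -
  have "(\<integral>\<^sup>+w. ennreal (indicator (cball (0 :: 'x rvec) (2 * R)) w * kernel_bound w) \<partial>lborel) < \<infinity>"
    using R by (intro kernel_bound_integral_finite[OF card]) auto
  then have k: "ennreal (kernel_const TYPE('x) R) = (\<integral>\<^sup>+w. ennreal (indicator (cball (0 :: 'x rvec) (2 * R)) w * kernel_bound w) \<partial>lborel)"
    by (simp add: kernel_const_def ennreal_enn2real)
  have sym: "kernel_bound (x - y) = kernel_bound (y - x)" for y
    by (simp add: kernel_bound_def norm_minus_commute)
  have "(\<integral>\<^sup>+y. ennreal (indicator (cball 0 R) y * kernel_bound (y - x)) \<partial>lborel) \<le>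
      (\<integral>\<^sup>+y. ennreal (indicator (cball 0 (2 * R)) (y - x) * kernel_bound (y - x)) \<partial>lborel)"
  proof (rule nn_integral_mono)
    fix y :: "'x rvec"
    have "y - x \<in> cball 0 (2 * R)" if "y \<in> cball 0 R"
      using that x norm_triangle_ineq4[of y x] by auto
    then have "indicator (cball 0 R) y \<le> (indicator (cball 0 (2 * R)) (y - x) :: real)"
      by (auto split: split_indicator)
    then show "ennreal (indicator (cball 0 R) y * kernel_bound (y - x)) \<le>
        ennreal (indicator (cball 0 (2 * R)) (y - x) * kernel_bound (y - x))"
      by (intro ennreal_leI mult_right_mono kernel_bound_nonneg)
  qed
  also have "\<dots> = (\<integral>\<^sup>+y. ennreal (indicator (cball 0 (2 * R)) y * kernel_bound y) \<partial>distr lborel borel ((+) (- x)))"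
    by (subst nn_integral_distr) auto
  also have "\<dots> = ennreal (kernel_const TYPE('x) R)" unfolding k by (simp add: lborel_distr_plus)
  finally show "(\<integral>\<^sup>+y. ennreal (indicator (cball 0 R) y * kernel_bound (y - x)) \<partial>lborel) \<le> ennreal (kernel_const TYPE('x) R)" .
  then show "(\<integral>\<^sup>+y. ennreal (indicator (cball 0 R) y * kernel_bound (x - y)) \<partial>lborel) \<le> ennreal (kernel_const TYPE('x) R)"
    by (simp add: sym)
qed

lemma kernel_const_nonneg: "0 \<le> kernel_const TYPE('x) R" by (simp add: kernel_const_def)

lemma charge_kernel_bound:
  fixes f :: "('x, 'v::finite) density"
  assumes f: "nice_density T R Rv f" and C: "0 \<le> C" "\<And>y. \<bar>charge f t y\<bar> \<le> C" and x: "x \<in> cball 0 R"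
  shows "(\<integral>\<^sup>+y. ennreal (norm (charge f t y *\<^sub>R field_kernel x y)) \<partial>lborel) \<le> ennreal (C * kernel_const TYPE('x) R)"
proof -
  have "(\<integral>\<^sup>+y. ennreal (norm (charge f t y *\<^sub>R field_kernel x y)) \<partial>lborel) \<le>
      (\<integral>\<^sup>+y. ennreal C * ennreal (indicator (cball 0 R) y * kernel_bound (x - y)) \<partial>lborel)"
  proof (rule nn_integral_mono)
    fix y :: "'x rvec"
    have "norm (charge f t y *\<^sub>R field_kernel x y) \<le> C * (indicator (cball 0 R) y * kernel_bound (x - y))"
      using charge_support[OF f, of y t] mult_mono[OF C(2)[of y] norm_field_kernel_le[of x y] C(1)]
      by (auto split: split_indicator)
    then show "ennreal (norm (charge f t y *\<^sub>R field_kernel x y)) \<le> ennreal C * ennreal (indicator (cball 0 R) y * kernel_bound (x - y))"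
      by (subst ennreal_mult[symmetric]) (auto intro: ennreal_leI simp: C kernel_bound_nonneg)
  qed
  also have "\<dots> = ennreal C * (\<integral>\<^sup>+y. ennreal (indicator (cball 0 R) y * kernel_bound (x - y)) \<partial>lborel)"
    by (rule nn_integral_cmult) measurable
  also have "\<dots> \<le> ennreal C * ennreal (kernel_const TYPE('x) R)"
    by (intro mult_left_mono kernel_integral_le x) auto
  finally show ?thesis using C(1) kernel_const_nonneg by (simp add: ennreal_mult)
qed

lemma charge_kernel_measurable:
  fixes f :: "('x, 'v::finite) density"
  assumes f: "nice_density T R Rv f"
  shows "(\<lambda>y. charge f t y *\<^sub>R field_kernel x y) \<in> borel_measurable borel"
proof -
  have "(\<lambda>y. charge f (fst (t, y)) (snd (t, y))) \<in> borel_measurable borel"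
    by (rule measurable_compose[OF _ charge_measurable[OF f]]) (auto intro!: borel_measurable_continuous_onI continuous_intros)
  moreover have "(\<lambda>y. field_kernel (fst (x, y)) (snd (x, y))) \<in> borel_measurable borel"
    by (rule measurable_compose[OF _ field_kernel_measurable]) measurable
  ultimately show ?thesis by simp
qed

lemma charge_kernel_integrable:
  fixes f :: "('x, 'v::finite) density"
  assumes f: "nice_density T R Rv f" and x: "x \<in> cball 0 R"
  shows "integrable lborel (\<lambda>y. charge f t y *\<^sub>R field_kernel x y)"
proof -
  obtain C where C: "0 \<le> C" "\<And>t y. \<bar>charge f t y\<bar> \<le> C" using charge_bounded[OF f] by auto
  show ?thesis
    unfolding integrable_iff_bounded
    using charge_kernel_measurable[OF f] le_less_trans[OF charge_kernel_bound[OF f C x]] by simp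
qed

lemma efield_bounded:
  fixes f :: "('x, 'v::finite) density"
  assumes f: "nice_density T R Rv f"
  shows "\<exists>C\<ge>0. \<forall>t. \<forall>x\<in>cball 0 R. norm (efield f t x) \<le> C"
proof -
  obtain C where C: "0 \<le> C" "\<And>t y. \<bar>charge f t y\<bar> \<le> C" using charge_bounded[OF f] by auto
  have "norm (efield f t x) \<le> C * kernel_const TYPE('x) R" if x: "x \<in> cball 0 R" for t x
  proof -
    have "ennreal (norm (efield f t x)) \<le> (\<integral>\<^sup>+y. ennreal (norm (charge f t y *\<^sub>R field_kernel x y)) \<partial>lborel)"
      unfolding efield_eq by (rule integral_norm_bound_ennreal[OF charge_kernel_integrable[OF f x]])
    also have "\<dots> \<le> ennreal (C * kernel_const TYPE('x) R)" by (rule charge_kernel_bound[OF f C x])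
    finally show ?thesis using C kernel_const_nonneg by (simp add: ennreal_le_iff)
  qed
  then show ?thesis using C kernel_const_nonneg by (intro exI[of _ "C * kernel_const TYPE('x) R"]) auto
qed

lemma efield_diff:
  fixes f g :: "('x, 'v::finite) density"
  assumes f: "nice_density T R Rv f" and g: "nice_density T R Rv g" and x: "x \<in> cball 0 R"
  shows "efield f t x - efield g t x = efield (\<lambda>s p. f s p - g s p) t x"
  unfolding efield_eq charge_diff[OF f g, symmetric] scaleR_diff_left
  by (rule Bochner_Integration.integral_diff[symmetric, OF charge_kernel_integrable[OF f x] charge_kernel_integrable[OF g x]])

lemma efield_measurable:
  fixes f :: "('x, 'v::finite) density"
  assumes f: "nice_density T R Rv f"
  shows "(\<lambda>p. efield f (fst p) (snd p)) \<in> borel_measurable borel"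
proof -
  have [measurable]: "(\<lambda>p. charge f (fst (fst p)) (snd p)) \<in> borel_measurable ((borel :: (real \<times> 'x rvec) measure) \<Otimes>\<^sub>M (borel :: 'x rvec measure))"
  proof -
    have "(\<lambda>p. charge f (fst (fst (fst p), snd p)) (snd (fst (fst p), snd p))) \<in> borel_measurable ((borel :: (real \<times> 'x rvec) measure) \<Otimes>\<^sub>M (borel :: 'x rvec measure))"
      by (rule measurable_compose[of "\<lambda>p. (fst (fst p), snd p)", OF _ charge_measurable[OF f]], unfold borel_prod)
        (intro borel_measurable_continuous_onI continuous_intros)
    then show ?thesis by simp
  qed
  have [measurable]: "(\<lambda>p. field_kernel (snd (fst p)) (snd p)) \<in> borel_measurable ((borel :: (real \<times> 'x rvec) measure) \<Otimes>\<^sub>M (borel :: 'x rvec measure))"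
  proof -
    have "(\<lambda>p. field_kernel (fst (snd (fst p), snd p)) (snd (snd (fst p), snd p))) \<in> borel_measurable ((borel :: (real \<times> 'x rvec) measure) \<Otimes>\<^sub>M (borel :: 'x rvec measure))"
      by (rule measurable_compose[of "\<lambda>p. (snd (fst p), snd p)", OF _ field_kernel_measurable], unfold borel_prod)
        (intro borel_measurable_continuous_onI continuous_intros)
    then show ?thesis by simp
  qed
  show ?thesis unfolding efield_eq
    by (rule lborel.borel_measurable_lebesgue_integral) (simp add: case_prod_beta')
qed

lemma efield_L1:
  fixes f :: "('x, 'v::finite) density"
  assumes f: "nice_density T R Rv f"
  shows "(\<integral>\<^sup>+x. indicator (cball 0 R) x * ennreal (norm (efield f t x)) \<partial>lborel) \<le>
    ennreal (kernel_const TYPE('x) R * ((LINT z|lborel. \<bar>f Pos (t, z)\<bar>) + (LINT z|lborel. \<bar>f Neg (t, z)\<bar>)))"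
proof -
  have [measurable]: "(\<lambda>y. charge f t y) \<in> borel_measurable borel"
  proof -
    have "(\<lambda>y. charge f (fst (t, y)) (snd (t, y))) \<in> borel_measurable borel"
      by (rule measurable_compose[OF _ charge_measurable[OF f]]) (auto intro!: borel_measurable_continuous_onI continuous_intros)
    then show ?thesis by simp
  qed
  define H where "H x y = indicator (cball 0 R) x * (ennreal \<bar>charge f t y\<bar> * ennreal (kernel_bound (x - y)))" for x y :: "'x rvec"
  have [measurable]: "(\<lambda>(x, y). H x y) \<in> borel_measurable (lborel \<Otimes>\<^sub>M lborel)"
    unfolding H_def by measurable
  have "(\<integral>\<^sup>+x. indicator (cball 0 R) x * ennreal (norm (efield f t x)) \<partial>lborel) \<le> (\<integral>\<^sup>+x. \<integral>\<^sup>+y. H x y \<partial>lborel \<partial>lborel)"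
  proof (rule nn_integral_mono)
    fix x :: "'x rvec"
    show "indicator (cball 0 R) x * ennreal (norm (efield f t x)) \<le> (\<integral>\<^sup>+y. H x y \<partial>lborel)"
    proof (cases "x \<in> cball 0 R")
      case True
      have "ennreal (norm (efield f t x)) \<le> (\<integral>\<^sup>+y. ennreal (norm (charge f t y *\<^sub>R field_kernel x y)) \<partial>lborel)"
        unfolding efield_eq by (rule integral_norm_bound_ennreal[OF charge_kernel_integrable[OF f True]])
      also have "\<dots> \<le> (\<integral>\<^sup>+y. H x y \<partial>lborel)"
      proof (rule nn_integral_mono)
        fix y
        show "ennreal (norm (charge f t y *\<^sub>R field_kernel x y)) \<le> H x y"
          using True norm_field_kernel_le[of x y]
          by (auto simp: H_def kernel_bound_nonneg simp flip: ennreal_mult intro!: ennreal_leI mult_left_mono)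
      qed
      finally show ?thesis using True by simp
    qed simp
  qed
  also have "\<dots> = (\<integral>\<^sup>+y. \<integral>\<^sup>+x. H x y \<partial>lborel \<partial>lborel)"
    by (rule lborel_pair.Fubini'[symmetric]) measurable
  also have "\<dots> \<le> (\<integral>\<^sup>+y. ennreal \<bar>charge f t y\<bar> * ennreal (kernel_const TYPE('x) R) \<partial>lborel)"
  proof (rule nn_integral_mono)
    fix y :: "'x rvec"
    have "(\<integral>\<^sup>+x. H x y \<partial>lborel) = (\<integral>\<^sup>+x. ennreal \<bar>charge f t y\<bar> * ennreal (indicator (cball 0 R) x * kernel_bound (x - y)) \<partial>lborel)"
      by (intro nn_integral_cong) (auto simp: H_def split: split_indicator)
    also have "\<dots> = ennreal \<bar>charge f t y\<bar> * (\<integral>\<^sup>+x. ennreal (indicator (cball 0 R) x * kernel_bound (x - y)) \<partial>lborel)"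
      by (rule nn_integral_cmult) measurable
    also have "\<dots> \<le> ennreal \<bar>charge f t y\<bar> * ennreal (kernel_const TYPE('x) R)"
    proof (cases "y \<in> cball 0 R")
      case True
      then show ?thesis by (intro mult_left_mono kernel_integral_le(2)) auto
    qed (simp add: charge_support[OF f])
    finally show "(\<integral>\<^sup>+x. H x y \<partial>lborel) \<le> ennreal \<bar>charge f t y\<bar> * ennreal (kernel_const TYPE('x) R)" .
  qed
  also have "\<dots> = (\<integral>\<^sup>+y. ennreal \<bar>charge f t y\<bar> \<partial>lborel) * ennreal (kernel_const TYPE('x) R)"
    by (rule nn_integral_multc) measurable
  also have "\<dots> \<le> ennreal ((LINT z|lborel. \<bar>f Pos (t, z)\<bar>) + (LINT z|lborel. \<bar>f Neg (t, z)\<bar>)) * ennreal (kernel_const TYPE('x) R)"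
    by (intro mult_right_mono charge_L1[OF f]) auto
  finally show ?thesis using kernel_const_nonneg
    by (simp add: mult.commute add_nonneg_nonneg integral_nonneg_AE flip: ennreal_mult del: ennreal_plus)
qed

end

lemma W1inf_gradient:
  fixes g :: "'a::euclidean_space \<Rightarrow> real"
  assumes U: "open U" and W: "in_W1inf U g" and g: "g \<in> borel_measurable borel"
    and Z: "closed Z" "\<And>p. p \<in> U - Z \<Longrightarrow> g p = 0"
  shows "\<exists>G M. bwg U g G \<and> 0 \<le> M \<and> (\<forall>p. norm (G p) \<le> M) \<and> (\<forall>p. p \<notin> U \<inter> Z \<longrightarrow> G p = 0) \<and>
    (AE p in lborel. p \<in> U \<longrightarrow> wgrad U g p = G p)"
proof -
  obtain G0 where G0: "has_weak_grad U g G0" "in_Linf U G0" using W by (auto simp: in_W1inf_def)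
  have w: "has_weak_grad U g (wgrad U g)" by (rule has_weak_grad_wgrad[OF G0(1)])
  have mg: "g \<in> borel_measurable (lebesgue_on U)" and mw: "wgrad U g \<in> borel_measurable (lebesgue_on U)"
    using w loc_integrable_measurable[OF _ U] by (auto simp: has_weak_grad_def)
  obtain G1 where G1: "G1 \<in> borel_measurable borel" "AE x in lborel. x \<in> U \<longrightarrow> wgrad U g x = G1 x"
    using borel_version[OF mw U] by auto
  have w1: "bwg U g G1"
    using has_weak_grad_iff_bwg[OF U mg mw g G1(1) _ G1(2)] w by simp
  obtain C where C: "AE p in lborel. p \<in> U \<longrightarrow> norm (G0 p) \<le> C"
    using G0(2) U by (auto simp: in_Linf_def AE_lebesgue_on_iff)
  have uniq: "AE p in lborel. p \<in> U \<longrightarrow> wgrad U g p = G0 p"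
    by (rule has_weak_grad_unique[OF U w G0(1)])
  have "AE p in lborel. p \<in> U - Z \<longrightarrow> G1 p = 0"
    by (rule bwg_zero[OF w1]) (use U Z in \<open>auto simp: open_Diff\<close>)
  define G where "G p = (if p \<in> U \<inter> Z \<and> norm (G1 p) \<le> C then G1 p else 0)" for p
  have [measurable]: "U \<in> sets borel" "Z \<in> sets borel" using U Z by auto
  note G1(1)[measurable]
  have Gm: "G \<in> borel_measurable borel" unfolding G_def by measurable
  have ae: "AE p in lborel. p \<in> U \<longrightarrow> wgrad U g p = G p"
    using G1(2) C uniq \<open>AE p in lborel. p \<in> U - Z \<longrightarrow> G1 p = 0\<close>
    by eventually_elim (auto simp: G_def)
  have "bwg U g G" using has_weak_grad_iff_bwg[OF U mg mw g Gm _ ae] w by simp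
  moreover have "norm (G p) \<le> max C 0" for p by (auto simp: G_def)
  moreover have "p \<notin> U \<inter> Z \<longrightarrow> G p = 0" for p by (simp add: G_def)
  ultimately show ?thesis using ae by (intro exI[of _ G] exI[of _ "max C 0"]) auto
qed

lemma AE_lborel_lift:
  fixes P :: "'a::euclidean_space \<times> 'b::euclidean_space \<Rightarrow> bool"
  assumes "AE q in lborel. P q"
  shows "AE p in (lborel :: ('a \<times> 'b \<times> 'c::euclidean_space) measure). P (fst p, fst (snd p))"
proof -
  obtain N where N: "N \<in> null_sets lborel" "{q \<in> space lborel. \<not> P q} \<subseteq> N"
    using assms unfolding eventually_ae_filter by auto
  have [measurable]: "N \<in> sets borel" using N(1) by (auto simp: null_sets_def)
  define A where "A = {p :: 'a \<times> 'b \<times> 'c. (fst p, fst (snd p)) \<in> N}"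
  have pm: "(\<lambda>p :: 'a \<times> 'b \<times> 'c. (fst p, fst (snd p))) \<in> borel_measurable borel"
    by (intro borel_measurable_continuous_onI continuous_intros)
  have A [measurable]: "A \<in> sets borel"
    using measurable_sets[OF pm, of N] by (simp add: A_def vimage_def)
  have [measurable]: "(\<lambda>q. indicator N q :: ennreal) \<in> borel_measurable (lborel \<Otimes>\<^sub>M lborel)"
    by (simp add: lborel_prod)
  have "emeasure lborel A = (\<integral>\<^sup>+p. indicator A p \<partial>(lborel \<Otimes>\<^sub>M lborel))"
    using A by (simp add: lborel_prod)
  also have "\<dots> = (\<integral>\<^sup>+t. \<integral>\<^sup>+z. indicator A (t, z) \<partial>lborel \<partial>lborel)"
    by (rule lborel.nn_integral_fst[symmetric]) (use A in \<open>simp add: lborel_prod\<close>)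
  also have "\<dots> = (\<integral>\<^sup>+t. \<integral>\<^sup>+x. indicator N (t, x) * emeasure lborel (UNIV :: 'c set) \<partial>lborel \<partial>lborel)"
  proof (rule nn_integral_cong)
    fix t :: 'a
    have m: "(\<lambda>z. indicator A (t, z) :: ennreal) \<in> borel_measurable borel"
    proof -
      have "(\<lambda>z. (t, z)) \<in> borel_measurable (borel :: ('b \<times> 'c) measure)"
        by (intro borel_measurable_continuous_onI continuous_intros)
      from measurable_compose[OF this borel_measurable_indicator[OF A]] show ?thesis .
    qed
    have "(\<integral>\<^sup>+z. indicator A (t, z) \<partial>lborel) = (\<integral>\<^sup>+z. indicator A (t, z) \<partial>((lborel :: 'b measure) \<Otimes>\<^sub>M (lborel :: 'c measure)))"
      by (simp add: lborel_prod)
    also have "\<dots> = (\<integral>\<^sup>+x. \<integral>\<^sup>+v. indicator A (t, x, v) \<partial>(lborel :: 'c measure) \<partial>(lborel :: 'b measure))"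
      using m by (intro lborel.nn_integral_fst[symmetric]) (simp add: lborel_prod)
    also have "\<dots> = (\<integral>\<^sup>+x. indicator N (t, x) * emeasure lborel (UNIV :: 'c set) \<partial>lborel)"
      by (intro nn_integral_cong) (auto simp: A_def split: split_indicator)
    finally show "(\<integral>\<^sup>+z. indicator A (t, z) \<partial>lborel) = (\<integral>\<^sup>+x. indicator N (t, x) * emeasure lborel (UNIV :: 'c set) \<partial>lborel)" .
  qed
  also have "\<dots> = (\<integral>\<^sup>+q. indicator N q * emeasure lborel (UNIV :: 'c set) \<partial>(lborel \<Otimes>\<^sub>M lborel))"
    by (rule lborel.nn_integral_fst[of "\<lambda>q. indicator N q * emeasure lborel (UNIV :: 'c set)"]) measurable
  also have "\<dots> = 0"
    using N(1) by (simp add: lborel_prod nn_integral_multc null_sets_def)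
  finally have "A \<in> null_sets lborel" using A by (simp add: null_sets_def)
  then have "AE p in lborel. p \<notin> A" by (rule AE_not_in)
  then show ?thesis by (rule eventually_mono) (use N(2) in \<open>auto simp: A_def\<close>)
qed

section \<open>The transport operator\<close>

definition clampv :: "real \<Rightarrow> 'v::finite rvec \<Rightarrow> 'v rvec" where
  "clampv R v = (\<chi> l. max (- R) (min R (v $ l)))"

text \<open>
  Along the directions \<open>dirs\<close> the coefficients \<open>coef\<close> are constant, since the fields do not depend on
  \<open>v\<close> and \<open>v \<otimes> B\<close> has divergence zero componentwise. Clamping \<open>v\<close> and restricting \<open>x\<close> to
  a ball makes them bounded without changing the operator on the support of the densities.
\<close>

definition coef ::
  "real \<Rightarrow> real \<Rightarrow> real \<Rightarrow> real \<Rightarrow> (real \<times> 'x::{finite,linorder} rvec \<Rightarrow> 'x rvec) \<Rightarrow>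
   (real \<times> 'x rvec \<Rightarrow> 'b::{finite,linorder} rvec) \<Rightarrow> ('v::{finite,linorder} \<times> 'x) + 'v \<Rightarrow> real \<times> ('x, 'v) phase \<Rightarrow> real" where
  "coef Rx Rv mx mv E B i p = (case i of
      Inl (l, k) \<Rightarrow> if rank k = rank l then mx * clampv Rv (snd (snd p)) $ l else 0
    | Inr l \<Rightarrow> mv * (indicator (cball 0 Rx) (fst (snd p)) *
        (entry (E (fst p, fst (snd p))) (rank l) + mx * lorentz (clampv Rv (snd (snd p))) (B (fst p, fst (snd p))) $ l)))"

definition dirs :: "('v::{finite,linorder} \<times> 'x::{finite,linorder}) + 'v \<Rightarrow> real \<times> ('x, 'v) phase" where
  "dirs i = (case i of Inl (l, k) \<Rightarrow> (0, axis k 1, 0) | Inr l \<Rightarrow> (0, 0, axis l 1))"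

lemma entry_diff: "entry (x - y) i = entry x i - entry y i"
  by (simp add: entry_def sum_subtractf)

lemma abs_entry_le: "\<bar>entry (x :: 'n::{finite,linorder} rvec) i\<bar> \<le> real CARD('n) * norm x"
proof -
  have "\<bar>entry x i\<bar> \<le> (\<Sum>k | rank k = i. \<bar>x $ k\<bar>)" unfolding entry_def by (rule sum_abs)
  also have "\<dots> \<le> (\<Sum>k\<in>UNIV. \<bar>x $ k\<bar>)" by (rule sum_mono2) auto
  also have "\<dots> \<le> (\<Sum>k\<in>(UNIV :: 'n set). norm x)" by (intro sum_mono component_le_norm_cart)
  finally show ?thesis by simp
qed

lemma entry_cong:
  fixes w v :: "'n::{finite,linorder} rvec"
  assumes "\<And>k. k \<noteq> l \<Longrightarrow> w $ k = v $ k" "rank l \<noteq> i"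
  shows "entry w i = entry v i"
  unfolding entry_def
proof (rule sum.cong[OF refl])
  fix k :: 'n assume "k \<in> {k. rank k = i}"
  then have "k \<noteq> l" using assms(2) by auto
  then show "w $ k = v $ k" by (rule assms(1))
qed

lemma lorentz_component_cong:
  fixes w v :: "'n::{finite,linorder} rvec"
  assumes "\<And>k. k \<noteq> l \<Longrightarrow> w $ k = v $ k"
  shows "lorentz w B $ l = lorentz v B $ l"
  using entry_cong[OF assms, where l=l] by (auto simp: lorentz_def vec_of_def Let_def)

lemma lorentz_nth:
  fixes v :: "'v::{finite,linorder} rvec"
  shows "lorentz v B $ l =
    (if CARD('v) = 2 then if rank l = 1 then entry v 2 * entry B 1 else - (entry v 1 * entry B 1)
      else if rank l = 1 then entry v 2 * entry B 3 - entry v 3 * entry B 2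
      else if rank l = 2 then entry v 3 * entry B 1 - entry v 1 * entry B 3
      else entry v 1 * entry B 2 - entry v 2 * entry B 1)"
  by (simp add: lorentz_def vec_of_def Let_def)

lemma lorentz_diff: "lorentz v B $ l - lorentz v B' $ l = lorentz v (B - B') $ l"
  unfolding lorentz_nth entry_diff right_diff_distrib by simp

lemma abs_lorentz_le:
  fixes v :: "'v::{finite,linorder} rvec" and B :: "'b::{finite,linorder} rvec"
  shows "\<bar>lorentz v B $ l\<bar> \<le> 2 * (real CARD('v) * norm v) * (real CARD('b) * norm B)"
proof -
  have p: "\<bar>entry v i * entry B j\<bar> \<le> (real CARD('v) * norm v) * (real CARD('b) * norm B)" for i j
    unfolding abs_mult by (intro mult_mono abs_entry_le) auto
  have q: "0 \<le> (real CARD('v) * norm v) * (real CARD('b) * norm B)" by simp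
  show ?thesis
    unfolding lorentz_nth
    using p[of 2 1] p[of 1 1] p[of 2 3] p[of 3 2] p[of 3 1] p[of 1 3] p[of 1 2] q
    by (simp only: abs_le_iff split: if_split) linarith
qed

lemma norm_clampv_le: "0 \<le> R \<Longrightarrow> norm (clampv R v) \<le> real CARD('v) * R" for v :: "'v::finite rvec"
proof -
  assume R: "0 \<le> R"
  have "norm (clampv R v) \<le> (\<Sum>l\<in>UNIV. \<bar>clampv R v $ l\<bar>)" by (rule norm_le_l1_cart)
  also have "\<dots> \<le> (\<Sum>l\<in>(UNIV :: 'v set). R)" using R by (intro sum_mono) (auto simp: clampv_def)
  finally show ?thesis by simp
qed

lemma clampv_ident: "norm v \<le> R \<Longrightarrow> clampv R v = v"
  unfolding clampv_def vec_eq_iff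
proof
  fix i assume "norm v \<le> R"
  then have "\<bar>v $ i\<bar> \<le> R" using component_le_norm_cart[of v i] by linarith
  then show "(\<chi> l. max (- R) (min R (v $ l))) $ i = v $ i" by (simp add: abs_le_iff)
qed

lemma clampv_measurable [measurable]: "(\<lambda>v. clampv R v $ l) \<in> borel_measurable (borel :: 'v::finite rvec measure)"
proof -
  have [measurable]: "(\<lambda>v :: 'v rvec. v $ l) \<in> borel_measurable borel"
    by (intro borel_measurable_continuous_onI continuous_intros)
  show ?thesis unfolding clampv_def vec_lambda_beta by measurable
qed

lemma coef_invariant: "coef Rx Rv mx mv E B i (p + s *\<^sub>R dirs i) = coef Rx Rv mx mv E B i p"
proof (cases i)
  case (Inl lk)
  then show ?thesis by (cases lk) (simp add: coef_def dirs_def)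
next
  case (Inr l)
  have "lorentz (clampv Rv (snd (snd p) + s *\<^sub>R axis l 1)) B' $ l = lorentz (clampv Rv (snd (snd p))) B' $ l" for B' :: "'b rvec"
    by (rule lorentz_component_cong) (simp add: clampv_def axis_def)
  then show ?thesis using Inr by (simp add: coef_def dirs_def)
qed

lemma fst_dirs [simp]: "fst (dirs i) = 0"
  by (auto simp: dirs_def split: sum.split)

lemma norm_dirs [simp]: "norm (dirs i) = 1"
  by (auto simp: dirs_def norm_Pair norm_axis_1 split: sum.split)

lemma field_point_measurable:
  fixes E :: "real \<times> 'x::finite rvec \<Rightarrow> 'c::euclidean_space"
  assumes "E \<in> borel_measurable borel"
  shows "(\<lambda>p. E (fst p, fst (snd p))) \<in> borel_measurable (borel :: (real \<times> ('x, 'v::finite) phase) measure)"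
  by (rule measurable_compose[of "\<lambda>p. (fst p, fst (snd p))", OF _ assms])
    (intro borel_measurable_continuous_onI continuous_intros)

lemma lorentz_measurable:
  fixes v :: "'a \<Rightarrow> 'b::{finite,linorder} rvec"
  assumes "\<And>i. (\<lambda>p. entry (v p) i) \<in> borel_measurable M" "\<And>i. (\<lambda>p. entry (B p) i) \<in> borel_measurable M"
  shows "(\<lambda>p. lorentz (v p) (B p) $ l) \<in> borel_measurable M"
proof -
  note [measurable] = assms
  show ?thesis unfolding lorentz_nth by simp
qed

lemma coef_measurable:
  fixes E :: "real \<times> 'x::{finite,linorder} rvec \<Rightarrow> 'x rvec" and B :: "real \<times> 'x rvec \<Rightarrow> 'b::{finite,linorder} rvec"
  assumes E: "E \<in> borel_measurable borel" and B: "B \<in> borel_measurable borel"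
  shows "coef Rx Rv mx mv E B i \<in> borel_measurable (borel :: (real \<times> ('x, 'v::{finite,linorder}) phase) measure)"
proof -
  have [measurable]: "(\<lambda>p :: real \<times> ('x, 'v) phase. snd (snd p)) \<in> borel_measurable borel"
    "(\<lambda>p :: real \<times> ('x, 'v) phase. fst (snd p)) \<in> borel_measurable borel"
    by (intro borel_measurable_continuous_onI continuous_intros)+
  have [measurable]: "(\<lambda>p :: real \<times> ('x, 'v) phase. clampv Rv (snd (snd p)) $ l) \<in> borel_measurable borel" for l
    by measurable
  note [measurable] = field_point_measurable[OF E, where 'v='v] field_point_measurable[OF B, where 'v='v]
  have [measurable]: "(\<lambda>p :: real \<times> ('x, 'v) phase. lorentz (clampv Rv (snd (snd p))) (B (fst p, fst (snd p))) $ l) \<in> borel_measurable borel" for l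
    by (rule lorentz_measurable) (simp_all add: entry_def[of "clampv _ _"])
  show ?thesis
    by (cases i) (auto simp: coef_def[abs_def] case_prod_beta')
qed

lemma coef_bounded:
  fixes E :: "real \<times> 'x::{finite,linorder} rvec \<Rightarrow> 'x rvec" and B :: "real \<times> 'x rvec \<Rightarrow> 'b::{finite,linorder} rvec"
  assumes R: "0 \<le> Rv" and E: "\<And>t x. x \<in> cball 0 Rx \<Longrightarrow> norm (E (t, x)) \<le> CE" "0 \<le> CE"
    and B: "\<And>q. norm (B q) \<le> CB"
  shows "\<exists>K. \<forall>i. \<forall>p :: real \<times> ('x, 'v::{finite,linorder}) phase. \<bar>coef Rx Rv mx mv E B i p\<bar> \<le> K"
proof -
  have CB: "0 \<le> CB" using B[of undefined] norm_ge_zero order_trans by blast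
  let ?V = "real CARD('v) * Rv"
  let ?K1 = "\<bar>mx\<bar> * ?V"
  let ?K2 = "\<bar>mv\<bar> * (real CARD('x) * CE + \<bar>mx\<bar> * (2 * (real CARD('v) * ?V) * (real CARD('b) * CB)))"
  have "\<bar>coef Rx Rv mx mv E B i p\<bar> \<le> max ?K1 ?K2" for i and p :: "real \<times> ('x, 'v) phase"
  proof (cases i)
    case (Inl lk)
    have "\<bar>clampv Rv (snd (snd p)) $ fst lk\<bar> \<le> ?V"
      using component_le_norm_cart norm_clampv_le[OF R] order_trans by blast
    then have "\<bar>mx * clampv Rv (snd (snd p)) $ fst lk\<bar> \<le> ?K1"
      unfolding abs_mult by (rule mult_left_mono) simp
    then show ?thesis using Inl R by (auto simp: coef_def case_prod_beta' le_max_iff_disj)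
  next
    case (Inr l)
    let ?q = "(fst p, fst (snd p))"
    show ?thesis
    proof (cases "fst (snd p) \<in> cball 0 Rx")
      case True
      have "\<bar>entry (E ?q) (rank l)\<bar> \<le> real CARD('x) * CE"
        by (rule order_trans[OF abs_entry_le mult_left_mono[OF E(1)[OF True]]]) simp
      moreover have "\<bar>lorentz (clampv Rv (snd (snd p))) (B ?q) $ l\<bar> \<le> 2 * (real CARD('v) * ?V) * (real CARD('b) * CB)"
        by (rule order_trans[OF abs_lorentz_le])
          (use R CB in \<open>intro mult_mono mult_nonneg_nonneg norm_clampv_le B order_refl; simp\<close>)
      then have "\<bar>mx * lorentz (clampv Rv (snd (snd p))) (B ?q) $ l\<bar> \<le> \<bar>mx\<bar> * (2 * (real CARD('v) * ?V) * (real CARD('b) * CB))"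
        unfolding abs_mult by (rule mult_left_mono) simp
      ultimately have "\<bar>entry (E ?q) (rank l) + mx * lorentz (clampv Rv (snd (snd p))) (B ?q) $ l\<bar> \<le>
          real CARD('x) * CE + \<bar>mx\<bar> * (2 * (real CARD('v) * ?V) * (real CARD('b) * CB))" by linarith
      from mult_left_mono[OF this, of "\<bar>mv\<bar>"] show ?thesis
        using Inr True by (simp add: coef_def abs_mult le_max_iff_disj)
    next
      case False
      have "0 \<le> ?K1" using R by simp
      then show ?thesis using Inr False by (simp add: coef_def le_max_iff_disj)
    qed
  qed
  then show ?thesis by blast
qed

lemma coef_operator:
  fixes g :: "real \<times> ('x::{finite,linorder}, 'v::{finite,linorder}) phase" and B :: "real \<times> 'x rvec \<Rightarrow> 'b::{finite,linorder} rvec"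
  assumes x: "norm x \<le> Rx" and v: "norm v \<le> Rv"
  shows "(\<Sum>i\<in>UNIV. coef Rx Rv mx mv E B i (t, x, v) * (g \<bullet> dirs i)) =
    mx * (v \<bullet> pad (fst (snd g))) + mv * ((pad (E (t, x)) + mx *\<^sub>R lorentz v (B (t, x))) \<bullet> snd (snd g))"
proof -
  have d: "g \<bullet> dirs (Inl (l, k)) = fst (snd g) $ k" "g \<bullet> dirs (Inr l) = snd (snd g) $ l" for l k
    by (simp_all add: dirs_def inner_prod_def inner_axis)
  have "(\<Sum>i\<in>UNIV. coef Rx Rv mx mv E B i (t, x, v) * (g \<bullet> dirs i)) =
      (\<Sum>lk\<in>UNIV. coef Rx Rv mx mv E B (Inl lk) (t, x, v) * (g \<bullet> dirs (Inl lk))) +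
      (\<Sum>l\<in>UNIV. coef Rx Rv mx mv E B (Inr l) (t, x, v) * (g \<bullet> dirs (Inr l)))"
    unfolding UNIV_Plus_UNIV[symmetric] by (subst sum.Plus) auto
  also have "(\<Sum>lk\<in>UNIV. coef Rx Rv mx mv E B (Inl lk) (t, x, v) * (g \<bullet> dirs (Inl lk))) =
      (\<Sum>l\<in>UNIV. \<Sum>k\<in>UNIV. if rank k = rank l then mx * v $ l * fst (snd g) $ k else 0)"
  proof -
    have "(\<Sum>lk\<in>UNIV. F lk) = (\<Sum>l\<in>UNIV. \<Sum>k\<in>UNIV. F (l, k))" for F :: "'v \<times> 'x \<Rightarrow> real"
      by (simp add: sum.cartesian_product case_prod_beta')
    then show ?thesis
      by (simp only:) (intro sum.cong refl, simp add: coef_def d clampv_ident[OF v])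
  qed
  also have "\<dots> = (\<Sum>l\<in>UNIV. mx * (v $ l * entry (fst (snd g)) (rank l)))"
    by (intro sum.cong refl) (simp add: entry_def sum.If_cases sum_distrib_left mult.assoc)
  also have "\<dots> = mx * (v \<bullet> pad (fst (snd g)))"
    by (simp add: inner_vec_def pad_def vec_of_def sum_distrib_left)
  also have "(\<Sum>l\<in>UNIV. coef Rx Rv mx mv E B (Inr l) (t, x, v) * (g \<bullet> dirs (Inr l))) =
      (\<Sum>l\<in>UNIV. mv * ((entry (E (t, x)) (rank l) + mx * lorentz v (B (t, x)) $ l) * snd (snd g) $ l))"
    using x by (intro sum.cong refl) (simp add: coef_def d clampv_ident[OF v])
  also have "\<dots> = mv * ((pad (E (t, x)) + mx *\<^sub>R lorentz v (B (t, x))) \<bullet> snd (snd g))"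
    by (simp add: inner_vec_def pad_def vec_of_def sum_distrib_left)
  finally show ?thesis .
qed

lemma gronwall:
  fixes D :: "real \<Rightarrow> real"
  assumes K: "0 < K" and c: "continuous_on {0..T} D"
    and D: "\<And>t. t \<in> {0..T} \<Longrightarrow> D t \<le> d + K * integral {0..t} D" and d: "0 \<le> d" and t: "t \<in> {0..T}"
  shows "D t \<le> 2 * d * exp (2 * K * T)"
proof -
  define w where "w t = exp (- (2 * K * t)) * D t" for t
  have "continuous_on {0..T} w" unfolding w_def by (intro continuous_intros c)
  then obtain s where s: "s \<in> {0..T}" "\<And>r. r \<in> {0..T} \<Longrightarrow> w r \<le> w s"
    using continuous_attains_sup[of "{0..T}" w] t by auto
  define m where "m = max 0 (w s)"
  have Dm: "D r \<le> m * exp (2 * K * r)" if "r \<in> {0..T}" for r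
  proof -
    have "w r \<le> m" using s(2)[OF that] by (simp add: m_def)
    then have "w r * exp (2 * K * r) \<le> m * exp (2 * K * r)" by (intro mult_right_mono) auto
    moreover have "w r * exp (2 * K * r) = D r"
      by (simp add: w_def mult.commute[of _ "D r"] mult.assoc flip: exp_add)
    ultimately show ?thesis by simp
  qed
  have "((\<lambda>r. m * exp (2 * K * r)) has_integral m * exp (2 * K * s) / (2 * K) - m * exp (2 * K * 0) / (2 * K)) {0..s}"
    by (rule fundamental_theorem_of_calculus)
      (use s K in \<open>auto intro!: derivative_eq_intros simp flip: has_real_derivative_iff_has_vector_derivative\<close>)
  moreover have "D integrable_on {0..s}"
    using s by (intro integrable_continuous_real continuous_on_subset[OF c]) auto
  ultimately have "integral {0..s} D \<le> m * exp (2 * K * s) / (2 * K) - m * exp (2 * K * 0) / (2 * K)"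
    using s Dm by (intro has_integral_le[OF integrable_integral]) auto
  also have "\<dots> \<le> m * exp (2 * K * s) / (2 * K)" using K by (simp add: m_def)
  finally have "K * integral {0..s} D \<le> K * (m * exp (2 * K * s) / (2 * K))" using K by (intro mult_left_mono) auto
  then have "D s \<le> d + m * exp (2 * K * s) / 2" using D[OF s(1)] K by simp
  then have "exp (- (2 * K * s)) * D s \<le> exp (- (2 * K * s)) * (d + m * exp (2 * K * s) / 2)"
    by (intro mult_left_mono) auto
  also have "\<dots> = exp (- (2 * K * s)) * d + m / 2" by (simp add: algebra_simps flip: exp_add)
  also have "\<dots> \<le> 1 * d + m / 2" using d K s by (intro add_right_mono mult_right_mono) auto
  finally have "w s \<le> d + m / 2" by (simp add: w_def)
  then have "m \<le> 2 * d" using d by (auto simp: m_def max_def split: if_splits)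
  moreover have "exp (2 * K * t) \<le> exp (2 * K * T)" using t K by simp
  ultimately have "m * exp (2 * K * t) \<le> 2 * d * exp (2 * K * T)"
    using d by (intro mult_mono) auto
  then show ?thesis using Dm[OF t] by linarith
qed

section \<open>Stability of strong solutions\<close>

definition borel_control ::
  "real \<Rightarrow> real \<Rightarrow> (real \<times> 'x::finite rvec \<Rightarrow> 'b::finite rvec) \<Rightarrow> (real \<times> 'x rvec \<Rightarrow> 'b rvec) \<Rightarrow> bool" where
  "borel_control T Rx B B' \<longleftrightarrow> B' \<in> borel_measurable borel \<and> (\<exists>C. \<forall>q. norm (B' q) \<le> C) \<and>
     (AE q in lborel. q \<in> Qx T Rx \<longrightarrow> B q = B' q)"

definition L1_dist :: "('x::finite, 'v::finite) density \<Rightarrow> ('x, 'v) density \<Rightarrow> real \<Rightarrow> real" where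
  "L1_dist F f t = (LINT z|lborel. \<bar>F Pos (t, z) - f Pos (t, z)\<bar>) + (LINT z|lborel. \<bar>F Neg (t, z) - f Neg (t, z)\<bar>)"

lemma nn_integral_phase:
  fixes h :: "real \<times> 'x::finite rvec \<Rightarrow> ennreal" and k :: "'v::finite rvec \<Rightarrow> ennreal"
  assumes h: "h \<in> borel_measurable borel" and k: "k \<in> borel_measurable borel"
  shows "(\<integral>\<^sup>+p. h (fst p, fst (snd p)) * k (snd (snd p)) \<partial>lborel) =
    (\<integral>\<^sup>+t. (\<integral>\<^sup>+x. h (t, x) \<partial>lborel) \<partial>lborel) * (\<integral>\<^sup>+v. k v \<partial>lborel)"
proof -
  note [measurable] = h k
  have hm [measurable]: "h \<in> borel_measurable (lborel \<Otimes>\<^sub>M lborel)" using h by (simp add: lborel_prod)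
  have ht [measurable]: "(\<lambda>x. h (t, x)) \<in> borel_measurable borel" for t
    by (rule measurable_compose[of "\<lambda>x. (t, x)", OF _ h]) (intro borel_measurable_continuous_onI continuous_intros)
  have m: "(\<lambda>p :: real \<times> 'x rvec \<times> 'v rvec. h (fst p, fst (snd p)) * k (snd (snd p))) \<in> borel_measurable borel"
  proof -
    have [measurable]: "(\<lambda>p :: real \<times> 'x rvec \<times> 'v rvec. h (fst p, fst (snd p))) \<in> borel_measurable borel"
      by (rule measurable_compose[of "\<lambda>p. (fst p, fst (snd p))", OF _ h]) (intro borel_measurable_continuous_onI continuous_intros)
    have [measurable]: "(\<lambda>p :: real \<times> 'x rvec \<times> 'v rvec. k (snd (snd p))) \<in> borel_measurable borel"
      by (rule measurable_compose[of "\<lambda>p. snd (snd p)", OF _ k]) (intro borel_measurable_continuous_onI continuous_intros)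
    show ?thesis by measurable
  qed
  have mt: "(\<lambda>z :: 'x rvec \<times> 'v rvec. h (t, fst z) * k (snd z)) \<in> borel_measurable borel" for t
    using measurable_compose[of "\<lambda>z. (t, z)", OF _ m, of borel]
    by (auto intro!: borel_measurable_continuous_onI continuous_intros)
  have "(\<integral>\<^sup>+p. h (fst p, fst (snd p)) * k (snd (snd p)) \<partial>lborel) =
      (\<integral>\<^sup>+p. h (fst p, fst (snd p)) * k (snd (snd p)) \<partial>((lborel :: real measure) \<Otimes>\<^sub>M (lborel :: ('x rvec \<times> 'v rvec) measure)))"
    by (simp add: lborel_prod)
  also have "\<dots> = (\<integral>\<^sup>+t. \<integral>\<^sup>+z. h (t, fst z) * k (snd z) \<partial>(lborel :: ('x rvec \<times> 'v rvec) measure) \<partial>lborel)"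
    by (subst lborel.nn_integral_fst[symmetric]) (use m in \<open>simp_all add: lborel_prod\<close>)
  also have "\<dots> = (\<integral>\<^sup>+t. (\<integral>\<^sup>+x. h (t, x) \<partial>lborel) * (\<integral>\<^sup>+v. k v \<partial>lborel) \<partial>lborel)"
  proof (rule nn_integral_cong)
    fix t :: real
    have "(\<integral>\<^sup>+z. h (t, fst z) * k (snd z) \<partial>lborel) =
        (\<integral>\<^sup>+z. h (t, fst z) * k (snd z) \<partial>((lborel :: 'x rvec measure) \<Otimes>\<^sub>M (lborel :: 'v rvec measure)))"
      by (simp add: lborel_prod)
    also have "\<dots> = (\<integral>\<^sup>+x. \<integral>\<^sup>+v. h (t, x) * k v \<partial>(lborel :: 'v rvec measure) \<partial>lborel)"
      by (subst lborel.nn_integral_fst[symmetric]) (use mt in \<open>simp_all add: lborel_prod\<close>)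
    also have "\<dots> = (\<integral>\<^sup>+x. h (t, x) * (\<integral>\<^sup>+v. k v \<partial>lborel) \<partial>lborel)"
      by (intro nn_integral_cong nn_integral_cmult) simp
    also have "\<dots> = (\<integral>\<^sup>+x. h (t, x) \<partial>lborel) * (\<integral>\<^sup>+v. k v \<partial>lborel)"
      by (rule nn_integral_multc) simp
    finally show "(\<integral>\<^sup>+z. h (t, fst z) * k (snd z) \<partial>lborel) = (\<integral>\<^sup>+x. h (t, x) \<partial>lborel) * (\<integral>\<^sup>+v. k v \<partial>lborel)" .
  qed
  also have "\<dots> = (\<integral>\<^sup>+t. (\<integral>\<^sup>+x. h (t, x) \<partial>lborel) \<partial>lborel) * (\<integral>\<^sup>+v. k v \<partial>lborel)"
    using lborel.borel_measurable_nn_integral[of "\<lambda>t x. h (t, x)" lborel] by (intro nn_integral_multc) simp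
  finally show ?thesis .
qed

lemma AE_norm_neq:
  fixes Rx :: real
  assumes "0 < Rx"
  shows "AE q in (lborel :: (real \<times> 'x::finite rvec) measure). norm (snd q) \<noteq> Rx"
proof -
  have "negligible (sphere (0 :: 'x rvec) Rx)" by (rule negligible_sphere)
  then have s: "sphere (0 :: 'x rvec) Rx \<in> null_sets lborel"
    using null_sets_completion_iff[of "sphere (0 :: 'x rvec) Rx" lborel]
    by (simp add: negligible_iff_null_sets borel_closed)
  have "emeasure (lborel \<Otimes>\<^sub>M lborel) ((UNIV :: real set) \<times> sphere (0 :: 'x rvec) Rx) =
      emeasure lborel (UNIV :: real set) * emeasure lborel (sphere (0 :: 'x rvec) Rx)"
    by (rule lborel.emeasure_pair_measure_Times) (auto simp: borel_closed)
  then have "(UNIV :: real set) \<times> sphere (0 :: 'x rvec) Rx \<in> null_sets lborel"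
    using s by (auto simp: lborel_prod null_sets_def intro!: borel_closed closed_Times)
  then have "AE q in lborel. q \<notin> (UNIV :: real set) \<times> sphere (0 :: 'x rvec) Rx" by (rule AE_not_in)
  then show ?thesis by (rule eventually_mono) (auto simp: mem_Times_iff)
qed

locale vlasov_setup =
  fixes T Rx Rv :: real and mux muv :: "species \<Rightarrow> real"
    and f0 :: "species \<Rightarrow> ('x::{finite,linorder}, 'v::{finite,linorder}) phase \<Rightarrow> real"
    and B :: "('x, 'b::{finite,linorder}) control" and B0 :: "('x, 'b) control" and f :: "('x, 'v) density"
  assumes T: "0 < T" and Rx: "0 < Rx" and Rv: "0 < Rv" and card: "CARD('x) \<in> {1, 2}"
    and solution: "strong_solution T Rx Rv mux muv f0 B f"
    and control: "borel_control T Rx B B0"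
begin

definition Z :: "('x, 'v) phase set" where "Z = cball 0 Rx \<times> cball 0 Rv"

lemma closure_Omega: "closure (Omega Rx Rv :: ('x, 'v) phase set) = Z"
  using Rx Rv by (simp add: Omega_def Z_def closure_Times)

lemma compact_Z: "compact Z" unfolding Z_def by (intro compact_Times compact_cball)

lemma nice: "nice_density T Rx Rv f"
  unfolding nice_density_def
proof (intro allI conjI impI)
  fix s
  show "continuous_on ({0..T} \<times> UNIV) (f s)" using solution by (simp add: strong_solution_def)
  show z: "f s (t, z) = 0" if "t \<notin> {0..T}" for t z using solution that unfolding strong_solution_def by blast
  show "f s (t, x, v) = 0" if "x \<notin> cball 0 Rx \<or> v \<notin> cball 0 Rv" for t x v
  proof (cases "t \<in> {0..T}")
    case True
    have "closure {z. f s (t, z) \<noteq> 0} \<subseteq> closure (Omega Rx Rv)"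
      using solution True unfolding strong_solution_def by blast
    then have "closure {z. f s (t, z) \<noteq> 0} \<subseteq> Z" unfolding closure_Omega .
    then have sub: "{z. f s (t, z) \<noteq> 0} \<subseteq> Z" by (rule order_trans[OF closure_subset])
    have "(x, v) \<notin> Z" using that unfolding Z_def by blast
    with sub have "(x, v) \<notin> {z. f s (t, z) \<noteq> 0}" by blast
    then show ?thesis unfolding mem_Collect_eq not_not .
  qed (rule z)
qed

lemma Qz_open: "open (Qz T :: (real \<times> ('x, 'v) phase) set)"
  unfolding Qz_def by (intro open_Times) auto

definition E :: "real \<times> 'x rvec \<Rightarrow> 'x rvec" where "E q = efield f (fst q) (snd q)"

lemma E_measurable: "E \<in> borel_measurable borel"
  unfolding E_def[abs_def] by (rule efield_measurable[OF card _ nice]) (use Rx in simp)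

lemma B0_measurable: "B0 \<in> borel_measurable borel"
  using control by (simp add: borel_control_def)

lemma coef_bound: "\<exists>K. \<forall>i. \<forall>p :: real \<times> ('x, 'v) phase. \<bar>coef Rx Rv mx mv E B0 i p\<bar> \<le> K"
proof -
  obtain CE where CE: "0 \<le> CE" "\<And>t x. x \<in> cball 0 Rx \<Longrightarrow> norm (efield f t x) \<le> CE"
    using efield_bounded[OF card _ nice] Rx by auto
  obtain CB where CB: "\<And>q. norm (B0 q) \<le> CB" using control by (auto simp: borel_control_def)
  show ?thesis
    by (rule coef_bounded[of Rv Rx E CE B0 CB]) (use CE CB Rv in \<open>auto simp: E_def\<close>)
qed

lemma gradient:
  "\<exists>G M. bwg (Qz T) (f s) G \<and> 0 \<le> M \<and> (\<forall>p. norm (G p) \<le> M) \<and> (\<forall>p. p \<notin> {0..T} \<times> Z \<longrightarrow> G p = 0) \<and>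
    (AE p in lborel. fst p \<in> {0<..<T} \<longrightarrow>
      G p \<bullet> (1, 0) + (\<Sum>i\<in>UNIV. coef Rx Rv (mux s) (muv s) E B0 i p * (G p \<bullet> dirs i)) = 0)"
proof -
  have W: "in_W1inf (Qz T) (f s)" using solution by (simp add: strong_solution_def)
  have cl: "closed ((UNIV :: real set) \<times> Z)"
    by (intro closed_Times closed_UNIV compact_imp_closed compact_Z)
  have z: "f s p = 0" if "p \<in> Qz T - UNIV \<times> Z" for p
  proof -
    have "snd p \<notin> cball 0 Rx \<times> cball 0 Rv" using that unfolding Z_def by (simp add: mem_Times_iff)
    then have "f s (fst p, snd p) = 0" by (rule nice_densityD(5)[OF nice])
    then show ?thesis by simp
  qed
  have "\<exists>G M. bwg (Qz T) (f s) G \<and> 0 \<le> M \<and> (\<forall>p. norm (G p) \<le> M) \<and>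
      (\<forall>p. p \<notin> Qz T \<inter> UNIV \<times> Z \<longrightarrow> G p = 0) \<and> (AE p in lborel. p \<in> Qz T \<longrightarrow> wgrad (Qz T) (f s) p = G p)"
    by (rule W1inf_gradient[OF Qz_open W nice_density_measurable[OF nice] cl]) (rule z)
  then obtain G M where G: "bwg (Qz T) (f s) G" "0 \<le> M" "\<forall>p. norm (G p) \<le> M"
      "\<forall>p. p \<notin> Qz T \<inter> UNIV \<times> Z \<longrightarrow> G p = 0" "AE p in lborel. p \<in> Qz T \<longrightarrow> wgrad (Qz T) (f s) p = G p"
    by (elim exE conjE) (rule that; assumption)
  have pde: "AE p in lborel. p \<in> Qz T \<longrightarrow> (case p of (t, x, v) \<Rightarrow>
        (let G = wgrad (Qz T) (f s) (t, x, v);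
             ft = fst G; fx = fst (snd G); fv = snd (snd G)
         in ft + mux s * (v \<bullet> pad fx)
              + muv s * ((pad (efield f t x) + mux s *\<^sub>R lorentz v (B (t, x))) \<bullet> fv) = 0))"
    using solution unfolding strong_solution_def vlasov_ae_def AE_lebesgue_on_iff[OF Qz_open] by blast
  have bc: "AE p in (lborel :: (real \<times> ('x, 'v) phase) measure). (fst p, fst (snd p)) \<in> Qx T Rx \<longrightarrow> B (fst p, fst (snd p)) = B0 (fst p, fst (snd p))"
    by (rule AE_lborel_lift[of "\<lambda>q. q \<in> Qx T Rx \<longrightarrow> B q = B0 q"]) (use control in \<open>simp add: borel_control_def\<close>)
  have sph: "AE p in (lborel :: (real \<times> ('x, 'v) phase) measure). norm (snd (fst p, fst (snd p))) \<noteq> Rx"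
    by (rule AE_lborel_lift[OF AE_norm_neq[OF Rx]])
  have "AE p in lborel. fst p \<in> {0<..<T} \<longrightarrow>
      G p \<bullet> (1, 0) + (\<Sum>i\<in>UNIV. coef Rx Rv (mux s) (muv s) E B0 i p * (G p \<bullet> dirs i)) = 0"
    using G(5) pde bc sph
  proof eventually_elim
    case (elim p)
    show ?case
    proof
      assume t: "fst p \<in> {0<..<T}"
      obtain t x v where p: "p = (t, x, v)" by (cases p)
      show "G p \<bullet> (1, 0) + (\<Sum>i\<in>UNIV. coef Rx Rv (mux s) (muv s) E B0 i p * (G p \<bullet> dirs i)) = 0"
      proof (cases "(x, v) \<in> Z")
        case False
        then have "p \<notin> Qz T \<inter> UNIV \<times> Z" by (simp add: p)
        then have "G p = 0" using G(4) by blast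
        then show ?thesis by simp
      next
        case True
        then have n: "norm x \<le> Rx" "norm v \<le> Rv" by (auto simp: Z_def)
        then have q: "(t, x) \<in> Qx T Rx" using elim(4) t by (auto simp: p Qx_def)
        have pQ: "p \<in> Qz T" using t by (auto simp: p Qz_def)
        have "G p \<bullet> (1, 0) = fst (G p)" by (simp add: inner_prod_def)
        moreover have "B (t, x) = B0 (t, x)" using elim(3) q by (simp add: p)
        moreover have "fst (G p) + mux s * (v \<bullet> pad (fst (snd (G p)))) +
            muv s * ((pad (efield f t x) + mux s *\<^sub>R lorentz v (B (t, x))) \<bullet> snd (snd (G p))) = 0"
          using elim(1,2) pQ by (simp add: p Let_def)
        ultimately show ?thesis
          unfolding p coef_operator[OF n] by (simp add: E_def p add.assoc)
      qed
    qed
  qed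
  moreover have "G p = 0" if "p \<notin> {0..T} \<times> Z" for p
  proof -
    have "p \<notin> Qz T \<inter> UNIV \<times> Z" using that by (cases p) (simp add: Qz_def)
    then show ?thesis using G(4) by blast
  qed
  ultimately show ?thesis using G(1-3) by (intro exI[of _ G] exI[of _ M] conjI allI impI) blast+
qed

definition Gr :: "species \<Rightarrow> real \<times> ('x, 'v) phase \<Rightarrow> real \<times> ('x, 'v) phase" where
  "Gr s = (SOME G. \<exists>M. bwg (Qz T) (f s) G \<and> 0 \<le> M \<and> (\<forall>p. norm (G p) \<le> M) \<and> (\<forall>p. p \<notin> {0..T} \<times> Z \<longrightarrow> G p = 0) \<and>
    (AE p in lborel. fst p \<in> {0<..<T} \<longrightarrow>
      G p \<bullet> (1, 0) + (\<Sum>i\<in>UNIV. coef Rx Rv (mux s) (muv s) E B0 i p * (G p \<bullet> dirs i)) = 0))"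

lemma Gr_exists: "\<exists>M. bwg (Qz T) (f s) (Gr s) \<and> 0 \<le> M \<and> (\<forall>p. norm (Gr s p) \<le> M) \<and> (\<forall>p. p \<notin> {0..T} \<times> Z \<longrightarrow> Gr s p = 0) \<and>
    (AE p in lborel. fst p \<in> {0<..<T} \<longrightarrow>
      Gr s p \<bullet> (1, 0) + (\<Sum>i\<in>UNIV. coef Rx Rv (mux s) (muv s) E B0 i p * (Gr s p \<bullet> dirs i)) = 0)"
  unfolding Gr_def by (rule someI_ex[OF gradient])

definition Mr :: "species \<Rightarrow> real" where "Mr s = (SOME M. 0 \<le> M \<and> (\<forall>p. norm (Gr s p) \<le> M))"

lemma Gr:
  shows "bwg (Qz T) (f s) (Gr s)" "p \<notin> {0..T} \<times> Z \<Longrightarrow> Gr s p = 0"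
    "AE p in lborel. fst p \<in> {0<..<T} \<longrightarrow>
      Gr s p \<bullet> (1, 0) + (\<Sum>i\<in>UNIV. coef Rx Rv (mux s) (muv s) E B0 i p * (Gr s p \<bullet> dirs i)) = 0"
  using Gr_exists[of s] by blast+

lemma Mr: "0 \<le> Mr s" "norm (Gr s p) \<le> Mr s"
proof -
  have "0 \<le> Mr s \<and> (\<forall>p. norm (Gr s p) \<le> Mr s)"
    unfolding Mr_def by (rule someI_ex) (use Gr_exists in blast)
  then show "0 \<le> Mr s" "norm (Gr s p) \<le> Mr s" by blast+
qed

lemma transport: "transport_density T (f s) (Gr s) (Mr s) Z"
proof
  show "0 < T" by (rule T)
  show "continuous_on ({0..T} \<times> UNIV) (f s)" by (rule nice_densityD(1)[OF nice])
  show "f s (t, z) = 0" if "t \<notin> {0..T}" for t z using nice_densityD(2)[OF nice that] .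
  show "f s (t, z) = 0" if "z \<notin> Z" for t z using nice_densityD(5)[OF nice] that unfolding Z_def by blast
  show "compact Z" by (rule compact_Z)
  show "bwg ({0<..<T} \<times> UNIV) (f s) (Gr s)" using Gr(1) by (simp add: Qz_def)
  show "norm (Gr s p) \<le> Mr s" for p by (rule Mr)
  show "Gr s p = 0" if "p \<notin> {0..T} \<times> Z" for p by (rule Gr(2)[OF that])
qed

lemma initial: "f s (0, z) = f0 s z"
  using solution unfolding strong_solution_def by blast

lemma coef_bound': obtains K where "\<And>i p. \<bar>coef Rx Rv mx mv E B0 i (p :: real \<times> ('x, 'v) phase)\<bar> \<le> K"
  using coef_bound by blast

lemma mass: assumes t: "t \<in> {0..T}" shows "(LINT z|lborel. f s (t, z)) = (LINT z|lborel. f0 s z)"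
proof -
  interpret transport_density T "f s" "Gr s" "Mr s" Z by (rule transport)
  obtain K where K: "\<And>i p. \<bar>coef Rx Rv (mux s) (muv s) E B0 i (p :: real \<times> ('x, 'v) phase)\<bar> \<le> K" using coef_bound' by blast
  have "(LINT z|lborel. f s (t, z)) = (LINT z|lborel. f s (0, z))"
    by (rule mass_conserved[of UNIV dirs "coef Rx Rv (mux s) (muv s) E B0" K "\<lambda>_. 0"])
      (use K Gr(3) t in \<open>auto intro: coef_measurable E_measurable B0_measurable simp: coef_invariant\<close>)
  then show ?thesis by (simp add: initial)
qed

lemma nonneg:
  assumes f0: "\<And>z. 0 \<le> f0 s z" and t: "t \<in> {0..T}"
  shows "0 \<le> f s (t, z)"
proof -
  interpret transport_density T "f s" "Gr s" "Mr s" Z by (rule transport)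
  obtain K where K: "\<And>i p. \<bar>coef Rx Rv (mux s) (muv s) E B0 i (p :: real \<times> ('x, 'v) phase)\<bar> \<le> K" using coef_bound' by blast
  have "(LINT z|lborel. \<bar>f s (t, z)\<bar>) \<le> (LINT z|lborel. \<bar>f s (0, z)\<bar>) + (LINT p|lborel. indicator ({0<..<t} \<times> (UNIV :: ('x, 'v) phase set)) p * \<bar>0\<bar>)"
    by (rule L1_bound[of UNIV dirs "coef Rx Rv (mux s) (muv s) E B0" K "\<lambda>_. 0"])
      (use K Gr(3) t in \<open>auto intro: coef_measurable E_measurable B0_measurable simp: coef_invariant\<close>)
  also have "(LINT z|lborel. \<bar>f s (0, z)\<bar>) = (LINT z|lborel. f s (t, z))"
    using mass[OF t] f0 by (simp add: initial)
  finally have le: "(LINT z|lborel. \<bar>f s (t, z)\<bar>) \<le> (LINT z|lborel. f s (t, z))" by simp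
  have i: "integrable lborel (\<lambda>z. f s (t, z))" by (rule nice_density_space_integrable(1)[OF nice])
  have i2: "integrable lborel (\<lambda>z. \<bar>f s (t, z)\<bar> - f s (t, z))" using i by auto
  have "(LINT z|lborel. \<bar>f s (t, z)\<bar> - f s (t, z)) = 0"
    using le integral_nonneg_AE[of "\<lambda>z. \<bar>f s (t, z)\<bar> - f s (t, z)" lborel] i by simp
  then have "AE z in lborel. \<bar>f s (t, z)\<bar> - f s (t, z) = 0"
    using integral_nonneg_eq_0_iff_AE[OF i2] by simp
  then have ae: "AE z in lebesgue. \<not> f s (t, z) < 0"
    unfolding AE_completion_iff by (rule eventually_mono) auto
  have "continuous_on UNIV (\<lambda>z. f s (t, z))"
    by (rule continuous_on_compose2[OF u_cont]) (use t in \<open>auto intro!: continuous_intros\<close>)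
  then have o: "open {z. f s (t, z) < 0}"
    using open_Collect_less[of "\<lambda>z. f s (t, z)" "\<lambda>_. 0"] by auto
  have "negligible {z. f s (t, z) < 0}"
    using AE_iff_null_sets[of "{z. f s (t, z) < 0}" lebesgue] ae o
    by (simp add: negligible_iff_null_sets)
  then have "{z. f s (t, z) < 0} = {}" using open_not_negligible[OF o] by blast
  then have "z \<notin> {z. f s (t, z) < 0}" by blast
  then show ?thesis unfolding mem_Collect_eq not_less .
qed

end

lemma coef_diff_bound:
  fixes p :: "real \<times> ('x::{finite,linorder}, 'v::{finite,linorder}) phase"
    and B1 B0 :: "real \<times> 'x rvec \<Rightarrow> 'b::{finite,linorder} rvec"
  assumes Rv: "0 \<le> Rv"
  defines "q \<equiv> (fst p, fst (snd p))"
  shows "\<bar>coef Rx Rv mx mv E1 B1 i p - coef Rx Rv mx mv E B0 i p\<bar> \<le>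
    \<bar>mv\<bar> * (real CARD('x) * norm (E1 q - E q) +
      \<bar>mx\<bar> * (2 * (real CARD('v) * (real CARD('v) * Rv)) * (real CARD('b) * norm (B1 q - B0 q))))"
    (is "_ \<le> ?K")
proof (cases i)
  case (Inl lk)
  then show ?thesis using Rv by (auto simp: coef_def case_prod_beta')
next
  case (Inr l)
  let ?v = "clampv Rv (snd (snd p))"
  have "coef Rx Rv mx mv E1 B1 i p - coef Rx Rv mx mv E B0 i p =
      mv * (indicator (cball 0 Rx) (fst (snd p)) * (entry (E1 q - E q) (rank l) + mx * lorentz ?v (B1 q - B0 q) $ l))"
    unfolding lorentz_diff[symmetric] entry_diff Inr coef_def q_def by (simp add: algebra_simps)
  then have eq: "\<bar>coef Rx Rv mx mv E1 B1 i p - coef Rx Rv mx mv E B0 i p\<bar> =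
      \<bar>mv\<bar> * (indicator (cball 0 Rx) (fst (snd p)) * \<bar>entry (E1 q - E q) (rank l) + mx * lorentz ?v (B1 q - B0 q) $ l\<bar>)"
    by (simp add: abs_mult)
  have "\<bar>lorentz ?v (B1 q - B0 q) $ l\<bar> \<le> 2 * (real CARD('v) * norm ?v) * (real CARD('b) * norm (B1 q - B0 q))"
    by (rule abs_lorentz_le)
  also have "\<dots> \<le> 2 * (real CARD('v) * (real CARD('v) * Rv)) * (real CARD('b) * norm (B1 q - B0 q))"
    using norm_clampv_le[OF Rv, of "snd (snd p)"] by (intro mult_right_mono mult_left_mono) auto
  finally have "\<bar>mx * lorentz ?v (B1 q - B0 q) $ l\<bar> \<le>
      \<bar>mx\<bar> * (2 * (real CARD('v) * (real CARD('v) * Rv)) * (real CARD('b) * norm (B1 q - B0 q)))"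
    unfolding abs_mult by (rule mult_left_mono) simp
  moreover have "\<bar>entry (E1 q - E q) (rank l)\<bar> \<le> real CARD('x) * norm (E1 q - E q)" by (rule abs_entry_le)
  ultimately have le: "\<bar>entry (E1 q - E q) (rank l) + mx * lorentz ?v (B1 q - B0 q) $ l\<bar> \<le>
      real CARD('x) * norm (E1 q - E q) + \<bar>mx\<bar> * (2 * (real CARD('v) * (real CARD('v) * Rv)) * (real CARD('b) * norm (B1 q - B0 q)))"
    by linarith
  have "indicator (cball 0 Rx) (fst (snd p)) * \<bar>entry (E1 q - E q) (rank l) + mx * lorentz ?v (B1 q - B0 q) $ l\<bar> \<le>
      \<bar>entry (E1 q - E q) (rank l) + mx * lorentz ?v (B1 q - B0 q) $ l\<bar>"
    by (auto split: split_indicator)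
  then show ?thesis unfolding eq using le by (intro mult_left_mono) linarith+
qed

context vlasov_setup
begin

definition c1 :: "species \<Rightarrow> real" where
  "c1 s = real CARD(('v \<times> 'x) + 'v) * (Mr s * (\<bar>muv s\<bar> * real CARD('x)))"

definition c2 :: "species \<Rightarrow> real" where
  "c2 s = real CARD(('v \<times> 'x) + 'v) * (Mr s * (\<bar>muv s\<bar> * (\<bar>mux s\<bar> *
     (2 * (real CARD('v) * (real CARD('v) * Rv)) * real CARD('b)))))"

lemma c_nonneg: "0 \<le> c1 s" "0 \<le> c2 s"
  using Mr(1)[of s] Rv by (simp_all add: c1_def c2_def)

lemma stability_step:
  assumes other: "vlasov_setup T Rx Rv mux muv f0 B' B1 F" and \<delta>: "0 \<le> \<delta>"
    and close: "AE q in lborel. q \<in> Qx T Rx \<longrightarrow> norm (B1 q - B0 q) \<le> \<delta>" and t: "t \<in> {0..T}"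
  defines "V \<equiv> measure lborel (cball (0 :: 'v rvec) Rv)" and "X \<equiv> measure lborel (cball (0 :: 'x rvec) Rx)"
  shows "(LINT z|lborel. \<bar>F s (t, z) - f s (t, z)\<bar>) \<le>
    V * (c1 s * kernel_const TYPE('x) Rx * integral {0..t} (L1_dist F f) + c2 s * \<delta> * X * T)"
    and "continuous_on {0..T} (L1_dist F f)"
proof -
  interpret Fs: vlasov_setup T Rx Rv mux muv f0 B' B1 F by (rule other)
  have hn: "nice_density T Rx Rv (\<lambda>s p. F s p - f s p)" by (rule nice_density_diff[OF Fs.nice nice])
  have td: "transport_density T (\<lambda>p. F s p - f s p) (\<lambda>p. Fs.Gr s p - Gr s p) (Fs.Mr s + Mr s) Z" for s
  proof
    show "0 < T" by (rule T)
    show "continuous_on ({0..T} \<times> UNIV) (\<lambda>p. F s p - f s p)" by (rule nice_densityD(1)[OF hn])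
    show "F s (t, z) - f s (t, z) = 0" if "t \<notin> {0..T}" for t z using nice_densityD(2)[OF hn that] .
    show "F s (t, z) - f s (t, z) = 0" if "z \<notin> Z" for t z using nice_densityD(5)[OF hn] that unfolding Z_def by blast
    show "compact Z" by (rule compact_Z)
    show "bwg ({0<..<T} \<times> UNIV) (\<lambda>p. F s p - f s p) (\<lambda>p. Fs.Gr s p - Gr s p)"
      using bwg_diff[OF Fs.Gr(1) Gr(1)] by (simp add: Qz_def)
    show "norm (Fs.Gr s p - Gr s p) \<le> Fs.Mr s + Mr s" for p
      using norm_triangle_ineq4[of "Fs.Gr s p" "Gr s p"] Fs.Mr(2)[of s p] Mr(2)[of s p] by linarith
    show "Fs.Gr s p - Gr s p = 0" if "p \<notin> {0..T} \<times> Z" for p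
      using Fs.Gr(2)[of p s] Gr(2)[OF that, of s] that by (simp add: Fs.Z_def Z_def)
  qed
  show cont: "continuous_on {0..T} (L1_dist F f)"
    unfolding L1_dist_def[abs_def]
    by (intro continuous_on_add transport_density.continuous_on_space_integral(1)[OF td, of abs])
      (auto intro: continuous_intros)
  define m :: "('v \<times> 'x) + 'v \<Rightarrow> real \<times> ('x, 'v) phase \<Rightarrow> real" where "m = coef Rx Rv (mux s) (muv s) Fs.E B1"
  define m0 :: "('v \<times> 'x) + 'v \<Rightarrow> real \<times> ('x, 'v) phase \<Rightarrow> real" where "m0 = coef Rx Rv (mux s) (muv s) E B0"
  define r where "r p = - (\<Sum>i\<in>UNIV. (m i p - m0 i p) * (Gr s p \<bullet> dirs i))" for p
  have [measurable]: "m i \<in> borel_measurable borel" "m0 i \<in> borel_measurable borel" for i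
    unfolding m_def m0_def by (intro coef_measurable Fs.E_measurable Fs.B0_measurable E_measurable B0_measurable)+
  have [measurable]: "Gr s \<in> borel_measurable borel" by (rule bwgD(2)[OF Gr(1)])
  have rm: "r \<in> borel_measurable borel" unfolding r_def by measurable
  obtain K where K: "\<And>i p. \<bar>m i p\<bar> \<le> K" using Fs.coef_bound' unfolding m_def by blast
  have eqn: "AE p in lborel. fst p \<in> {0<..<T} \<longrightarrow>
      (Fs.Gr s p - Gr s p) \<bullet> (1, 0) + (\<Sum>i\<in>UNIV. m i p * ((Fs.Gr s p - Gr s p) \<bullet> dirs i)) = r p"
    using Fs.Gr(3)[of s] Gr(3)[of s]
  proof eventually_elim
    case (elim p)
    show ?case
    proof
      assume p: "fst p \<in> {0<..<T}"
      have "Fs.Gr s p \<bullet> (1, 0) + (\<Sum>i\<in>UNIV. m i p * (Fs.Gr s p \<bullet> dirs i)) = 0"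
        "Gr s p \<bullet> (1, 0) + (\<Sum>i\<in>UNIV. m0 i p * (Gr s p \<bullet> dirs i)) = 0"
        using elim p by (simp_all add: m_def m0_def)
      then show "(Fs.Gr s p - Gr s p) \<bullet> (1, 0) + (\<Sum>i\<in>UNIV. m i p * ((Fs.Gr s p - Gr s p) \<bullet> dirs i)) = r p"
        by (simp add: r_def inner_diff_left right_diff_distrib left_diff_distrib sum_subtractf)
    qed
  qed
  have L1: "(LINT z|lborel. \<bar>F s (t, z) - f s (t, z)\<bar>) \<le> (LINT z|lborel. \<bar>F s (0, z) - f s (0, z)\<bar>) +
      (LINT p|lborel. indicator ({0<..<t} \<times> UNIV) p * \<bar>r p\<bar>)"
    by (rule transport_density.L1_bound[OF td[of s], of UNIV dirs m K r])
      (use K eqn t rm in \<open>auto simp: m_def coef_invariant intro: coef_measurable Fs.E_measurable Fs.B0_measurable\<close>)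
  have "{0<..<t} \<subseteq> {0<..<T}" using t by auto
  from transport_density.source_integrable[OF td[of s], of UNIV dirs m K r "{0<..<t}", OF _ _ _ _ _ rm eqn _ this]
  have "integrable lborel (\<lambda>p. indicator ({0<..<t} \<times> UNIV) p * r p)"
    using K by (auto simp: m_def coef_invariant intro: coef_measurable Fs.E_measurable Fs.B0_measurable)
  from integrable_norm[OF this]
  have ri: "integrable lborel (\<lambda>p. indicator ({0<..<t} \<times> UNIV) p * \<bar>r p\<bar>)" by (simp add: abs_mult)
  define dE where "dE q = Fs.E q - E q" for q
  have [measurable]: "dE \<in> borel_measurable borel" unfolding dE_def
    by (intro borel_measurable_diff Fs.E_measurable E_measurable)
  have dE: "dE (\<tau>, x) = efield (\<lambda>s p. F s p - f s p) \<tau> x" if "x \<in> cball 0 Rx" for \<tau> x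
    unfolding dE_def Fs.E_def E_def fst_conv snd_conv
    by (rule efield_diff[OF card _ Fs.nice nice that]) (use Rx in simp)
  have rb: "\<bar>r p\<bar> \<le> c1 s * norm (dE (fst p, fst (snd p))) + c2 s * norm (B1 (fst p, fst (snd p)) - B0 (fst p, fst (snd p)))" for p
  proof -
    let ?q = "(fst p, fst (snd p))"
    let ?k = "\<bar>muv s\<bar> * (real CARD('x) * norm (dE ?q) +
      \<bar>mux s\<bar> * (2 * (real CARD('v) * (real CARD('v) * Rv)) * (real CARD('b) * norm (B1 ?q - B0 ?q))))"
    have "\<bar>r p\<bar> \<le> (\<Sum>i\<in>(UNIV :: (('v \<times> 'x) + 'v) set). \<bar>(m i p - m0 i p) * (Gr s p \<bullet> dirs i)\<bar>)"
      unfolding r_def abs_minus_cancel by (rule sum_abs)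
    also have "\<dots> \<le> (\<Sum>i\<in>(UNIV :: (('v \<times> 'x) + 'v) set). ?k * Mr s)"
    proof (rule sum_mono)
      fix i :: "('v \<times> 'x) + 'v"
      have "\<bar>m i p - m0 i p\<bar> \<le> ?k" unfolding m_def m0_def dE_def by (rule coef_diff_bound) (use Rv in simp)
      moreover have "\<bar>Gr s p \<bullet> dirs i\<bar> \<le> Mr s"
        using Cauchy_Schwarz_ineq2[of "Gr s p" "dirs i"] Mr(2)[of s p] by simp
      ultimately show "\<bar>(m i p - m0 i p) * (Gr s p \<bullet> dirs i)\<bar> \<le> ?k * Mr s"
        unfolding abs_mult by (intro mult_mono) auto
    qed
    also have "\<dots> = c1 s * norm (dE ?q) + c2 s * norm (B1 ?q - B0 ?q)"
      by (simp add: c1_def c2_def algebra_simps)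
    finally show ?thesis .
  qed
  have r0: "r p = 0" if "p \<notin> {0..T} \<times> Z" for p using Gr(2)[OF that, of s] by (simp add: r_def)
  define H where "H q = indicator {0<..<t} (fst q) * (indicator (cball 0 Rx) (snd q) * ennreal (c1 s * norm (dE q) + c2 s * \<delta>))" for q
  have Hm: "H \<in> borel_measurable borel"
  proof -
    have [measurable]: "(\<lambda>q :: real \<times> 'x rvec. fst q) \<in> borel_measurable borel" "(\<lambda>q :: real \<times> 'x rvec. snd q) \<in> borel_measurable borel"
      by (intro borel_measurable_continuous_onI continuous_intros)+
    show ?thesis unfolding H_def by measurable
  qed
  have cl: "AE p in (lborel :: (real \<times> ('x, 'v) phase) measure). (fst p, fst (snd p)) \<in> Qx T Rx \<longrightarrow> norm (B1 (fst p, fst (snd p)) - B0 (fst p, fst (snd p))) \<le> \<delta>"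
    by (rule AE_lborel_lift[OF close])
  have sph: "AE p in (lborel :: (real \<times> ('x, 'v) phase) measure). norm (snd (fst p, fst (snd p))) \<noteq> Rx"
    by (rule AE_lborel_lift[OF AE_norm_neq[OF Rx]])
  have ae: "AE p in lborel. ennreal (indicator ({0<..<t} \<times> UNIV) p * \<bar>r p\<bar>) \<le> H (fst p, fst (snd p)) * indicator (cball 0 Rv) (snd (snd p))"
    using cl sph
  proof eventually_elim
    case (elim p)
    show ?case
    proof (cases "fst p \<in> {0<..<t} \<and> snd p \<in> Z")
      case True
      then have x: "fst (snd p) \<in> cball 0 Rx" "snd (snd p) \<in> cball 0 Rv" "fst p \<in> {0<..<t}"
        by (auto simp: Z_def)
      have "(fst p, fst (snd p)) \<in> Qx T Rx" using x elim(2) t by (auto simp: Qx_def)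
      then have "norm (B1 (fst p, fst (snd p)) - B0 (fst p, fst (snd p))) \<le> \<delta>" using elim(1) by blast
      then have "c2 s * norm (B1 (fst p, fst (snd p)) - B0 (fst p, fst (snd p))) \<le> c2 s * \<delta>"
        by (rule mult_left_mono[OF _ c_nonneg(2)])
      then have "\<bar>r p\<bar> \<le> c1 s * norm (dE (fst p, fst (snd p))) + c2 s * \<delta>"
        using rb[of p] by linarith
      moreover have "p \<in> {0<..<t} \<times> UNIV" using x by (simp add: mem_Times_iff)
      ultimately show ?thesis using x by (simp add: H_def ennreal_leI)
    next
      case False
      then have "indicator ({0<..<t} \<times> UNIV) p * \<bar>r p\<bar> = 0"
        using r0[of p] by (cases "fst p \<in> {0<..<t}") (auto simp: mem_Times_iff)
      then show ?thesis by (simp only: ennreal_0 zero_le)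
    qed
  qed
  have Vf: "emeasure lborel (cball (0 :: 'v rvec) Rv) = ennreal V" "emeasure lborel (cball (0 :: 'x rvec) Rx) = ennreal X"
    unfolding V_def X_def
    using emeasure_lborel_cball_finite[of "0 :: 'v rvec" Rv] emeasure_lborel_cball_finite[of "0 :: 'x rvec" Rx]
    by (auto intro!: emeasure_eq_ennreal_measure)
  have VX: "0 \<le> V" "0 \<le> X" by (simp_all add: V_def X_def)
  have \<kappa>: "0 \<le> kernel_const TYPE('x) Rx" by (simp add: kernel_const_def)
  have D0: "0 \<le> L1_dist F f \<tau>" for \<tau> by (simp add: L1_dist_def integral_nonneg_AE)
  define g where "g \<tau> = c1 s * (kernel_const TYPE('x) Rx * L1_dist F f \<tau>) + c2 s * \<delta> * X" for \<tau>
  have g0: "0 \<le> g \<tau>" for \<tau> unfolding g_def using c_nonneg \<kappa> D0 VX \<delta> by simp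
  have inner: "(\<integral>\<^sup>+x. H (\<tau>, x) \<partial>lborel) \<le> ennreal (g \<tau>) * indicator {0..t} \<tau>" for \<tau>
  proof (cases "\<tau> \<in> {0<..<t}")
    case True
    have [measurable]: "(\<lambda>x. dE (\<tau>, x)) \<in> borel_measurable borel"
      by (rule measurable_compose[of "\<lambda>x. (\<tau>, x)" _ borel]) (auto intro!: borel_measurable_continuous_onI continuous_intros)
    have "(\<integral>\<^sup>+x. H (\<tau>, x) \<partial>lborel) = (\<integral>\<^sup>+x. ennreal (c1 s) * (indicator (cball 0 Rx) x * ennreal (norm (dE (\<tau>, x)))) +
        ennreal (c2 s * \<delta>) * indicator (cball 0 Rx) x \<partial>lborel)"
      using True c_nonneg \<delta>
      by (intro nn_integral_cong) (auto simp: H_def ennreal_mult split: split_indicator)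
    also have "\<dots> = ennreal (c1 s) * (\<integral>\<^sup>+x. indicator (cball 0 Rx) x * ennreal (norm (dE (\<tau>, x))) \<partial>lborel) + ennreal (c2 s * \<delta>) * ennreal X"
      by (subst nn_integral_add) (auto simp: nn_integral_cmult Vf)
    also have "\<dots> \<le> ennreal (c1 s) * ennreal (kernel_const TYPE('x) Rx * L1_dist F f \<tau>) + ennreal (c2 s * \<delta>) * ennreal X"
    proof (intro add_right_mono mult_left_mono)
      have "(\<integral>\<^sup>+x. indicator (cball 0 Rx) x * ennreal (norm (dE (\<tau>, x))) \<partial>lborel) =
          (\<integral>\<^sup>+x. indicator (cball 0 Rx) x * ennreal (norm (efield (\<lambda>s p. F s p - f s p) \<tau> x)) \<partial>lborel)"
        by (intro nn_integral_cong) (auto simp: dE split: split_indicator)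
      also have "\<dots> \<le> ennreal (kernel_const TYPE('x) Rx * L1_dist F f \<tau>)"
        unfolding L1_dist_def by (rule efield_L1[OF card _ hn]) (use Rx in simp)
      finally show "(\<integral>\<^sup>+x. indicator (cball 0 Rx) x * ennreal (norm (dE (\<tau>, x))) \<partial>lborel) \<le>
          ennreal (kernel_const TYPE('x) Rx * L1_dist F f \<tau>)" .
    qed simp
    also have "\<dots> = ennreal (g \<tau>)"
      unfolding g_def using c_nonneg \<kappa> D0 VX \<delta> by (simp flip: ennreal_mult ennreal_plus)
    finally show ?thesis using True by simp
  next
    case False
    then show ?thesis by (simp add: H_def)
  qed
  have gi: "(g has_integral c1 s * (kernel_const TYPE('x) Rx * integral {0..t} (L1_dist F f)) + c2 s * \<delta> * X * t) {0..t}"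
  proof -
    have "L1_dist F f integrable_on {0..t}"
      using t by (intro integrable_continuous_real continuous_on_subset[OF cont]) auto
    from has_integral_mult_right[OF has_integral_mult_right[OF integrable_integral[OF this], of "kernel_const TYPE('x) Rx"], of "c1 s"]
      has_integral_const_real[of "c2 s * \<delta> * X" 0 t]
    have "((\<lambda>\<tau>. c1 s * (kernel_const TYPE('x) Rx * L1_dist F f \<tau>) + c2 s * \<delta> * X) has_integral
        c1 s * (kernel_const TYPE('x) Rx * integral {0..t} (L1_dist F f)) + measure lborel {0..t} *\<^sub>R (c2 s * \<delta> * X)) {0..t}"
      by (rule has_integral_add)
    then show ?thesis using t by (simp add: g_def[abs_def] mult.commute[of t])
  qed
  have "ennreal (LINT p|lborel. indicator ({0<..<t} \<times> UNIV) p * \<bar>r p\<bar>) =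
      (\<integral>\<^sup>+p. ennreal (indicator ({0<..<t} \<times> UNIV) p * \<bar>r p\<bar>) \<partial>lborel)"
    by (rule nn_integral_eq_integral[symmetric, OF ri]) auto
  also have "\<dots> \<le> (\<integral>\<^sup>+p. H (fst p, fst (snd p)) * indicator (cball (0 :: 'v rvec) Rv) (snd (snd p)) \<partial>lborel)"
    by (rule nn_integral_mono_AE[OF ae])
  also have "\<dots> = (\<integral>\<^sup>+\<tau>. (\<integral>\<^sup>+x. H (\<tau>, x) \<partial>lborel) \<partial>lborel) * ennreal V"
    by (subst nn_integral_phase[OF Hm]) (simp_all add: Vf)
  also have "\<dots> \<le> (\<integral>\<^sup>+\<tau>. ennreal (g \<tau>) * indicator {0..t} \<tau> \<partial>lborel) * ennreal V"
    by (intro mult_right_mono nn_integral_mono inner) auto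
  also have "(\<integral>\<^sup>+\<tau>. ennreal (g \<tau>) * indicator {0..t} \<tau> \<partial>lborel) =
      ennreal (c1 s * (kernel_const TYPE('x) Rx * integral {0..t} (L1_dist F f)) + c2 s * \<delta> * X * t)"
    by (rule nn_integral_has_integral_lebesgue'[OF _ gi]) (rule g0)
  also have "\<dots> * ennreal V = ennreal ((c1 s * (kernel_const TYPE('x) Rx * integral {0..t} (L1_dist F f)) + c2 s * \<delta> * X * t) * V)"
    by (rule ennreal_mult''[symmetric]) (rule VX)
  finally have "(LINT p|lborel. indicator ({0<..<t} \<times> UNIV) p * \<bar>r p\<bar>) \<le>
      (c1 s * (kernel_const TYPE('x) Rx * integral {0..t} (L1_dist F f)) + c2 s * \<delta> * X * t) * V"
    using has_integral_nonneg[OF gi] g0 VX by (subst (asm) ennreal_le_iff) auto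
  also have "\<dots> \<le> (c1 s * (kernel_const TYPE('x) Rx * integral {0..t} (L1_dist F f)) + c2 s * \<delta> * X * T) * V"
    using t c_nonneg \<delta> VX by (intro mult_right_mono add_left_mono mult_left_mono) auto
  finally show "(LINT z|lborel. \<bar>F s (t, z) - f s (t, z)\<bar>) \<le>
    V * (c1 s * kernel_const TYPE('x) Rx * integral {0..t} (L1_dist F f) + c2 s * \<delta> * X * T)"
    using L1 by (simp add: initial Fs.initial mult.commute mult.left_commute)
qed

lemma stability:
  "\<exists>K\<ge>0. \<forall>B' B1 F \<delta>. vlasov_setup T Rx Rv mux muv f0 B' B1 F \<longrightarrow> 0 \<le> \<delta> \<longrightarrow>
     (AE q in lborel. q \<in> Qx T Rx \<longrightarrow> norm (B1 q - B0 q) \<le> \<delta>) \<longrightarrow>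
     (\<forall>t\<in>{0..T}. L1_dist F f t \<le> K * \<delta>)"
proof -
  define V where "V = measure lborel (cball (0 :: 'v rvec) Rv)"
  define X where "X = measure lborel (cball (0 :: 'x rvec) Rx)"
  define \<kappa> where "\<kappa> = kernel_const TYPE('x) Rx"
  have nn: "0 \<le> V" "0 \<le> X" "0 \<le> \<kappa>" by (simp_all add: V_def X_def \<kappa>_def kernel_const_def)
  define K1 where "K1 = V * ((c1 Pos + c1 Neg) * \<kappa>) + 1"
  define K2 where "K2 = V * ((c2 Pos + c2 Neg) * X * T)"
  have K: "0 < K1" "0 \<le> K2" using nn c_nonneg T by (simp_all add: K1_def K2_def add_nonneg_pos)
  have "L1_dist F f t \<le> (2 * K2 * exp (2 * K1 * T)) * \<delta>"
    if a: "vlasov_setup T Rx Rv mux muv f0 B' B1 F" and \<delta>: "0 \<le> \<delta>"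
      and c: "AE q in lborel. q \<in> Qx T Rx \<longrightarrow> norm (B1 q - B0 q) \<le> \<delta>" and t: "t \<in> {0..T}" for B' B1 F \<delta> t
  proof -
    have cont: "continuous_on {0..T} (L1_dist F f)" by (rule stability_step(2)[OF a \<delta> c t])
    have "L1_dist F f \<tau> \<le> K2 * \<delta> + K1 * integral {0..\<tau>} (L1_dist F f)" if \<tau>: "\<tau> \<in> {0..T}" for \<tau>
    proof -
      define J where "J = integral {0..\<tau>} (L1_dist F f)"
      have "L1_dist F f integrable_on {0..\<tau>}"
        using \<tau> by (intro integrable_continuous_real continuous_on_subset[OF cont]) auto
      then have J: "0 \<le> J" unfolding J_def by (intro integral_nonneg) (auto simp: L1_dist_def integral_nonneg_AE)
      have "L1_dist F f \<tau> \<le> V * (c1 Pos * \<kappa> * J + c2 Pos * \<delta> * X * T) + V * (c1 Neg * \<kappa> * J + c2 Neg * \<delta> * X * T)"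
        unfolding V_def X_def \<kappa>_def J_def L1_dist_def[of F f \<tau>]
        by (intro add_mono stability_step(1)[OF a \<delta> c \<tau>])
      also have "\<dots> = K2 * \<delta> + (K1 - 1) * J" by (simp add: K1_def K2_def algebra_simps)
      also have "\<dots> \<le> K2 * \<delta> + K1 * J" using J by (simp add: left_diff_distrib)
      finally show ?thesis by (simp add: J_def)
    qed
    from gronwall[OF K(1) cont this _ t] have "L1_dist F f t \<le> 2 * (K2 * \<delta>) * exp (2 * K1 * T)"
      using K \<delta> by simp
    then show ?thesis by (simp add: mult_ac)
  qed
  then show ?thesis using K by (intro exI[of _ "2 * K2 * exp (2 * K1 * T)"]) auto
qed

end

section \<open>Convex combinations converging almost everywhere\<close>

lemma AE_summable:
  fixes h :: "nat \<Rightarrow> 'a \<Rightarrow> real"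
  assumes i: "\<And>j. integrable M (h j)" and nn: "\<And>j x. 0 \<le> h j x" and le: "\<And>j. (LINT x|M. h j x) \<le> K * (1/2) ^ j"
  shows "AE x in M. summable (\<lambda>j. h j x)"
proof -
  have "0 \<le> (LINT x|M. h 0 x)" using nn by (intro integral_nonneg_AE) auto
  then have K: "0 \<le> K" using le[of 0] by simp
  note [measurable] = borel_measurable_integrable[OF i]
  have "(\<integral>\<^sup>+x. (\<Sum>j. ennreal (h j x)) \<partial>M) = (\<Sum>j. \<integral>\<^sup>+x. ennreal (h j x) \<partial>M)"
    by (rule nn_integral_suminf) measurable
  also have "\<dots> = (\<Sum>j. ennreal (LINT x|M. h j x))"
    using i nn by (simp add: nn_integral_eq_integral)
  also have "\<dots> \<le> (\<Sum>j. ennreal (K * (1/2) ^ j))"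
    by (intro suminf_le ennreal_leI le) auto
  also have "\<dots> = ennreal (\<Sum>j. K * (1/2) ^ j)"
    using K by (intro suminf_ennreal_eq summable_sums summable_mult summable_geometric) auto
  finally have "(\<integral>\<^sup>+x. (\<Sum>j. ennreal (h j x)) \<partial>M) < \<infinity>" by (rule le_less_trans) simp
  then have "(\<integral>\<^sup>+x. (\<Sum>j. ennreal (h j x)) \<partial>M) \<noteq> \<infinity>" by simp
  then have "AE x in M. (\<Sum>j. ennreal (h j x)) \<noteq> \<infinity>"
    by (intro nn_integral_PInf_AE) auto
  then show ?thesis
  proof (rule eventually_mono)
    fix x assume "(\<Sum>j. ennreal (h j x)) \<noteq> \<infinity>"
    then show "summable (\<lambda>j. h j x)" by (intro summable_suminf_not_top nn) auto
  qed
qed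

definition convex_comb :: "(nat \<Rightarrow> 'a \<Rightarrow> 'b::real_vector) \<Rightarrow> nat set \<Rightarrow> (nat \<Rightarrow> real) \<Rightarrow> 'a \<Rightarrow> 'b" where
  "convex_comb W S c x = (\<Sum>k\<in>S. c k *\<^sub>R W k x)"

definition weights :: "nat \<Rightarrow> nat set \<Rightarrow> (nat \<Rightarrow> real) \<Rightarrow> bool" where
  "weights n S c \<longleftrightarrow> finite S \<and> S \<subseteq> {n..} \<and> (\<forall>k\<in>S. 0 \<le> c k) \<and> sum c S = 1"

lemma weights_mono: "weights m S c \<Longrightarrow> n \<le> m \<Longrightarrow> weights n S c"
  by (auto simp: weights_def)

lemma weights_single: "n \<le> k \<Longrightarrow> weights n {k} (\<lambda>_. 1)"
  by (auto simp: weights_def)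

lemma convex_comb_single: "convex_comb W {k} (\<lambda>_. 1) = W k"
  by (simp add: convex_comb_def fun_eq_iff)

lemma weights_midpoint:
  assumes 1: "weights n S c" and 2: "weights n S' c'"
  shows "\<exists>S'' c''. weights n S'' c'' \<and>
    (\<forall>W x. convex_comb W S'' c'' x = (1/2) *\<^sub>R (convex_comb W S c x + convex_comb W S' c' x))"
proof (intro exI conjI allI)
  let ?e = "\<lambda>S c k. if k \<in> S then c k else (0 :: real)"
  let ?c = "\<lambda>k. (1/2) * (?e S c k + ?e S' c' k)"
  have f: "finite S" "finite S'" using 1 2 by (auto simp: weights_def)
  have r: "(\<Sum>k\<in>S \<union> S'. ?e S c k *\<^sub>R w k) = (\<Sum>k\<in>S. c k *\<^sub>R w k)"
    "(\<Sum>k\<in>S \<union> S'. ?e S' c' k *\<^sub>R w k) = (\<Sum>k\<in>S'. c' k *\<^sub>R w k)" for w :: "nat \<Rightarrow> 'z::real_vector"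
    using f by (auto intro!: sum.mono_neutral_cong_right)
  show "weights n (S \<union> S') ?c"
    using 1 2 r[of "\<lambda>_. 1 :: real"] unfolding weights_def
    by (auto simp: sum.distrib distrib_left simp flip: sum_divide_distrib)
  fix W :: "nat \<Rightarrow> 'a \<Rightarrow> 'b" and x
  show "convex_comb W (S \<union> S') ?c x = (1/2) *\<^sub>R (convex_comb W S c x + convex_comb W S' c' x)"
    unfolding convex_comb_def r[of "\<lambda>k. W k x", symmetric]
    by (simp add: scaleR_sum_right sum.distrib[symmetric] scaleR_add_left scaleR_add_right add_divide_distrib)
qed

lemma convex_comb_bound:
  fixes W :: "nat \<Rightarrow> 'a \<Rightarrow> 'b::real_normed_vector"
  assumes w: "weights n S c" and b: "\<And>k. n \<le> k \<Longrightarrow> norm (W k x - a) \<le> C"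
  shows "norm (convex_comb W S c x - a) \<le> C"
proof -
  have "convex_comb W S c x - a = (\<Sum>k\<in>S. c k *\<^sub>R (W k x - a))"
    using w by (simp add: convex_comb_def weights_def scaleR_diff_right sum_subtractf flip: scaleR_sum_left)
  then have "norm (convex_comb W S c x - a) \<le> (\<Sum>k\<in>S. norm (c k *\<^sub>R (W k x - a)))" by (simp only: norm_sum)
  also have "\<dots> \<le> (\<Sum>k\<in>S. c k * C)"
    using w b by (intro sum_mono) (auto simp: weights_def intro!: mult_left_mono)
  also have "\<dots> = C" using w by (simp add: weights_def flip: sum_distrib_right)
  finally show ?thesis .
qed

text \<open>
  Elements of almost minimal norm in the convex hulls of the tails form a Cauchy sequence, by the
  parallelogram law. This replaces weak compactness together with Mazur's lemma.
\<close>

lemma convex_combinations_converge: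
  fixes W :: "nat \<Rightarrow> 'a \<Rightarrow> 'e::euclidean_space"
  assumes fin: "finite_measure M" and m: "\<And>k. W k \<in> borel_measurable M"
    and b: "\<And>k x. norm (W k x) \<le> C"
  shows "\<exists>S c Wl. (\<forall>n. weights n (S n) (c n)) \<and> Wl \<in> borel_measurable M \<and>
    (AE x in M. (\<lambda>n. convex_comb W (S n) (c n) x) \<longlonglongrightarrow> Wl x) \<and>
    (\<forall>r. (\<exists>\<^sub>F k in sequentially. (LINT x|M. (norm (W k x))\<^sup>2) \<le> r) \<longrightarrow> (LINT x|M. (norm (Wl x))\<^sup>2) \<le> r)"
proof -
  interpret finite_measure M by (rule fin)
  define \<mu> where "\<mu> = measure M (space M)"
  have C: "0 \<le> C" using b norm_ge_zero order_trans by blast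
  define Q where "Q g = (LINT x|M. (norm (g x))\<^sup>2)" for g :: "'a \<Rightarrow> 'e"
  have Q0: "0 \<le> Q g" for g by (simp add: Q_def)
  define A where "A n = {Q (convex_comb W S c) | S c. weights n S c}" for n
  have cm [measurable]: "convex_comb W S c \<in> borel_measurable M" for S c
    unfolding convex_comb_def using m by measurable
  have cb: "norm (convex_comb W S c x) \<le> C" if "weights n S c" for n S c x
    using convex_comb_bound[OF that, of W x 0 C] b by simp
  have sq: "integrable M (\<lambda>x. (norm (g x))\<^sup>2)" if "g \<in> borel_measurable M" "\<And>x. norm (g x) \<le> K" for g :: "'a \<Rightarrow> 'e" and K
    by (rule integrable_const_bound[where B="K\<^sup>2"]) (use that in \<open>auto intro!: power_mono\<close>)
  have Qle: "Q (convex_comb W S c) \<le> C\<^sup>2 * \<mu>" if "weights n S c" for n S c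
  proof -
    have "Q (convex_comb W S c) \<le> (LINT x|M. C\<^sup>2)"
      unfolding Q_def using cb[OF that] sq[OF cm cb[OF that]] by (intro integral_mono) (auto intro!: power_mono)
    then show ?thesis by (simp add: \<mu>_def mult.commute)
  qed
  have Ane: "A n \<noteq> {}" for n using weights_single[of n n] by (auto simp: A_def)
  have Abdd: "bdd_below (A n)" for n using Q0 by (intro bdd_belowI[of _ 0]) (auto simp: A_def)
  define d where "d n = Inf (A n)" for n
  have dle: "d n \<le> Q (convex_comb W S c)" if "weights n S c" for n S c
    unfolding d_def by (rule cInf_lower[OF _ Abdd]) (use that in \<open>auto simp: A_def\<close>)
  have "d n \<le> d m" if "n \<le> m" for n m
  proof -
    have "A m \<subseteq> A n" unfolding A_def using weights_mono[OF _ that] by blast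
    then show ?thesis unfolding d_def by (rule cInf_superset_mono[OF Ane Abdd])
  qed
  then have "incseq d" by (simp add: incseq_def)
  moreover have "d n \<le> C\<^sup>2 * \<mu>" for n
    using dle[OF weights_single[of n n]] Qle[OF weights_single[of n n]] by auto
  ultimately obtain dl where dl: "d \<longlonglongrightarrow> dl" "\<And>n. d n \<le> dl"
    using incseq_convergent[of d "C\<^sup>2 * \<mu>"] by auto
  have "\<exists>S c. weights n S c \<and> Q (convex_comb W S c) \<le> d n + 1 / real (Suc n)" for n
  proof -
    have "Inf (A n) < d n + 1 / real (Suc n)" by (simp add: d_def)
    then obtain q where "q \<in> A n" "q < d n + 1 / real (Suc n)" using cInf_lessD[OF Ane] by blast
    then show ?thesis unfolding A_def mem_Collect_eq using less_imp_le by blast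
  qed
  then obtain S c where w: "\<And>n. weights n (S n) (c n)" and near: "\<And>n. Q (convex_comb W (S n) (c n)) \<le> d n + 1 / real (Suc n)"
    by metis
  define g where "g n = convex_comb W (S n) (c n)" for n
  have gm [measurable]: "g n \<in> borel_measurable M" for n by (simp add: g_def cm)
  have gb: "norm (g n x) \<le> C" for n x unfolding g_def by (rule cb[OF w])
  have diffb: "norm (g n x - g k x) \<le> 2 * C" for n k x
    using norm_triangle_ineq4[of "g n x" "g k x"] gb[of n x] gb[of k x] by linarith
  define \<epsilon> where "\<epsilon> n = 2 * (dl - d n) + 4 * (1 / real (Suc n))" for n
  have cauchy: "Q (\<lambda>x. g n x - g k x) \<le> \<epsilon> n" if nk: "n \<le> k" for n k
  proof -
    obtain S'' c'' where w'': "weights n S'' c''"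
      and mid: "\<And>x. convex_comb W S'' c'' x = (1/2) *\<^sub>R (g n x + g k x)"
    proof -
      from weights_midpoint[OF w[of n] weights_mono[OF w[of k] nk], where 'a='a and 'b='e]
      obtain S'' c'' where 1: "weights n S'' c''"
        and 2: "\<forall>(W :: nat \<Rightarrow> 'a \<Rightarrow> 'e) x. convex_comb W S'' c'' x =
          (1/2) *\<^sub>R (convex_comb W (S n) (c n) x + convex_comb W (S k) (c k) x)"
        by (elim exE conjE) (rule that)
      show thesis by (rule that[OF 1]) (simp add: 2 g_def)
    qed
    have par: "(norm (g n x - g k x))\<^sup>2 = 2 * (norm (g n x))\<^sup>2 + 2 * (norm (g k x))\<^sup>2 - 4 * (norm (convex_comb W S'' c'' x))\<^sup>2" for x
      unfolding mid power2_norm_eq_inner by (simp add: inner_diff_left inner_diff_right inner_add_left inner_add_right inner_commute, simp add: field_simps)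
    have "Q (\<lambda>x. g n x - g k x) = 2 * Q (g n) + 2 * Q (g k) - 4 * Q (convex_comb W S'' c'')"
      unfolding Q_def par using sq[OF gm gb, of n] sq[OF gm gb, of k] sq[OF cm cb[OF w'']] by simp
    also have "\<dots> \<le> 2 * (d n + 1 / real (Suc n)) + 2 * (d k + 1 / real (Suc k)) - 4 * d n"
      unfolding g_def by (intro diff_mono add_mono mult_left_mono near dle[OF w'']) simp_all
    also have "\<dots> \<le> \<epsilon> n"
    proof -
      have "1 / real (Suc k) \<le> 1 / real (Suc n)" using nk by (intro divide_left_mono) auto
      then have "2 * (1 / real (Suc k)) \<le> 2 * (1 / real (Suc n))" by (intro mult_left_mono) auto
      moreover have "2 * d k \<le> 2 * dl" using dl(2)[of k] by simp
      ultimately show ?thesis unfolding \<epsilon>_def distrib_left right_diff_distrib by linarith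
    qed
    finally show ?thesis .
  qed
  have "\<epsilon> \<longlonglongrightarrow> 2 * (dl - dl) + 4 * 0"
    unfolding \<epsilon>_def by (intro tendsto_intros dl LIMSEQ_Suc[OF lim_1_over_n])
  then have \<epsilon>: "\<epsilon> \<longlonglongrightarrow> 0" by simp
  have "\<exists>m>n. \<epsilon> m < (1/4) ^ j" for n j
  proof -
    have "eventually (\<lambda>m. \<epsilon> m < (1/4) ^ j) sequentially" by (rule order_tendstoD(2)[OF \<epsilon>]) simp
    from eventually_happens[OF eventually_conj[OF eventually_gt_at_top[of n] this]] show ?thesis by auto
  qed
  then obtain nxt where nxt: "\<And>n j. n < nxt n j" "\<And>n j. \<epsilon> (nxt n j) < (1/4) ^ j" by metis
  define \<phi> where "\<phi> = rec_nat (nxt 0 0) (\<lambda>j n. nxt n (Suc j))"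
  have \<phi>: "\<phi> (Suc j) = nxt (\<phi> j) (Suc j)" "\<phi> 0 = nxt 0 0" for j by (simp_all add: \<phi>_def)
  have mono: "strict_mono \<phi>" unfolding strict_mono_Suc_iff using nxt(1) by (simp add: \<phi>)
  have \<epsilon>\<phi>: "\<epsilon> (\<phi> j) \<le> (1/4) ^ j" for j
  proof (cases j)
    case 0
    then show ?thesis using less_imp_le[OF nxt(2)[of 0 0]] by (simp only: \<phi>)
  next
    case (Suc i)
    then show ?thesis using less_imp_le[OF nxt(2)[of "\<phi> i" "Suc i"]] by (simp only: \<phi>)
  qed
  define \<Delta> where "\<Delta> j x = g (\<phi> (Suc j)) x - g (\<phi> j) x" for j x
  have \<Delta>i: "integrable M (\<lambda>x. norm (\<Delta> j x))" for j
    by (rule integrable_const_bound[where B="2 * C"]) (use diffb in \<open>auto simp: \<Delta>_def\<close>)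
  have \<Delta>sq: "integrable M (\<lambda>x. (norm (\<Delta> j x))\<^sup>2)" for j
    by (rule sq[where K="2 * C"]) (use diffb in \<open>auto simp: \<Delta>_def\<close>)
  have "(LINT x|M. norm (\<Delta> j x)) \<le> (1 + \<mu>) * (1/2) ^ j" for j
  proof -
    have "(LINT x|M. norm (\<Delta> j x)) \<le> (LINT x|M. 2 ^ j * (norm (\<Delta> j x))\<^sup>2 + (1/2) ^ j)"
    proof (rule integral_mono[OF \<Delta>i])
      show "integrable M (\<lambda>x. 2 ^ j * (norm (\<Delta> j x))\<^sup>2 + (1/2) ^ j)" using \<Delta>sq by simp
      fix x
      let ?t = "norm (\<Delta> j x)"
      have "a \<le> a\<^sup>2 + 1" if "0 \<le> a" for a :: real
        using sum_squares_bound[of a 1] that by simp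
      then have le: "2 ^ j * ?t \<le> (2 ^ j * ?t)\<^sup>2 + 1" by simp
      have "(2 :: real) ^ j * (1/2) ^ j = 1" by (simp flip: power_mult_distrib)
      then have "2 ^ j * (2 ^ j * ?t\<^sup>2 + (1/2) ^ j) = (2 ^ j * ?t)\<^sup>2 + 1"
        by (simp only: distrib_left) (simp add: power2_eq_square mult_ac)
      then have "2 ^ j * ?t \<le> 2 ^ j * (2 ^ j * ?t\<^sup>2 + (1/2) ^ j)" using le by simp
      then show "?t \<le> 2 ^ j * ?t\<^sup>2 + (1/2) ^ j" by (simp only: mult_le_cancel_left_pos zero_less_power zero_less_numeral)
    qed
    also have "\<dots> = 2 ^ j * Q (\<lambda>x. \<Delta> j x) + (1/2) ^ j * \<mu>"
      using \<Delta>sq[of j] by (simp add: Q_def \<mu>_def mult.commute)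
    also have "\<dots> \<le> 2 ^ j * (1/4) ^ j + (1/2) ^ j * \<mu>"
    proof -
      have "Q (\<lambda>x. \<Delta> j x) = Q (\<lambda>x. g (\<phi> j) x - g (\<phi> (Suc j)) x)" by (simp add: Q_def \<Delta>_def norm_minus_commute)
      also have "\<dots> \<le> \<epsilon> (\<phi> j)" using mono by (intro cauchy) (simp add: strict_mono_less_eq)
      also have "\<dots> \<le> (1/4) ^ j" by (rule \<epsilon>\<phi>)
      finally show ?thesis by (intro add_right_mono mult_left_mono) auto
    qed
    also have "\<dots> = (1 + \<mu>) * (1/2) ^ j" by (simp add: distrib_right mult.commute flip: power_mult_distrib)
    finally show ?thesis .
  qed
  then have "AE x in M. summable (\<lambda>j. norm (\<Delta> j x))" by (intro AE_summable[OF \<Delta>i]) auto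
  then have conv: "AE x in M. convergent (\<lambda>j. g (\<phi> j) x)"
  proof (rule eventually_mono)
    fix x assume "summable (\<lambda>j. norm (\<Delta> j x))"
    then have "summable (\<lambda>j. \<Delta> j x)" by (rule summable_norm_cancel)
    then have "convergent (\<lambda>n. (\<Sum>j<n. \<Delta> j x) + g (\<phi> 0) x)"
      by (intro convergent_add) (auto simp: summable_iff_convergent convergent_const)
    moreover have "(\<Sum>j<n. \<Delta> j x) + g (\<phi> 0) x = g (\<phi> n) x" for n
      unfolding \<Delta>_def by (subst sum_lessThan_telescope) simp
    ultimately show "convergent (\<lambda>j. g (\<phi> j) x)" by simp
  qed
  define Wl where "Wl x = lim (\<lambda>j. g (\<phi> j) x)" for x
  have Wlm [measurable]: "Wl \<in> borel_measurable M"
    unfolding Wl_def by (rule borel_measurable_lim_metric) measurable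
  have lim: "AE x in M. (\<lambda>j. g (\<phi> j) x) \<longlonglongrightarrow> Wl x"
    using conv by (rule eventually_mono) (simp add: Wl_def convergent_LIMSEQ_iff)
  have Qlim: "(\<lambda>j. Q (g (\<phi> j))) \<longlonglongrightarrow> Q Wl"
    unfolding Q_def
  proof (rule integral_dominated_convergence[where w="\<lambda>_. C\<^sup>2"])
    show "AE x in M. (\<lambda>j. (norm (g (\<phi> j) x))\<^sup>2) \<longlonglongrightarrow> (norm (Wl x))\<^sup>2"
      using lim by (rule eventually_mono) (intro tendsto_intros)
    show "AE x in M. norm ((norm (g (\<phi> j) x))\<^sup>2) \<le> C\<^sup>2" for j
      using gb by (auto intro!: AE_I2 power_mono)
  qed auto
  have "Q Wl \<le> r" if fr: "\<exists>\<^sub>F k in sequentially. Q (W k) \<le> r" for r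
  proof -
    have dr: "d n \<le> r" for n
    proof -
      obtain k where "n \<le> k" "Q (W k) \<le> r"
        using frequently_eventually_frequently[OF fr eventually_ge_at_top[of n]] frequently_ex by blast
      then show ?thesis using dle[OF weights_single[of n k]] by (simp add: convex_comb_single)
    qed
    have "Q (g (\<phi> j)) \<le> r + 1 / real (Suc (\<phi> j))" for j
      using near[of "\<phi> j"] dr[of "\<phi> j"] unfolding g_def by linarith
    moreover have "(\<lambda>j. r + 1 / real (Suc (\<phi> j))) \<longlonglongrightarrow> r + 0"
      by (intro tendsto_intros LIMSEQ_subseq_LIMSEQ[OF LIMSEQ_Suc[OF lim_1_over_n] mono, unfolded comp_def])
    ultimately show ?thesis using LIMSEQ_le[OF Qlim] by fastforce
  qed
  moreover have "weights n (S (\<phi> n)) (c (\<phi> n))" for n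
    by (rule weights_mono[OF w]) (rule strict_mono_imp_increasing[OF mono])
  ultimately show ?thesis
    using Wlm lim unfolding Q_def g_def
    by (intro exI[of _ "\<lambda>n. S (\<phi> n)"] exI[of _ "\<lambda>n. c (\<phi> n)"] exI[of _ Wl]) auto
qed

section \<open>Controls\<close>

lemma rank_less: "k < l \<Longrightarrow> rank k < rank (l :: 'n::{finite,linorder})"
  unfolding rank_def
proof (intro psubset_card_mono)
  assume "k < l"
  then have "{x. x \<le> k} \<subseteq> {x. x \<le> l}" "l \<in> {x. x \<le> l}" "l \<notin> {x. x \<le> k}" by auto
  then show "{x. x \<le> k} \<subset> {x. x \<le> l}" by blast
qed simp

lemma rank_inj: "inj (rank :: 'n::{finite,linorder} \<Rightarrow> nat)"
  by (intro injI) (metis rank_less linorder_neqE less_irrefl)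

lemma rank_bij: "bij_betw (rank :: 'n::{finite,linorder} \<Rightarrow> nat) UNIV {1..CARD('n)}"
  unfolding bij_betw_def
proof
  have "rank k \<in> {1..CARD('n)}" for k :: 'n
  proof -
    have "0 < card {l. l \<le> k}" by (subst card_gt_0_iff) auto
    moreover have "card {l. l \<le> k} \<le> CARD('n)" by (rule card_mono) auto
    ultimately show ?thesis by (simp add: rank_def)
  qed
  then show "range (rank :: 'n \<Rightarrow> nat) = {1..CARD('n)}"
    using card_image[OF rank_inj[where 'n='n]] by (intro card_subset_eq) auto
qed (rule rank_inj)

lemma entry_rank [simp]: "entry x (rank k) = x $ k"
proof -
  have "{l. rank l = rank k} = {k}" using rank_inj by (auto simp: inj_def)
  then show ?thesis by (simp add: entry_def)
qed

lemma sum_rank: "(\<Sum>j\<in>{1..CARD('n)}. g j) = (\<Sum>k\<in>(UNIV :: 'n::{finite,linorder} set). g (rank k))"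
  by (rule sum.reindex_bij_betw[OF rank_bij, symmetric])

lemma ball_rank: "(\<forall>j\<in>{1..CARD('n)}. P j) \<longleftrightarrow> (\<forall>k :: 'n::{finite,linorder}. P (rank k))"
  using rank_bij[where 'n='n] unfolding bij_betw_def by (metis (no_types, lifting) image_iff rangeI)

lemma Qx_open: "open (Qx T Rx)" and Qx_convex: "convex (Qx T Rx)" and Qx_bounded: "bounded (Qx T Rx)"
  unfolding Qx_def by (auto intro!: open_Times convex_Times bounded_Times convex_box simp: bounded_box)

lemma Qx_borel [measurable]: "Qx T Rx \<in> sets borel"
  using Qx_open by (rule borel_open)

lemma Qx_finite: "emeasure lborel (Qx T Rx) < \<infinity>"
  using emeasure_bounded_finite[OF Qx_bounded] by simp

lemma Qx_positive:
  assumes "0 < T" "0 < Rx"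
  shows "0 < measure lborel (Qx T Rx :: (real \<times> 'x::finite rvec) set)"
proof -
  have "(T / 2, 0) \<in> (Qx T Rx :: (real \<times> 'x rvec) set)" using assms by (simp add: Qx_def)
  then have "\<not> negligible (Qx T Rx :: (real \<times> 'x rvec) set)" using open_not_negligible[OF Qx_open] by blast
  then have "Qx T Rx \<notin> null_sets (lborel :: (real \<times> 'x rvec) measure)"
    using negligible_iff_null_sets null_sets_completion_iff[of "Qx T Rx :: (real \<times> 'x rvec) set" lborel] by auto
  then have "emeasure lborel (Qx T Rx :: (real \<times> 'x rvec) set) \<noteq> 0" by (auto simp: null_sets_def)
  then show ?thesis using Qx_finite[of T Rx, where 'a='x]
    by (simp add: measure_def enn2real_positive_iff zero_less_iff_neq_zero)
qed

lemma borel_measurable_lebesgue_on: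
  "f \<in> borel_measurable borel \<Longrightarrow> f \<in> borel_measurable (lebesgue_on U)"
  by (intro measurable_restrict_space1 measurable_completion) simp

lemma bwg_cong_AE:
  assumes U: "open U" and w: "bwg U g G" and m: "g' \<in> borel_measurable borel" "G' \<in> borel_measurable borel"
    and ae: "AE x in lborel. x \<in> U \<longrightarrow> g x = g' x" "AE x in lborel. x \<in> U \<longrightarrow> G x = G' x"
  shows "bwg U g' G'"
proof -
  note l = borel_measurable_lebesgue_on[OF bwgD(1)[OF w]] borel_measurable_lebesgue_on[OF bwgD(2)[OF w]]
  have "has_weak_grad U g G"
    using has_weak_grad_iff_bwg[OF U l bwgD(1,2)[OF w]] w by simp
  then show ?thesis using has_weak_grad_iff_bwg[OF U l m ae] by simp
qed

definition regular_version ::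
  "real \<Rightarrow> real \<Rightarrow> real \<Rightarrow> ('x::{finite,linorder}, 'b::{finite,linorder}) control \<Rightarrow>
   ('x, 'b) control \<Rightarrow> ('b \<Rightarrow> real \<times> 'x rvec \<Rightarrow> real \<times> 'x rvec) \<Rightarrow> bool" where
  "regular_version T Rx M B h G \<longleftrightarrow>
     (\<forall>p q. norm (h p - h q) \<le> real CARD('b) * M * norm (p - q)) \<and>
     (\<forall>k. bwg (Qx T Rx) (\<lambda>q. h q $ k) (G k) \<and> (\<forall>q. norm (G k q) \<le> M) \<and> (\<forall>q. q \<notin> Qx T Rx \<longrightarrow> G k q = 0)) \<and>
     (AE q in lborel. q \<in> Qx T Rx \<longrightarrow> B q = h q \<and> (\<forall>k. wgrad (Qx T Rx) (\<lambda>p. entry (B p) (rank k)) q = G k q))"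

lemma control_deriv_rank:
  "control_deriv T Rx 0 B (rank k) q = fst (wgrad (Qx T Rx) (\<lambda>p. entry (B p) (rank k)) q)"
  "control_deriv T Rx (rank l) B (rank k) q = snd (wgrad (Qx T Rx) (\<lambda>p. entry (B p) (rank k)) q) $ l"
proof -
  have "rank l \<noteq> 0" using rank_bij[where 'n='a] unfolding bij_betw_def by force
  then show "control_deriv T Rx (rank l) B (rank k) q = snd (wgrad (Qx T Rx) (\<lambda>p. entry (B p) (rank k)) q) $ l"
    by (simp add: control_deriv_def del: entry_rank) (simp add: entry_rank)
qed (simp add: control_deriv_def)

lemma rank_in: "rank (k :: 'n::{finite,linorder}) \<in> {1..CARD('n)}" "rank k \<in> {0..CARD('n)}"
  using rank_bij[where 'n='n] unfolding bij_betw_def by force+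

lemma admissible_constraints:
  fixes B :: "('x::{finite,linorder}, 'b::{finite,linorder}) control"
  assumes "B \<in> admissible T Rx a b"
  shows "AE q in lborel. q \<in> Qx T Rx \<longrightarrow> (\<forall>i\<in>{0..CARD('x)}. \<forall>j\<in>{1..CARD('b)}.
     a i j q \<le> control_deriv T Rx i B j q \<and> control_deriv T Rx i B j q \<le> b i j q)"
proof -
  have "AE q in lborel. \<forall>i\<in>{0..CARD('x)}. \<forall>j\<in>{1..CARD('b)}.
      q \<in> Qx T Rx \<longrightarrow> a i j q \<le> control_deriv T Rx i B j q \<and> control_deriv T Rx i B j q \<le> b i j q"
  proof (intro AE_ball_countable' countable_finite)
    fix i j assume "i \<in> {0..CARD('x)}" "j \<in> {1..CARD('b)}"
    then have "AE q in lebesgue_on (Qx T Rx). a i j q \<le> control_deriv T Rx i B j q \<and> control_deriv T Rx i B j q \<le> b i j q"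
      using assms unfolding admissible_def by blast
    then show "AE q in lborel. q \<in> Qx T Rx \<longrightarrow> a i j q \<le> control_deriv T Rx i B j q \<and> control_deriv T Rx i B j q \<le> b i j q"
      unfolding AE_lebesgue_on_iff[OF Qx_open] .
  qed auto
  then show ?thesis by (rule eventually_mono) blast
qed

lemma bound_constant:
  fixes a b :: "nat \<Rightarrow> nat \<Rightarrow> real \<times> ('x::{finite,linorder}) rvec \<Rightarrow> real"
  assumes "\<And>i j. i \<in> {0..CARD('x)} \<Longrightarrow> j \<in> {1..N} \<Longrightarrow> in_Linf (Qx T Rx) (a i j) \<and> in_Linf (Qx T Rx) (b i j)"
  shows "\<exists>C\<ge>0. AE q in lborel. q \<in> Qx T Rx \<longrightarrow> (\<forall>i\<in>{0..CARD('x)}. \<forall>j\<in>{1..N}. \<bar>a i j q\<bar> \<le> C \<and> \<bar>b i j q\<bar> \<le> C)"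
proof -
  have "\<exists>C\<ge>0. AE q in lborel. q \<in> Qx T Rx \<longrightarrow> \<bar>a i j q\<bar> \<le> C \<and> \<bar>b i j q\<bar> \<le> C"
    if ij: "i \<in> {0..CARD('x)}" "j \<in> {1..N}" for i j
  proof -
    obtain Ca Cb where C: "AE q in lborel. q \<in> Qx T Rx \<longrightarrow> norm (a i j q) \<le> Ca"
      "AE q in lborel. q \<in> Qx T Rx \<longrightarrow> norm (b i j q) \<le> Cb"
      using assms[OF ij] unfolding in_Linf_def AE_lebesgue_on_iff[OF Qx_open] by blast
    have "AE q in lborel. q \<in> Qx T Rx \<longrightarrow> \<bar>a i j q\<bar> \<le> max 0 (max Ca Cb) \<and> \<bar>b i j q\<bar> \<le> max 0 (max Ca Cb)"
      using C by eventually_elim auto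
    then show ?thesis by (intro exI[of _ "max 0 (max Ca Cb)"]) auto
  qed
  note ex = this
  define C where "C i j = (SOME C. 0 \<le> C \<and> (AE q in lborel. q \<in> Qx T Rx \<longrightarrow> \<bar>a i j q\<bar> \<le> C \<and> \<bar>b i j q\<bar> \<le> C))" for i j
  have C: "0 \<le> C i j" "AE q in lborel. q \<in> Qx T Rx \<longrightarrow> \<bar>a i j q\<bar> \<le> C i j \<and> \<bar>b i j q\<bar> \<le> C i j"
    if "i \<in> {0..CARD('x)}" "j \<in> {1..N}" for i j
    using someI_ex[OF ex[OF that]] unfolding C_def by blast+
  define K where "K = (\<Sum>i\<in>{0..CARD('x)}. \<Sum>j\<in>{1..N}. C i j)"
  have le: "C i j \<le> K" if "i \<in> {0..CARD('x)}" "j \<in> {1..N}" for i j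
  proof -
    have "C i j \<le> (\<Sum>j\<in>{1..N}. C i j)" using that C(1) by (intro member_le_sum) auto
    also have "\<dots> \<le> K" unfolding K_def
      using that C(1) by (intro member_le_sum[of i _ "\<lambda>i. \<Sum>j\<in>{1..N}. C i j"] sum_nonneg) auto
    finally show ?thesis .
  qed
  have "AE q in lborel. \<forall>i\<in>{0..CARD('x)}. \<forall>j\<in>{1..N}. q \<in> Qx T Rx \<longrightarrow> \<bar>a i j q\<bar> \<le> C i j \<and> \<bar>b i j q\<bar> \<le> C i j"
    by (intro AE_ball_countable' countable_finite) (use C(2) in auto)
  then have "AE q in lborel. q \<in> Qx T Rx \<longrightarrow> (\<forall>i\<in>{0..CARD('x)}. \<forall>j\<in>{1..N}. \<bar>a i j q\<bar> \<le> K \<and> \<bar>b i j q\<bar> \<le> K)"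
    by (rule eventually_mono) (blast intro: order_trans[OF _ le])
  moreover have "0 \<le> K" unfolding K_def using C(1) by (intro sum_nonneg) auto
  ultimately show ?thesis by blast
qed

lemma measurable_vec_lambda:
  fixes g :: "'b::finite \<Rightarrow> 'a \<Rightarrow> 'c::euclidean_space"
  assumes "\<And>k. g k \<in> borel_measurable M"
  shows "(\<lambda>q. \<chi> k. g k q) \<in> borel_measurable M"
proof (rule borel_measurable_euclidean_space[THEN iffD2], rule ballI)
  fix c :: "'c ^ 'b" assume "c \<in> Basis"
  then obtain k d where "c = axis k d" by (auto simp: Basis_vec_def)
  then have "(\<lambda>q. (\<chi> k. g k q) \<bullet> c) = (\<lambda>q. g k q \<bullet> d)" by (simp add: inner_axis)
  then show "(\<lambda>q. (\<chi> k. g k q) \<bullet> c) \<in> borel_measurable M" using assms by simp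
qed

lemma admissible_regular:
  fixes B :: "('x::{finite,linorder}, 'b::{finite,linorder}) control"
  assumes C: "0 \<le> C" "AE q in lborel. q \<in> Qx T Rx \<longrightarrow> (\<forall>i\<in>{0..CARD('x)}. \<forall>j\<in>{1..CARD('b)}. \<bar>a i j q\<bar> \<le> C \<and> \<bar>b i j q\<bar> \<le> C)"
    and B: "B \<in> admissible T Rx a b" and TR: "0 < T" "0 < Rx"
  shows "\<exists>h G. regular_version T Rx ((1 + real CARD('x)) * C) B h G"
proof -
  let ?Q = "Qx T Rx :: (real \<times> 'x rvec) set"
  let ?w = "\<lambda>k :: 'b. wgrad ?Q (\<lambda>p. entry (B p) (rank k))"
  define M where "M = (1 + real CARD('x)) * C"
  have M: "0 \<le> M" using C by (simp add: M_def)
  define X where "X k g G \<longleftrightarrow> bwg ?Q g G \<and> (AE q in lborel. q \<in> ?Q \<longrightarrow> entry (B q) (rank k) = g q) \<and>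
    (AE q in lborel. q \<in> ?Q \<longrightarrow> ?w k q = G q)" for k g G
  have "\<exists>g G. X k g G" for k
  proof -
    have "in_H1 ?Q (\<lambda>p. entry (B p) (rank k))"
      using B rank_in(1)[of k] unfolding admissible_def control_space_def by blast
    then have "has_weak_grad ?Q (\<lambda>p. entry (B p) (rank k)) (?w k)"
      using has_weak_grad_wgrad unfolding in_H1_def by blast
    then obtain g G where "bwg ?Q g G" "AE q in lborel. q \<in> ?Q \<longrightarrow> entry (B q) (rank k) = g q"
      "AE q in lborel. q \<in> ?Q \<longrightarrow> ?w k q = G q"
      by (rule has_weak_grad_borel_version[OF Qx_open])
    then show ?thesis unfolding X_def by blast
  qed
  then have "\<forall>k. \<exists>g G. X k g G" by blast
  from choice[OF this] obtain g where "\<forall>k. \<exists>G. X k (g k) G" by blast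
  from choice[OF this] obtain G where "\<forall>k. X k (g k) (G k)" by blast
  then have gG: "bwg ?Q (g k) (G k)" "AE q in lborel. q \<in> ?Q \<longrightarrow> entry (B q) (rank k) = g k q"
    "AE q in lborel. q \<in> ?Q \<longrightarrow> ?w k q = G k q" for k
    unfolding X_def by blast+
  have wb: "AE q in lborel. q \<in> ?Q \<longrightarrow> (\<forall>k. norm (?w k q) \<le> M)"
    using C(2) admissible_constraints[OF B]
  proof eventually_elim
    case (elim q)
    show ?case
    proof (intro impI allI)
      fix k :: 'b assume q: "q \<in> ?Q"
      have dle: "\<bar>control_deriv T Rx i B (rank k) q\<bar> \<le> C" if "i \<in> {0..CARD('x)}" for i
      proof -
        have "\<bar>a i (rank k) q\<bar> \<le> C" "\<bar>b i (rank k) q\<bar> \<le> C"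
          "a i (rank k) q \<le> control_deriv T Rx i B (rank k) q" "control_deriv T Rx i B (rank k) q \<le> b i (rank k) q"
          using elim q that rank_in(1)[of k] by blast+
        then show ?thesis by linarith
      qed
      have "norm (snd (?w k q)) \<le> (\<Sum>l\<in>UNIV. \<bar>snd (?w k q) $ l\<bar>)" by (rule norm_le_l1_cart)
      also have "\<dots> \<le> (\<Sum>l\<in>(UNIV :: 'x set). C)"
        using dle[OF rank_in(2)] unfolding control_deriv_rank by (intro sum_mono)
      finally have "norm (snd (?w k q)) \<le> real CARD('x) * C" by simp
      moreover have "norm (fst (?w k q)) \<le> C" using dle[of 0] unfolding control_deriv_rank by simp
      moreover have "norm (?w k q) \<le> norm (fst (?w k q)) + norm (snd (?w k q))"
        using norm_Pair_le[of "fst (?w k q)" "snd (?w k q)"] by simp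
      ultimately show "norm (?w k q) \<le> M" by (simp add: M_def distrib_right)
    qed
  qed
  have Gb: "AE q in lborel. q \<in> ?Q \<longrightarrow> norm (G k q) \<le> M" for k
    using wb gG(3)[of k]
  proof eventually_elim
    case (elim q)
    show ?case
    proof
      assume "q \<in> ?Q"
      then have w: "norm (?w k q) \<le> M" and "?w k q = G k q" using elim by blast+
      from this(2)[symmetric] show "norm (G k q) \<le> M" by (rule ssubst) (rule w)
    qed
  qed
  define G' where "G' k q = (if q \<in> ?Q \<and> norm (G k q) \<le> M then G k q else 0)" for k q
  have [measurable]: "G k \<in> borel_measurable borel" for k by (rule bwgD(2)[OF gG(1)])
  have G'm: "G' k \<in> borel_measurable borel" for k unfolding G'_def by measurable
  have GG': "AE q in lborel. q \<in> ?Q \<longrightarrow> G k q = G' k q" for k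
    using Gb[of k] by (rule eventually_mono) (auto simp: G'_def)
  have "\<forall>k. \<exists>N. N \<in> null_sets lborel \<and> (\<forall>x\<in>?Q - N. \<forall>y\<in>?Q - N. \<bar>g k x - g k y\<bar> \<le> M * norm (x - y))"
    using bwg_Lipschitz[OF gG(1) Qx_open Qx_convex Gb M] by blast
  from choice[OF this] obtain N where N': "\<forall>k. N k \<in> null_sets lborel \<and> (\<forall>x\<in>?Q - N k. \<forall>y\<in>?Q - N k. \<bar>g k x - g k y\<bar> \<le> M * norm (x - y))"
    by blast
  then have N: "N k \<in> null_sets lborel"
    "x \<in> ?Q - N k \<Longrightarrow> y \<in> ?Q - N k \<Longrightarrow> \<bar>g k x - g k y\<bar> \<le> M * norm (x - y)" for k x y by blast+
  have ne: "?Q - N k \<noteq> {}" for k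
  proof
    assume "?Q - N k = {}"
    then have "?Q \<subseteq> N k" by auto
    then have "?Q \<in> null_sets lborel" by (intro null_sets_subset[OF N(1)]) auto
    then show False using Qx_positive[OF TR, where 'x='x] by (auto simp: null_sets_def measure_def)
  qed
  have "\<forall>k. \<exists>h. (\<forall>x\<in>?Q - N k. h x = g k x) \<and> (\<forall>x y. \<bar>h x - h y\<bar> \<le> M * norm (x - y))"
    by (intro allI McShane_extension[OF ne M N(2)])
  from choice[OF this] obtain h0 where "\<forall>k. (\<forall>x\<in>?Q - N k. h0 k x = g k x) \<and> (\<forall>x y. \<bar>h0 k x - h0 k y\<bar> \<le> M * norm (x - y))"
    by blast
  then have h0: "x \<in> ?Q - N k \<Longrightarrow> h0 k x = g k x" "\<bar>h0 k x - h0 k y\<bar> \<le> M * norm (x - y)" for k x y by blast+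
  define h where "h x = (\<chi> k. h0 k x)" for x
  have h0g: "AE q in lborel. q \<in> ?Q \<longrightarrow> g k q = h0 k q" for k
    using AE_not_in[OF N(1)[of k]] by (rule eventually_mono) (use h0(1) in auto)
  have "norm (h p - h q) \<le> real CARD('b) * M * norm (p - q)" for p q
  proof -
    have "norm (h p - h q) \<le> (\<Sum>k\<in>UNIV. \<bar>(h p - h q) $ k\<bar>)" by (rule norm_le_l1_cart)
    also have "\<dots> \<le> (\<Sum>k\<in>(UNIV :: 'b set). M * norm (p - q))" by (intro sum_mono) (simp add: h_def h0(2))
    finally show ?thesis by simp
  qed
  moreover have "bwg ?Q (\<lambda>q. h q $ k) (G' k)" for k
  proof -
    have "continuous_on UNIV (h0 k)"
      by (rule lipschitz_on_continuous_on[of M]) (use M h0(2) in \<open>auto simp: lipschitz_on_def dist_norm\<close>)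
    then have "h0 k \<in> borel_measurable borel" by (rule borel_measurable_continuous_onI)
    from bwg_cong_AE[OF Qx_open gG(1) this G'm h0g GG'] show ?thesis by (simp add: h_def)
  qed
  moreover have "norm (G' k q) \<le> M" "q \<notin> ?Q \<longrightarrow> G' k q = 0" for k q
    using M by (auto simp: G'_def)
  moreover have "AE q in lborel. q \<in> ?Q \<longrightarrow> B q = h q \<and> (\<forall>k. ?w k q = G' k q)"
  proof -
    have "AE q in lborel. \<forall>k\<in>UNIV. q \<in> ?Q \<longrightarrow> B q $ k = h0 k q \<and> ?w k q = G' k q"
    proof (rule AE_ball_countable')
      fix k
      show "AE q in lborel. q \<in> ?Q \<longrightarrow> B q $ k = h0 k q \<and> ?w k q = G' k q"
        using gG(2)[of k] gG(3)[of k] h0g[of k] GG'[of k] by eventually_elim auto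
    qed (simp add: countable_finite)
    then show ?thesis by (rule eventually_mono) (auto simp: h_def vec_eq_iff)
  qed
  ultimately show ?thesis unfolding regular_version_def M_def[symmetric] by blast
qed

definition Wvec ::
  "real \<Rightarrow> real \<Rightarrow> (real \<times> 'x rvec) set \<Rightarrow> ('x::{finite,linorder}, 'b::{finite,linorder}) control \<Rightarrow>
   ('b \<Rightarrow> real \<times> 'x rvec \<Rightarrow> real \<times> 'x rvec) \<Rightarrow> real \<times> 'x rvec \<Rightarrow> 'b rvec \<times> (real \<times> 'x rvec, 'b) vec" where
  "Wvec \<kappa>t \<kappa>x Q h G q = indicator Q q *\<^sub>R (h q, \<chi> k. (sqrt \<kappa>t * fst (G k q), sqrt \<kappa>x *\<^sub>R snd (G k q)))"

lemma norm_Wvec: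
  fixes G :: "'b::{finite,linorder} \<Rightarrow> real \<times> 'x::{finite,linorder} rvec \<Rightarrow> real \<times> 'x rvec"
  assumes "0 < \<kappa>t" "0 < \<kappa>x"
  shows "(norm (Wvec \<kappa>t \<kappa>x Q h G q))\<^sup>2 = indicator Q q *
    (h q \<bullet> h q + \<kappa>t * (\<Sum>k\<in>UNIV. (fst (G k q))\<^sup>2) + \<kappa>x * (\<Sum>k\<in>UNIV. snd (G k q) \<bullet> snd (G k q)))"
proof -
  have t: "(sqrt \<kappa>t * c) \<bullet> (sqrt \<kappa>t * c) = \<kappa>t * c\<^sup>2" for c
  proof -
    have "(sqrt \<kappa>t * c) \<bullet> (sqrt \<kappa>t * c) = (sqrt \<kappa>t * c)\<^sup>2" unfolding inner_real_def power2_eq_square ..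
    then show ?thesis using assms unfolding power_mult_distrib by (simp only: real_sqrt_pow2 less_imp_le)
  qed
  have x: "(sqrt \<kappa>x *\<^sub>R y) \<bullet> (sqrt \<kappa>x *\<^sub>R y) = \<kappa>x * (y \<bullet> y)" for y :: "'x rvec"
  proof -
    have "(sqrt \<kappa>x *\<^sub>R y) \<bullet> (sqrt \<kappa>x *\<^sub>R y) = (sqrt \<kappa>x)\<^sup>2 * (y \<bullet> y)"
      unfolding inner_scaleR_left inner_scaleR_right power2_eq_square mult.assoc ..
    then show ?thesis using assms by (simp only: real_sqrt_pow2 less_imp_le)
  qed
  show ?thesis
  proof (cases "q \<in> Q")
    case True
    have "(norm (Wvec \<kappa>t \<kappa>x Q h G q))\<^sup>2 = h q \<bullet> h q +
        (\<Sum>k\<in>UNIV. (sqrt \<kappa>t * fst (G k q)) \<bullet> (sqrt \<kappa>t * fst (G k q)) + (sqrt \<kappa>x *\<^sub>R snd (G k q)) \<bullet> (sqrt \<kappa>x *\<^sub>R snd (G k q)))"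
      using True unfolding power2_norm_eq_inner Wvec_def by (simp only: indicator_simps scaleR_one inner_Pair inner_vec_def vec_lambda_beta)
    then show ?thesis unfolding t x sum.distrib sum_distrib_left[symmetric] using True by simp
  qed (simp add: Wvec_def)
qed

lemma regular_version_measurable:
  fixes h :: "('x::{finite,linorder}, 'b::{finite,linorder}) control"
  assumes "regular_version T Rx M B h G"
  shows "h \<in> borel_measurable borel" "G k \<in> borel_measurable borel" "continuous_on S h"
proof -
  have c: "continuous_on UNIV h"
  proof (rule lipschitz_on_continuous_on)
    show "(max 0 (real CARD('b) * M))-lipschitz_on UNIV h"
    proof (rule lipschitz_onI)
      fix p q
      have "norm (h p - h q) \<le> real CARD('b) * M * norm (p - q)"
        using assms unfolding regular_version_def by blast
      also have "\<dots> \<le> max 0 (real CARD('b) * M) * norm (p - q)" by (intro mult_right_mono) auto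
      finally show "dist (h p) (h q) \<le> max 0 (real CARD('b) * M) * dist p q" by (simp add: dist_norm)
    qed simp
  qed
  then show "h \<in> borel_measurable borel" by (rule borel_measurable_continuous_onI)
  show "continuous_on S h" by (rule continuous_on_subset[OF c]) simp
  show "G k \<in> borel_measurable borel" using assms bwgD(2) unfolding regular_version_def by blast
qed

lemma Wvec_measurable:
  fixes h :: "('x::{finite,linorder}, 'b::{finite,linorder}) control"
  assumes [measurable]: "h \<in> borel_measurable borel" "\<And>k. G k \<in> borel_measurable borel"
  shows "Wvec \<kappa>t \<kappa>x (Qx T Rx) h G \<in> borel_measurable borel"
proof -
  have c: "(fst :: real \<times> 'x rvec \<Rightarrow> real) \<in> borel_measurable borel" "(snd :: real \<times> 'x rvec \<Rightarrow> 'x rvec) \<in> borel_measurable borel"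
    by (intro borel_measurable_continuous_onI continuous_intros)+
  have [measurable]: "(\<lambda>q. fst (G k q)) \<in> borel_measurable borel" "(\<lambda>q. snd (G k q)) \<in> borel_measurable borel" for k
    using measurable_compose[OF assms(2) c(1)] measurable_compose[OF assms(2) c(2)] by auto
  have [measurable]: "(\<lambda>q. \<chi> k. (sqrt \<kappa>t * fst (G k q), sqrt \<kappa>x *\<^sub>R snd (G k q))) \<in> borel_measurable borel"
    by (rule measurable_vec_lambda) (simp add: borel_measurable_Pair)
  show ?thesis unfolding Wvec_def[abs_def] by (intro borel_measurable_scaleR borel_measurable_indicator borel_measurable_Pair) auto
qed

lemma control_norm_eq:
  fixes B :: "('x::{finite,linorder}, 'b::{finite,linorder}) control"
  assumes r: "regular_version T Rx M B h G" and \<kappa>: "0 < \<kappa>t" "0 < \<kappa>x" and B: "B \<in> control_space T Rx"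
  shows "(control_norm T Rx \<kappa>t \<kappa>x B)\<^sup>2 = (LINT q|lborel. (norm (Wvec \<kappa>t \<kappa>x (Qx T Rx) h G q))\<^sup>2)"
    and "integrable lborel (\<lambda>q. (norm (Wvec \<kappa>t \<kappa>x (Qx T Rx) h G q))\<^sup>2)"
proof -
  let ?Q = "Qx T Rx :: (real \<times> 'x rvec) set"
  let ?w = "\<lambda>k :: 'b. wgrad ?Q (\<lambda>p. entry (B p) (rank k))"
  note [measurable] = regular_version_measurable(1,2)[OF r]
  have ae: "AE q in lborel. q \<in> ?Q \<longrightarrow> B q = h q \<and> (\<forall>k. ?w k q = G k q)"
    and Gb: "\<And>k q. norm (G k q) \<le> M"
    using r unfolding regular_version_def by blast+
  have H: "in_H1 ?Q (\<lambda>p. entry (B p) (rank k))" for k :: 'b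
    using B rank_in(1)[of k] unfolding control_space_def by blast
  have wm: "?w k \<in> borel_measurable (lebesgue_on ?Q)" for k
    using H[of k] has_weak_grad_wgrad loc_integrable_measurable[OF _ Qx_open] unfolding in_H1_def has_weak_grad_def by blast
  have Bm: "(\<lambda>p. B p $ k) \<in> borel_measurable (lebesgue_on ?Q)" for k
    using H[of k] by (simp add: in_H1_def in_L2_def)
  have c: "(fst :: real \<times> 'x rvec \<Rightarrow> real) \<in> borel_measurable borel" "(\<lambda>y :: real \<times> 'x rvec. snd y $ l) \<in> borel_measurable borel" for l
    by (intro borel_measurable_continuous_onI continuous_intros)+
  have wm': "(\<lambda>q. fst (?w k q)) \<in> borel_measurable (lebesgue_on ?Q)" "(\<lambda>q. snd (?w k q) $ l) \<in> borel_measurable (lebesgue_on ?Q)" for k l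
    by (rule measurable_compose[OF wm c(1)], rule measurable_compose[OF wm c(2)])
  have Gm' [measurable]: "(\<lambda>q. fst (G k q)) \<in> borel_measurable borel" "(\<lambda>q. snd (G k q) $ l) \<in> borel_measurable borel" for k l
    using measurable_compose[OF regular_version_measurable(2)[OF r] c(1)] measurable_compose[OF regular_version_measurable(2)[OF r] c(2)] by auto
  define A1 where "A1 q = indicator ?Q q * (h q \<bullet> h q)" for q
  define A2 where "A2 q = indicator ?Q q * (\<Sum>k\<in>UNIV. (fst (G k q))\<^sup>2)" for q
  define A3 where "A3 q = indicator ?Q q * (\<Sum>k\<in>UNIV. snd (G k q) \<bullet> snd (G k q))" for q
  have [measurable]: "A1 \<in> borel_measurable borel" unfolding A1_def by measurable
  have [measurable]: "A2 \<in> borel_measurable borel"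
    unfolding A2_def by (intro borel_measurable_times borel_measurable_indicator borel_measurable_sum borel_measurable_power Gm') simp
  have [measurable]: "A3 \<in> borel_measurable borel"
    unfolding A3_def inner_vec_def inner_real_def
    by (intro borel_measurable_times borel_measurable_indicator borel_measurable_sum Gm') simp
  have "(LINT p|lebesgue_on ?Q. B p \<bullet> B p) = (LINT q|lborel. A1 q)"
  proof (rule lebesgue_on_integral_eq(1)[OF Qx_open])
    show "(\<lambda>p. B p \<bullet> B p) \<in> borel_measurable (lebesgue_on ?Q)"
      unfolding inner_vec_def using Bm by simp
    show "AE q in lborel. q \<in> ?Q \<longrightarrow> B q \<bullet> B q = A1 q" using ae by (rule eventually_mono) (simp add: A1_def)
    show "A1 \<in> borel_measurable borel" by measurable
  qed (simp add: A1_def)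
  moreover have "(LINT p|lebesgue_on ?Q. (\<Sum>j\<in>{1..CARD('b)}. control_deriv T Rx 0 B j p * control_deriv T Rx 0 B j p)) = (LINT q|lborel. A2 q)"
    unfolding sum_rank control_deriv_rank
  proof (rule lebesgue_on_integral_eq(1)[OF Qx_open])
    show "(\<lambda>p. \<Sum>k\<in>UNIV. fst (?w k p) * fst (?w k p)) \<in> borel_measurable (lebesgue_on ?Q)"
      using wm' by simp
    show "AE q in lborel. q \<in> ?Q \<longrightarrow> (\<Sum>k\<in>UNIV. fst (?w k q) * fst (?w k q)) = A2 q"
      using ae by (rule eventually_mono) (simp add: A2_def power2_eq_square)
    show "A2 \<in> borel_measurable borel" by measurable
  qed (simp add: A2_def)
  moreover have "(LINT p|lebesgue_on ?Q. (\<Sum>i\<in>{1..CARD('x)}. \<Sum>j\<in>{1..CARD('b)}. control_deriv T Rx i B j p * control_deriv T Rx i B j p)) = (LINT q|lborel. A3 q)"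
    unfolding sum_rank control_deriv_rank
  proof (rule lebesgue_on_integral_eq(1)[OF Qx_open])
    show "(\<lambda>p. \<Sum>l\<in>UNIV. \<Sum>k\<in>UNIV. snd (?w k p) $ l * snd (?w k p) $ l) \<in> borel_measurable (lebesgue_on ?Q)"
      using wm' by simp
    show "AE q in lborel. q \<in> ?Q \<longrightarrow> (\<Sum>l\<in>UNIV. \<Sum>k\<in>UNIV. snd (?w k q) $ l * snd (?w k q) $ l) = A3 q"
      using ae
    proof (rule eventually_mono, intro impI)
      fix q assume "q \<in> ?Q \<longrightarrow> B q = h q \<and> (\<forall>k. ?w k q = G k q)" "q \<in> ?Q"
      then show "(\<Sum>l\<in>UNIV. \<Sum>k\<in>UNIV. snd (?w k q) $ l * snd (?w k q) $ l) = A3 q"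
        by (simp add: A3_def inner_vec_def) (rule sum.swap)
    qed
    show "A3 \<in> borel_measurable borel" by measurable
  qed (simp add: A3_def)
  ultimately have inner: "control_inner T Rx \<kappa>t \<kappa>x B B = (LINT q|lborel. A1 q) + \<kappa>t * (LINT q|lborel. A2 q) + \<kappa>x * (LINT q|lborel. A3 q)"
    by (simp add: control_inner_def)
  have nn: "0 \<le> A1 q" "0 \<le> A2 q" "0 \<le> A3 q" for q by (simp_all add: A1_def A2_def A3_def sum_nonneg)
  have "compact (closure ?Q)" using Qx_bounded by (simp add: compact_closure)
  then have "bounded (h ` closure ?Q)"
    by (intro compact_imp_bounded compact_continuous_image regular_version_measurable(3)[OF r])
  then obtain K where "\<And>q. q \<in> closure ?Q \<Longrightarrow> norm (h q) \<le> K" unfolding bounded_iff by blast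
  then have K: "norm (h q) \<le> K" if "q \<in> ?Q" for q using that closure_subset[of ?Q] by blast
  have A1i: "integrable lborel A1"
  proof (rule integrable_bounded_support[OF _ _ Qx_bounded[of T Rx]])
    show "norm (A1 q) \<le> K\<^sup>2" for q
      using K[of q] by (auto simp: A1_def power2_norm_eq_inner[symmetric] split: split_indicator intro!: power_mono)
    show "A1 \<in> borel_measurable borel" by measurable
  qed (simp add: A1_def)
  have A2i: "integrable lborel A2"
  proof (rule integrable_bounded_support[OF _ _ Qx_bounded[of T Rx]])
    have "(fst (G k q))\<^sup>2 \<le> M\<^sup>2" for k q
      using norm_fst_le[of "fst (G k q)" "snd (G k q)"] Gb[of k q] by (simp add: abs_le_square_iff[symmetric])
    then have "(\<Sum>k\<in>(UNIV :: 'b set). (fst (G k q))\<^sup>2) \<le> (\<Sum>k\<in>(UNIV :: 'b set). M\<^sup>2)" for q by (intro sum_mono)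
    then show "norm (A2 q) \<le> (\<Sum>k\<in>(UNIV :: 'b set). M\<^sup>2)" for q by (auto simp: A2_def sum_nonneg split: split_indicator)
    show "A2 \<in> borel_measurable borel" by measurable
  qed (simp add: A2_def)
  have A3i: "integrable lborel A3"
  proof (rule integrable_bounded_support[OF _ _ Qx_bounded[of T Rx]])
    have "snd (G k q) \<bullet> snd (G k q) \<le> M\<^sup>2" for k q
      using norm_snd_le[of "snd (G k q)" "fst (G k q)"] Gb[of k q]
      by (simp add: power2_norm_eq_inner[symmetric] power_mono)
    then have "(\<Sum>k\<in>(UNIV :: 'b set). snd (G k q) \<bullet> snd (G k q)) \<le> (\<Sum>k\<in>(UNIV :: 'b set). M\<^sup>2)" for q by (intro sum_mono)
    then show "norm (A3 q) \<le> (\<Sum>k\<in>(UNIV :: 'b set). M\<^sup>2)" for q by (auto simp: A3_def sum_nonneg split: split_indicator)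
    show "A3 \<in> borel_measurable borel" by measurable
  qed (simp add: A3_def)
  have W: "(norm (Wvec \<kappa>t \<kappa>x ?Q h G q))\<^sup>2 = A1 q + \<kappa>t * A2 q + \<kappa>x * A3 q" for q
    unfolding norm_Wvec[OF \<kappa>] A1_def A2_def A3_def by (simp add: algebra_simps)
  show "integrable lborel (\<lambda>q. (norm (Wvec \<kappa>t \<kappa>x ?Q h G q))\<^sup>2)" unfolding W using A1i A2i A3i by simp
  have "(control_norm T Rx \<kappa>t \<kappa>x B)\<^sup>2 = control_inner T Rx \<kappa>t \<kappa>x B B"
    unfolding control_norm_def inner using \<kappa> nn by (intro real_sqrt_pow2 add_nonneg_nonneg mult_nonneg_nonneg integral_nonneg_AE) auto
  also have "\<dots> = (LINT q|lborel. A1 q + \<kappa>t * A2 q + \<kappa>x * A3 q)"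
    unfolding inner using A1i A2i A3i by simp
  finally show "(control_norm T Rx \<kappa>t \<kappa>x B)\<^sup>2 = (LINT q|lborel. (norm (Wvec \<kappa>t \<kappa>x ?Q h G q))\<^sup>2)"
    unfolding W .
qed

lemma bwg_zero_fun: "bwg U (\<lambda>_. 0) (\<lambda>_. 0)"
  by (auto simp: bwg_def set_integrable_def)

lemma bwg_scale:
  assumes g: "bwg U g G"
  shows "bwg U (\<lambda>x. c * g x) (\<lambda>x. c *\<^sub>R G x)"
  unfolding bwg_def
proof (intro conjI allI impI ballI)
  note [measurable] = bwgD(1,2)[OF g]
  show "(\<lambda>x. c * g x) \<in> borel_measurable borel" "(\<lambda>x. c *\<^sub>R G x) \<in> borel_measurable borel" by simp_all
  fix K assume "compact K \<and> K \<subseteq> U"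
  then have "set_integrable lborel K g" "set_integrable lborel K G" using bwgD(3,4)[OF g] by auto
  then have a: "integrable lborel (\<lambda>x. indicator K x *\<^sub>R g x)" "integrable lborel (\<lambda>x. indicator K x *\<^sub>R G x)"
    unfolding set_integrable_def .
  have i: "integrable lborel (\<lambda>x. c *\<^sub>R (indicator K x *\<^sub>R g x))" "integrable lborel (\<lambda>x. c *\<^sub>R (indicator K x *\<^sub>R G x))"
    by (rule integrable_scaleR_right, rule a)+
  show "set_integrable lborel K (\<lambda>x. c * g x)" using i(1) unfolding set_integrable_def real_scaleR_def mult.left_commute[of c] .
  show "set_integrable lborel K (\<lambda>x. c *\<^sub>R G x)" using i(2) unfolding set_integrable_def scaleR_left_commute[of c] .
next
  fix \<phi> :: "'a \<Rightarrow> real" and b :: 'a assume t: "test_fun U \<phi>" and b: "b \<in> Basis"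
  have "(LINT x|lborel. c * g x * frechet_derivative \<phi> (at x) b) = c * (LINT x|lborel. g x * frechet_derivative \<phi> (at x) b)"
    by (simp add: mult.assoc)
  also have "\<dots> = - (c * (LINT x|lborel. (G x \<bullet> b) * \<phi> x))"
    using bwg_direction[OF g t, of b] by simp
  also have "\<dots> = - (LINT x|lborel. ((c *\<^sub>R G x) \<bullet> b) * \<phi> x)" by (simp add: mult.assoc)
  finally show "(LINT x|lborel. c * g x * frechet_derivative \<phi> (at x) b) = - (LINT x|lborel. ((c *\<^sub>R G x) \<bullet> b) * \<phi> x)" .
qed

lemma bwg_sum:
  assumes "finite S" "\<And>j. j \<in> S \<Longrightarrow> bwg U (g j) (G j)"
  shows "bwg U (\<lambda>x. \<Sum>j\<in>S. c j * g j x) (\<lambda>x. \<Sum>j\<in>S. c j *\<^sub>R G j x)"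
  using assms
proof (induction S)
  case empty
  then show ?case by (simp add: bwg_zero_fun)
next
  case (insert j S)
  have "bwg U (\<lambda>x. (\<Sum>j\<in>S. c j * g j x) - (- c j) * g j x) (\<lambda>x. (\<Sum>j\<in>S. c j *\<^sub>R G j x) - (- c j) *\<^sub>R G j x)"
    by (intro bwg_diff bwg_scale insert) auto
  then show ?case using insert.hyps by (simp add: add.commute)
qed

definition grad_component :: "nat \<Rightarrow> real \<times> 'x::{finite,linorder} rvec \<Rightarrow> real" where
  "grad_component i y = (if i = 0 then fst y else entry (snd y) i)"

lemma control_deriv_eq: "control_deriv T Rx i B j p = grad_component i (wgrad (Qx T Rx) (\<lambda>q. entry (B q) j) p)"
  by (simp add: control_deriv_def grad_component_def)

lemma grad_component_sum: "grad_component i (\<Sum>j\<in>S. c j *\<^sub>R G j) = (\<Sum>j\<in>S. c j * grad_component i (G j))"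
proof -
  have "entry (snd (\<Sum>j\<in>S. c j *\<^sub>R G j)) i = (\<Sum>j\<in>S. c j * entry (snd (G j)) i)"
    unfolding entry_def by (simp add: snd_sum sum_distrib_left) (rule sum.swap)
  then show ?thesis by (simp add: grad_component_def fst_sum)
qed

lemma grad_component_tendsto:
  assumes "G \<longlonglongrightarrow> y" shows "(\<lambda>n. grad_component i (G n)) \<longlonglongrightarrow> grad_component i y"
  unfolding grad_component_def entry_def by (cases "i = 0") (auto intro!: tendsto_intros assms)

lemma in_L2_bounded:
  fixes f :: "real \<times> 'x::finite rvec \<Rightarrow> 'c::euclidean_space"
  assumes m: "f \<in> borel_measurable borel" and b: "\<And>q. norm (f q) \<le> K"
  shows "in_L2 (Qx T Rx) f"
  unfolding in_L2_def
proof
  show ml: "f \<in> borel_measurable (lebesgue_on (Qx T Rx))" by (rule borel_measurable_lebesgue_on[OF m])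
  let ?f = "\<lambda>q. indicator (Qx T Rx) q * (norm (f q))\<^sup>2"
  note [measurable] = m
  have fm: "?f \<in> borel_measurable borel" by measurable
  have nm: "(\<lambda>q. (norm (f q))\<^sup>2) \<in> borel_measurable (lebesgue_on (Qx T Rx))" using ml by simp
  have "integrable lborel ?f"
  proof (rule integrable_bounded_support[OF fm _ Qx_bounded[of T Rx]])
    have "(norm (f q))\<^sup>2 \<le> K\<^sup>2" for q using b[of q] by (intro power_mono) auto
    then show "norm (?f q) \<le> K\<^sup>2" for q by (auto split: split_indicator)
  qed simp
  then show "integrable (lebesgue_on (Qx T Rx)) (\<lambda>q. (norm (f q))\<^sup>2)"
    by (subst lebesgue_on_integral_eq(2)[OF Qx_open nm fm]) auto
qed

text \<open>Gives the pointwise boundedness required by the theorem of Arzela and Ascoli.\<close>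

lemma regular_sup_bound:
  fixes B :: "('x::{finite,linorder}, 'b::{finite,linorder}) control"
  assumes r: "regular_version T Rx M B h G" and \<kappa>: "0 < \<kappa>t" "0 < \<kappa>x" and B: "B \<in> control_space T Rx"
    and R: "(control_norm T Rx \<kappa>t \<kappa>x B)\<^sup>2 \<le> R" and TR: "0 < T" "0 < Rx" and M: "0 \<le> M"
    and q: "q \<in> Qx T Rx"
  shows "norm (h q) \<le> sqrt ((R + 1) / measure lborel (Qx T Rx :: (real \<times> 'x rvec) set)) +
    real CARD('b) * M * diameter (Qx T Rx :: (real \<times> 'x rvec) set)"
proof -
  let ?Q = "Qx T Rx :: (real \<times> 'x rvec) set"
  define \<mu> where "\<mu> = measure lborel ?Q"
  have \<mu>: "0 < \<mu>" unfolding \<mu>_def by (rule Qx_positive[OF TR])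
  have "\<exists>q0\<in>?Q. (norm (h q0))\<^sup>2 \<le> (R + 1) / \<mu>"
  proof (rule ccontr)
    assume "\<not> ?thesis"
    then have gt: "(R + 1) / \<mu> \<le> (norm (h q0))\<^sup>2" if "q0 \<in> ?Q" for q0 using that by force
    have "R + 1 = (LINT q|lborel. indicator ?Q q * ((R + 1) / \<mu>))"
      using \<mu> by (simp add: \<mu>_def)
    also have "\<dots> \<le> (LINT q|lborel. (norm (Wvec \<kappa>t \<kappa>x ?Q h G q))\<^sup>2)"
    proof (rule integral_mono)
      show "integrable lborel (\<lambda>q. indicator ?Q q * ((R + 1) / \<mu>))"
        by (rule integrable_bounded_support[OF _ _ Qx_bounded[of T Rx], of _ "\<bar>(R + 1) / \<mu>\<bar>"]) (auto split: split_indicator)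
      show "integrable lborel (\<lambda>q. (norm (Wvec \<kappa>t \<kappa>x ?Q h G q))\<^sup>2)" by (rule control_norm_eq(2)[OF r \<kappa> B])
      fix q
      have "0 \<le> \<kappa>t * (\<Sum>k\<in>UNIV. (fst (G k q))\<^sup>2)" "0 \<le> \<kappa>x * (\<Sum>k\<in>UNIV. snd (G k q) \<bullet> snd (G k q))"
        using \<kappa> by (auto intro!: mult_nonneg_nonneg sum_nonneg)
      moreover have "q \<in> ?Q \<Longrightarrow> (R + 1) / \<mu> \<le> h q \<bullet> h q" using gt[of q] by (simp add: power2_norm_eq_inner)
      ultimately show "indicator ?Q q * ((R + 1) / \<mu>) \<le> (norm (Wvec \<kappa>t \<kappa>x ?Q h G q))\<^sup>2"
        unfolding norm_Wvec[OF \<kappa>] by (auto split: split_indicator)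
    qed
    also have "\<dots> \<le> R" using R control_norm_eq(1)[OF r \<kappa> B] by simp
    finally show False by simp
  qed
  then obtain q0 where q0: "q0 \<in> ?Q" "(norm (h q0))\<^sup>2 \<le> (R + 1) / \<mu>" by blast
  have "norm (h q) \<le> norm (h q0) + norm (h q - h q0)" using norm_triangle_sub[of "h q" "h q0"] by simp
  also have "norm (h q0) \<le> sqrt ((R + 1) / \<mu>)" by (rule real_le_rsqrt[OF q0(2)])
  also have "norm (h q - h q0) \<le> real CARD('b) * M * norm (q - q0)"
    using r unfolding regular_version_def by blast
  also have "\<dots> \<le> real CARD('b) * M * diameter ?Q"
    using diameter_bounded_bound[OF Qx_bounded q q0(1)] M by (intro mult_left_mono) (auto simp: dist_norm)
  finally show ?thesis unfolding \<mu>_def by simp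
qed

lemma uniform_subsequence:
  fixes h :: "nat \<Rightarrow> 'a::euclidean_space \<Rightarrow> 'b::euclidean_space"
  assumes S: "compact S" and b: "\<And>n x. x \<in> S \<Longrightarrow> norm (h n x) \<le> K"
    and lip: "\<And>n x y. norm (h n x - h n y) \<le> L * norm (x - y)"
  shows "\<exists>g \<phi>. continuous_on S g \<and> strict_mono (\<phi> :: nat \<Rightarrow> nat) \<and> (\<forall>n. \<forall>x\<in>S. norm (h (\<phi> n) x - g x) \<le> (1/2) ^ n)"
proof -
  obtain g k where g: "continuous_on S g" and k: "strict_mono (k :: nat \<Rightarrow> nat)"
    and unif: "\<And>e. 0 < e \<Longrightarrow> \<exists>N. \<forall>n x. n \<ge> N \<and> x \<in> S \<longrightarrow> norm (h (k n) x - g x) < e"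
  proof (rule Arzela_Ascoli[OF S b])
    fix x and e :: real assume "x \<in> S" "0 < e"
    have "norm (h n x - h n y) < e" if "norm (x - y) < e / (\<bar>L\<bar> + 1)" for n y
    proof -
      have "norm (h n x - h n y) \<le> (\<bar>L\<bar> + 1) * norm (x - y)"
        by (rule order_trans[OF lip]) (intro mult_right_mono, auto)
      also have "\<dots> < (\<bar>L\<bar> + 1) * (e / (\<bar>L\<bar> + 1))" using that by (intro mult_strict_left_mono) auto
      finally show ?thesis by simp
    qed
    then show "\<exists>d. 0 < d \<and> (\<forall>n y. y \<in> S \<and> norm (x - y) < d \<longrightarrow> norm (h n x - h n y) < e)"
      using \<open>0 < e\<close> by (intro exI[of _ "e / (\<bar>L\<bar> + 1)"]) auto
  qed auto
  have "\<forall>j. \<exists>N. \<forall>n x. n \<ge> N \<and> x \<in> S \<longrightarrow> norm (h (k n) x - g x) < (1/2) ^ j"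
    by (intro allI unif) simp
  from choice[OF this] obtain N where N: "\<forall>j. \<forall>n x. n \<ge> N j \<and> x \<in> S \<longrightarrow> norm (h (k n) x - g x) < (1/2) ^ j" by blast
  define \<sigma> where "\<sigma> = rec_nat (N 0) (\<lambda>j m. max (Suc m) (N (Suc j)))"
  have \<sigma>: "\<sigma> 0 = N 0" "\<sigma> (Suc j) = max (Suc (\<sigma> j)) (N (Suc j))" for j by (simp_all add: \<sigma>_def)
  have "strict_mono \<sigma>" by (simp add: strict_mono_Suc_iff \<sigma> less_max_iff_disj)
  moreover have "N j \<le> \<sigma> j" for j by (cases j) (simp_all add: \<sigma>)
  ultimately have "strict_mono (k \<circ> \<sigma>)" "\<forall>n. \<forall>x\<in>S. norm (h ((k \<circ> \<sigma>) n) x - g x) \<le> (1/2) ^ n"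
    using k N by (auto simp: strict_mono_o intro: less_imp_le)
  with g show ?thesis by blast
qed

lemma admissible_limit:
  fixes B :: "nat \<Rightarrow> ('x::{finite,linorder}, 'b::{finite,linorder}) control"
  assumes TR: "0 < T" "0 < Rx" and \<kappa>: "0 < \<kappa>t" "0 < \<kappa>x" and C: "0 \<le> C"
    "AE q in lborel. q \<in> Qx T Rx \<longrightarrow> (\<forall>i\<in>{0..CARD('x)}. \<forall>j\<in>{1..CARD('b)}. \<bar>a i j q\<bar> \<le> C \<and> \<bar>b i j q\<bar> \<le> C)"
    and M: "M = (1 + real CARD('x)) * C"
    and adm: "\<And>n. B n \<in> admissible T Rx a b"
    and reg: "\<And>n. regular_version T Rx M (B n) (h n) (G n)"
    and K: "\<And>n q. q \<in> Qx T Rx \<Longrightarrow> norm (h n q) \<le> K"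
  shows "\<exists>\<phi> Bl. strict_mono (\<phi> :: nat \<Rightarrow> nat) \<and> Bl \<in> admissible T Rx a b \<and>
    (\<forall>n. \<forall>q\<in>Qx T Rx. norm (h (\<phi> n) q - Bl q) \<le> (1/2) ^ n) \<and>
    (\<forall>r. (\<exists>\<^sub>F n in sequentially. (control_norm T Rx \<kappa>t \<kappa>x (B (\<phi> n)))\<^sup>2 \<le> r) \<longrightarrow>
      (control_norm T Rx \<kappa>t \<kappa>x Bl)\<^sup>2 \<le> r)"
proof -
  let ?Q = "Qx T Rx :: (real \<times> 'x rvec) set"
  have M0: "0 \<le> M" using C M by simp
  have clQ: "compact (closure ?Q)" using Qx_bounded by (simp add: compact_closure)
  have Kcl: "norm (h n q) \<le> K" if "q \<in> closure ?Q" for n q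
    using image_closure_subset[OF regular_version_measurable(3)[OF reg, of "closure ?Q" n] closed_cball, of 0 K] K that
    by (auto simp: image_subset_iff)
  have lip: "norm (h n p - h n q) \<le> (real CARD('b) * M) * norm (p - q)" for n p q
    using reg[of n] unfolding regular_version_def by blast
  obtain g \<phi> where gc: "continuous_on (closure ?Q) g" and \<phi>: "strict_mono (\<phi> :: nat \<Rightarrow> nat)"
    and unif: "\<And>n q. q \<in> closure ?Q \<Longrightarrow> norm (h (\<phi> n) q - g q) \<le> (1/2) ^ n"
    using uniform_subsequence[of "closure ?Q" h K "real CARD('b) * M", OF clQ Kcl lip] by blast
  define Bl where "Bl q = indicator ?Q q *\<^sub>R g q" for q
  have Qcl: "?Q \<subseteq> closure ?Q" by (rule closure_subset)
  have near: "norm (h (\<phi> n) q - Bl q) \<le> (1/2) ^ n" if "q \<in> ?Q" for n q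
    using unif[of q n] Qcl that by (auto simp: Bl_def)
  have Blm [measurable]: "Bl \<in> borel_measurable borel"
    unfolding Bl_def by (rule borel_measurable_continuous_on_indicator[OF Qx_borel continuous_on_subset[OF gc Qcl]])
  have hQ: "(\<lambda>n. h (\<phi> n) q) \<longlonglongrightarrow> Bl q" if "q \<in> ?Q" for q
  proof (rule Lim_null_comparison[of "\<lambda>n. h (\<phi> n) q - Bl q" "\<lambda>n. (1/2) ^ n", THEN Lim_null[THEN iffD2]])
    show "(\<lambda>n. (1/2 :: real) ^ n) \<longlonglongrightarrow> 0" by (rule LIMSEQ_realpow_zero) auto
  qed (use near that in auto)
  have Blb: "norm (Bl q) \<le> max K 0" for q
  proof (cases "q \<in> ?Q")
    case True
    have "norm (Bl q) \<le> K"
      using K[OF True] by (intro tendsto_upperbound[OF tendsto_norm[OF hQ[OF True]]]) auto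
    then show ?thesis by simp
  qed (simp add: Bl_def)
  define W where "W n = Wvec \<kappa>t \<kappa>x ?Q (h (\<phi> n)) (G (\<phi> n))" for n
  have Wm: "W n \<in> borel_measurable borel" for n
    unfolding W_def by (intro Wvec_measurable regular_version_measurable[OF reg])
  have Gb: "norm (G n k q) \<le> M" and Gz: "q \<notin> ?Q \<Longrightarrow> G n k q = 0" and Gw: "bwg ?Q (\<lambda>q. h n q $ k) (G n k)" for n k q
    using reg[of n] unfolding regular_version_def by blast+
  have Bae: "AE q in lborel. q \<in> ?Q \<longrightarrow> B n q = h n q \<and> (\<forall>k. wgrad ?Q (\<lambda>p. entry (B n p) (rank k)) q = G n k q)" for n
    using reg[of n] unfolding regular_version_def by blast
  define CW where "CW = K\<^sup>2 + \<kappa>t * (\<Sum>k\<in>(UNIV :: 'b set). M\<^sup>2) + \<kappa>x * (\<Sum>k\<in>(UNIV :: 'b set). M\<^sup>2)"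
  have Wb: "norm (W n q) \<le> sqrt CW" for n q
  proof (rule real_le_rsqrt)
    have CW0: "0 \<le> CW" unfolding CW_def using \<kappa> by (intro add_nonneg_nonneg mult_nonneg_nonneg sum_nonneg) auto
    show "(norm (W n q))\<^sup>2 \<le> CW"
    proof (cases "q \<in> ?Q")
      case True
      have "h (\<phi> n) q \<bullet> h (\<phi> n) q \<le> K\<^sup>2" using K[OF True] by (simp add: power2_norm_eq_inner[symmetric] power_mono)
      moreover have "(fst (G (\<phi> n) k q))\<^sup>2 \<le> M\<^sup>2" for k
        using norm_fst_le[of "fst (G (\<phi> n) k q)" "snd (G (\<phi> n) k q)"] Gb[of "\<phi> n" k q] by (simp add: abs_le_square_iff[symmetric])
      then have "\<kappa>t * (\<Sum>k\<in>(UNIV :: 'b set). (fst (G (\<phi> n) k q))\<^sup>2) \<le> \<kappa>t * (\<Sum>k\<in>(UNIV :: 'b set). M\<^sup>2)"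
        using \<kappa> by (intro mult_left_mono sum_mono) auto
      moreover have "snd (G (\<phi> n) k q) \<bullet> snd (G (\<phi> n) k q) \<le> M\<^sup>2" for k
        using norm_snd_le[of "snd (G (\<phi> n) k q)" "fst (G (\<phi> n) k q)"] Gb[of "\<phi> n" k q]
        by (simp add: power2_norm_eq_inner[symmetric] power_mono)
      then have "\<kappa>x * (\<Sum>k\<in>(UNIV :: 'b set). snd (G (\<phi> n) k q) \<bullet> snd (G (\<phi> n) k q)) \<le> \<kappa>x * (\<Sum>k\<in>(UNIV :: 'b set). M\<^sup>2)"
        using \<kappa> by (intro mult_left_mono sum_mono) auto
      ultimately show ?thesis unfolding W_def norm_Wvec[OF \<kappa>] CW_def using True by simp
    next
      case False
      then show ?thesis using CW0 by (simp add: W_def Wvec_def)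
    qed
  qed
  define Mq where "Mq = restrict_space (lborel :: (real \<times> 'x rvec) measure) ?Q"
  have Mq: "finite_measure Mq"
    using Qx_finite[of T Rx, where 'a='x] by (intro finite_measureI) (simp add: Mq_def emeasure_restrict_space space_restrict_space)
  have Mqi: "(LINT x|Mq. F x) = (LINT x|lborel. indicator ?Q x * F x)" for F :: "real \<times> 'x rvec \<Rightarrow> real"
    unfolding Mq_def by (simp add: integral_restrict_space)
  have "W n \<in> borel_measurable Mq" for n unfolding Mq_def using Wm by (intro measurable_restrict_space1) simp
  from convex_combinations_converge[of Mq W "sqrt CW", OF Mq this Wb] obtain S c Wl where
    w: "\<forall>n. weights n (S n) (c n)" and Wlm: "Wl \<in> borel_measurable Mq"
    and Wlim: "AE q in Mq. (\<lambda>n. convex_comb W (S n) (c n) q) \<longlonglongrightarrow> Wl q"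
    and Wlsc: "\<forall>r. (\<exists>\<^sub>F k in sequentially. (LINT q|Mq. (norm (W k q))\<^sup>2) \<le> r) \<longrightarrow> (LINT q|Mq. (norm (Wl q))\<^sup>2) \<le> r"
    by blast
  have Wlm': "(\<lambda>q. indicator ?Q q *\<^sub>R Wl q) \<in> borel_measurable borel"
    using Wlm unfolding Mq_def by (simp add: borel_measurable_restrict_space_iff)
  define hc where "hc n q = convex_comb (\<lambda>j. h (\<phi> j)) (S n) (c n) q" for n q
  define Gc where "Gc k n q = convex_comb (\<lambda>j. G (\<phi> j) k) (S n) (c n) q" for k n q
  have Wc: "convex_comb W (S n) (c n) q = (hc n q, \<chi> k. (sqrt \<kappa>t * fst (Gc k n q), sqrt \<kappa>x *\<^sub>R snd (Gc k n q)))" if "q \<in> ?Q" for n q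
    unfolding convex_comb_def hc_def Gc_def W_def Wvec_def using that
    by (simp add: prod_eq_iff fst_sum snd_sum vec_eq_iff sum_distrib_left scaleR_sum_right mult_ac)
  define Gl0 where "Gl0 k q = (let y = snd (indicator ?Q q *\<^sub>R Wl q) $ k in (fst y / sqrt \<kappa>t, snd y /\<^sub>R sqrt \<kappa>x))" for k q
  define Gl where "Gl k q = (if norm (Gl0 k q) \<le> M then Gl0 k q else 0)" for k q
  have sq: "sqrt \<kappa>t \<noteq> 0" "sqrt \<kappa>x \<noteq> 0" using \<kappa> by auto
  have Gcb: "norm (Gc k n q) \<le> M" for k n q
    using convex_comb_bound[OF w[rule_format, of n], of "\<lambda>j. G (\<phi> j) k" q 0 M] Gb by (simp add: Gc_def)
  have Glim: "AE q in lborel. q \<in> ?Q \<longrightarrow> fst (Wl q) = Bl q \<and> (\<forall>k. (\<lambda>n. Gc k n q) \<longlonglongrightarrow> Gl k q \<and> snd (Wl q) $ k = (sqrt \<kappa>t * fst (Gl k q), sqrt \<kappa>x *\<^sub>R snd (Gl k q)))"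
  proof -
    have "AE q in lborel. q \<in> ?Q \<longrightarrow> (\<lambda>n. convex_comb W (S n) (c n) q) \<longlonglongrightarrow> Wl q"
      using Wlim unfolding Mq_def by (simp add: AE_restrict_space_iff)
    then show ?thesis
    proof (rule eventually_mono, intro impI)
      fix q assume "q \<in> ?Q \<longrightarrow> (\<lambda>n. convex_comb W (S n) (c n) q) \<longlonglongrightarrow> Wl q" and q: "q \<in> ?Q"
      then have l: "(\<lambda>n. (hc n q, \<chi> k. (sqrt \<kappa>t * fst (Gc k n q), sqrt \<kappa>x *\<^sub>R snd (Gc k n q)))) \<longlonglongrightarrow> Wl q"
        by (simp add: Wc)
      have "(\<lambda>n. hc n q - Bl q) \<longlonglongrightarrow> 0"
      proof (rule Lim_null_comparison[of _ "\<lambda>n. (1/2) ^ n"])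
        have "norm (hc n q - Bl q) \<le> (1/2) ^ n" for n
          unfolding hc_def
        proof (rule convex_comb_bound[OF w[rule_format]])
          fix k assume "n \<le> k"
          then have "(1/2 :: real) ^ k \<le> (1/2) ^ n" by (intro power_decreasing) auto
          from order_trans[OF near[OF q, of k] this] show "norm (h (\<phi> k) q - Bl q) \<le> (1/2) ^ n" .
        qed
        then show "\<forall>\<^sub>F n in sequentially. norm (hc n q - Bl q) \<le> (1/2) ^ n" by simp
        show "(\<lambda>n. (1/2 :: real) ^ n) \<longlonglongrightarrow> 0" by (rule LIMSEQ_realpow_zero) auto
      qed
      then have "(\<lambda>n. hc n q) \<longlonglongrightarrow> Bl q" by (rule Lim_null[THEN iffD2])
      moreover have "(\<lambda>n. hc n q) \<longlonglongrightarrow> fst (Wl q)" using tendsto_fst[OF l] by simp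
      ultimately have e: "fst (Wl q) = Bl q" using LIMSEQ_unique by blast
      have "(\<lambda>n. Gc k n q) \<longlonglongrightarrow> Gl k q \<and> snd (Wl q) $ k = (sqrt \<kappa>t * fst (Gl k q), sqrt \<kappa>x *\<^sub>R snd (Gl k q))" for k
      proof -
        have lk: "(\<lambda>n. (sqrt \<kappa>t * fst (Gc k n q), sqrt \<kappa>x *\<^sub>R snd (Gc k n q))) \<longlonglongrightarrow> snd (Wl q) $ k"
          using tendsto_vec_nth[OF tendsto_snd[OF l], of k] by simp
        have "(\<lambda>n. ((sqrt \<kappa>t * fst (Gc k n q)) / sqrt \<kappa>t, (sqrt \<kappa>x *\<^sub>R snd (Gc k n q)) /\<^sub>R sqrt \<kappa>x)) \<longlonglongrightarrow>
            (fst (snd (Wl q) $ k) / sqrt \<kappa>t, snd (snd (Wl q) $ k) /\<^sub>R sqrt \<kappa>x)"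
          using tendsto_fst[OF lk] tendsto_snd[OF lk] sq by (intro tendsto_intros) auto
        then have g: "(\<lambda>n. Gc k n q) \<longlonglongrightarrow> Gl0 k q"
          using sq q by (simp add: Gl0_def Let_def)
        have "norm (Gl0 k q) \<le> M"
          by (rule tendsto_upperbound[OF tendsto_norm[OF g]]) (auto simp: Gcb)
        then have "Gl k q = Gl0 k q" by (simp add: Gl_def)
        with g show ?thesis using sq q by (simp add: Gl0_def Let_def)
      qed
      with e show "fst (Wl q) = Bl q \<and> (\<forall>k. (\<lambda>n. Gc k n q) \<longlonglongrightarrow> Gl k q \<and> snd (Wl q) $ k = (sqrt \<kappa>t * fst (Gl k q), sqrt \<kappa>x *\<^sub>R snd (Gl k q)))" by blast
    qed
  qed
  have Glm [measurable]: "Gl k \<in> borel_measurable borel" for k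
  proof -
    have c: "(\<lambda>y :: 'b rvec \<times> (real \<times> 'x rvec, 'b) vec. (fst (snd y $ k) / sqrt \<kappa>t, snd (snd y $ k) /\<^sub>R sqrt \<kappa>x)) \<in> borel_measurable borel"
      using sq by (intro borel_measurable_continuous_onI continuous_intros) auto
    have [measurable]: "Gl0 k \<in> borel_measurable borel"
      using measurable_compose[OF Wlm' c] unfolding Gl0_def[abs_def] Let_def .
    show ?thesis unfolding Gl_def[abs_def] by measurable
  qed
  have Glb: "norm (Gl k q) \<le> M" for k q using M0 by (simp add: Gl_def)
  have Blw: "bwg ?Q (\<lambda>q. Bl q $ k) (Gl k)" for k
    unfolding bwg_def
  proof (intro conjI allI impI ballI)
    have cmp: "(\<lambda>y :: 'b rvec. y $ k) \<in> borel_measurable borel"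
      by (intro borel_measurable_continuous_onI continuous_intros)
    show Bkm: "(\<lambda>q. Bl q $ k) \<in> borel_measurable borel" by (rule measurable_compose[OF Blm cmp])
    show "Gl k \<in> borel_measurable borel" by (rule Glm)
    fix K' :: "(real \<times> 'x rvec) set" assume K': "compact K' \<and> K' \<subseteq> ?Q"
    then have [measurable]: "K' \<in> sets borel" and bK: "bounded K'" by (auto simp: borel_compact compact_imp_bounded)
    show "set_integrable lborel K' (\<lambda>q. Bl q $ k)" unfolding set_integrable_def
    proof (rule integrable_bounded_support[OF _ _ bK])
      show "norm (indicator K' q *\<^sub>R (Bl q $ k)) \<le> max K 0" for q
        using component_le_norm_cart[of "Bl q" k] Blb[of q] by (auto split: split_indicator)
    qed (use Bkm in auto)
    show "set_integrable lborel K' (Gl k)" unfolding set_integrable_def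
    proof (rule integrable_bounded_support[OF _ _ bK])
      show "norm (indicator K' q *\<^sub>R Gl k q) \<le> M" for q using Glb[of k q] M0 by (auto split: split_indicator)
    qed auto
  next
    fix \<phi>' :: "real \<times> 'x rvec \<Rightarrow> real" and e :: "real \<times> 'x rvec" assume t: "test_fun ?Q \<phi>'"
    note tb = test_fun_derivative_bound[OF t]
    note [measurable] = test_fun_measurable[OF t]
    have Bkm': "(\<lambda>q. Bl q $ k) \<in> borel_measurable borel"
      by (rule measurable_compose[OF Blm]) (intro borel_measurable_continuous_onI continuous_intros)
    obtain C1 where C1: "\<And>x e. \<bar>frechet_derivative \<phi>' (at x) e\<bar> \<le> C1 * norm e" using tb(3) by blast
    obtain C2 where C2: "\<And>x. \<bar>\<phi>' x\<bar> \<le> C2" using tb(4) by blast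
    have hcw: "bwg ?Q (\<lambda>q. hc n q $ k) (Gc k n)" for n
    proof -
      have "finite (S n)" using w by (auto simp: weights_def)
      from bwg_sum[OF this, of ?Q "\<lambda>j q. h (\<phi> j) q $ k" "\<lambda>j. G (\<phi> j) k" "c n"] Gw
      show ?thesis by (simp add: hc_def Gc_def[abs_def] convex_comb_def)
    qed
    have hcb: "\<bar>hc n q $ k\<bar> \<le> K" if "q \<in> ?Q" for n q
    proof -
      have "norm (hc n q) \<le> K"
        using convex_comb_bound[OF w[rule_format, of n], of "\<lambda>j. h (\<phi> j)" q 0 K] K that by (simp add: hc_def)
      then show ?thesis using component_le_norm_cart[of "hc n q" k] by linarith
    qed
    have Wlim': "AE q in lborel. q \<in> ?Q \<longrightarrow> (\<lambda>n. convex_comb W (S n) (c n) q) \<longlonglongrightarrow> Wl q"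
      using Wlim unfolding Mq_def by (simp add: AE_restrict_space_iff)
    have l1: "(\<lambda>n. LINT q|lborel. (hc n q $ k) * frechet_derivative \<phi>' (at q) e) \<longlonglongrightarrow>
        (LINT q|lborel. (Bl q $ k) * frechet_derivative \<phi>' (at q) e)"
    proof (rule integral_dominated_convergence[where w="\<lambda>q. max K 0 * \<bar>frechet_derivative \<phi>' (at q) e\<bar>"])
      show "integrable lborel (\<lambda>q. max K 0 * \<bar>frechet_derivative \<phi>' (at q) e\<bar>)"
      proof (rule integrable_bounded_support[OF _ _ Qx_bounded[of T Rx]])
        show "norm (max K 0 * \<bar>frechet_derivative \<phi>' (at q) e\<bar>) \<le> max K 0 * (C1 * norm e)" for q
          using C1[of q e] by (simp add: abs_mult mult_left_mono)
      qed (simp_all add: test_fun_outside[OF t])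
      show "AE q in lborel. (\<lambda>n. (hc n q $ k) * frechet_derivative \<phi>' (at q) e) \<longlonglongrightarrow> (Bl q $ k) * frechet_derivative \<phi>' (at q) e"
        using Glim Wlim'
      proof eventually_elim
        case (elim q)
        show ?case
        proof (cases "q \<in> ?Q")
          case True
          then have "(\<lambda>n. fst (convex_comb W (S n) (c n) q)) \<longlonglongrightarrow> fst (Wl q)"
            using elim(2) by (intro tendsto_fst) auto
          then have "(\<lambda>n. hc n q) \<longlonglongrightarrow> Bl q" using elim(1) True by (simp add: Wc)
          then show ?thesis by (intro tendsto_mult tendsto_const tendsto_vec_nth)
        qed (simp add: test_fun_outside[OF t])
      qed
      show "AE q in lborel. norm ((hc n q $ k) * frechet_derivative \<phi>' (at q) e) \<le> max K 0 * \<bar>frechet_derivative \<phi>' (at q) e\<bar>" for n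
      proof (rule AE_I2)
        fix q
        show "norm ((hc n q $ k) * frechet_derivative \<phi>' (at q) e) \<le> max K 0 * \<bar>frechet_derivative \<phi>' (at q) e\<bar>"
        proof (cases "q \<in> ?Q")
          case True
          then show ?thesis using hcb[OF True, of n] unfolding real_norm_def abs_mult by (intro mult_right_mono) auto
        qed (simp add: test_fun_outside[OF t])
      qed
    qed (use bwgD(1)[OF hcw] Bkm' in \<open>simp_all\<close>)
    have l2: "(\<lambda>n. LINT q|lborel. (Gc k n q \<bullet> e) * \<phi>' q) \<longlonglongrightarrow> (LINT q|lborel. (Gl k q \<bullet> e) * \<phi>' q)"
    proof (rule integral_dominated_convergence[where w="\<lambda>q. (M * norm e) * \<bar>\<phi>' q\<bar>"])
      show "integrable lborel (\<lambda>q. (M * norm e) * \<bar>\<phi>' q\<bar>)"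
      proof (rule integrable_bounded_support[OF _ _ Qx_bounded[of T Rx]])
        show "norm ((M * norm e) * \<bar>\<phi>' q\<bar>) \<le> (M * norm e) * C2" for q
          using C2[of q] M0 by (simp add: abs_mult mult_left_mono)
      qed (simp_all add: test_fun_outside[OF t])
      show "AE q in lborel. (\<lambda>n. (Gc k n q \<bullet> e) * \<phi>' q) \<longlonglongrightarrow> (Gl k q \<bullet> e) * \<phi>' q"
        using Glim
      proof (rule eventually_mono)
        fix q assume q: "q \<in> ?Q \<longrightarrow> fst (Wl q) = Bl q \<and> (\<forall>k. (\<lambda>n. Gc k n q) \<longlonglongrightarrow> Gl k q \<and> snd (Wl q) $ k = (sqrt \<kappa>t * fst (Gl k q), sqrt \<kappa>x *\<^sub>R snd (Gl k q)))"
        show "(\<lambda>n. (Gc k n q \<bullet> e) * \<phi>' q) \<longlonglongrightarrow> (Gl k q \<bullet> e) * \<phi>' q"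
        proof (cases "q \<in> ?Q")
          case True
          then have "(\<lambda>n. Gc k n q) \<longlonglongrightarrow> Gl k q" using q by blast
          then show ?thesis by (intro tendsto_mult tendsto_const tendsto_inner)
        qed (simp add: test_fun_outside[OF t])
      qed
      show "AE q in lborel. norm ((Gc k n q \<bullet> e) * \<phi>' q) \<le> (M * norm e) * \<bar>\<phi>' q\<bar>" for n
      proof (rule AE_I2)
        fix q
        have "\<bar>Gc k n q \<bullet> e\<bar> \<le> M * norm e"
          using Cauchy_Schwarz_ineq2[of "Gc k n q" e] mult_right_mono[OF Gcb[of k n q], of "norm e"] by simp
        then show "norm ((Gc k n q \<bullet> e) * \<phi>' q) \<le> (M * norm e) * \<bar>\<phi>' q\<bar>"
          unfolding real_norm_def abs_mult by (rule mult_right_mono) simp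
      qed
    qed (use bwgD(2)[OF hcw] in \<open>simp_all\<close>)
    have "(LINT q|lborel. (hc n q $ k) * frechet_derivative \<phi>' (at q) e) = - (LINT q|lborel. (Gc k n q \<bullet> e) * \<phi>' q)" for n
      by (rule bwg_direction[OF hcw t])
    from LIMSEQ_unique[OF l1[unfolded this] tendsto_minus[OF l2]]
    show "(LINT q|lborel. (Bl q $ k) * frechet_derivative \<phi>' (at q) e) = - (LINT q|lborel. (Gl k q \<bullet> e) * \<phi>' q)" .
  qed
  have hwg: "has_weak_grad ?Q (\<lambda>q. entry (Bl q) (rank k)) (Gl k)" for k :: 'b
  proof -
    have "has_weak_grad ?Q (\<lambda>q. Bl q $ k) (Gl k) \<longleftrightarrow> bwg ?Q (\<lambda>q. Bl q $ k) (Gl k)"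
      by (rule has_weak_grad_iff_bwg[OF Qx_open borel_measurable_lebesgue_on[OF bwgD(1)[OF Blw[of k]]] borel_measurable_lebesgue_on[OF Glm] bwgD(1)[OF Blw[of k]] Glm])
        simp_all
    then show ?thesis using Blw[of k] by simp
  qed
  have "in_H1 ?Q (\<lambda>q. entry (Bl q) (rank k))" for k :: 'b
    unfolding in_H1_def
  proof (intro conjI exI[of _ "Gl k"] hwg)
    show "in_L2 ?Q (\<lambda>q. entry (Bl q) (rank k))"
      by (rule in_L2_bounded[where K="max K 0"])
        (use bwgD(1)[OF Blw[of k]] order_trans[OF component_le_norm_cart Blb] in auto)
    show "in_L2 ?Q (Gl k)" by (rule in_L2_bounded[OF Glm Glb])
  qed
  then have Blcs: "Bl \<in> control_space T Rx"
    unfolding control_space_def mem_Collect_eq ball_rank by blast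
  have wgl: "AE q in lborel. q \<in> ?Q \<longrightarrow> (\<forall>k. wgrad ?Q (\<lambda>p. entry (Bl p) (rank k)) q = Gl k q)"
  proof -
    have "AE q in lborel. \<forall>k\<in>UNIV. q \<in> ?Q \<longrightarrow> wgrad ?Q (\<lambda>p. entry (Bl p) (rank k)) q = Gl k q"
      by (intro AE_ball_countable' has_weak_grad_unique[OF Qx_open has_weak_grad_wgrad[OF hwg] hwg]) (simp add: countable_finite)
    then show ?thesis by (rule eventually_mono) blast
  qed
  have cons: "AE q in lborel. \<forall>n\<in>UNIV. q \<in> ?Q \<longrightarrow> (\<forall>i\<in>{0..CARD('x)}. \<forall>k.
      a i (rank k) q \<le> grad_component i (G n k q) \<and> grad_component i (G n k q) \<le> b i (rank k) q)"
  proof (rule AE_ball_countable')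
    fix n
    show "AE q in lborel. q \<in> ?Q \<longrightarrow> (\<forall>i\<in>{0..CARD('x)}. \<forall>k.
      a i (rank k) q \<le> grad_component i (G n k q) \<and> grad_component i (G n k q) \<le> b i (rank k) q)"
      using admissible_constraints[OF adm[of n]] Bae[of n]
    proof eventually_elim
      case (elim q)
      show ?case
      proof (intro impI ballI allI)
        fix i and k :: 'b assume "q \<in> ?Q" "i \<in> {0..CARD('x)}"
        then have "a i (rank k) q \<le> control_deriv T Rx i (B n) (rank k) q \<and> control_deriv T Rx i (B n) (rank k) q \<le> b i (rank k) q"
          and "wgrad ?Q (\<lambda>p. entry (B n p) (rank k)) q = G n k q"
          using elim rank_in(1)[of k] by blast+
        then show "a i (rank k) q \<le> grad_component i (G n k q) \<and> grad_component i (G n k q) \<le> b i (rank k) q"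
          unfolding control_deriv_eq by simp
      qed
    qed
  qed simp
  have lcons: "AE q in lborel. q \<in> ?Q \<longrightarrow> (\<forall>i\<in>{0..CARD('x)}. \<forall>k :: 'b.
      a i (rank k) q \<le> control_deriv T Rx i Bl (rank k) q \<and> control_deriv T Rx i Bl (rank k) q \<le> b i (rank k) q)"
    using cons wgl Glim
  proof eventually_elim
    case (elim q)
    show ?case
    proof (intro impI ballI allI)
      fix i and k :: 'b assume q: "q \<in> ?Q" and i: "i \<in> {0..CARD('x)}"
      have lim: "(\<lambda>n. grad_component i (Gc k n q)) \<longlonglongrightarrow> grad_component i (Gl k q)"
        by (rule grad_component_tendsto) (use elim(3) q in blast)
      have bounds: "a i (rank k) q \<le> grad_component i (Gc k n q) \<and> grad_component i (Gc k n q) \<le> b i (rank k) q" for n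
      proof -
        have wn: "finite (S n)" "\<And>j. j \<in> S n \<Longrightarrow> 0 \<le> c n j" "sum (c n) (S n) = 1" using w by (auto simp: weights_def)
        have e: "a i (rank k) q \<le> grad_component i (G (\<phi> j) k q)" "grad_component i (G (\<phi> j) k q) \<le> b i (rank k) q" for j
          using elim(1) q i by blast+
        have gcs: "grad_component i (Gc k n q) = (\<Sum>j\<in>S n. c n j * grad_component i (G (\<phi> j) k q))"
          unfolding Gc_def convex_comb_def by (rule grad_component_sum)
        have "a i (rank k) q = (\<Sum>j\<in>S n. c n j * a i (rank k) q)" using wn by (simp flip: sum_distrib_right)
        also have "\<dots> \<le> grad_component i (Gc k n q)" unfolding gcs using wn e by (intro sum_mono mult_left_mono)
        finally have 1: "a i (rank k) q \<le> grad_component i (Gc k n q)" .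
        have "grad_component i (Gc k n q) \<le> (\<Sum>j\<in>S n. c n j * b i (rank k) q)" unfolding gcs using wn e by (intro sum_mono mult_left_mono)
        also have "\<dots> = b i (rank k) q" using wn by (simp flip: sum_distrib_right)
        finally show ?thesis using 1 by simp
      qed
      have "control_deriv T Rx i Bl (rank k) q = grad_component i (Gl k q)"
        unfolding control_deriv_eq using elim(2) q by metis
      moreover have "a i (rank k) q \<le> grad_component i (Gl k q)"
        by (rule tendsto_lowerbound[OF lim]) (use bounds in auto)
      moreover have "grad_component i (Gl k q) \<le> b i (rank k) q"
        by (rule tendsto_upperbound[OF lim]) (use bounds in auto)
      ultimately show "a i (rank k) q \<le> control_deriv T Rx i Bl (rank k) q \<and> control_deriv T Rx i Bl (rank k) q \<le> b i (rank k) q" by simp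
    qed
  qed
  have Bladm: "Bl \<in> admissible T Rx a b"
    unfolding admissible_def mem_Collect_eq ball_rank AE_lebesgue_on_iff[OF Qx_open]
  proof (intro conjI Blcs ballI allI)
    fix i and k :: 'b assume "i \<in> {0..CARD('x)}"
    then show "AE q in lborel. q \<in> ?Q \<longrightarrow> a i (rank k) q \<le> control_deriv T Rx i Bl (rank k) q \<and> control_deriv T Rx i Bl (rank k) q \<le> b i (rank k) q"
      using lcons by (auto elim!: eventually_mono simp del: entry_rank)
  qed
  obtain h' G' where reg': "regular_version T Rx M Bl h' G'"
    using admissible_regular[OF C Bladm TR] M by blast
  have norml: "(control_norm T Rx \<kappa>t \<kappa>x Bl)\<^sup>2 = (LINT q|Mq. (norm (Wl q))\<^sup>2)"
  proof -
    have "(control_norm T Rx \<kappa>t \<kappa>x Bl)\<^sup>2 = (LINT q|lborel. (norm (Wvec \<kappa>t \<kappa>x ?Q h' G' q))\<^sup>2)"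
      by (rule control_norm_eq(1)[OF reg' \<kappa> Blcs])
    also have "\<dots> = (LINT q|lborel. (norm (indicator ?Q q *\<^sub>R Wl q))\<^sup>2)"
    proof (rule integral_cong_AE)
      show "(\<lambda>q. (norm (Wvec \<kappa>t \<kappa>x ?Q h' G' q))\<^sup>2) \<in> borel_measurable lborel"
        using Wvec_measurable[OF regular_version_measurable(1,2)[OF reg']] by simp
      show "(\<lambda>q. (norm (indicator ?Q q *\<^sub>R Wl q))\<^sup>2) \<in> borel_measurable lborel"
        unfolding measurable_lborel2
        by (rule measurable_compose[OF Wlm']) (intro borel_measurable_continuous_onI continuous_intros)
      have "AE q in lborel. q \<in> ?Q \<longrightarrow> Bl q = h' q \<and> (\<forall>k. wgrad ?Q (\<lambda>p. entry (Bl p) (rank k)) q = G' k q)"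
        using reg' unfolding regular_version_def by blast
      then show "AE q in lborel. (norm (Wvec \<kappa>t \<kappa>x ?Q h' G' q))\<^sup>2 = (norm (indicator ?Q q *\<^sub>R Wl q))\<^sup>2"
        using wgl Glim
      proof eventually_elim
        case (elim q)
        show ?case
        proof (cases "q \<in> ?Q")
          case True
          have "h' q = fst (Wl q)" using elim(1,3) True by simp
          moreover have "(\<chi> k. (sqrt \<kappa>t * fst (G' k q), sqrt \<kappa>x *\<^sub>R snd (G' k q))) = snd (Wl q)"
            unfolding vec_eq_iff
          proof
            fix k
            have "G' k q = Gl k q" using elim(1,2) True by metis
            then show "(\<chi> k. (sqrt \<kappa>t * fst (G' k q), sqrt \<kappa>x *\<^sub>R snd (G' k q))) $ k = snd (Wl q) $ k"
              using elim(3) True by simp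
          qed
          ultimately show ?thesis using True by (simp add: Wvec_def)
        qed (simp add: Wvec_def)
      qed
    qed
    also have "\<dots> = (LINT q|Mq. (norm (Wl q))\<^sup>2)"
      unfolding Mqi by (intro Bochner_Integration.integral_cong) (auto split: split_indicator)
    finally show ?thesis .
  qed
  have normW: "(control_norm T Rx \<kappa>t \<kappa>x (B (\<phi> n)))\<^sup>2 = (LINT q|Mq. (norm (W n q))\<^sup>2)" for n
  proof -
    have "B (\<phi> n) \<in> control_space T Rx" using adm[of "\<phi> n"] by (simp add: admissible_def)
    then have "(control_norm T Rx \<kappa>t \<kappa>x (B (\<phi> n)))\<^sup>2 = (LINT q|lborel. (norm (W n q))\<^sup>2)"
      unfolding W_def by (rule control_norm_eq(1)[OF reg \<kappa>])
    also have "\<dots> = (LINT q|Mq. (norm (W n q))\<^sup>2)"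
      unfolding Mqi W_def by (intro Bochner_Integration.integral_cong) (auto simp: Wvec_def zero_prod_def split: split_indicator)
    finally show ?thesis .
  qed
  have lsc: "\<forall>r. (\<exists>\<^sub>F n in sequentially. (control_norm T Rx \<kappa>t \<kappa>x (B (\<phi> n)))\<^sup>2 \<le> r) \<longrightarrow> (control_norm T Rx \<kappa>t \<kappa>x Bl)\<^sup>2 \<le> r"
    using Wlsc unfolding norml normW .
  show ?thesis
    by (intro exI[of _ \<phi>] exI[of _ Bl] conjI \<phi> Bladm lsc allI ballI near)
qed

section \<open>Lower semicontinuity of the cost\<close>

lemma enn2ereal_liminf_le: "enn2ereal (liminf x) \<le> liminf (\<lambda>n. enn2ereal (x n))" for x :: "nat \<Rightarrow> ennreal"
  unfolding le_Liminf_iff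
proof (intro allI impI)
  fix y assume y: "y < enn2ereal (liminf x)"
  show "\<forall>\<^sub>F n in sequentially. y < enn2ereal (x n)"
  proof (cases "y < 0")
    case True
    then show ?thesis using less_le_trans[OF _ enn2ereal_nonneg] by (intro always_eventually) blast
  next
    case False
    then have e: "enn2ereal (e2ennreal y) = y" by (intro enn2ereal_e2ennreal) simp
    have "e2ennreal y < liminf x" using y e by (simp add: less_ennreal.rep_eq)
    from less_LiminfD[OF this] show ?thesis
      by (rule eventually_mono) (simp add: less_ennreal.rep_eq e)
  qed
qed

lemma ext_integral_cong: "(\<And>x. x \<in> S \<Longrightarrow> g x = g' x) \<Longrightarrow> ext_integral S g = ext_integral S g'"
  unfolding ext_integral_def
  by (intro arg_cong2[where f=minus] arg_cong[where f=enn2ereal] nn_integral_cong) (auto split: split_indicator)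

lemma ext_integral_shift:
  assumes [measurable]: "S \<in> sets borel" "\<theta> \<in> borel_measurable borel" "f \<in> borel_measurable borel"
    and c: "0 \<le> c" "\<And>x. x \<in> S \<Longrightarrow> - c \<le> \<theta> x" and f0: "\<And>x. x \<in> S \<Longrightarrow> 0 \<le> f x"
    and int: "integrable lborel (\<lambda>x. indicator S x * f x)"
  shows "ext_integral S (\<lambda>x. \<theta> x * f x) =
    enn2ereal (\<integral>\<^sup>+x. ennreal (indicator S x * ((\<theta> x + c) * f x)) \<partial>lborel) - ereal (c * (LINT x|lborel. indicator S x * f x))"
proof -
  define P where "P = (\<integral>\<^sup>+x. ennreal (indicator S x * (\<theta> x * f x)) \<partial>lborel)"
  define N where "N = (\<integral>\<^sup>+x. ennreal (indicator S x * - (\<theta> x * f x)) \<partial>lborel)"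
  define A where "A = (\<integral>\<^sup>+x. ennreal (indicator S x * ((\<theta> x + c) * f x)) \<partial>lborel)"
  define L where "L = (\<integral>\<^sup>+x. ennreal (c * (indicator S x * f x)) \<partial>lborel)"
  define l where "l = c * (LINT x|lborel. indicator S x * f x)"
  have f0': "0 \<le> indicator S x * f x" for x using f0 by (auto split: split_indicator)
  have Ll: "L = ennreal l" unfolding L_def l_def
    by (subst nn_integral_eq_integral) (use int c(1) f0' in \<open>auto intro!: AE_I2\<close>)
  have l0: "0 \<le> l" unfolding l_def by (intro mult_nonneg_nonneg c integral_nonneg_AE AE_I2 f0')
  have ext: "ext_integral S (\<lambda>x. \<theta> x * f x) = enn2ereal P - enn2ereal N"
    unfolding ext_integral_def P_def N_def
    by (intro arg_cong2[where f=minus] arg_cong[where f=enn2ereal] nn_integral_cong) (auto split: split_indicator)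
  have "A + N = P + L" unfolding A_def N_def P_def L_def
  proof (subst (1 2) nn_integral_add[symmetric])
    have "ennreal (indicator S x * ((\<theta> x + c) * f x)) + ennreal (indicator S x * - (\<theta> x * f x)) =
        ennreal (indicator S x * (\<theta> x * f x)) + ennreal (c * (indicator S x * f x))" for x
    proof (cases "x \<in> S")
      case True
      have p: "0 \<le> (\<theta> x + c) * f x" "0 \<le> c * f x" using c(1) c(2)[OF True] f0[OF True] by (auto intro!: mult_nonneg_nonneg)
      have e: "(\<theta> x + c) * f x = \<theta> x * f x + c * f x" by (simp add: distrib_right)
      show ?thesis
      proof (cases "0 \<le> \<theta> x * f x")
        case True': True
        then have "ennreal (- (\<theta> x * f x)) = 0" by (intro ennreal_neg) simp
        then show ?thesis using True True' p unfolding e by (simp add: ennreal_plus[symmetric] del: ennreal_plus)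
      next
        case False
        then have "ennreal (\<theta> x * f x) = 0" by (intro ennreal_neg) simp
        moreover have "ennreal ((\<theta> x + c) * f x) + ennreal (- (\<theta> x * f x)) = ennreal (c * f x)"
          using False p by (subst ennreal_plus[symmetric]) (auto simp: e)
        ultimately show ?thesis using True by simp
      qed
    qed simp
    then show "(\<integral>\<^sup>+x. (ennreal (indicator S x * ((\<theta> x + c) * f x)) + ennreal (indicator S x * - (\<theta> x * f x))) \<partial>lborel) =
      (\<integral>\<^sup>+x. (ennreal (indicator S x * (\<theta> x * f x)) + ennreal (c * (indicator S x * f x))) \<partial>lborel)" by simp
  qed measurable
  moreover have "N \<le> L" unfolding N_def L_def
  proof (intro nn_integral_mono ennreal_leI)
    fix x
    show "indicator S x * - (\<theta> x * f x) \<le> c * (indicator S x * f x)"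
      using mult_right_mono[OF c(2) f0, of x x] by (cases "x \<in> S") auto
  qed
  then have "N < top" unfolding Ll by (rule le_less_trans) simp
  then obtain n where n: "0 \<le> n" "N = ennreal n" by (cases N) auto
  ultimately have e: "A + ennreal n = P + ennreal l" unfolding Ll by simp
  have "enn2ereal P - enn2ereal N = enn2ereal A - ereal l"
  proof (cases P)
    case (real p)
    have "A \<noteq> top"
    proof
      assume "A = top"
      then have "ennreal p + ennreal l = top" using e real by simp
      then show False by (simp add: ennreal_add_eq_top)
    qed
    then obtain a where a: "0 \<le> a" "A = ennreal a" by (cases A) auto
    then have "ennreal (a + n) = ennreal (p + l)" using e real n l0 by simp
    then have "a + n = p + l" using a real n l0 by (subst (asm) ennreal_inj) auto
    then show ?thesis using a real n by simp
  next
    case top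
    then have "A + ennreal n = top" using e by simp
    then have "A = top" by (simp add: ennreal_add_eq_top)
    then show ?thesis using top n by simp
  qed
  then show ?thesis unfolding ext A_def l_def .
qed

lemma ext_integral_lower:
  assumes S: "S \<in> sets borel" and \<theta>: "continuous_on S \<theta>" and f: "f \<in> borel_measurable borel"
    and c: "0 \<le> c" "\<And>x. x \<in> S \<Longrightarrow> - c \<le> \<theta> x" and f0: "\<And>x. x \<in> S \<Longrightarrow> 0 \<le> f x"
    and int: "integrable lborel (\<lambda>x. indicator S x * f x)"
  shows "ext_integral S (\<lambda>x. \<theta> x * f x) =
    enn2ereal (\<integral>\<^sup>+x. ennreal (indicator S x * ((\<theta> x + c) * f x)) \<partial>lborel) - ereal (c * (LINT x|lborel. indicator S x * f x))"
    "ereal (- (c * (LINT x|lborel. indicator S x * f x))) \<le> ext_integral S (\<lambda>x. \<theta> x * f x)"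
proof -
  define \<theta>' where "\<theta>' x = indicator S x *\<^sub>R \<theta> x" for x
  have m: "\<theta>' \<in> borel_measurable borel" unfolding \<theta>'_def[abs_def] by (rule borel_measurable_continuous_on_indicator[OF S \<theta>])
  have "ext_integral S (\<lambda>x. \<theta> x * f x) = ext_integral S (\<lambda>x. \<theta>' x * f x)"
    by (rule ext_integral_cong) (simp add: \<theta>'_def)
  also have "\<dots> = enn2ereal (\<integral>\<^sup>+x. ennreal (indicator S x * ((\<theta>' x + c) * f x)) \<partial>lborel) - ereal (c * (LINT x|lborel. indicator S x * f x))"
    by (rule ext_integral_shift[OF S m f c(1) _ f0 int]) (use c(2) in \<open>auto simp: \<theta>'_def\<close>)
  also have "(\<integral>\<^sup>+x. ennreal (indicator S x * ((\<theta>' x + c) * f x)) \<partial>lborel) = (\<integral>\<^sup>+x. ennreal (indicator S x * ((\<theta> x + c) * f x)) \<partial>lborel)"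
    by (intro nn_integral_cong) (auto simp: \<theta>'_def split: split_indicator)
  finally show e: "ext_integral S (\<lambda>x. \<theta> x * f x) =
    enn2ereal (\<integral>\<^sup>+x. ennreal (indicator S x * ((\<theta> x + c) * f x)) \<partial>lborel) - ereal (c * (LINT x|lborel. indicator S x * f x))" .
  have "0 - ereal (c * (LINT x|lborel. indicator S x * f x)) \<le> ext_integral S (\<lambda>x. \<theta> x * f x)"
    unfolding e by (intro ereal_minus_mono) simp_all
  then show "ereal (- (c * (LINT x|lborel. indicator S x * f x))) \<le> ext_integral S (\<lambda>x. \<theta> x * f x)" by simp
qed

lemma ext_integral_lsc:
  assumes S: "S \<in> sets borel" and \<theta>: "continuous_on S \<theta>"
    and f: "f \<in> borel_measurable borel" and F: "\<And>n. F n \<in> borel_measurable borel"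
    and c: "0 \<le> c" "\<And>x. x \<in> S \<Longrightarrow> - c \<le> \<theta> x" and f0: "\<And>x. x \<in> S \<Longrightarrow> 0 \<le> f x" and F0: "\<And>n x. x \<in> S \<Longrightarrow> 0 \<le> F n x"
    and int: "integrable lborel (\<lambda>x. indicator S x * f x)" "\<And>n. integrable lborel (\<lambda>x. indicator S x * F n x)"
    and ae: "AE x in lborel. (\<lambda>n. F n x) \<longlonglongrightarrow> f x"
    and lim: "(\<lambda>n. LINT x|lborel. indicator S x * F n x) \<longlonglongrightarrow> (LINT x|lborel. indicator S x * f x)"
  shows "ext_integral S (\<lambda>x. \<theta> x * f x) \<le> liminf (\<lambda>n. ext_integral S (\<lambda>x. \<theta> x * F n x))"
proof -
  define A where "A g = (\<integral>\<^sup>+x. ennreal (indicator S x * ((\<theta> x + c) * g x)) \<partial>lborel)" for g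
  define I where "I g = c * (LINT x|lborel. indicator S x * g x)" for g
  have [measurable]: "(\<lambda>x. indicator S x * ((\<theta> x + c) * g x)) \<in> borel_measurable borel" if [measurable]: "g \<in> borel_measurable borel" for g
  proof -
    have [measurable]: "(\<lambda>x. indicator S x *\<^sub>R (\<theta> x + c)) \<in> borel_measurable borel"
      by (intro borel_measurable_continuous_on_indicator S continuous_intros \<theta>)
    have "(\<lambda>x. (indicator S x *\<^sub>R (\<theta> x + c)) * g x) \<in> borel_measurable borel" by measurable
    then show ?thesis by (simp only: real_scaleR_def mult.assoc)
  qed
  have "A f \<le> (\<integral>\<^sup>+x. liminf (\<lambda>n. ennreal (indicator S x * ((\<theta> x + c) * F n x))) \<partial>lborel)"
    unfolding A_def
  proof (rule nn_integral_mono_AE, use ae in eventually_elim)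
    case (elim x)
    have "(\<lambda>n. ennreal (indicator S x * ((\<theta> x + c) * F n x))) \<longlonglongrightarrow> ennreal (indicator S x * ((\<theta> x + c) * f x))"
      by (intro tendsto_ennrealI tendsto_mult tendsto_const elim)
    then show ?case using lim_imp_Liminf[OF sequentially_bot] by fastforce
  qed
  also have "\<dots> \<le> liminf (\<lambda>n. A (F n))" unfolding A_def
    by (rule nn_integral_liminf) (use F in measurable)
  finally have "enn2ereal (A f) \<le> enn2ereal (liminf (\<lambda>n. A (F n)))" by (simp add: less_eq_ennreal.rep_eq)
  also have "\<dots> \<le> liminf (\<lambda>n. enn2ereal (A (F n)))" by (rule enn2ereal_liminf_le)
  finally have a: "enn2ereal (A f) \<le> liminf (\<lambda>n. enn2ereal (A (F n)))" .
  have "(\<lambda>n. ereal (- I (F n))) \<longlonglongrightarrow> ereal (- I f)" unfolding I_def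
    by (intro tendsto_intros lim)
  then have i: "liminf (\<lambda>n. ereal (- I (F n))) = ereal (- I f)" by (rule lim_imp_Liminf[OF sequentially_bot])
  have "enn2ereal (A f) + ereal (- I f) \<le> liminf (\<lambda>n. enn2ereal (A (F n))) + liminf (\<lambda>n. ereal (- I (F n)))"
    unfolding i by (intro add_mono a) simp
  also have "\<dots> \<le> liminf (\<lambda>n. enn2ereal (A (F n)) + ereal (- I (F n)))"
    by (rule ereal_liminf_add_mono) (auto simp: i)
  finally have "enn2ereal (A f) - ereal (I f) \<le> liminf (\<lambda>n. enn2ereal (A (F n)) - ereal (I (F n)))"
    by (simp add: minus_ereal_def)
  moreover have "ext_integral S (\<lambda>x. \<theta> x * f x) = enn2ereal (A f) - ereal (I f)" unfolding A_def I_def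
    by (rule ext_integral_lower(1)[OF S \<theta> f c(1) _ _ int(1)]) (use c(2) f0 in auto)
  moreover have "ext_integral S (\<lambda>x. \<theta> x * F n x) = enn2ereal (A (F n)) - ereal (I (F n))" for n unfolding A_def I_def
    by (rule ext_integral_lower(1)[OF S \<theta> F c(1) _ _ int(2)]) (use c(2) F0 in auto)
  ultimately show ?thesis by simp
qed

lemma L1_geometric:
  fixes F :: "nat \<Rightarrow> 'a::euclidean_space \<Rightarrow> real"
  assumes f: "integrable lborel f" and F: "\<And>n. integrable lborel (F n)"
    and E: "\<And>n. (LINT x|lborel. \<bar>F n x - f x\<bar>) \<le> E * (1/2)^n"
  shows "AE x in lborel. (\<lambda>n. F n x) \<longlonglongrightarrow> f x"
    and "S \<in> sets borel \<Longrightarrow> (\<lambda>n. LINT x|lborel. indicator S x * F n x) \<longlonglongrightarrow> (LINT x|lborel. indicator S x * f x)"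
proof -
  have d: "integrable lborel (\<lambda>x. \<bar>F n x - f x\<bar>)" for n by (intro integrable_abs Bochner_Integration.integrable_diff F f)
  have "AE x in lborel. summable (\<lambda>n. \<bar>F n x - f x\<bar>)" by (rule AE_summable[OF d _ E]) simp
  then show "AE x in lborel. (\<lambda>n. F n x) \<longlonglongrightarrow> f x"
    by (rule eventually_mono) (auto dest!: summable_LIMSEQ_zero tendsto_rabs_zero_cancel LIM_zero_cancel)
  assume [measurable]: "S \<in> sets borel"
  have i: "integrable lborel (\<lambda>x. indicator S x * g x)" if "integrable lborel g" for g :: "'a \<Rightarrow> real"
    using integrable_mult_indicator[OF _ that, of S] by simp
  have b: "norm ((LINT x|lborel. indicator S x * F n x) - (LINT x|lborel. indicator S x * f x)) \<le> E * (1/2)^n" for n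
  proof -
    have "(LINT x|lborel. indicator S x * F n x) - (LINT x|lborel. indicator S x * f x) = (LINT x|lborel. indicator S x * (F n x - f x))"
      by (subst Bochner_Integration.integral_diff[symmetric]) (simp_all add: i F f right_diff_distrib)
    also have "norm \<dots> \<le> (LINT x|lborel. norm (indicator S x * (F n x - f x)))" by (rule integral_norm_bound)
    also have "\<dots> \<le> (LINT x|lborel. \<bar>F n x - f x\<bar>)"
      by (intro integral_mono integrable_norm i d Bochner_Integration.integrable_diff F f) (auto split: split_indicator)
    also note E
    finally show ?thesis .
  qed
  have "(\<lambda>n. (1/2 :: real)^n) \<longlonglongrightarrow> 0" by (rule LIMSEQ_realpow_zero) simp_all
  then have z: "(\<lambda>n. E * (1/2)^n) \<longlonglongrightarrow> 0" by (rule tendsto_mult_right_zero)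
  have "(\<lambda>n. (LINT x|lborel. indicator S x * F n x) - (LINT x|lborel. indicator S x * f x)) \<longlonglongrightarrow> 0"
    by (rule Lim_null_comparison[OF always_eventually[OF allI[OF b]] z])
  then show "(\<lambda>n. LINT x|lborel. indicator S x * F n x) \<longlonglongrightarrow> (LINT x|lborel. indicator S x * f x)" by (rule LIM_zero_cancel)
qed

lemma nice_density_integrable:
  fixes f :: "('x::finite, 'v::finite) density"
  assumes f: "nice_density T Rx Rv f"
  shows "integrable lborel (f s)"
proof -
  note [measurable] = nice_density_measurable[OF f]
  obtain C where C: "\<And>s p. \<bar>f s p\<bar> \<le> C" using nice_density_bounded[OF f] by auto
  show ?thesis
  proof (rule integrable_bounded_support[where C=C and S="{0..T} \<times> (cball 0 Rx \<times> cball 0 Rv)"])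
    fix p :: "real \<times> ('x, 'v) phase" assume "p \<notin> {0..T} \<times> (cball 0 Rx \<times> cball 0 Rv)"
    then show "f s p = 0" using nice_densityD(2,5)[OF f] by (cases p) blast
  qed (simp_all add: C bounded_Times)
qed

lemma nice_density_time_bound:
  assumes f: "nice_density T Rx Rv f" and T: "0 \<le> T"
    and D: "\<And>t. t \<in> {0..T} \<Longrightarrow> (LINT z|lborel. \<bar>f s (t, z)\<bar>) \<le> D"
  shows "(LINT p|lborel. \<bar>f s p\<bar>) \<le> T * D"
proof -
  have i: "integrable (lborel \<Otimes>\<^sub>M lborel) (\<lambda>p. \<bar>f s p\<bar>)"
    unfolding lborel_prod by (intro integrable_abs nice_density_integrable[OF f])
  have "(LINT p|lborel. \<bar>f s p\<bar>) = (LINT t|lborel. LINT z|lborel. \<bar>f s (t, z)\<bar>)"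
    using lborel_pair.integral_fst'[OF i] unfolding lborel_prod by simp
  also have "\<dots> \<le> (LINT t|lborel. indicator {0..T} t * D)"
  proof (rule integral_mono)
    show "integrable lborel (\<lambda>t. LINT z|lborel. \<bar>f s (t, z)\<bar>)" using lborel_pair.integrable_fst'[OF i] by simp
    fix t show "(LINT z|lborel. \<bar>f s (t, z)\<bar>) \<le> indicator {0..T} t * D"
      using D[of t] nice_densityD(2)[OF f, of t] by (cases "t \<in> {0..T}") simp_all
    show "integrable lborel (\<lambda>t. indicator {0..T} t * D)"
      by (intro integrable_mult_left integrable_real_indicator) (simp_all add: emeasure_lborel_Icc_eq)
  qed
  also have "\<dots> = T * D" using T by simp
  finally show ?thesis .
qed

section \<open>Existence of an optimal control\<close>

lemma admissible_setup:
  fixes B :: "('x::{finite,linorder}, 'b::{finite,linorder}) control"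
    and f0 :: "species \<Rightarrow> ('x, 'v::{finite,linorder}) phase \<Rightarrow> real"
  assumes TR: "0 < Rx" "0 < Rv" and card: "CARD('x) \<in> {1, 2}"
    and final: "final_time TYPE('b) T Rx Rv mux muv f0"
    and B: "B \<in> control_space T Rx" and r: "regular_version T Rx M B h G"
  shows "vlasov_setup T Rx Rv mux muv f0 B (\<lambda>q. indicator (Qx T Rx) q *\<^sub>R h q) (state T Rx Rv mux muv f0 B)"
proof
  let ?Q = "Qx T Rx :: (real \<times> 'x rvec) set"
  show "0 < T" using final by (simp add: final_time_def)
  have ae: "AE q in lborel. q \<in> ?Q \<longrightarrow> B q = h q \<and> (\<forall>k. wgrad ?Q (\<lambda>p. entry (B p) (rank k)) q = G k q)"
    and GM: "norm (G k q) \<le> M" for k q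
    using r unfolding regular_version_def by blast+
  have "bounded (h ` closure ?Q)"
    by (intro compact_imp_bounded compact_continuous_image regular_version_measurable(3)[OF r])
      (simp add: compact_closure Qx_bounded)
  then obtain C where C0: "\<And>q. q \<in> closure ?Q \<Longrightarrow> norm (h q) \<le> C" unfolding bounded_iff by blast
  have C: "norm (h q) \<le> C" if "q \<in> ?Q" for q using C0 closure_subset that by blast
  have "in_W1inf ?Q (\<lambda>p. entry (B p) (rank k))" for k :: 'b
  proof -
    have H1: "in_H1 ?Q (\<lambda>p. entry (B p) (rank k))"
      using B unfolding control_space_def mem_Collect_eq ball_rank by blast
    then obtain G0 where "has_weak_grad ?Q (\<lambda>p. entry (B p) (rank k)) G0" unfolding in_H1_def by blast
    then have w: "has_weak_grad ?Q (\<lambda>p. entry (B p) (rank k)) (wgrad ?Q (\<lambda>p. entry (B p) (rank k)))"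
      by (rule has_weak_grad_wgrad)
    have "in_Linf ?Q (\<lambda>p. entry (B p) (rank k))"
      unfolding in_Linf_def
    proof (intro conjI exI[of _ C])
      show "(\<lambda>p. entry (B p) (rank k)) \<in> borel_measurable (lebesgue_on ?Q)"
        using H1 unfolding in_H1_def in_L2_def by blast
      show "AE q in lebesgue_on ?Q. norm (entry (B q) (rank k)) \<le> C"
        unfolding AE_lebesgue_on_iff[OF Qx_open] using ae
      proof (rule eventually_mono, intro impI)
        fix q assume "q \<in> ?Q \<longrightarrow> B q = h q \<and> (\<forall>k. wgrad ?Q (\<lambda>p. entry (B p) (rank k)) q = G k q)" and q: "q \<in> ?Q"
        then have "B q = h q" by blast
        then show "norm (entry (B q) (rank k)) \<le> C"
          using order_trans[OF component_le_norm_cart[of "h q" k] C[OF q]] by simp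
      qed
    qed
    moreover have "in_Linf ?Q (wgrad ?Q (\<lambda>p. entry (B p) (rank k)))"
      unfolding in_Linf_def
    proof (intro conjI exI[of _ M])
      have "loc_integrable ?Q (wgrad ?Q (\<lambda>p. entry (B p) (rank k)))" using w unfolding has_weak_grad_def by blast
      then show "wgrad ?Q (\<lambda>p. entry (B p) (rank k)) \<in> borel_measurable (lebesgue_on ?Q)"
        by (rule loc_integrable_measurable[OF _ Qx_open])
      show "AE q in lebesgue_on ?Q. norm (wgrad ?Q (\<lambda>p. entry (B p) (rank k)) q) \<le> M"
        unfolding AE_lebesgue_on_iff[OF Qx_open] using ae
      proof (rule eventually_mono, intro impI)
        fix q assume "q \<in> ?Q \<longrightarrow> B q = h q \<and> (\<forall>k. wgrad ?Q (\<lambda>p. entry (B p) (rank k)) q = G k q)" and "q \<in> ?Q"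
        then have "wgrad ?Q (\<lambda>p. entry (B p) (rank k)) q = G k q" by blast
        then show "norm (wgrad ?Q (\<lambda>p. entry (B p) (rank k)) q) \<le> M" using GM by (simp only:)
      qed
    qed
    ultimately show ?thesis using w unfolding in_W1inf_def by blast
  qed
  then have "control_W1inf T Rx B" unfolding control_W1inf_def ball_rank by blast
  then have "\<exists>!f. strong_solution T Rx Rv mux muv f0 B f" using final unfolding final_time_def by blast
  from theI'[OF this] show "strong_solution T Rx Rv mux muv f0 B (state T Rx Rv mux muv f0 B)"
    unfolding state_def .
  show "borel_control T Rx B (\<lambda>q. indicator ?Q q *\<^sub>R h q)"
    unfolding borel_control_def
  proof (intro conjI exI[of _ "max C 0"] allI)
    have [measurable]: "h \<in> borel_measurable borel" by (rule regular_version_measurable(1)[OF r])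
    show "(\<lambda>q. indicator ?Q q *\<^sub>R h q) \<in> borel_measurable borel" by measurable
    show "norm (indicator ?Q q *\<^sub>R h q) \<le> max C 0" for q
      using C[of q] by (cases "q \<in> ?Q") auto
    show "AE q in lborel. q \<in> ?Q \<longrightarrow> B q = indicator ?Q q *\<^sub>R h q"
      using ae by (rule eventually_mono) (simp add: indicator_def)
  qed
qed (use TR card in simp_all)

lemma zero_admissible:
  fixes a b :: "nat \<Rightarrow> nat \<Rightarrow> real \<times> ('x::{finite,linorder}) rvec \<Rightarrow> real"
  assumes bounds_sign: "\<And>i j. i \<in> {0..CARD('x)} \<Longrightarrow> j \<in> {1..CARD('b)} \<Longrightarrow>
          AE p in lebesgue_on (Qx T Rx). a i j p \<le> 0 \<and> 0 \<le> b i j p"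
  shows "(\<lambda>_. 0) \<in> (admissible T Rx a b :: ('x, 'b::{finite,linorder}) control set)"
proof -
  let ?Q = "Qx T Rx :: (real \<times> 'x rvec) set"
  have e0: "entry (0 :: 'n::{finite,linorder} rvec) j = 0" for j by (simp add: entry_def)
  have "has_weak_grad ?Q (\<lambda>_. 0) (\<lambda>_. 0) \<longleftrightarrow> bwg ?Q (\<lambda>_. 0) (\<lambda>_. 0)"
    by (rule has_weak_grad_iff_bwg[OF Qx_open]) simp_all
  then have w: "has_weak_grad ?Q (\<lambda>_. 0) (\<lambda>_. 0)" using bwg_zero_fun by blast
  have "in_H1 ?Q (\<lambda>_. 0)" unfolding in_H1_def
    by (intro conjI exI[of _ "\<lambda>_. 0"] w in_L2_bounded[where K=0]) simp_all
  moreover have "AE p in lborel. p \<in> ?Q \<longrightarrow> a i j p \<le> control_deriv T Rx i (\<lambda>_. 0 :: 'b rvec) j p \<and>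
      control_deriv T Rx i (\<lambda>_. 0 :: 'b rvec) j p \<le> b i j p" if "i \<in> {0..CARD('x)}" "j \<in> {1..CARD('b)}" for i j
    using bounds_sign[OF that, unfolded AE_lebesgue_on_iff[OF Qx_open]]
      has_weak_grad_unique[OF Qx_open has_weak_grad_wgrad[OF w] w]
  proof eventually_elim
    case (elim p)
    show ?case
    proof
      assume p: "p \<in> ?Q"
      have "control_deriv T Rx i (\<lambda>_. 0 :: 'b rvec) j p = 0"
        using elim(2) p by (simp add: control_deriv_eq e0 grad_component_def)
      then show "a i j p \<le> control_deriv T Rx i (\<lambda>_. 0 :: 'b rvec) j p \<and> control_deriv T Rx i (\<lambda>_. 0 :: 'b rvec) j p \<le> b i j p"
        using elim(1) p by simp
    qed
  qed
  ultimately show ?thesis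
    unfolding admissible_def control_space_def mem_Collect_eq AE_lebesgue_on_iff[OF Qx_open] e0 by blast
qed

lemma Omega_borel: "(Omega Rx Rv :: ('x::finite, 'v::finite) phase set) \<in> sets borel"
  "{0..T :: real} \<times> (Omega Rx Rv :: ('x, 'v) phase set) \<in> sets borel"
proof -
  have o: "open (Omega Rx Rv :: ('x, 'v) phase set)" unfolding Omega_def by (intro open_Times) auto
  then show "(Omega Rx Rv :: ('x, 'v) phase set) \<in> sets borel" by (rule borel_open)
  have "{0..T} \<times> (Omega Rx Rv :: ('x, 'v) phase set) = ({0..T} \<times> UNIV) \<inter> (UNIV \<times> Omega Rx Rv)" by auto
  also have "\<dots> \<in> sets borel"
    by (rule sets.Int[OF borel_closed[OF closed_Times] borel_open[OF open_Times]]) (auto simp: o)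
  finally show "{0..T} \<times> (Omega Rx Rv :: ('x, 'v) phase set) \<in> sets borel" .
qed

lemma C1_on_continuous: "C1_on S f \<Longrightarrow> continuous_on S f"
  unfolding C1_on_def continuous_on_eq_continuous_within by (blast intro: has_derivative_continuous)

lemma integrable_indicator_mult:
  fixes f :: "'a::euclidean_space \<Rightarrow> real"
  assumes "S \<in> sets borel" "integrable lborel f"
  shows "integrable lborel (\<lambda>x. indicator S x * f x)"
  using integrable_mult_indicator[OF _ assms(2), of S] assms(1) by simp

context vlasov_setup
begin

lemma nonneg':
  assumes f0: "\<And>z. 0 \<le> f0 s z"
  shows "0 \<le> f s p"
proof -
  obtain t z where "p = (t, z)" by (rule prod.exhaust)
  then show ?thesis using nonneg[of s t z] f0 nice_densityD(2)[OF nice, of t s z] by (cases "t \<in> {0..T}") auto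
qed

lemma time_slice: "(\<lambda>z. f s (t, z)) \<in> borel_measurable borel"
  by (rule measurable_compose[OF _ nice_density_measurable[OF nice]]) (intro borel_measurable_continuous_onI continuous_intros)

lemma cost_lower:
  assumes f0: "\<And>s z. 0 \<le> f0 s z" and c: "0 \<le> c"
  shows "continuous_on ({0..T} \<times> Omega Rx Rv) \<theta> \<Longrightarrow> (\<And>p. p \<in> {0..T} \<times> Omega Rx Rv \<Longrightarrow> - c \<le> \<theta> p) \<Longrightarrow>
      ereal (- (c * (T * (LINT z|lborel. f0 s z)))) \<le> ext_integral ({0..T} \<times> Omega Rx Rv) (\<lambda>p. \<theta> p * f s p)"
    and "continuous_on (Omega Rx Rv) \<phi> \<Longrightarrow> (\<And>z. z \<in> Omega Rx Rv \<Longrightarrow> - c \<le> \<phi> z) \<Longrightarrow>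
      ereal (- (c * (LINT z|lborel. f0 s z))) \<le> ext_integral (Omega Rx Rv) (\<lambda>z. \<phi> z * f s (T, z))"
proof -
  note fn = nonneg'[OF f0]
  have fi: "integrable lborel (f s)" by (rule nice_density_integrable[OF nice])
  have ft: "integrable lborel (\<lambda>z. f s (T, z))" by (rule nice_density_space_integrable[OF nice])
  have "(LINT p|lborel. indicator ({0..T} \<times> Omega Rx Rv) p * f s p) \<le> (LINT p|lborel. \<bar>f s p\<bar>)"
    by (intro integral_mono integrable_indicator_mult Omega_borel fi integrable_abs) (auto simp: fn split: split_indicator)
  also have "\<dots> \<le> T * (LINT z|lborel. f0 s z)"
    by (rule nice_density_time_bound[OF nice]) (use T mass[of _ s] fn in simp_all)
  finally have m: "c * (LINT p|lborel. indicator ({0..T} \<times> Omega Rx Rv) p * f s p) \<le> c * (T * (LINT z|lborel. f0 s z))"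
    using c by (rule mult_left_mono)
  have "(LINT z|lborel. indicator (Omega Rx Rv) z * f s (T, z)) \<le> (LINT z|lborel. f s (T, z))"
    by (intro integral_mono integrable_indicator_mult Omega_borel ft) (auto simp: fn split: split_indicator)
  also have "\<dots> = (LINT z|lborel. f0 s z)" by (rule mass) (use T in simp)
  finally have m': "c * (LINT z|lborel. indicator (Omega Rx Rv) z * f s (T, z)) \<le> c * (LINT z|lborel. f0 s z)"
    using c by (rule mult_left_mono)
  {
    assume \<theta>: "continuous_on ({0..T} \<times> Omega Rx Rv) \<theta>" and b: "\<And>p. p \<in> {0..T} \<times> Omega Rx Rv \<Longrightarrow> - c \<le> \<theta> p"
    have "ereal (- (c * (T * (LINT z|lborel. f0 s z)))) \<le> ereal (- (c * (LINT p|lborel. indicator ({0..T} \<times> Omega Rx Rv) p * f s p)))"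
      using m by simp
    also have "\<dots> \<le> ext_integral ({0..T} \<times> Omega Rx Rv) (\<lambda>p. \<theta> p * f s p)"
      by (rule ext_integral_lower(2)[OF Omega_borel(2) \<theta> nice_density_measurable[OF nice] c _ fn])
        (use b fi in \<open>auto intro: integrable_indicator_mult Omega_borel\<close>)
    finally show "ereal (- (c * (T * (LINT z|lborel. f0 s z)))) \<le> ext_integral ({0..T} \<times> Omega Rx Rv) (\<lambda>p. \<theta> p * f s p)" .
  next
    assume \<phi>: "continuous_on (Omega Rx Rv) \<phi>" and b: "\<And>z. z \<in> Omega Rx Rv \<Longrightarrow> - c \<le> \<phi> z"
    have "ereal (- (c * (LINT z|lborel. f0 s z))) \<le> ereal (- (c * (LINT z|lborel. indicator (Omega Rx Rv) z * f s (T, z))))"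
      using m' by simp
    also have "\<dots> \<le> ext_integral (Omega Rx Rv) (\<lambda>z. \<phi> z * f s (T, z))"
      by (rule ext_integral_lower(2)[OF Omega_borel(1) \<phi> time_slice c _ fn])
        (use b ft in \<open>auto intro: integrable_indicator_mult Omega_borel\<close>)
    finally show "ereal (- (c * (LINT z|lborel. f0 s z))) \<le> ext_integral (Omega Rx Rv) (\<lambda>z. \<phi> z * f s (T, z))" .
  }
qed

lemma cost_lsc:
  assumes f0: "\<And>s z. 0 \<le> f0 s z" and c: "0 \<le> c"
    and F: "\<And>n. vlasov_setup T Rx Rv mux muv f0 (B' n) (B1 n) (F n)"
    and K: "\<And>n t. t \<in> {0..T} \<Longrightarrow> L1_dist (F n) f t \<le> K * (1/2)^n"
  shows "continuous_on ({0..T} \<times> Omega Rx Rv) \<theta> \<Longrightarrow> (\<And>p. p \<in> {0..T} \<times> Omega Rx Rv \<Longrightarrow> - c \<le> \<theta> p) \<Longrightarrow>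
      ext_integral ({0..T} \<times> Omega Rx Rv) (\<lambda>p. \<theta> p * f s p) \<le> liminf (\<lambda>n. ext_integral ({0..T} \<times> Omega Rx Rv) (\<lambda>p. \<theta> p * F n s p))"
    and "continuous_on (Omega Rx Rv) \<phi> \<Longrightarrow> (\<And>z. z \<in> Omega Rx Rv \<Longrightarrow> - c \<le> \<phi> z) \<Longrightarrow>
      ext_integral (Omega Rx Rv) (\<lambda>z. \<phi> z * f s (T, z)) \<le> liminf (\<lambda>n. ext_integral (Omega Rx Rv) (\<lambda>z. \<phi> z * F n s (T, z)))"
proof -
  note fn = nonneg'[OF f0] and Fn = vlasov_setup.nonneg'[OF F f0] and nF = vlasov_setup.nice[OF F]
  have fi: "integrable lborel (f s)" and Fi: "integrable lborel (F n s)" for n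
    by (rule nice_density_integrable[OF nice] nice_density_integrable[OF nF])+
  have ft: "integrable lborel (\<lambda>z. f s (T, z))" and Ft: "integrable lborel (\<lambda>z. F n s (T, z))" for n
    by (rule nice_density_space_integrable[OF nice] nice_density_space_integrable[OF nF])+
  have d: "(LINT z|lborel. \<bar>F n s (t, z) - f s (t, z)\<bar>) \<le> K * (1/2)^n" if "t \<in> {0..T}" for n t
  proof -
    have "(LINT z|lborel. \<bar>F n s (t, z) - f s (t, z)\<bar>) \<le> L1_dist (F n) f t"
      unfolding L1_dist_def by (cases s) (simp_all add: integral_nonneg_AE)
    then show ?thesis using K[OF that, of n] by linarith
  qed
  have D: "(LINT p|lborel. \<bar>F n s p - f s p\<bar>) \<le> (T * K) * (1/2)^n" for n
    using nice_density_time_bound[OF nice_density_diff[OF nF[of n] nice], of s "K * (1/2)^n"] T d by (simp add: mult.assoc)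
  have dT: "(LINT z|lborel. \<bar>F n s (T, z) - f s (T, z)\<bar>) \<le> K * (1/2)^n" for n
    by (rule d) (use T in simp)
  {
    assume \<theta>: "continuous_on ({0..T} \<times> Omega Rx Rv) \<theta>" and b: "\<And>p. p \<in> {0..T} \<times> Omega Rx Rv \<Longrightarrow> - c \<le> \<theta> p"
    show "ext_integral ({0..T} \<times> Omega Rx Rv) (\<lambda>p. \<theta> p * f s p) \<le> liminf (\<lambda>n. ext_integral ({0..T} \<times> Omega Rx Rv) (\<lambda>p. \<theta> p * F n s p))"
      by (rule ext_integral_lsc[where F="\<lambda>n. F n s", OF Omega_borel(2) \<theta> nice_density_measurable[OF nice] nice_density_measurable[OF nF] c _ fn Fn
            integrable_indicator_mult[OF Omega_borel(2) fi] integrable_indicator_mult[OF Omega_borel(2) Fi]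
            L1_geometric(1)[where F="\<lambda>n. F n s", OF fi Fi D] L1_geometric(2)[where F="\<lambda>n. F n s", OF fi Fi D Omega_borel(2)]])
        (use b in blast)
  next
    assume \<phi>: "continuous_on (Omega Rx Rv) \<phi>" and b: "\<And>z. z \<in> Omega Rx Rv \<Longrightarrow> - c \<le> \<phi> z"
    show "ext_integral (Omega Rx Rv) (\<lambda>z. \<phi> z * f s (T, z)) \<le> liminf (\<lambda>n. ext_integral (Omega Rx Rv) (\<lambda>z. \<phi> z * F n s (T, z)))"
      by (rule ext_integral_lsc[where F="\<lambda>n z. F n s (T, z)", OF Omega_borel(1) \<phi> time_slice vlasov_setup.time_slice[OF F] c _ fn Fn
            integrable_indicator_mult[OF Omega_borel(1) ft] integrable_indicator_mult[OF Omega_borel(1) Ft]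
            L1_geometric(1)[where F="\<lambda>n z. F n s (T, z)", OF ft Ft dT] L1_geometric(2)[where F="\<lambda>n z. F n s (T, z)", OF ft Ft dT Omega_borel(1)]])
        (use b in blast)
  }
qed

end

lemma liminf_add_bounded_below:
  fixes x y :: "nat \<Rightarrow> ereal"
  assumes "\<And>n. ereal a \<le> x n" "\<And>n. ereal b \<le> y n"
  shows "liminf x + liminf y \<le> liminf (\<lambda>n. x n + y n)"
proof (rule ereal_liminf_add_mono)
  have "ereal a \<le> liminf x" "ereal b \<le> liminf y"
    by (intro Liminf_bounded always_eventually allI assms)+
  then show "\<not> (liminf x = \<infinity> \<and> liminf y = - \<infinity> \<or> liminf x = - \<infinity> \<and> liminf y = \<infinity>)" by auto
qed

lemma le_liminf_ereal:
  assumes "\<And>r. (\<exists>\<^sub>F n in sequentially. y n \<le> r) \<Longrightarrow> x \<le> r"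
  shows "ereal x \<le> liminf (\<lambda>n. ereal (y n))"
  unfolding le_Liminf_iff
proof (intro allI impI)
  fix z assume z: "z < ereal x"
  show "\<forall>\<^sub>F n in sequentially. z < ereal (y n)"
  proof (cases z)
    case (real r)
    have "\<not> (\<exists>\<^sub>F n in sequentially. y n \<le> r)" using assms[of r] z real by auto
    then show ?thesis unfolding frequently_def using real by (simp add: not_le)
  qed (use z in auto)
qed

theorem theorem3p12:
  fixes T Rx Rv \<alpha> \<kappa>t \<kappa>x :: real
    and mux muv :: "species \<Rightarrow> real"
    and f0 :: "species \<Rightarrow> ('x::{finite,linorder}, 'v::{finite,linorder}) phase \<Rightarrow> real"
    and a b :: "nat \<Rightarrow> nat \<Rightarrow> real \<times> 'x rvec \<Rightarrow> real"
    and \<theta> :: "species \<Rightarrow> real \<times> ('x, 'v) phase \<Rightarrow> real"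
    and \<phi> :: "species \<Rightarrow> ('x, 'v) phase \<Rightarrow> real"
    and zd :: "species \<Rightarrow> real \<Rightarrow> ('x, 'v) phase"
    and zT :: "species \<Rightarrow> ('x, 'v) phase"
  assumes dims: "(CARD('x), CARD('v)) \<in> {(1, 2), (2, 2), (2, 3)}"
    and dimB: "CARD('b::{finite,linorder}) = (if CARD('v) = 2 then 1 else 3)"
    and radii: "0 < Rx" "0 < Rv"
    and scaling: "mux Neg = 1" "muv Neg = -1" "0 < mux Pos" "0 < muv Pos"
    and initial: "initial_datum Rx Rv f0"
    and final: "final_time TYPE('b) T Rx Rv mux muv f0"
    and weights: "0 < \<alpha>" "0 < \<kappa>t" "0 < \<kappa>x"
    and bounds_Linf: "\<And>i j. i \<in> {0..CARD('x)} \<Longrightarrow> j \<in> {1..CARD('b)} \<Longrightarrow>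
          in_Linf (Qx T Rx) (a i j) \<and> in_Linf (Qx T Rx) (b i j)"
    and bounds_sign: "\<And>i j. i \<in> {0..CARD('x)} \<Longrightarrow> j \<in> {1..CARD('b)} \<Longrightarrow>
          AE p in lebesgue_on (Qx T Rx). a i j p \<le> 0 \<and> 0 \<le> b i j p"
    and theta_C1: "\<And>s. C1_on ({0..T} \<times> Omega Rx Rv) (\<theta> s)"
    and phi_C1: "\<And>s. C1_on (Omega Rx Rv) (\<phi> s)"
    and theta_bdd: "\<And>s. bdd_below (\<theta> s ` ({0..T} \<times> Omega Rx Rv))"
    and phi_bdd: "\<And>s. bdd_below (\<phi> s ` Omega Rx Rv)"
    and theta_min: "\<And>s t. t \<in> {0..T} \<Longrightarrow>
          global_min_at (Omega Rx Rv) (\<lambda>z. \<theta> s (t, z)) (zd s t)"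
    and phi_min: "\<And>s. global_min_at (Omega Rx Rv) (\<phi> s) (zT s)"
    and theta_convex: "\<And>s t. t \<in> {0..T} \<Longrightarrow>
          convex_near (Omega Rx Rv) (\<lambda>z. \<theta> s (t, z)) (zd s t)"
    and phi_convex: "\<And>s. convex_near (Omega Rx Rv) (\<phi> s) (zT s)"
  shows "\<exists>Bbar \<in> (admissible T Rx a b :: ('x, 'b) control set).
           \<forall>B \<in> (admissible T Rx a b :: ('x, 'b) control set).
             reduced_cost T Rx Rv mux muv f0 \<theta> \<phi> \<alpha> \<kappa>t \<kappa>x Bbar
             \<le> reduced_cost T Rx Rv mux muv f0 \<theta> \<phi> \<alpha> \<kappa>t \<kappa>x B"
proof -
  let ?J = "reduced_cost T Rx Rv mux muv f0 \<theta> \<phi> \<alpha> \<kappa>t \<kappa>x :: ('x, 'b) control \<Rightarrow> ereal"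
  let ?A = "admissible T Rx a b :: ('x, 'b) control set"
  let ?st = "state T Rx Rv mux muv f0 :: ('x, 'b) control \<Rightarrow> ('x, 'v) density"
  let ?N = "\<lambda>B :: ('x, 'b) control. (control_norm T Rx \<kappa>t \<kappa>x B)\<^sup>2"
  let ?S = "{0..T} \<times> (Omega Rx Rv :: ('x, 'v) phase set)"
  let ?O = "Omega Rx Rv :: ('x, 'v) phase set"
  have T: "0 < T" using final by (simp add: final_time_def)
  have card: "CARD('x) \<in> {1, 2}" using dims by auto
  have f0: "0 \<le> f0 s z" for s z using initial unfolding initial_datum_def by blast
  have \<theta>c: "continuous_on ?S (\<theta> s)" and \<phi>c: "continuous_on ?O (\<phi> s)" for s
    by (intro C1_on_continuous theta_C1 phi_C1)+
  obtain c where c: "0 \<le> c" "\<And>s p. p \<in> ?S \<Longrightarrow> - c \<le> \<theta> s p" "\<And>s z. z \<in> ?O \<Longrightarrow> - c \<le> \<phi> s z"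
  proof -
    have "\<exists>m. \<forall>p\<in>?S. m \<le> \<theta> s p" "\<exists>m. \<forall>z\<in>?O. m \<le> \<phi> s z" for s
      using theta_bdd[of s] phi_bdd[of s] unfolding bdd_below_def by blast+
    then obtain m1 m2 where m: "\<And>s p. p \<in> ?S \<Longrightarrow> m1 s \<le> \<theta> s p" "\<And>s z. z \<in> ?O \<Longrightarrow> m2 s \<le> \<phi> s z" by metis
    define c where "c = \<bar>m1 Neg\<bar> + \<bar>m1 Pos\<bar> + \<bar>m2 Neg\<bar> + \<bar>m2 Pos\<bar>"
    have cm: "- c \<le> m1 s" "- c \<le> m2 s" for s unfolding c_def by (cases s; simp)+
    then have "- c \<le> \<theta> s p" if "p \<in> ?S" for s p using order_trans[OF _ m(1)[OF that]] by blast
    moreover have "- c \<le> \<phi> s z" if "z \<in> ?O" for s z using order_trans[OF _ m(2)[OF that]] cm by blast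
    moreover have "0 \<le> c" by (simp add: c_def)
    ultimately show thesis by (intro that) blast+
  qed
  obtain C where C: "0 \<le> C" "AE q in lborel. q \<in> Qx T Rx \<longrightarrow>
      (\<forall>i\<in>{0..CARD('x)}. \<forall>j\<in>{1..CARD('b)}. \<bar>a i j q\<bar> \<le> C \<and> \<bar>b i j q\<bar> \<le> C)"
    using bound_constant[where N="CARD('b)" and a=a and b=b, OF bounds_Linf] by blast
  define M where "M = (1 + real CARD('x)) * C"
  have M0: "0 \<le> M" using C(1) by (simp add: M_def)
  have rex: "\<exists>h G. regular_version T Rx M B h G" if "B \<in> ?A" for B
    unfolding M_def by (rule admissible_regular[OF C that T radii(1)])
  have Acs: "B \<in> control_space T Rx" if "B \<in> ?A" for B using that by (simp add: admissible_def)
  note solves = admissible_setup[OF radii card final Acs]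
  have zero: "(\<lambda>_. 0) \<in> ?A" by (rule zero_admissible[OF bounds_sign])
  define m where "m = Inf (?J ` ?A)"
  show ?thesis
  proof (cases "m = \<infinity>")
    case True
    then have "?J B = \<infinity>" if "B \<in> ?A" for B
      using INF_lower[OF that, of ?J] unfolding m_def by (simp add: top_ereal_def)
    then show ?thesis using zero by (intro bexI[OF _ zero]) simp
  next
    case False
    then obtain r :: real where r: "m < ereal r" using less_PInf_Ex_of_nat[of m] by blast
    have "?J ` ?A \<noteq> {}" using zero by blast
    from Inf_as_limit[OF this] obtain u where u: "\<And>n. u n \<in> ?J ` ?A" "u \<longlonglongrightarrow> m" unfolding m_def by blast
    have "\<forall>n. \<exists>B. B \<in> ?A \<and> u n = ?J B" using u(1) by blast
    from choice[OF this] obtain U where U: "\<And>n. U n \<in> ?A" "\<And>n. u n = ?J (U n)" by blast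
    obtain n0 where n0: "\<And>n. n0 \<le> n \<Longrightarrow> u n < ereal r"
      using order_tendstoD(2)[OF u(2) r] unfolding eventually_sequentially by blast
    define B where "B n = U (n + n0)" for n
    have BA: "B n \<in> ?A" and Br: "?J (B n) \<le> ereal r" for n
      using U n0[of "n + n0"] by (simp_all add: B_def less_imp_le)
    have Blim: "(\<lambda>n. ?J (B n)) \<longlonglongrightarrow> m"
      using LIMSEQ_ignore_initial_segment[OF u(2), of n0] U(2) by (simp add: B_def)
    have "\<forall>n. \<exists>p. regular_version T Rx M (B n) (fst p) (snd p)" using rex[OF BA] by simp
    from choice[OF this] obtain P where "\<forall>n. regular_version T Rx M (B n) (fst (P n)) (snd (P n))" ..
    then obtain h G where reg: "\<And>n. regular_version T Rx M (B n) (h n) (G n)"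
      by (intro that[of "\<lambda>n. fst (P n)" "\<lambda>n. snd (P n)"]) blast
    note Bsetup = solves[OF BA reg]
    define l where "l s = - (c * (T * (LINT z|lborel. f0 s z)))" for s
    define l' where "l' s = - (c * (LINT z|lborel. f0 s z))" for s
    define E where "E s n = ext_integral ?S (\<lambda>p. \<theta> s p * ?st (B n) s p)" for s n
    define E' where "E' s n = ext_integral ?O (\<lambda>z. \<phi> s z * ?st (B n) s (T, z))" for s n
    have El: "ereal (l s) \<le> E s n" for s n
      unfolding l_def E_def by (rule vlasov_setup.cost_lower(1)[OF Bsetup f0 c(1) \<theta>c]) (rule c(2))
    have El': "ereal (l' s) \<le> E' s n" for s n
      unfolding l'_def E'_def by (rule vlasov_setup.cost_lower(2)[OF Bsetup f0 c(1) \<phi>c]) (rule c(3))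
    have JB: "?J (B n) = (E Neg n + E Pos n) + (E' Neg n + E' Pos n) + ereal (\<alpha> / 2 * ?N (B n))" for n
      by (simp add: reduced_cost_def cost_def E_def E'_def)
    define R where "R = 2 / \<alpha> * (r - (l Neg + l Pos + (l' Neg + l' Pos)))"
    have NR: "?N (B n) \<le> R" for n
    proof -
      have "(ereal (l Neg) + ereal (l Pos)) + (ereal (l' Neg) + ereal (l' Pos)) + ereal (\<alpha> / 2 * ?N (B n)) \<le> ?J (B n)"
        unfolding JB by (intro add_mono El El' order_refl)
      also note Br
      finally have "\<alpha> / 2 * ?N (B n) \<le> r - (l Neg + l Pos + (l' Neg + l' Pos))" by simp
      from mult_left_mono[OF this, of "2 / \<alpha>"] show ?thesis using weights(1) by (simp add: R_def)
    qed
    obtain K0 where K0: "\<And>n q. q \<in> Qx T Rx \<Longrightarrow> norm (h n q) \<le> K0"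
      using regular_sup_bound[OF reg weights(2,3) Acs[OF BA] NR T radii(1) M0] by blast
    have "\<exists>\<psi> Bl. strict_mono \<psi> \<and> Bl \<in> ?A \<and> (\<forall>n. \<forall>q\<in>Qx T Rx. norm (h (\<psi> n) q - Bl q) \<le> (1/2)^n) \<and>
        (\<forall>r. (\<exists>\<^sub>F n in sequentially. ?N (B (\<psi> n)) \<le> r) \<longrightarrow> ?N Bl \<le> r)"
      by (rule admissible_limit[OF T radii(1) weights(2,3) C M_def BA reg]) (rule K0)
    then obtain \<psi> and Bl :: "('x, 'b) control" where \<psi>: "strict_mono \<psi>" and Bl: "Bl \<in> ?A"
      and near: "\<And>n q. q \<in> Qx T Rx \<Longrightarrow> norm (h (\<psi> n) q - Bl q) \<le> (1/2)^n"
      and lsc: "\<And>r. \<exists>\<^sub>F n in sequentially. ?N (B (\<psi> n)) \<le> r \<Longrightarrow> ?N Bl \<le> r"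
      by blast
    obtain hl Gl where regl: "regular_version T Rx M Bl hl Gl" using rex[OF Bl] by blast
    note Blsetup = solves[OF Bl regl]
    obtain K where K: "\<And>B' B1 F \<delta> t. vlasov_setup T Rx Rv mux muv f0 B' B1 F \<Longrightarrow> 0 \<le> \<delta> \<Longrightarrow>
        (AE q in lborel. q \<in> Qx T Rx \<longrightarrow> norm (B1 q - indicator (Qx T Rx) q *\<^sub>R hl q) \<le> \<delta>) \<Longrightarrow>
        t \<in> {0..T} \<Longrightarrow> L1_dist F (?st Bl) t \<le> K * \<delta>"
      using vlasov_setup.stability[OF Blsetup] by blast
    have "AE q in lborel. q \<in> Qx T Rx \<longrightarrow> Bl q = hl q"
      using regl unfolding regular_version_def by (blast intro: eventually_mono)
    then have close: "AE q in lborel. q \<in> Qx T Rx \<longrightarrow>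
        norm (indicator (Qx T Rx) q *\<^sub>R h (\<psi> n) q - indicator (Qx T Rx) q *\<^sub>R hl q) \<le> (1/2)^n" for n
    proof (rule eventually_mono, intro impI)
      fix q :: "real \<times> 'x rvec" assume "q \<in> Qx T Rx \<longrightarrow> Bl q = hl q" and q: "q \<in> Qx T Rx"
      then show "norm (indicator (Qx T Rx) q *\<^sub>R h (\<psi> n) q - indicator (Qx T Rx) q *\<^sub>R hl q) \<le> (1/2)^n"
        using near[OF q, of n] by simp
    qed
    have dist: "L1_dist (?st (B (\<psi> n))) (?st Bl) t \<le> K * (1/2)^n" if "t \<in> {0..T}" for n t
      by (rule K[OF Bsetup[of "\<psi> n"] _ close that]) simp
    define e where "e s = ext_integral ?S (\<lambda>p. \<theta> s p * ?st Bl s p)" for s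
    define e' where "e' s = ext_integral ?O (\<lambda>z. \<phi> s z * ?st Bl s (T, z))" for s
    have e: "e s \<le> liminf (\<lambda>n. E s (\<psi> n))" for s
      unfolding e_def E_def
      by (rule vlasov_setup.cost_lsc(1)[where F="\<lambda>n. ?st (B (\<psi> n))" and B'="\<lambda>n. B (\<psi> n)" and K=K, OF Blsetup f0 c(1) Bsetup _ \<theta>c])
        ((rule dist c(2), assumption)+)
    have e': "e' s \<le> liminf (\<lambda>n. E' s (\<psi> n))" for s
      unfolding e'_def E'_def
      by (rule vlasov_setup.cost_lsc(2)[where F="\<lambda>n. ?st (B (\<psi> n))" and B'="\<lambda>n. B (\<psi> n)" and K=K, OF Blsetup f0 c(1) Bsetup _ \<phi>c])
        ((rule dist c(3), assumption)+)
    have nl: "ereal (\<alpha> / 2 * ?N Bl) \<le> liminf (\<lambda>n. ereal (\<alpha> / 2 * ?N (B (\<psi> n))))"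
    proof (rule le_liminf_ereal)
      fix r assume "\<exists>\<^sub>F n in sequentially. \<alpha> / 2 * ?N (B (\<psi> n)) \<le> r"
      then have "\<exists>\<^sub>F n in sequentially. ?N (B (\<psi> n)) \<le> r * 2 / \<alpha>"
        by (rule frequently_elim1) (use weights(1) in \<open>simp add: field_simps\<close>)
      from lsc[OF this] show "\<alpha> / 2 * ?N Bl \<le> r" using weights(1) by (simp add: field_simps)
    qed
    have N0: "ereal 0 \<le> ereal (\<alpha> / 2 * ?N (B (\<psi> n)))" for n using weights(1) by simp
    have s: "ereal (l Neg + l Pos) \<le> E Neg (\<psi> n) + E Pos (\<psi> n)" "ereal (l' Neg + l' Pos) \<le> E' Neg (\<psi> n) + E' Pos (\<psi> n)"
      "ereal ((l Neg + l Pos) + (l' Neg + l' Pos)) \<le> (E Neg (\<psi> n) + E Pos (\<psi> n)) + (E' Neg (\<psi> n) + E' Pos (\<psi> n))" for n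
      unfolding plus_ereal.simps(1)[symmetric] by (intro add_mono El El')+
    have "?J Bl = (e Neg + e Pos) + (e' Neg + e' Pos) + ereal (\<alpha> / 2 * ?N Bl)"
      by (simp add: reduced_cost_def cost_def e_def e'_def)
    also have "\<dots> \<le> (liminf (\<lambda>n. E Neg (\<psi> n)) + liminf (\<lambda>n. E Pos (\<psi> n))) + (liminf (\<lambda>n. E' Neg (\<psi> n)) + liminf (\<lambda>n. E' Pos (\<psi> n)))
        + liminf (\<lambda>n. ereal (\<alpha> / 2 * ?N (B (\<psi> n))))"
      by (intro add_mono e e' nl)
    also have "\<dots> \<le> liminf (\<lambda>n. E Neg (\<psi> n) + E Pos (\<psi> n)) + liminf (\<lambda>n. E' Neg (\<psi> n) + E' Pos (\<psi> n))
        + liminf (\<lambda>n. ereal (\<alpha> / 2 * ?N (B (\<psi> n))))"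
      by (intro add_mono order_refl liminf_add_bounded_below[OF El El] liminf_add_bounded_below[OF El' El'])
    also have "\<dots> \<le> liminf (\<lambda>n. (E Neg (\<psi> n) + E Pos (\<psi> n)) + (E' Neg (\<psi> n) + E' Pos (\<psi> n)))
        + liminf (\<lambda>n. ereal (\<alpha> / 2 * ?N (B (\<psi> n))))"
      by (intro add_mono order_refl liminf_add_bounded_below[OF s(1,2)])
    also have "\<dots> \<le> liminf (\<lambda>n. ?J (B (\<psi> n)))"
      unfolding JB by (rule liminf_add_bounded_below[OF s(3) N0])
    also have "\<dots> = m"
      using lim_imp_Liminf[OF sequentially_bot LIMSEQ_subseq_LIMSEQ[OF Blim \<psi>]] by (simp add: comp_def)
    finally have "?J Bl \<le> m" .
    then show ?thesis
      by (intro bexI[OF _ Bl] ballI) (auto simp: m_def intro: order_trans INF_lower)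
  qed
qed

end
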